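(* Consider the following list of Bézoutian quatroids $\mathcal Q_i$ together with integers $\delta_i$. (Format: $i$: triples in $\mathcal I$; sextuples in $\mathcal J$; $\delta_i$. A dash means the empty set.) 1: –; –; 12. 2: –; 123456; 10. 3: –; 123456, 123478; 8. 4: –; 123456, 123478, 125678; 6. 5: –; 123456, 123478, 125678, 345678; 4. 8: 123; –; 10. 9: 123; 124567; 8. 10: 123; 145678; 9. 11: 123; 124567, 134568; 6. 12: 123; 124567, 345678; 7. 13: 123; 124567, 134568, 234578; 4. 15: 123, 145; –; 8. 16: 123, 145; 124678; 6. 17: 123, 145; 234567; 6. 18: 123, 145; 234678; 7. 19: 123, 145; 124678, 135678; 4. 20: 123, 145; 124678, 234567; 4. 21: 123, 145; 124678, 235678; 5. 22: 123, 145; 124678, 135678, 234567; 2. 24: 123, 145, 167; –; 6. 25: 123, 145, 167; 234567; 4. 26: 123, 145, 167; 234568; 5. 28: 123, 145, 167, 246; –; 4. 29: 123, 145, 167, 246; 234578; 3. 30: 123, 145, 167, 246, 257; –; 2. 31: 123, 145, 167, 246, 257; 345678; 1. 32: 123, 145, 167, 246, 257, 347; –; 0. 33: 123, 145, 167, 246, 257, 347, 358; –; 0. 34: 123, 145, 167, 246, 257, 348; –; 2. 35: 123, 145, 167, 246, 257, 348, 568; –; 1. 36: 123, 145, 167, 246, 257, 478; –; 1. 37: 123, 145, 167, 246, 258; –; 3. 38: 123, 145, 167, 246, 258; 345678; 2. 39: 123, 145, 167, 246, 258, 357; –; 2. 40: 123, 145, 167, 246, 258, 357, 368; –; 1. 41: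 123, 145, 167, 246, 258, 357, 368, 478; –; 0. 42: 123, 145, 167, 246, 258, 378; –; 3. 43: 123, 145, 167, 246, 357; –; 3. 44: 123, 145, 167, 246, 358; –; 4. 45: 123, 145, 167, 248; –; 5. 46: 123, 145, 167, 248; 234567; 3. 47: 123, 145, 167, 248; 235678; 4. 48: 123, 145, 167, 248, 358; –; 4. 49: 123, 145, 167, 248, 358; 234567; 2. 50: 123, 145, 167, 248, 368; –; 4. 51: 123, 145, 167, 248, 368; 234567; 2. 52: 123, 145, 167, 248, 368, 578; –; 3. 53: 123, 145, 167, 248, 368, 578; 234567; 1. 54: 123, 145, 246; –; 6. 55: 123, 145, 246; 125678; 4. 56: 123, 145, 246; 135678; 5. 57: 123, 145, 246; 125678, 134678; 2. 58: 123, 145, 246; 125678, 345678; 3. 59: 123, 145, 246; 125678, 134678, 234578; 0. 60: 123, 145, 246, 356; –; 4. 61: 123, 145, 246, 356; 125678; 2. 62: 123, 145, 246, 356; 125678, 134678; 0. 64: 123, 145, 246, 357; –; 5. 65: 123, 145, 246, 357; 125678; 3. 66: 123, 145, 246, 357; 125678, 134678; 1. 67: 123, 145, 246, 357, 678; –; 5. 68: 123, 145, 246, 378; –; 6. 69: 123, 145, 246, 378; 125678; 4. 70: 123, 145, 267; –; 7. 71: 123, 145, 267; 134678; 5. 72: 123, 145, 267; 345678; 6. 73: 123, 145, 267; 134678, 234568; 3. 74: 123, 145, 267, 468; –; 6. 75: 123, 145, 267, 468; 135678; 4. 76: 123, 145, 267, 468; 135678, 234578; 2. 77: 123, 145, 678;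 –; 8. 78: 123, 145, 678; 234567; 6. 79: 123, 456; –; 9. 80: 123, 456; 124578; 7. 81: 123, 456; 124578, 134678; 5. 82: 123, 456; 124578, 134678, 235678; 3. Then $12-m_{\mathcal Q_i}=\delta_i$ for all $i$ in the list except for the following $24$ values of $i$, for which $12-m_{\mathcal Q_i}=\delta_i+1$: (a) $i\in\{10,12,18,21,26,29,31,38,47,56,58,72\}$, and these are exactly the $i$ in the list with $\mathcal Q_i\preceq\mathcal Q_{10}$ and $\mathcal Q_i\not\preceq\mathcal Q_{77}$; (b) $i\in\{33,34,35,42,44,48,49,67,68,69,77,78\}$, and these are exactly the $i$ in the list with $\mathcal Q_i\preceq\mathcal Q_{77}$.
   Context: Let $\mathcal P\subset(\mathbb P^2_{\mathbb C})^8$ be the space of ordered $8$-tuples $\mathbf p=(p_1,\dots,p_8)$ of pairwise distinct points. A conic is an irreducible plane quadric. A pair $\mathcal Q=(\mathcal I,\mathcal J)$ consists of a set $\mathcal I$ of $3$-subsets and a set $\mathcal J$ of $6$-subsets of $\{1,\dots,8\}$ ($123$ abbreviates $\{1,2,3\}$, etc.). Its realization space $\mathcal S_{\mathcal Q}\subset\mathcal P$ is the set of $\mathbf p$ such that the triples of points of $\mathbf p$ lying on a line are exactly those indexed by $\mathcal I$ and the sextuples of points of $\mathbf p$ lying on a conic are exactly those indexed by $\mathcal J$. $\mathcal Q$ is a quatroid if $\mathcal S_{\mathcal Q}\ne\emptyset$. A quatroid is Bézoutian if any two distinct elements of $\mathcal I$ meet in at most one element and any two distinct elements of $\mathcal J$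 meet in at most four elements. For quatroids, $\mathcal Q\le\mathcal Q'$ means $\mathcal S_{\mathcal Q}\subseteq\overline{\mathcal S_{\mathcal Q'}}$ (Zariski closure in $\mathcal P$); $\mathcal Q\preceq\mathcal Q'$ means $\mathcal Q\le\mathcal Q''$ for some $\mathcal Q''$ in the $\mathfrak S_8$-orbit of $\mathcal Q'$ (action by permuting $\{1,\dots,8\}$). $\mathbb PS^3\mathbb C^3\cong\mathbb P^9$ is the space of plane cubics, $\mathcal D$ is the discriminant hypersurface of singular cubics, and $L_{\mathbf p}$ is the linear space of cubics vanishing at $p_1,\dots,p_8$. For $C\in\mathcal D$, $\mathrm{mult}_{\mathcal D}(C)$ is the multiplicity of $\mathcal D$ at $C$, i.e. the minimum over lines $L\ni C$ of the intersection multiplicity of $L$ and $\mathcal D$ at $C$. For $\mathbf p$ representing a Bézoutian quatroid ($L_{\mathbf p}\cap\mathcal D$ is then finite), $m_{\mathbf p}=\sum\mathrm{mult}_{\mathcal D}(C)$, the sum over reducible cubics $C\in L_{\mathbf p}$; and $m_{\mathcal Q}=\min_{\mathbf p\in\mathcal S_{\mathcal Q}}m_{\mathbf p}$. *)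

theory Defs
  imports
    "HOL-Analysis.Analysis"
    "HOL-Library.Poly_Mapping"
    "HOL-Library.Extended_Nat"
    "HOL-Computational_Algebra.Computational_Algebra"
begin

section \<open>Polynomials in several variables\<close>

text \<open>Complex polynomials with variables indexed by \<^typ>\<open>'v\<close>, as finitely supported families of
  coefficients indexed by exponent vectors.\<close>

type_synonym 'v cpoly = "('v \<Rightarrow>\<^sub>0 nat) \<Rightarrow>\<^sub>0 complex"

definition eval_in :: "(complex \<Rightarrow> 'a) \<Rightarrow> 'v cpoly \<Rightarrow> ('v \<Rightarrow> 'a) \<Rightarrow> 'a::comm_ring_1"
  where "eval_in \<iota> F x =
    (\<Sum>m\<in>Poly_Mapping.keys F. \<iota> (Poly_Mapping.lookup F m) *
      (\<Prod>v\<in>Poly_Mapping.keys m. x v ^ Poly_Mapping.lookup m v))"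

definition eval :: "'v cpoly \<Rightarrow> ('v \<Rightarrow> complex) \<Rightarrow> complex"
  where "eval = eval_in (\<lambda>c. c)"

definition homogeneous :: "nat \<Rightarrow> 'v cpoly \<Rightarrow> bool"
  where "homogeneous d F \<longleftrightarrow>
    (\<forall>m\<in>Poly_Mapping.keys F. (\<Sum>v\<in>Poly_Mapping.keys m. Poly_Mapping.lookup m v) = d)"

definition partial_deriv :: "'v \<Rightarrow> 'v cpoly \<Rightarrow> 'v cpoly"
  where "partial_deriv v F =
    (\<Sum>m\<in>Poly_Mapping.keys F. Poly_Mapping.single (m - Poly_Mapping.single v 1)
        (of_nat (Poly_Mapping.lookup m v) * Poly_Mapping.lookup F m))"

section \<open>Projective spaces\<close>

text \<open>A point of a projective space is the set of all nonzero multiples of a nonzero vector;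
  \<open>s\<close> is the scalar multiplication of the ambient vector space and \<open>V\<close> a linear subspace.\<close>

definition proj_space :: "(complex \<Rightarrow> 'a \<Rightarrow> 'a) \<Rightarrow> 'a::zero set \<Rightarrow> 'a set set"
  where "proj_space s V = (\<lambda>v. {s c v | c. c \<noteq> 0}) ` (V - {0})"

type_synonym point = "(complex^3) set"

definition proj_plane :: "point set"
  where "proj_plane = proj_space (*s) UNIV"

type_synonym form = "3 cpoly"

text \<open>Vanishing at one representative of the point is the same as vanishing at all of them when
  the polynomial is homogeneous.\<close>

definition vanishes_at :: "form \<Rightarrow> point \<Rightarrow> bool"
  where "vanishes_at f P \<longleftrightarrow> (\<forall>x\<in>P. eval f (($) x) = 0)"

definition is_line :: "form \<Rightarrow> bool"
  where "is_line f \<longleftrightarrow> homogeneous 1 f \<and> f \<noteq> 0"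

definition is_conic :: "form \<Rightarrow> bool"
  where "is_conic f \<longleftrightarrow> homogeneous 2 f \<and> irreducible f"

section \<open>Point configurations, quatroids and their order\<close>

text \<open>Tuples are indexed by the eight-element numeral type \<^typ>\<open>8\<close>, whose elements are
  \<open>1, \<dots>, 7\<close> and \<open>8 = 0\<close>.\<close>

type_synonym config = "8 \<Rightarrow> point"

definition configs :: "config set"
  where "configs = {p. (\<forall>i. p i \<in> proj_plane) \<and> inj p}"

type_synonym incidence = "8 set set \<times> 8 set set"

definition realizations :: "incidence \<Rightarrow> config set"
  where "realizations Q = {p \<in> configs.
    fst Q = {T. card T = 3 \<and> (\<exists>f. is_line f \<and> (\<forall>i\<in>T. vanishes_at f (p i)))} \<and>
    snd Q = {S. card S = 6 \<and> (\<exists>f. is_conic f \<and> (\<forall>i\<in>S. vanishes_at f (p i)))}}"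

definition quatroid :: "incidence \<Rightarrow> bool"
  where "quatroid Q \<longleftrightarrow> (\<forall>T\<in>fst Q. card T = 3) \<and> (\<forall>S\<in>snd Q. card S = 6) \<and> realizations Q \<noteq> {}"

definition bezoutian :: "incidence \<Rightarrow> bool"
  where "bezoutian Q \<longleftrightarrow>
    (\<forall>T\<in>fst Q. \<forall>T'\<in>fst Q. T \<noteq> T' \<longrightarrow> card (T \<inter> T') \<le> 1) \<and>
    (\<forall>S\<in>snd Q. \<forall>S'\<in>snd Q. S \<noteq> S' \<longrightarrow> card (S \<inter> S') \<le> 4)"

text \<open>Closed subsets of the product of eight projective planes are the zero loci of polynomials
  that are homogeneous separately in each block of coordinates \<open>(i, 1), (i, 2), (i, 3)\<close>.\<close>

definition multihomogeneous :: "(8 \<Rightarrow> nat) \<Rightarrow> (8 \<times> 3) cpoly \<Rightarrow> bool"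
  where "multihomogeneous d F \<longleftrightarrow>
    (\<forall>m\<in>Poly_Mapping.keys F. \<forall>i. (\<Sum>j\<in>UNIV. Poly_Mapping.lookup m (i, j)) = d i)"

definition vanishes_at_config :: "(8 \<times> 3) cpoly \<Rightarrow> config \<Rightarrow> bool"
  where "vanishes_at_config F p \<longleftrightarrow>
    (\<forall>x :: 8 \<Rightarrow> complex^3. (\<forall>i. x i \<in> p i) \<longrightarrow> eval F (\<lambda>(i, j). x i $ j) = 0)"

definition zariski_closure :: "config set \<Rightarrow> config set"
  where "zariski_closure S = {p \<in> configs. \<forall>d F. multihomogeneous d F \<longrightarrow>
    (\<forall>q\<in>S. vanishes_at_config F q) \<longrightarrow> vanishes_at_config F p}"

definition quatroid_le :: "incidence \<Rightarrow> incidence \<Rightarrow> bool"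
  where "quatroid_le Q Q' \<longleftrightarrow> realizations Q \<subseteq> zariski_closure (realizations Q')"

definition permute :: "(8 \<Rightarrow> 8) \<Rightarrow> incidence \<Rightarrow> incidence"
  where "permute \<sigma> Q = ((`) \<sigma> ` fst Q, (`) \<sigma> ` snd Q)"

definition quatroid_preceq :: "incidence \<Rightarrow> incidence \<Rightarrow> bool"
  where "quatroid_preceq Q Q' \<longleftrightarrow> (\<exists>\<sigma>. bij \<sigma> \<and> quatroid_le Q (permute \<sigma> Q'))"

section \<open>Plane cubics and the discriminant hypersurface\<close>

definition form_scale :: "complex \<Rightarrow> form \<Rightarrow> form"
  where "form_scale c f = Poly_Mapping.single 0 c * f"

definition cubic_space :: "form set set"
  where "cubic_space = proj_space form_scale {f. homogeneous 3 f}"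

definition singular_form :: "form \<Rightarrow> bool"
  where "singular_form f \<longleftrightarrow>
    (\<exists>x :: complex^3. x \<noteq> 0 \<and> eval f (($) x) = 0 \<and> (\<forall>j. eval (partial_deriv j f) (($) x) = 0))"

definition discriminant :: "form set set"
  where "discriminant = {C \<in> cubic_space. \<exists>f\<in>C. singular_form f}"

text \<open>Polynomials on the space of cubics have as variables the coefficients of a form, i.e.
  they are indexed by the exponent vectors of ternary monomials and are evaluated at
  \<^term>\<open>Poly_Mapping.lookup f\<close>.  Variables indexed by monomials of degree other than 3 vanish
  identically on cubics.\<close>

definition discriminant_ideal :: "(3 \<Rightarrow>\<^sub>0 nat) cpoly set"
  where "discriminant_ideal = {F. (\<exists>d. homogeneous d F) \<and>
    (\<forall>C\<in>discriminant. \<forall>f\<in>C. eval F (Poly_Mapping.lookup f) = 0)}"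

text \<open>The polynomial \<open>F (f + t g)\<close> in \<open>t\<close>.\<close>

definition restrict_to_line :: "(3 \<Rightarrow>\<^sub>0 nat) cpoly \<Rightarrow> form \<Rightarrow> form \<Rightarrow> complex poly"
  where "restrict_to_line F f g =
    eval_in (\<lambda>c. [:c:]) F (\<lambda>m. [:Poly_Mapping.lookup f m, Poly_Mapping.lookup g m:])"

text \<open>Intersection multiplicity, at the point \<open>f\<close>, of the line joining \<open>f\<close> and \<open>g\<close> with the
  (reduced) discriminant hypersurface: the length of the local ring of the line at \<open>f\<close> modulo the
  ideal of the hypersurface.  That local ring is a discrete valuation ring with uniformizer \<open>t\<close>,
  so the length is the least order of vanishing at \<open>t = 0\<close> of an element of the ideal (attained
  by the discriminant polynomial, which generates it); it is infinite if the line is contained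
  in the hypersurface.  The zero polynomial, whose order would be infinite, is left out because
  \<^const>\<open>order\<close> is only meaningful for nonzero polynomials.\<close>

definition line_intersection_mult :: "form \<Rightarrow> form \<Rightarrow> enat"
  where "line_intersection_mult f g =
    (INF F \<in> {F \<in> discriminant_ideal. restrict_to_line F f g \<noteq> 0}.
      enat (order 0 (restrict_to_line F f g)))"

text \<open>A line through \<open>C\<close> is given by a second point \<open>C'\<close>; the intersection multiplicity does not
  depend on the representatives \<open>f\<close> and \<open>g\<close>.\<close>

definition mult_discriminant :: "form set \<Rightarrow> nat"
  where "mult_discriminant C = (LEAST k. \<exists>f\<in>C. \<exists>C'\<in>cubic_space - {C}. \<exists>g\<in>C'.
    line_intersection_mult f g = enat k)"

definition cubics_through :: "config \<Rightarrow> form set set"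
  where "cubics_through p = proj_space form_scale {f. homogeneous 3 f \<and> (\<forall>i. vanishes_at f (p i))}"

definition reducible_cubic :: "form set \<Rightarrow> bool"
  where "reducible_cubic C \<longleftrightarrow> C \<in> cubic_space \<and> (\<exists>f\<in>C. \<not> irreducible f)"

text \<open>For configurations representing Bezoutian quatroids the index set is finite.\<close>

definition m_config :: "config \<Rightarrow> nat"
  where "m_config p = (\<Sum>C\<in>{C \<in> cubics_through p. reducible_cubic C}. mult_discriminant C)"

definition m_quatroid :: "incidence \<Rightarrow> nat"
  where "m_quatroid Q = (LEAST k. \<exists>p\<in>realizations Q. k = m_config p)"

section \<open>The list of quatroids\<close>

text \<open>Entries are \<open>(i, Q\<^sub>i, \<delta>\<^sub>i)\<close>.\<close>

definition quatroid_list :: "(nat \<times> incidence \<times> int) list"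
  where "quatroid_list = [
   (1, ({}, {}), 12),
   (2, ({}, {{1,2,3,4,5,6}}), 10),
   (3, ({}, {{1,2,3,4,5,6}, {1,2,3,4,7,8}}), 8),
   (4, ({}, {{1,2,3,4,5,6}, {1,2,3,4,7,8}, {1,2,5,6,7,8}}), 6),
   (5, ({}, {{1,2,3,4,5,6}, {1,2,3,4,7,8}, {1,2,5,6,7,8}, {3,4,5,6,7,8}}), 4),
   (8, ({{1,2,3}}, {}), 10),
   (9, ({{1,2,3}}, {{1,2,4,5,6,7}}), 8),
   (10, ({{1,2,3}}, {{1,4,5,6,7,8}}), 9),
   (11, ({{1,2,3}}, {{1,2,4,5,6,7}, {1,3,4,5,6,8}}), 6),
   (12, ({{1,2,3}}, {{1,2,4,5,6,7}, {3,4,5,6,7,8}}), 7),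
   (13, ({{1,2,3}}, {{1,2,4,5,6,7}, {1,3,4,5,6,8}, {2,3,4,5,7,8}}), 4),
   (15, ({{1,2,3}, {1,4,5}}, {}), 8),
   (16, ({{1,2,3}, {1,4,5}}, {{1,2,4,6,7,8}}), 6),
   (17, ({{1,2,3}, {1,4,5}}, {{2,3,4,5,6,7}}), 6),
   (18, ({{1,2,3}, {1,4,5}}, {{2,3,4,6,7,8}}), 7),
   (19, ({{1,2,3}, {1,4,5}}, {{1,2,4,6,7,8}, {1,3,5,6,7,8}}), 4),
   (20, ({{1,2,3}, {1,4,5}}, {{1,2,4,6,7,8}, {2,3,4,5,6,7}}), 4),
   (21, ({{1,2,3}, {1,4,5}}, {{1,2,4,6,7,8}, {2,3,5,6,7,8}}), 5),
   (22, ({{1,2,3}, {1,4,5}}, {{1,2,4,6,7,8}, {1,3,5,6,7,8}, {2,3,4,5,6,7}}), 2),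
   (24, ({{1,2,3}, {1,4,5}, {1,6,7}}, {}), 6),
   (25, ({{1,2,3}, {1,4,5}, {1,6,7}}, {{2,3,4,5,6,7}}), 4),
   (26, ({{1,2,3}, {1,4,5}, {1,6,7}}, {{2,3,4,5,6,8}}), 5),
   (28, ({{1,2,3}, {1,4,5}, {1,6,7}, {2,4,6}}, {}), 4),
   (29, ({{1,2,3}, {1,4,5}, {1,6,7}, {2,4,6}}, {{2,3,4,5,7,8}}), 3),
   (30, ({{1,2,3}, {1,4,5}, {1,6,7}, {2,4,6}, {2,5,7}}, {}), 2),
   (31, ({{1,2,3}, {1,4,5}, {1,6,7}, {2,4,6}, {2,5,7}}, {{3,4,5,6,7,8}}), 1),
   (32, ({{1,2,3}, {1,4,5}, {1,6,7}, {2,4,6}, {2,5,7}, {3,4,7}}, {}), 0),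
   (33, ({{1,2,3}, {1,4,5}, {1,6,7}, {2,4,6}, {2,5,7}, {3,4,7}, {3,5,8}}, {}), 0),
   (34, ({{1,2,3}, {1,4,5}, {1,6,7}, {2,4,6}, {2,5,7}, {3,4,8}}, {}), 2),
   (35, ({{1,2,3}, {1,4,5}, {1,6,7}, {2,4,6}, {2,5,7}, {3,4,8}, {5,6,8}}, {}), 1),
   (36, ({{1,2,3}, {1,4,5}, {1,6,7}, {2,4,6}, {2,5,7}, {4,7,8}}, {}), 1),
   (37, ({{1,2,3}, {1,4,5}, {1,6,7}, {2,4,6}, {2,5,8}}, {}), 3),
   (38, ({{1,2,3}, {1,4,5}, {1,6,7}, {2,4,6}, {2,5,8}}, {{3,4,5,6,7,8}}), 2),
   (39, ({{1,2,3}, {1,4,5}, {1,6,7}, {2,4,6}, {2,5,8}, {3,5,7}}, {}), 2),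
   (40, ({{1,2,3}, {1,4,5}, {1,6,7}, {2,4,6}, {2,5,8}, {3,5,7}, {3,6,8}}, {}), 1),
   (41, ({{1,2,3}, {1,4,5}, {1,6,7}, {2,4,6}, {2,5,8}, {3,5,7}, {3,6,8}, {4,7,8}}, {}), 0),
   (42, ({{1,2,3}, {1,4,5}, {1,6,7}, {2,4,6}, {2,5,8}, {3,7,8}}, {}), 3),
   (43, ({{1,2,3}, {1,4,5}, {1,6,7}, {2,4,6}, {3,5,7}}, {}), 3),
   (44, ({{1,2,3}, {1,4,5}, {1,6,7}, {2,4,6}, {3,5,8}}, {}), 4),
   (45, ({{1,2,3}, {1,4,5}, {1,6,7}, {2,4,8}}, {}), 5),
   (46, ({{1,2,3}, {1,4,5}, {1,6,7}, {2,4,8}}, {{2,3,4,5,6,7}}), 3),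
   (47, ({{1,2,3}, {1,4,5}, {1,6,7}, {2,4,8}}, {{2,3,5,6,7,8}}), 4),
   (48, ({{1,2,3}, {1,4,5}, {1,6,7}, {2,4,8}, {3,5,8}}, {}), 4),
   (49, ({{1,2,3}, {1,4,5}, {1,6,7}, {2,4,8}, {3,5,8}}, {{2,3,4,5,6,7}}), 2),
   (50, ({{1,2,3}, {1,4,5}, {1,6,7}, {2,4,8}, {3,6,8}}, {}), 4),
   (51, ({{1,2,3}, {1,4,5}, {1,6,7}, {2,4,8}, {3,6,8}}, {{2,3,4,5,6,7}}), 2),
   (52, ({{1,2,3}, {1,4,5}, {1,6,7}, {2,4,8}, {3,6,8}, {5,7,8}}, {}), 3),
   (53, ({{1,2,3}, {1,4,5}, {1,6,7}, {2,4,8}, {3,6,8}, {5,7,8}}, {{2,3,4,5,6,7}}), 1),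
   (54, ({{1,2,3}, {1,4,5}, {2,4,6}}, {}), 6),
   (55, ({{1,2,3}, {1,4,5}, {2,4,6}}, {{1,2,5,6,7,8}}), 4),
   (56, ({{1,2,3}, {1,4,5}, {2,4,6}}, {{1,3,5,6,7,8}}), 5),
   (57, ({{1,2,3}, {1,4,5}, {2,4,6}}, {{1,2,5,6,7,8}, {1,3,4,6,7,8}}), 2),
   (58, ({{1,2,3}, {1,4,5}, {2,4,6}}, {{1,2,5,6,7,8}, {3,4,5,6,7,8}}), 3),
   (59, ({{1,2,3}, {1,4,5}, {2,4,6}}, {{1,2,5,6,7,8}, {1,3,4,6,7,8}, {2,3,4,5,7,8}}), 0),
   (60, ({{1,2,3}, {1,4,5}, {2,4,6}, {3,5,6}}, {}), 4),
   (61, ({{1,2,3}, {1,4,5}, {2,4,6}, {3,5,6}}, {{1,2,5,6,7,8}}), 2),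
   (62, ({{1,2,3}, {1,4,5}, {2,4,6}, {3,5,6}}, {{1,2,5,6,7,8}, {1,3,4,6,7,8}}), 0),
   (64, ({{1,2,3}, {1,4,5}, {2,4,6}, {3,5,7}}, {}), 5),
   (65, ({{1,2,3}, {1,4,5}, {2,4,6}, {3,5,7}}, {{1,2,5,6,7,8}}), 3),
   (66, ({{1,2,3}, {1,4,5}, {2,4,6}, {3,5,7}}, {{1,2,5,6,7,8}, {1,3,4,6,7,8}}), 1),
   (67, ({{1,2,3}, {1,4,5}, {2,4,6}, {3,5,7}, {6,7,8}}, {}), 5),
   (68, ({{1,2,3}, {1,4,5}, {2,4,6}, {3,7,8}}, {}), 6),
   (69, ({{1,2,3}, {1,4,5}, {2,4,6}, {3,7,8}}, {{1,2,5,6,7,8}}), 4),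
   (70, ({{1,2,3}, {1,4,5}, {2,6,7}}, {}), 7),
   (71, ({{1,2,3}, {1,4,5}, {2,6,7}}, {{1,3,4,6,7,8}}), 5),
   (72, ({{1,2,3}, {1,4,5}, {2,6,7}}, {{3,4,5,6,7,8}}), 6),
   (73, ({{1,2,3}, {1,4,5}, {2,6,7}}, {{1,3,4,6,7,8}, {2,3,4,5,6,8}}), 3),
   (74, ({{1,2,3}, {1,4,5}, {2,6,7}, {4,6,8}}, {}), 6),
   (75, ({{1,2,3}, {1,4,5}, {2,6,7}, {4,6,8}}, {{1,3,5,6,7,8}}), 4),
   (76, ({{1,2,3}, {1,4,5}, {2,6,7}, {4,6,8}}, {{1,3,5,6,7,8}, {2,3,4,5,7,8}}), 2),
   (77, ({{1,2,3}, {1,4,5}, {6,7,8}}, {}), 8),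
   (78, ({{1,2,3}, {1,4,5}, {6,7,8}}, {{2,3,4,5,6,7}}), 6),
   (79, ({{1,2,3}, {4,5,6}}, {}), 9),
   (80, ({{1,2,3}, {4,5,6}}, {{1,2,4,5,7,8}}), 7),
   (81, ({{1,2,3}, {4,5,6}}, {{1,2,4,5,7,8}, {1,3,4,6,7,8}}), 5),
   (82, ({{1,2,3}, {4,5,6}}, {{1,2,4,5,7,8}, {1,3,4,6,7,8}, {2,3,5,6,7,8}}), 3)
  ]"

definition listed :: "nat set"
  where "listed = fst ` set quatroid_list"

definition quat :: "nat \<Rightarrow> incidence"
  where "quat i = fst (the (map_of quatroid_list i))"

definition delta :: "nat \<Rightarrow> int"
  where "delta i = snd (the (map_of quatroid_list i))"

end

theory Submission
  imports Defs
begin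

text \<open>A reducible cubic through eight points that represent a Bezoutian quatroid is the line through
  a collinear triple times the conic, possibly reducible, through the other five points, or the conic
  through a sextuple in \<open>\<J>\<close> times the line through the other two points.  Each node \<open>p\<close> of a cubic \<open>f\<close>
  forces the leading form at \<open>f\<close> of any polynomial vanishing on the discriminant to vanish on the
  hyperplane of the cubics through \<open>p\<close>.  Hence the multiplicity of the discriminant is at least 2 at a line and a conic,
  and at least 3 at three lines, by specialization also when they are tangent or concurrent.  Restricting
  Sylvester's determinant for the discriminant to suitable pencils gives equality when they are not.
  So \<open>m\<^sub>\<Q>\<close> is at least a number that depends only on the incidences, and a single realization without
  tangencies and concurrences shows that it is equal to it; such realizations have integral
  coordinates, except that number 41 needs a third root of unity.

  As collinearity and the six-point conic condition are closed, \<open>\<Q> \<preceq> \<Q>\<^sub>7\<^sub>7\<close> forces two triples of \<open>\<I>\<close> that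
  meet in a point and a third one disjoint from both, while \<open>\<Q> \<preceq> \<Q>\<^sub>1\<^sub>0\<close> forces a triple and a sextuple that
  meet in a point or, if the conic degenerates to two lines, the previous pattern.  Conversely, a
  configuration with such a pattern is joined to a realization of \<open>\<Q>\<^sub>7\<^sub>7\<close> or \<open>\<Q>\<^sub>1\<^sub>0\<close> by a polynomial curve
  along which the pattern persists.\<close>

section \<open>Evaluation of polynomials\<close>

text \<open>\<open>mult_discriminant\<close> refers to all polynomials vanishing on the
  discriminant, and no generator of that ideal is determined. A lower bound therefore has to hold
  for every element of the ideal, whereas an upper bound needs one element, \<open>disc\<close>, and
  one line on which it does not vanish identically. Limits and tangent cones enter only through
  polynomial curves: a polynomial in a parameter that vanishes wherever another, nonzero one does
  not is zero.

  The two patterns mark coincidences among the cubics. If a triple and a sextuple meet in one point,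
  together they exhaust the labels, and the line of the triple times the conic of the sextuple is
  one cubic that arises in both ways. If a triple is disjoint from two triples that share a point,
  the labels are again exhausted, and each of the three triples yields the cubic formed by the same
  three lines. That these coincidences shift the number by exactly one is not derived in general; it
  is read off entry by entry when the count \<open>generic_m\<close> is evaluated.\<close>

abbreviation lk :: "('a \<Rightarrow>\<^sub>0 'b) \<Rightarrow> 'a \<Rightarrow> 'b::zero" where "lk \<equiv> Poly_Mapping.lookup"
abbreviation ks :: "('a \<Rightarrow>\<^sub>0 'b::zero) \<Rightarrow> 'a set" where "ks \<equiv> Poly_Mapping.keys"

text \<open>One notion covers every change of coefficients below: values of univariate polynomials,
  values of polynomials in the coefficients of a cubic, the grading by degree, and the embeddings of
  the integers and of \<open>eis\<close> into the complex numbers.\<close>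

definition ring_hom1 :: "('a::comm_ring_1 \<Rightarrow> 'b::comm_ring_1) \<Rightarrow> bool"
  where "ring_hom1 \<iota> \<longleftrightarrow> \<iota> 1 = 1 \<and> (\<forall>a b. \<iota> (a + b) = \<iota> a + \<iota> b) \<and> (\<forall>a b. \<iota> (a * b) = \<iota> a * \<iota> b)"

lemma ring_hom1D:
  assumes "ring_hom1 \<iota>"
  shows "\<iota> 1 = 1" "\<iota> (a + b) = \<iota> a + \<iota> b" "\<iota> (a * b) = \<iota> a * \<iota> b" "\<iota> 0 = 0"
proof -
  show "\<iota> 1 = 1" "\<iota> (a + b) = \<iota> a + \<iota> b" "\<iota> (a * b) = \<iota> a * \<iota> b"
    using assms by (auto simp: ring_hom1_def)
  have "\<iota> (0 + 0) = \<iota> 0 + \<iota> 0" using assms unfolding ring_hom1_def by blast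
  thus "\<iota> 0 = 0" by simp
qed

lemma ring_hom1_id: "ring_hom1 (\<lambda>c. c)" by (simp add: ring_hom1_def)
lemma ring_hom1_poly: "ring_hom1 (\<lambda>p::'a::comm_ring_1 poly. poly p t)" by (simp add: ring_hom1_def)

definition monom_val :: "('v \<Rightarrow> 'a) \<Rightarrow> ('v \<Rightarrow>\<^sub>0 nat) \<Rightarrow> 'a::comm_ring_1"
  where "monom_val x m = (\<Prod>v\<in>ks m. x v ^ lk m v)"

lemma monom_val_superset:
  assumes "finite A" "ks m \<subseteq> A"
  shows "monom_val x m = (\<Prod>v\<in>A. x v ^ lk m v)"
  unfolding monom_val_def using assms
  by (intro prod.mono_neutral_left) (auto simp: in_keys_iff)

lemma monom_val_add: "monom_val x (m + n) = monom_val x m * monom_val x n"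
proof -
  have "ks (m + n) \<subseteq> ks m \<union> ks n" by (rule Poly_Mapping.keys_add)
  thus ?thesis
    by (subst (1 2 3) monom_val_superset[of "ks m \<union> ks n"])
       (auto simp: lookup_add power_add prod.distrib)
qed

lemma monom_val_0: "monom_val x 0 = 1" by (simp add: monom_val_def)

lemma monom_val_single: "monom_val x (Poly_Mapping.single v k) = x v ^ k"
  by (subst monom_val_superset[of "{v}"]) auto

lemma eval_in_alt: "eval_in \<iota> F x = (\<Sum>m\<in>ks F. \<iota> (lk F m) * monom_val x m)"
  by (simp add: eval_in_def monom_val_def)

lemma eval_in_superset:
  assumes "\<iota> 0 = 0" "finite A" "ks F \<subseteq> A"
  shows "eval_in \<iota> F x = (\<Sum>m\<in>A. \<iota> (lk F m) * monom_val x m)"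
  unfolding eval_in_alt using assms
  by (intro sum.mono_neutral_left) (auto simp: in_keys_iff)

lemma eval_in_single:
  assumes "\<iota> 0 = 0"
  shows "eval_in \<iota> (Poly_Mapping.single m c) x = \<iota> c * monom_val x m"
  by (subst eval_in_superset[of _ "{m}"]) (auto simp: assms)

lemma eval_in_zero [simp]: "eval_in \<iota> 0 x = 0"
  by (simp add: eval_in_def)

lemma eval_in_add:
  assumes "ring_hom1 \<iota>"
  shows "eval_in \<iota> (F + G) x = eval_in \<iota> F x + eval_in \<iota> G x"
proof -
  note h = ring_hom1D[OF assms]
  have "ks (F + G) \<subseteq> ks F \<union> ks G" by (rule Poly_Mapping.keys_add)
  thus ?thesis
    by (subst (1 2 3) eval_in_superset[where A="ks F \<union> ks G"])
       (auto simp: lookup_add h sum.distrib algebra_simps)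
qed

lemma eval_in_sum:
  assumes "ring_hom1 \<iota>"
  shows "eval_in \<iota> (\<Sum>a\<in>A. F a) x = (\<Sum>a\<in>A. eval_in \<iota> (F a) x)"
  by (induction A rule: infinite_finite_induct) (auto simp: eval_in_add[OF assms])

lemma cpoly_eq_sum_single: "F = (\<Sum>m\<in>ks F. Poly_Mapping.single m (lk F m))"
  by (rule poly_mapping_eqI)
     (auto simp: lookup_sum lookup_single when_def in_keys_iff if_distrib sum.delta' cong: if_cong)

lemma eval_in_mult:
  assumes "ring_hom1 \<iota>"
  shows "eval_in \<iota> (F * G) x = eval_in \<iota> F x * eval_in \<iota> G x"
proof -
  note h = ring_hom1D[OF assms]
  have "F * G = (\<Sum>m\<in>ks F. \<Sum>n\<in>ks G. Poly_Mapping.single (m + n) (lk F m * lk G n))"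
    by (subst (1) cpoly_eq_sum_single[of F], subst (1) cpoly_eq_sum_single[of G])
       (simp add: sum_product mult_single)
  also have "eval_in \<iota> \<dots> x = (\<Sum>m\<in>ks F. \<Sum>n\<in>ks G. (\<iota> (lk F m) * monom_val x m) * (\<iota> (lk G n) * monom_val x n))"
    by (simp add: eval_in_sum[OF assms] eval_in_single h monom_val_add mult_ac)
  also have "\<dots> = eval_in \<iota> F x * eval_in \<iota> G x"
    by (simp add: eval_in_alt sum_product)
  finally show ?thesis .
qed

lemma eval_in_one: "ring_hom1 \<iota> \<Longrightarrow> eval_in \<iota> 1 x = 1"
  using eval_in_single[of \<iota> 0 1 x] ring_hom1D[of \<iota>]
  by (simp add: monom_val_0 single_one[symmetric] del: single_one)

lemma eval_in_prod:
  assumes "ring_hom1 \<iota>"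
  shows "eval_in \<iota> (\<Prod>a\<in>A. F a) x = (\<Prod>a\<in>A. eval_in \<iota> (F a) x)"
  by (induction A rule: infinite_finite_induct) (auto simp: eval_in_mult[OF assms] eval_in_one[OF assms])

lemma eval_in_uminus:
  assumes "ring_hom1 \<iota>"
  shows "eval_in \<iota> (- F) x = - eval_in \<iota> F x"
proof -
  have "eval_in \<iota> (- F + F) x = 0" by simp
  thus ?thesis unfolding eval_in_add[OF assms] by (simp add: eq_neg_iff_add_eq_0)
qed

lemma eval_in_diff: "ring_hom1 \<iota> \<Longrightarrow> eval_in \<iota> (F - G) x = eval_in \<iota> F x - eval_in \<iota> G x"
  using eval_in_add[of \<iota> F "- G" x] by (simp add: eval_in_uminus)

lemma eval_in_power: "ring_hom1 \<iota> \<Longrightarrow> eval_in \<iota> (F ^ n) x = eval_in \<iota> F x ^ n"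
  by (induction n) (auto simp: eval_in_mult eval_in_one)

lemma monom_val_hom:
  assumes "ring_hom1 h"
  shows "h (monom_val x m) = monom_val (\<lambda>v. h (x v)) m"
proof -
  note h = ring_hom1D[OF assms]
  have pw: "h (a ^ n) = h a ^ n" for a n by (induction n) (auto simp: h)
  have "h (\<Prod>v\<in>A. x v ^ lk m v) = (\<Prod>v\<in>A. h (x v ^ lk m v))" for A
    by (induction A rule: infinite_finite_induct) (auto simp: h)
  thus ?thesis by (simp add: monom_val_def pw)
qed

lemma eval_in_hom:
  assumes "ring_hom1 h"
  shows "h (eval_in \<iota> F x) = eval_in (\<lambda>c. h (\<iota> c)) F (\<lambda>v. h (x v))"
proof -
  note h = ring_hom1D[OF assms]
  have "h (\<Sum>v\<in>A. \<iota> (lk F v) * monom_val x v) = (\<Sum>v\<in>A. h (\<iota> (lk F v) * monom_val x v))" for A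
    by (induction A rule: infinite_finite_induct) (auto simp: h)
  thus ?thesis by (simp add: eval_in_alt h monom_val_hom[OF assms])
qed

lemma poly_eval_in:
  "poly (eval_in (\<lambda>c. [:c:]) F X) t = eval F (\<lambda>v. poly (X v) t)"
  unfolding eval_def by (subst eval_in_hom[OF ring_hom1_poly]) simp

lemmas eval_simps =
  eval_in_add[OF ring_hom1_id, folded eval_def] eval_in_mult[OF ring_hom1_id, folded eval_def]
  eval_in_diff[OF ring_hom1_id, folded eval_def] eval_in_uminus[OF ring_hom1_id, folded eval_def]
  eval_in_sum[OF ring_hom1_id, folded eval_def] eval_in_prod[OF ring_hom1_id, folded eval_def]
  eval_in_power[OF ring_hom1_id, folded eval_def] eval_in_one[OF ring_hom1_id, folded eval_def]
  eval_in_zero[of "\<lambda>c::complex. c", folded eval_def]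

lemma eval_single: "eval (Poly_Mapping.single m c) x = c * monom_val x m"
  unfolding eval_def by (rule eval_in_single) simp

text \<open>Kronecker substitution: with a large base the exponents of the monomials become distinct
  natural numbers, and a univariate polynomial is determined by its values.\<close>

lemma cpoly_eq_0I:
  fixes F :: "'v::finite cpoly"
  assumes "\<And>x. eval F x = 0"
  shows "F = 0"
proof (rule ccontr)
  assume "F \<noteq> 0"
  then obtain m0 where m0: "m0 \<in> ks F" by (metis keys_eq_empty all_not_in_conv)
  define N where "N = Suc (Max (insert 0 (\<Union>m\<in>ks F. range (lk m))))"
  have Npos: "0 < N" by (simp add: N_def)
  have lt: "lk m v < N" if "m \<in> ks F" for m v
    using that by (auto simp: N_def less_Suc_eq_le intro!: Max_ge)
  obtain e :: "'v \<Rightarrow> nat" where e: "bij_betw e UNIV {..<CARD('v)}"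
    using ex_bij_betw_finite_nat[of "UNIV :: 'v set"] by (auto simp: lessThan_atLeast0)
  define code where "code m = (\<Sum>v\<in>UNIV. lk m v * N ^ e v)" for m :: "'v \<Rightarrow>\<^sub>0 nat"
  have inj: "m = m'" if "m \<in> ks F" "m' \<in> ks F" "code m = code m'" for m m'
  proof -
    define d where "d k = inv_into UNIV e k" for k
    have de: "d (e v) = v" for v using e by (simp add: d_def bij_betw_def)
    have c: "code m = (\<Sum>k<CARD('v). lk m (d k) * N ^ k)" for m
      unfolding code_def sum.reindex_bij_betw[OF e, of "\<lambda>k. lk m (d k) * N ^ k", symmetric] by (simp add: de)
    have "(\<forall>k<n. a k = b k)" if "(\<Sum>k<n. a k * N ^ k) = (\<Sum>k<n. b k * N ^ k)"
      "\<And>k. a k < N" "\<And>k. b k < N" for n :: nat and a b :: "nat \<Rightarrow> nat"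
      using that
    proof (induction n arbitrary: a b)
      case (Suc n)
      have s: "(\<Sum>k<Suc n. a k * N ^ k) = a 0 + N * (\<Sum>k<n. a (Suc k) * N ^ k)" for a :: "nat \<Rightarrow> nat"
        by (subst sum.lessThan_Suc_shift) (simp add: sum_distrib_left mult_ac)
      have eq: "a 0 + N * (\<Sum>k<n. a (Suc k) * N ^ k) = b 0 + N * (\<Sum>k<n. b (Suc k) * N ^ k)"
        using Suc.prems(1) unfolding s .
      have a0: "a 0 = b 0"
        using arg_cong[OF eq, of "\<lambda>x. x mod N"] unfolding mod_mult_self2 mod_less[OF Suc.prems(2)] mod_less[OF Suc.prems(3)] .
      have "N * (\<Sum>k<n. a (Suc k) * N ^ k) = N * (\<Sum>k<n. b (Suc k) * N ^ k)"
        using eq unfolding a0 by (rule add_left_imp_eq)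
      hence "(\<Sum>k<n. a (Suc k) * N ^ k) = (\<Sum>k<n. b (Suc k) * N ^ k)"
        unfolding nat_mult_eq_cancel1[OF Npos] .
      hence ih: "\<forall>k<n. a (Suc k) = b (Suc k)"
        by (rule Suc.IH) (rule Suc.prems)+
      show ?case
      proof (intro allI impI)
        fix k assume "k < Suc n"
        thus "a k = b k" using ih a0 by (cases k) auto
      qed
    qed auto
    note digits = this
    have "(\<Sum>k<CARD('v). lk m (d k) * N ^ k) = (\<Sum>k<CARD('v). lk m' (d k) * N ^ k)"
      using \<open>code m = code m'\<close> unfolding c .
    from digits[OF this lt[OF \<open>m \<in> ks F\<close>] lt[OF \<open>m' \<in> ks F\<close>]]
    have dk: "\<And>k. k < CARD('v) \<Longrightarrow> lk m (d k) = lk m' (d k)" by simp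
    have "e v < CARD('v)" for v using e unfolding bij_betw_def by blast
    from dk[OF this] have "lk m v = lk m' v" for v unfolding de .
    thus ?thesis by (rule poly_mapping_eqI)
  qed
  define P where "P = (\<Sum>m\<in>ks F. Polynomial.monom (lk F m) (code m))"
  have "poly P t = 0" for t
  proof -
    have mv: "monom_val (\<lambda>v. t ^ (N ^ e v)) m = t ^ code m" for m :: "'v \<Rightarrow>\<^sub>0 nat"
      by (subst monom_val_superset[of UNIV]) (auto simp: code_def power_sum power_mult[symmetric] mult.commute)
    have "poly P t = eval F (\<lambda>v. t ^ (N ^ e v))"
      unfolding eval_def eval_in_alt P_def by (simp add: poly_sum poly_monom mv)
    thus ?thesis using assms by simp
  qed
  hence "P = 0" by (metis poly_all_0_iff_0)
  moreover have "coeff P (code m0) = (\<Sum>m\<in>ks F. if m = m0 then lk F m else 0)"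
    unfolding P_def coeff_sum by (intro sum.cong) (auto dest: inj[OF _ m0])
  ultimately show False using m0 by (simp add: in_keys_iff)
qed

lemma cpoly_eqI:
  fixes F G :: "'v::finite cpoly"
  assumes "\<And>x. eval F x = eval G x"
  shows "F = G"
  using cpoly_eq_0I[of "F - G"] assms by (simp add: eval_simps)

section \<open>Ternary forms as functions on vectors\<close>

definition ev :: "form \<Rightarrow> complex^3 \<Rightarrow> complex" where "ev f x = eval f (($) x)"

lemma form_eqI: "(\<And>x. ev f x = ev g x) \<Longrightarrow> f = g"
proof (rule cpoly_eqI)
  fix x :: "3 \<Rightarrow> complex"
  assume "\<And>x. ev f x = ev g x"
  moreover have "($) (\<chi> i. x i) = x" by (rule ext) simp
  ultimately show "eval f x = eval g x" by (metis ev_def)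
qed

definition cst :: "complex \<Rightarrow> form" where "cst c = Poly_Mapping.single 0 c"

lemma ev_simps [simp]:
  "ev (f + g) x = ev f x + ev g x" "ev (f * g) x = ev f x * ev g x" "ev (f - g) x = ev f x - ev g x"
  "ev (- f) x = - ev f x" "ev 0 x = 0" "ev 1 x = 1" "ev (cst c) x = c" "ev (f ^ n) x = ev f x ^ n"
  "ev (sum h A) x = (\<Sum>a\<in>A. ev (h a) x)"
  by (simp_all add: ev_def eval_simps cst_def eval_single monom_val_0)

lemma cst_0 [simp]: "cst 0 = 0" by (simp add: cst_def)

lemma cst_eq_0_iff [simp]: "cst c = 0 \<longleftrightarrow> c = 0"
  using ev_simps(5,7) by (metis cst_0)

lemma form_scale_cst: "form_scale c f = cst c * f"
  by (simp add: form_scale_def cst_def)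

definition lin :: "complex^3 \<Rightarrow> form"
  where "lin a = (\<Sum>i\<in>UNIV. Poly_Mapping.single (Poly_Mapping.single i 1) (a $ i))"

text \<open>The bilinear pairing, without conjugation, so that it is polynomial in both
  arguments.\<close>

definition dot3 :: "complex^3 \<Rightarrow> complex^3 \<Rightarrow> complex"  (infixl \<open>\<odot>\<close> 70)
  where "a \<odot> x = a$1 * x$1 + a$2 * x$2 + a$3 * x$3"

lemma ev_lin [simp]: "ev (lin a) x = a \<odot> x"
  unfolding lin_def ev_simps
  by (simp add: sum_3 ev_def eval_single monom_val_single dot3_def)

lemma lin_eq_0_iff [simp]: "lin a = 0 \<longleftrightarrow> a = 0"
proof
  assume "lin a = 0"
  hence *: "a \<odot> x = 0" for x using ev_lin[of a x] by simp
  show "a = 0" using *[of "axis 1 1"] *[of "axis 2 1"] *[of "axis 3 1"]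
    by (simp add: dot3_def vec_eq_iff forall_3 axis_def)
qed (simp add: lin_def)

section \<open>Homogeneous forms\<close>

definition mdeg :: "('v \<Rightarrow>\<^sub>0 nat) \<Rightarrow> nat" where "mdeg m = (\<Sum>v\<in>ks m. lk m v)"

lemma mdeg_superset: "finite A \<Longrightarrow> ks m \<subseteq> A \<Longrightarrow> mdeg m = (\<Sum>v\<in>A. lk m v)"
  unfolding mdeg_def by (intro sum.mono_neutral_left) (auto simp: in_keys_iff)

lemma mdeg_add: "mdeg (m + n) = mdeg m + mdeg n"
proof -
  have "ks (m + n) \<subseteq> ks m \<union> ks n" by (rule Poly_Mapping.keys_add)
  thus ?thesis
    by (subst (1 2 3) mdeg_superset[of "ks m \<union> ks n"]) (auto simp: lookup_add sum.distrib)
qed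

lemma mdeg_single [simp]: "mdeg (Poly_Mapping.single v k) = k"
  by (subst mdeg_superset[of "{v}"]) auto

lemma mdeg_0 [simp]: "mdeg 0 = 0" by (simp add: mdeg_def)

lemma mdeg_SucE:
  assumes "mdeg m = Suc d"
  obtains v n where "m = Poly_Mapping.single v 1 + n" "mdeg n = d"
proof -
  from assms have "ks m \<noteq> {}" by (auto simp: mdeg_def)
  then obtain v where v: "v \<in> ks m" by blast
  have e: "m = Poly_Mapping.single v 1 + (m - Poly_Mapping.single v 1)"
    by (rule poly_mapping_eqI) (use v in \<open>auto simp: lookup_add lookup_minus lookup_single when_def in_keys_iff\<close>)
  show ?thesis
    by (rule that[OF e]) (use assms e mdeg_add mdeg_single in \<open>metis plus_1_eq_Suc old.nat.inject\<close>)
qed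

lemma mdeg_eq_0_iff: "mdeg m = 0 \<longleftrightarrow> m = 0"
  by (metis keys_eq_empty keys_zero mdeg_0 mdeg_def sum_eq_0_iff finite_keys in_keys_iff ex_in_conv)

lemma homogeneous_iff: "homogeneous d F \<longleftrightarrow> (\<forall>m\<in>ks F. mdeg m = d)"
  by (simp add: homogeneous_def mdeg_def)

lemma homogeneous_0 [simp]: "homogeneous d 0" by (simp add: homogeneous_iff)

lemma homogeneous_single: "mdeg m = d \<Longrightarrow> homogeneous d (Poly_Mapping.single m c)"
  by (auto simp: homogeneous_iff)

lemma homogeneous_add: "homogeneous d F \<Longrightarrow> homogeneous d G \<Longrightarrow> homogeneous d (F + G)"
  using Poly_Mapping.keys_add[of F G] by (auto simp: homogeneous_iff)

lemma homogeneous_uminus: "homogeneous d F \<Longrightarrow> homogeneous d (- F)"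
  by (auto simp: homogeneous_iff in_keys_iff)

lemma homogeneous_diff: "homogeneous d F \<Longrightarrow> homogeneous d G \<Longrightarrow> homogeneous d (F - G)"
  using homogeneous_add[of d F "- G"] homogeneous_uminus[of d G] by simp

lemma homogeneous_sum: "(\<And>a. a \<in> A \<Longrightarrow> homogeneous d (f a)) \<Longrightarrow> homogeneous d (sum f A)"
  by (induction A rule: infinite_finite_induct) (auto intro: homogeneous_add)

lemma homogeneous_mult: "homogeneous d F \<Longrightarrow> homogeneous e G \<Longrightarrow> homogeneous (d + e) (F * G)"
  using Poly_Mapping.keys_mult[of F G] by (fastforce simp: homogeneous_iff mdeg_add)

lemma homogeneous_cst: "homogeneous 0 (cst c)"
  by (auto simp: cst_def intro: homogeneous_single)

lemma homogeneous_cst_mult: "homogeneous d f \<Longrightarrow> homogeneous d (cst c * f)"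
  using homogeneous_mult[OF homogeneous_cst[of c], of d f] by simp

lemma homogeneous_lin [simp]: "homogeneous 1 (lin a)"
  unfolding lin_def by (intro homogeneous_sum homogeneous_single) simp

text \<open>A form is the sum of its monomials, all of the same degree; statements additive in the
  form reduce to a single monomial.\<close>

lemma homogeneous_induct [consumes 1, case_names zero add single]:
  assumes "homogeneous d F" "P 0" "\<And>F G. P F \<Longrightarrow> P G \<Longrightarrow> P (F + G)"
    "\<And>m c. mdeg m = d \<Longrightarrow> P (Poly_Mapping.single m c)"
  shows "P F"
proof -
  have "P (\<Sum>m\<in>A. Poly_Mapping.single m (lk F m))" if "A \<subseteq> ks F" "finite A" for A
    using that(2,1) by (induction rule: finite_induct) (use assms in \<open>auto simp: homogeneous_iff\<close>)
  from this[of "ks F"] show ?thesis using cpoly_eq_sum_single[of F] by simp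
qed

lemma monom_val_scale: "monom_val (\<lambda>v. c * x v) m = c ^ mdeg m * monom_val x m"
  by (simp add: monom_val_def mdeg_def power_mult_distrib prod.distrib power_sum)

lemma eval_scale:
  assumes "homogeneous d F"
  shows "eval F (\<lambda>v. c * x v) = c ^ d * eval F x"
  using assms
  by (induction rule: homogeneous_induct)
     (auto simp: eval_simps eval_single monom_val_scale algebra_simps)

lemma ev_scale: assumes "homogeneous d f" shows "ev f (c *s x) = c ^ d * ev f x"
proof -
  have "($) (c *s x) = (\<lambda>i. c * x $ i)" by (rule ext) simp
  thus ?thesis using eval_scale[OF assms, of c "($) x"] by (simp add: ev_def)
qed

lemma homogeneous_1E:
  assumes "homogeneous 1 f"
  obtains a where "f = lin a"
proof -
  have "\<exists>a. f = lin a"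
    using assms
  proof (induction rule: homogeneous_induct)
    case zero thus ?case by (intro exI[of _ 0]) simp
  next
    case (add F G)
    then obtain a b where "F = lin a" "G = lin b" by blast
    hence "F + G = lin (a + b)" by (intro form_eqI) (simp add: dot3_def algebra_simps)
    thus ?case by blast
  next
    case (single m c)
    then obtain i n where "m = Poly_Mapping.single i 1 + n" "mdeg n = 0"
      using mdeg_SucE[of m 0] by auto
    hence "m = Poly_Mapping.single i 1" by (simp add: mdeg_eq_0_iff)
    hence "ev (Poly_Mapping.single m c) x = ev (lin (axis i c)) x" for x
      using exhaust_3[of i] unfolding ev_lin by (auto simp: ev_def eval_single monom_val_single dot3_def axis_def)
    hence "Poly_Mapping.single m c = lin (axis i c)" by (rule form_eqI)
    thus ?case by blast
  qed
  thus ?thesis using that by blast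
qed

section \<open>The polar form of a quadric, normalized to return the quadric on the diagonal\<close>

definition bil :: "form \<Rightarrow> complex^3 \<Rightarrow> complex^3 \<Rightarrow> complex"
  where "bil q x y = (ev q (x + y) - ev q x - ev q y) / 2"

text \<open>No symmetry is asked of the matrix: it serves to check the rules for \<open>bil\<close>
  in coordinates.\<close>

lemma quad_matrix:
  assumes "homogeneous 2 q"
  obtains M :: "complex^3^3" where "\<And>x. ev q x = (\<Sum>i\<in>UNIV. \<Sum>j\<in>UNIV. M$i$j * x$i * x$j)"
proof -
  have "\<exists>M::complex^3^3. \<forall>x. ev q x = (\<Sum>i\<in>UNIV. \<Sum>j\<in>UNIV. M$i$j * x$i * x$j)"
    using assms
  proof (induction rule: homogeneous_induct)
    case zero thus ?case by (intro exI[of _ 0]) simp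
  next
    case (add F G)
    then obtain M N :: "complex^3^3" where
      "\<forall>x. ev F x = (\<Sum>i\<in>UNIV. \<Sum>j\<in>UNIV. M$i$j * x$i * x$j)"
      "\<forall>x. ev G x = (\<Sum>i\<in>UNIV. \<Sum>j\<in>UNIV. N$i$j * x$i * x$j)" by blast
    thus ?case by (intro exI[of _ "M + N"]) (simp add: distrib_right sum.distrib)
  next
    case (single m c)
    then obtain i n where m: "m = Poly_Mapping.single i 1 + n" "mdeg n = 1"
      using mdeg_SucE[of m 1] by (auto simp: numeral_2_eq_2)
    then obtain j k where "n = Poly_Mapping.single j 1 + k" "mdeg k = 0"
      using mdeg_SucE[of n 0] by auto
    hence n: "n = Poly_Mapping.single j 1" by (simp add: mdeg_eq_0_iff)
    have "ev (Poly_Mapping.single m c) x = (\<Sum>i'\<in>UNIV. \<Sum>j'\<in>UNIV. (axis i (axis j c) :: complex^3^3)$i'$j' * x$i' * x$j')" for x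
      unfolding m n sum_3 ev_def eval_single monom_val_add monom_val_single
      using exhaust_3[of i] exhaust_3[of j] by (auto simp: axis_def)
    thus ?case by blast
  qed
  thus ?thesis using that by blast
qed

lemma
  assumes "homogeneous 2 q"
  shows bil_add_left: "bil q (x + y) z = bil q x z + bil q y z"
    and bil_scale_left: "bil q (c *s x) z = c * bil q x z"
    and bil_commute: "bil q x y = bil q y x"
    and bil_diag: "bil q x x = ev q x"
proof -
  obtain M :: "complex^3^3" where M: "\<And>x. ev q x = (\<Sum>i\<in>UNIV. \<Sum>j\<in>UNIV. M$i$j * x$i * x$j)"
    using quad_matrix[OF assms] by blast
  show "bil q (x + y) z = bil q x z + bil q y z" "bil q (c *s x) z = c * bil q x z"
    "bil q x y = bil q y x" "bil q x x = ev q x"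
    unfolding bil_def M sum_3 by (simp_all add: field_simps)
qed

lemma bil_add_right: "homogeneous 2 q \<Longrightarrow> bil q z (x + y) = bil q z x + bil q z y"
  and bil_scale_right: "homogeneous 2 q \<Longrightarrow> bil q z (c *s x) = c * bil q z x"
  using bil_add_left bil_scale_left bil_commute by metis+

lemmas bil_simps = bil_add_left bil_add_right bil_scale_left bil_scale_right

lemma ev_quad_expand:
  assumes "homogeneous 2 q"
  shows "ev q (a *s x + b *s y) = a^2 * ev q x + b^2 * ev q y + 2 * a * b * bil q x y"
    and "ev q (a *s x + b *s y + c *s z) = a^2 * ev q x + b^2 * ev q y + c^2 * ev q z
      + 2 * a * b * bil q x y + 2 * a * c * bil q x z + 2 * b * c * bil q y z"
  unfolding bil_diag[OF assms, symmetric]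
  by (simp_all add: bil_simps assms bil_commute[OF assms, of y x] bil_commute[OF assms, of z x]
      bil_commute[OF assms, of z y] algebra_simps power2_eq_square)

text \<open>Sending each variable \<open>X\<close> to \<open>X t\<close> turns a homogeneous form into a monomial in \<open>t\<close>;
  a factor of a monomial is a monomial.\<close>

lemma factor_of_monom:
  fixes p q :: "'a::idom poly"
  assumes "p * q = Polynomial.monom a n" "a \<noteq> 0"
  shows "\<exists>b i. p = Polynomial.monom b i"
proof -
  have nz: "p \<noteq> 0" "q \<noteq> 0" using assms by auto
  \<comment> \<open>Order at 0 and degree are additive and both total \<open>n\<close>. Neither
    factor has order above its degree, so the two agree for \<open>p\<close>, which therefore has a
    single term.\<close>
  have "order 0 (p * q) = n" using assms by (simp add: order_0_monom)
  hence o: "order 0 p + order 0 q = n" using order_mult[of p q] nz by simp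
  have d: "degree p + degree q = n"
    using assms nz by (metis degree_mult_eq degree_monom_eq)
  have "order 0 p \<le> degree p" "order 0 q \<le> degree q" using nz by (auto intro: order_degree)
  with o d have "order 0 p = degree p" by linarith
  hence "Polynomial.monom 1 (degree p) dvd p"
    using order_1[of 0 p] by (simp add: monom_altdef)
  hence "\<forall>k<degree p. coeff p k = 0" by (simp add: monom_1_dvd_iff')
  hence "p = Polynomial.monom (lead_coeff p) (degree p)"
    by (intro poly_eqI) (metis coeff_monom coeff_eq_0 linorder_neqE_nat)
  thus ?thesis by blast
qed

definition grade :: "form \<Rightarrow> form poly"
  where "grade f = eval_in (\<lambda>c. [:cst c:]) f (\<lambda>i. [:0, Poly_Mapping.single (Poly_Mapping.single i 1) 1:])"

lemma ring_hom1_grade: "ring_hom1 (\<lambda>c. [:cst c:])"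
  by (simp add: ring_hom1_def one_pCons cst_def single_one[symmetric] mult_single single_add mult.commute del: single_one)

lemma grade_mult: "grade (f * g) = grade f * grade g"
  by (simp add: grade_def eval_in_mult[OF ring_hom1_grade])

lemma grade_eq: "grade f = (\<Sum>m\<in>ks f. Polynomial.monom (Poly_Mapping.single m (lk f m)) (mdeg m))"
proof -
  have mv: "monom_val (\<lambda>i. [:0, Poly_Mapping.single (Poly_Mapping.single i 1) 1:]) m
    = Polynomial.monom (Poly_Mapping.single m (1::complex)) (mdeg m)" for m :: "3 \<Rightarrow>\<^sub>0 nat"
  proof (induction "mdeg m" arbitrary: m)
    case 0
    hence "m = 0" using mdeg_eq_0_iff by metis
    thus ?case by (simp add: monom_val_0 one_pCons monom_0)
  next
    case (Suc d)
    then obtain v n where m: "m = Poly_Mapping.single v 1 + n" "mdeg n = d" by (metis mdeg_SucE)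
    have x: "[:0, Poly_Mapping.single (Poly_Mapping.single v 1) 1:] = Polynomial.monom (Poly_Mapping.single (Poly_Mapping.single v 1) (1::complex)) 1"
      by (simp add: monom_Suc monom_0)
    have "monom_val (\<lambda>i. [:0, Poly_Mapping.single (Poly_Mapping.single i 1) 1:]) m
      = Polynomial.monom (Poly_Mapping.single (Poly_Mapping.single v 1) (1::complex)) 1 * Polynomial.monom (Poly_Mapping.single n 1) (mdeg n)"
      unfolding m(1) monom_val_add monom_val_single power_one_right x
      by (subst Suc.hyps(1)) (simp_all add: m(2))
    also have "\<dots> = Polynomial.monom (Poly_Mapping.single m 1) (mdeg m)"
      unfolding m(1) mult_monom mult_single mdeg_add mdeg_single by simp
    finally show ?case .
  qed
  have "Polynomial.monom (cst c) 0 * Polynomial.monom (Poly_Mapping.single m 1) (mdeg m)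
    = Polynomial.monom (Poly_Mapping.single m c) (mdeg m)" for c and m :: "3 \<Rightarrow>\<^sub>0 nat"
    by (simp add: mult_monom cst_def mult_single)
  thus ?thesis unfolding grade_def eval_in_alt mv by (simp add: monom_0)
qed

lemma grade_homogeneous:
  assumes h: "homogeneous d f"
  shows "grade f = Polynomial.monom f d"
proof -
  have "(\<Sum>m\<in>ks f. Polynomial.monom (Poly_Mapping.single m (lk f m)) (mdeg m))
    = (\<Sum>m\<in>ks f. Polynomial.monom (Poly_Mapping.single m (lk f m)) d)"
    using h by (intro sum.cong) (auto simp: homogeneous_iff)
  also have "\<dots> = Polynomial.monom (\<Sum>m\<in>ks f. Poly_Mapping.single m (lk f m)) d"
    by (intro poly_eqI) (simp add: coeff_sum)
  finally show "grade f = Polynomial.monom f d" using cpoly_eq_sum_single[of f] unfolding grade_eq by metis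
qed

lemma grade_monomD:
  assumes "grade f = Polynomial.monom b i"
  shows "homogeneous i f"
  unfolding homogeneous_iff
proof (rule ccontr)
  assume "\<not> (\<forall>m\<in>ks f. mdeg m = i)"
  then obtain m0 where m0: "m0 \<in> ks f" "mdeg m0 \<noteq> i" by blast
  have "0 = coeff (grade f) (mdeg m0)" using assms m0 by simp
  also have "\<dots> = (\<Sum>m\<in>ks f. if mdeg m = mdeg m0 then Poly_Mapping.single m (lk f m) else 0)"
    unfolding grade_eq coeff_sum by (intro sum.cong) auto
  finally have "0 = lk (\<Sum>m\<in>ks f. if mdeg m = mdeg m0 then Poly_Mapping.single m (lk f m) else 0) m0" by simp
  also have "\<dots> = (\<Sum>m\<in>ks f. if m = m0 then lk f m else 0)"
    unfolding lookup_sum by (intro sum.cong) (auto simp: lookup_single when_def)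
  finally show False using m0 by (auto simp: in_keys_iff)
qed

lemma homogeneous_unique: "homogeneous d f \<Longrightarrow> homogeneous e f \<Longrightarrow> f \<noteq> 0 \<Longrightarrow> d = e"
  by (metis homogeneous_iff keys_eq_empty all_not_in_conv)

lemma homogeneous_factor:
  fixes g h :: form
  assumes "homogeneous d (g * h)" "g * h \<noteq> 0"
  obtains e k where "homogeneous e g" "homogeneous k h" "e + k = d"
proof -
  have *: "grade g * grade h = Polynomial.monom (g * h) d"
    using grade_homogeneous[OF assms(1)] by (simp add: grade_mult)
  obtain b i where "grade g = Polynomial.monom b i" using factor_of_monom[OF * assms(2)] by blast
  hence g: "homogeneous i g" by (rule grade_monomD)
  obtain c k where "grade h = Polynomial.monom c k"
    using factor_of_monom[of "grade h" "grade g"] * assms(2) by (metis mult.commute)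
  hence h: "homogeneous k h" by (rule grade_monomD)
  have "i + k = d" using homogeneous_unique[OF homogeneous_mult[OF g h] assms(1,2)] .
  with g h show ?thesis using that by blast
qed

section \<open>Units, irreducible quadrics and reducible cubics\<close>

lemma homogeneous_0E:
  assumes "homogeneous 0 f" obtains c where "f = cst c"
proof -
  have "f = cst (lk f 0)"
    by (rule poly_mapping_eqI) (use assms in \<open>auto simp: cst_def lookup_single when_def homogeneous_iff mdeg_eq_0_iff in_keys_iff\<close>)
  thus ?thesis using that by blast
qed

lemma cst_mult: "cst c * cst d = cst (c * d)" by (simp add: cst_def mult_single)
lemma cst_1: "cst 1 = 1" by (simp add: cst_def)

lemma form_unit_iff:
  fixes f :: form
  assumes "f \<noteq> 0" "homogeneous d f"
  shows "f dvd 1 \<longleftrightarrow> d = 0"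
proof
  assume "f dvd 1"
  then obtain g where g: "1 = f * g" by auto
  have "homogeneous 0 (f * g)" unfolding g[symmetric] using homogeneous_cst[of 1] by (simp add: cst_1)
  moreover have "f * g \<noteq> 0" unfolding g[symmetric] by simp
  ultimately obtain e k where "homogeneous e f" "e + k = 0" using homogeneous_factor by metis
  thus "d = 0" using homogeneous_unique assms by auto
next
  assume "d = 0"
  then obtain c where c: "f = cst c" using assms homogeneous_0E by blast
  hence "1 = f * cst (1 / c)" using assms by (simp add: cst_mult cst_1)
  thus "f dvd 1" by (rule dvdI)
qed

text \<open>Factors of a form are forms, so a proper factorization of a quadric has two factors of
  degree one.\<close>

lemma irreducible_quadI:
  assumes q: "homogeneous 2 q" "q \<noteq> 0" and n: "\<And>a b. q \<noteq> lin a * lin b"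
  shows "irreducible q"
proof (rule irreducibleI)
  show "q \<noteq> 0" by fact
  show "\<not> q dvd 1" using form_unit_iff[OF q(2,1)] by simp
  fix g h assume gh: "q = g * h"
  obtain e k where ek: "homogeneous e g" "homogeneous k h" "e + k = 2"
    using homogeneous_factor[of 2 g h] q gh by auto
  have nz: "g \<noteq> 0" "h \<noteq> 0" using q gh by auto
  show "g dvd 1 \<or> h dvd 1"
  proof (rule ccontr)
    assume "\<not> (g dvd 1 \<or> h dvd 1)"
    hence "e = 1" "k = 1" using ek form_unit_iff[OF nz(1) ek(1)] form_unit_iff[OF nz(2) ek(2)] by auto
    thus False using ek n gh homogeneous_1E by metis
  qed
qed

lemma irreducible_quadD:
  assumes "irreducible q"
  shows "q \<noteq> lin a * lin b"
proof
  assume e: "q = lin a * lin b"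
  have "q \<noteq> 0" using assms by auto
  hence nz: "lin a \<noteq> 0" "lin b \<noteq> 0" using e by auto
  have "lin a dvd 1 \<or> lin b dvd 1" using assms e by (rule irreducibleD)
  thus False using form_unit_iff[OF nz(1) homogeneous_lin] form_unit_iff[OF nz(2) homogeneous_lin] by simp
qed

lemma reducible_cubicE:
  assumes f: "homogeneous 3 f" "f \<noteq> 0" and n: "\<not> irreducible f"
  obtains a q where "f = lin a * q" "homogeneous 2 q"
proof -
  have "\<not> f dvd 1" using form_unit_iff[OF f(2,1)] by simp
  then obtain g h where gh: "f = g * h" "\<not> g dvd 1" "\<not> h dvd 1"
    using n f by (auto simp: irreducible_def)
  obtain e k where ek: "homogeneous e g" "homogeneous k h" "e + k = 3"
    using homogeneous_factor[of 3 g h] f gh by auto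
  have nz: "g \<noteq> 0" "h \<noteq> 0" using f gh by auto
  have "e \<noteq> 0" "k \<noteq> 0" using form_unit_iff[OF nz(1) ek(1)] form_unit_iff[OF nz(2) ek(2)] gh by auto
  with ek(3) consider "e = 1" "k = 2" | "e = 2" "k = 1" by linarith
  thus ?thesis
  proof cases
    case 1 thus ?thesis using ek that gh homogeneous_1E by metis
  next
    case 2 thus ?thesis using ek that gh homogeneous_1E mult.commute by metis
  qed
qed

lemma reducible_cubicI:
  assumes "f = lin a * q" "homogeneous 2 q" "f \<noteq> 0"
  shows "\<not> irreducible f"
proof
  assume i: "irreducible f"
  have nz: "lin a \<noteq> 0" "q \<noteq> 0" using assms by auto
  have "lin a dvd 1 \<or> q dvd 1" using i assms(1) by (rule irreducibleD)
  thus False using form_unit_iff[OF nz(1) homogeneous_lin] form_unit_iff[OF nz(2) assms(2)] by simp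
qed

section \<open>Lines and conics through given points\<close>

definition crs :: "complex^3 \<Rightarrow> complex^3 \<Rightarrow> complex^3"
  where "crs a b = vector [a$2 * b$3 - a$3 * b$2, a$3 * b$1 - a$1 * b$3, a$1 * b$2 - a$2 * b$1]"

text \<open>The determinant of three vectors, the bracket of classical invariant theory: it vanishes
  exactly when some line contains all three.\<close>

definition br :: "complex^3 \<Rightarrow> complex^3 \<Rightarrow> complex^3 \<Rightarrow> complex"
  where "br a b c = crs a b \<odot> c"

lemmas coord_simps = br_def crs_def dot3_def vector_3 vec_eq_iff forall_3
  vector_add_component vector_minus_component vector_scalar_mult_def vec_lambda_beta zero_index

lemma dot3_simps:
  "(a + b) \<odot> x = a \<odot> x + b \<odot> x" "(a - b) \<odot> x = a \<odot> x - b \<odot> x" "(k *s a) \<odot> x = k * (a \<odot> x)"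
  "x \<odot> (a + b) = x \<odot> a + x \<odot> b" "x \<odot> (a - b) = x \<odot> a - x \<odot> b" "x \<odot> (k *s a) = k * (x \<odot> a)"
  "0 \<odot> x = 0" "x \<odot> 0 = 0" "(- a) \<odot> x = - (a \<odot> x)" "x \<odot> (- a) = - (x \<odot> a)"
  by (simp_all add: coord_simps algebra_simps)

lemma dot3_commute: "a \<odot> b = b \<odot> a" by (simp add: dot3_def mult.commute)

lemma crs_dot [simp]: "crs a b \<odot> a = 0" "crs a b \<odot> b = 0"
  by (simp_all add: coord_simps algebra_simps)

lemma crs_swap: "crs a b = - crs b a" by (simp add: coord_simps)

lemma crs_eq_0_swap: "crs a b = 0 \<longleftrightarrow> crs b a = 0"
  by (simp add: crs_swap[of a b])

lemma crs_self [simp]: "crs a a = 0" by (simp add: coord_simps)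

lemma br_rot: "br a b c = br b c a" "br a b c = br c a b" by (simp_all add: coord_simps algebra_simps)
lemma br_swap: "br b a c = - br a b c" "br a c b = - br a b c" "br c b a = - br a b c"
  by (simp_all add: coord_simps algebra_simps)
lemma br_same [simp]: "br a a c = 0" "br a b a = 0" "br a b b = 0"
  by (simp_all add: coord_simps algebra_simps)

lemma br_perms_eq_0:
  "br a b c = 0 \<Longrightarrow> br a c b = 0 \<and> br b a c = 0 \<and> br b c a = 0 \<and> br c a b = 0 \<and> br c b a = 0"
  using br_rot[of a b c] br_swap[of b a c] br_swap(2)[of a c b] br_swap(3)[of c b a] by simp

lemma br_linear: "br a b (x + y) = br a b x + br a b y" "br a b (k *s x) = k * br a b x"
  by (simp_all add: br_def dot3_simps)

lemma cramer: "br a b c *s x = br x b c *s a + br a x c *s b + br a b x *s c"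
  by (simp add: coord_simps algebra_simps)

lemma cramer_dual: "br u v w *s a = (a \<odot> u) *s crs v w + (a \<odot> v) *s crs w u + (a \<odot> w) *s crs u v"
  by (simp add: coord_simps algebra_simps)

lemma smult_cancel: "k *s (x::complex^3) = k *s y \<Longrightarrow> k \<noteq> 0 \<Longrightarrow> x = y"
  by simp

lemma basis_expand:
  assumes "br a b c \<noteq> 0"
  shows "x = (br x b c / br a b c) *s a + (br a x c / br a b c) *s b + (br a b x / br a b c) *s c"
  by (rule smult_cancel[of "br a b c"])
     (use assms cramer[of a b c x] in \<open>simp_all add: vector_add_ldistrib\<close>)

lemma dot_basis_eqI:
  assumes "br u v w \<noteq> 0" "a \<odot> u = b \<odot> u" "a \<odot> v = b \<odot> v" "a \<odot> w = b \<odot> w"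
  shows "a = b"
  by (rule smult_cancel[of "br u v w"]) (use assms cramer_dual in simp_all)

lemma indep_completion:
  assumes "crs u v \<noteq> 0" obtains w where "br u v w \<noteq> 0"
proof -
  obtain i where "crs u v $ i \<noteq> 0" using assms by (auto simp: vec_eq_iff)
  hence "br u v (axis i 1) \<noteq> 0"
    using exhaust_3[of i] by (auto simp: br_def dot3_def axis_def)
  thus ?thesis using that by blast
qed

lemma orth_crs:
  assumes "crs u v \<noteq> 0" "a \<odot> u = 0" "a \<odot> v = 0"
  obtains k where "a = k *s crs u v"
proof -
  obtain w where w: "br u v w \<noteq> 0" using indep_completion assms by blast
  have "a = ((a \<odot> w) / br u v w) *s crs u v"
    by (rule dot_basis_eqI[OF w]) (use assms w in \<open>simp_all add: dot3_simps br_def\<close>)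
  thus ?thesis using that by blast
qed

lemma crs_eq_0E:
  assumes "crs u v = 0" "u \<noteq> 0" obtains k where "v = k *s u"
proof -
  obtain i where i: "u $ i \<noteq> 0" using assms by (auto simp: vec_eq_iff)
  have "v = (v $ i / u $ i) *s u"
    using assms(1) i exhaust_3[of i] by (auto simp: coord_simps field_simps)
  thus ?thesis using that by blast
qed

lemma crs_scale [simp]: "crs (k *s a) b = k *s crs a b" "crs a (k *s b) = k *s crs a b"
  by (simp_all add: coord_simps algebra_simps)

lemma vec_scale_assoc: "a *s (b *s (v::complex^3)) = (a * b) *s v"
  by (simp add: vec_eq_iff)

lemma span_indep:
  assumes "crs a b \<noteq> 0" "br a b x = 0"
  obtains s t where "x = s *s a + t *s b"
proof -
  obtain w where w: "br a b w \<noteq> 0" using indep_completion assms by blast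
  show ?thesis
    by (rule that[of "br x b w / br a b w" "br a x w / br a b w"], rule trans[OF basis_expand[OF w]]) (simp add: assms(2))
qed

lemma orth_br_eq_0:
  assumes "a \<noteq> 0" "a \<odot> u = 0" "a \<odot> v = 0" "a \<odot> w = 0"
  shows "br u v w = 0"
  using dot_basis_eqI[of u v w a 0] assms by (auto simp: dot3_simps)

lemma lin_scale: "lin (k *s a) = cst k * lin a"
  by (rule form_eqI) (simp add: dot3_simps)

section \<open>Quadrics containing a line or passing through five points\<close>

lemma homogeneous_lin_mult: "homogeneous 2 (lin a * lin b)"
  using homogeneous_mult[OF homogeneous_lin homogeneous_lin] by (simp add: numeral_2_eq_2)

text \<open>On the line \<open>a b\<close> the quadric is a binary form with three distinct zeros,
  which forces \<open>bil q a b = 0\<close>. In a basis \<open>a\<close>, \<open>b\<close>,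
  \<open>w\<close> every remaining term contains the coordinate along \<open>w\<close>, and that
  coordinate is a multiple of the equation of the line.\<close>

lemma quad_contains_line:
  assumes q: "homogeneous 2 q" "ev q a = 0" "ev q b = 0" "ev q c = 0"
    and i: "crs a b \<noteq> 0" "crs a c \<noteq> 0" "crs b c \<noteq> 0" "br a b c = 0"
  obtains m where "q = lin (crs a b) * lin m"
proof -
  obtain s t where c: "c = s *s a + t *s b" using span_indep[OF i(1,4)] .
  have "s \<noteq> 0" using i c by auto
  moreover have "t \<noteq> 0" using i c by auto
  moreover have "2 * s * t * bil q a b = 0"
    using q(4) unfolding c ev_quad_expand(1)[OF q(1)] using q by simp
  ultimately have B: "bil q a b = 0" by simp
  obtain w where w: "br a b w \<noteq> 0" using indep_completion i by blast
  define D where "D = br a b w"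
  \<comment> \<open>The cofactor, read off from the expansion of \<open>q\<close> in the basis; each
    of the two coordinates in a product contributes one denominator \<open>D\<close>.\<close>
  define m where "m = (2 * bil q a w / D / D) *s crs b w + (2 * bil q b w / D / D) *s crs w a + (ev q w / D / D) *s crs a b"
  have "ev q x = ev (lin (crs a b) * lin m) x" for x
  proof -
    have "ev q x = ev q ((br x b w / D) *s a + (br a x w / D) *s b + (br a b x / D) *s w)"
      unfolding D_def by (intro arg_cong[where f="ev q"] basis_expand w)
    also have "\<dots> = (br a b x / D)^2 * ev q w + 2 * (br x b w / D) * (br a b x / D) * bil q a w
      + 2 * (br a x w / D) * (br a b x / D) * bil q b w"
      unfolding ev_quad_expand(2)[OF q(1)] using q B by simp
    also have "\<dots> = br a b x * (m \<odot> x)"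
      unfolding m_def dot3_simps br_def[symmetric] br_rot(1)[of x b w] br_rot(2)[of a x w]
      by (simp add: power2_eq_square distrib_left add_divide_distrib mult_ac)
    finally show ?thesis by (simp add: br_def)
  qed
  hence "q = lin (crs a b) * lin m" by (rule form_eqI)
  thus ?thesis using that by blast
qed

lemma irreducible_no_collinear:
  assumes "irreducible q" "homogeneous 2 q" "ev q a = 0" "ev q b = 0" "ev q c = 0"
    "crs a b \<noteq> 0" "crs a c \<noteq> 0" "crs b c \<noteq> 0"
  shows "br a b c \<noteq> 0"
proof
  assume "br a b c = 0"
  then obtain m where "q = lin (crs a b) * lin m" using quad_contains_line assms by metis
  thus False using irreducible_quadD[OF assms(1)] by blast
qed

text \<open>The member through \<open>t\<close> of the pencil of quadrics through \<open>p\<close>,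
  \<open>q\<close>, \<open>r\<close>, \<open>s\<close> spanned by two of their line pairs: each pair
  is weighted by the value of the other at \<open>t\<close>.\<close>

definition conic5 :: "complex^3 \<Rightarrow> complex^3 \<Rightarrow> complex^3 \<Rightarrow> complex^3 \<Rightarrow> complex^3 \<Rightarrow> form"
  where "conic5 p q r s t = cst (br p r t * br q s t) * (lin (crs p q) * lin (crs r s))
    - cst (br p q t * br r s t) * (lin (crs p r) * lin (crs q s))"

lemma homogeneous_conic5: "homogeneous 2 (conic5 p q r s t)"
  unfolding conic5_def by (intro homogeneous_diff homogeneous_cst_mult homogeneous_lin_mult)

lemma ev_conic5: "ev (conic5 p q r s t) x
  = br p r t * br q s t * (br p q x * br r s x) - br p q t * br r s t * (br p r x * br q s x)"
  by (simp add: conic5_def br_def)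

lemma ev_conic5_self [simp]:
  "ev (conic5 p q r s t) p = 0" "ev (conic5 p q r s t) q = 0" "ev (conic5 p q r s t) r = 0"
  "ev (conic5 p q r s t) s = 0" "ev (conic5 p q r s t) t = 0"
  by (simp_all add: ev_conic5)

lemma crs_nz_of_br: "br a b c \<noteq> 0 \<Longrightarrow> crs a b \<noteq> 0 \<and> crs a c \<noteq> 0 \<and> crs b c \<noteq> 0"
proof (intro conjI notI)
  show "crs a b = 0 \<Longrightarrow> br a b c \<noteq> 0 \<Longrightarrow> False" by (simp add: br_def dot3_simps)
  show "crs a c = 0 \<Longrightarrow> br a b c \<noteq> 0 \<Longrightarrow> False"
    using br_swap(2)[of a c b] by (simp add: br_def[of a c] dot3_simps)
  show "crs b c = 0 \<Longrightarrow> br a b c \<noteq> 0 \<Longrightarrow> False"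
    using br_rot(1)[of a b c] by (simp add: br_def[of b c] dot3_simps)
qed

lemma lin_vanish3:
  assumes "br a b c \<noteq> 0" "m \<odot> a = 0" "m \<odot> b = 0" "m \<odot> c = 0" shows "m = 0"
  using dot_basis_eqI[of a b c m 0] assms by (simp add: dot3_simps)

text \<open>Subtracting the multiple of \<open>conic5\<close> that agrees with \<open>f\<close> at
  the further point \<open>p + q\<close> leaves a quadric with three zeros on the line
  \<open>p q\<close>. It contains this line, and its other factor vanishes at the non-collinear
  points \<open>r\<close>, \<open>s\<close>, \<open>t\<close>, so it is zero.\<close>

lemma quad5_unique:
  assumes q: "homogeneous 2 f" "ev f p = 0" "ev f q = 0" "ev f r = 0" "ev f s = 0" "ev f t = 0"
    and nz: "br p q r \<noteq> 0" "br p q s \<noteq> 0" "br p q t \<noteq> 0" "br p r s \<noteq> 0"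
     "br q r s \<noteq> 0"  "br r s t \<noteq> 0"
  obtains c where "f = cst c * conic5 p q r s t"
proof -
  define x where "x = p + q"
  have br: "br p q x = 0" "br p r x = - br p q r" "br q s x = br p q s"
    by (simp_all add: x_def coord_simps algebra_simps)
  have Q: "ev (conic5 p q r s t) x \<noteq> 0"
    using nz by (simp add: ev_conic5 br)
  define c where "c = ev f x / ev (conic5 p q r s t) x"
  define g where "g = f - cst c * conic5 p q r s t"
  have hg: "homogeneous 2 g" unfolding g_def
    by (intro homogeneous_diff homogeneous_cst_mult homogeneous_conic5 q)
  have g: "ev g p = 0" "ev g q = 0" "ev g r = 0" "ev g s = 0" "ev g t = 0" "ev g x = 0"
    using q Q by (simp_all add: g_def c_def)
  have "crs p q \<noteq> 0" using nz crs_nz_of_br by blast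
  moreover have "crs p x = crs p q" "crs q x = - crs p q" by (simp_all add: x_def coord_simps algebra_simps)
  ultimately obtain m where m: "g = lin (crs p q) * lin m"
    using quad_contains_line[OF hg g(1,2,6)] br by (metis neg_equal_0_iff_equal)
  have "m \<odot> r = 0" "m \<odot> s = 0" "m \<odot> t = 0"
    using g nz by (auto simp: m br_def)
  hence "m = 0" using lin_vanish3 nz by blast
  hence "g = 0" using m by simp
  hence "f = cst c * conic5 p q r s t" by (simp add: g_def)
  thus ?thesis by (rule that)
qed

lemma quad_line_unique:
  assumes q: "homogeneous 2 f" "ev f a = 0" "ev f b = 0" "ev f c = 0" "ev f d = 0" "ev f e = 0"
    and i: "crs a b \<noteq> 0" "crs a c \<noteq> 0" "crs b c \<noteq> 0" "br a b c = 0" "br a b d \<noteq> 0" "br a b e \<noteq> 0" "crs d e \<noteq> 0"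
  obtains k where "f = cst k * (lin (crs a b) * lin (crs d e))"
proof -
  obtain m where m: "f = lin (crs a b) * lin m" using quad_contains_line q i by metis
  have "m \<odot> d = 0" "m \<odot> e = 0" using q i by (auto simp: m br_def)
  then obtain k where "m = k *s crs d e" using orth_crs i by metis
  thus ?thesis using that[of k] m by (simp add: lin_scale mult_ac)
qed

text \<open>If the quadric were a product of two lines, one of them would contain three of the five
  points by the pigeonhole principle, and their bracket would vanish.\<close>

lemma conic5_irreducible:
  assumes nz: "br p q r \<noteq> 0" "br p q s \<noteq> 0" "br p q t \<noteq> 0" "br p r s \<noteq> 0" "br p r t \<noteq> 0"
     "br p s t \<noteq> 0" "br q r s \<noteq> 0" "br q r t \<noteq> 0" "br q s t \<noteq> 0" "br r s t \<noteq> 0"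
  shows "irreducible (conic5 p q r s t)"
proof (rule irreducible_quadI[OF homogeneous_conic5])
  define x where "x = p + q"
  have "br p q x = 0" "br p r x = - br p q r" "br q s x = br p q s"
    by (simp_all add: x_def coord_simps algebra_simps)
  hence "ev (conic5 p q r s t) x \<noteq> 0" using nz by (simp add: ev_conic5)
  thus nz0: "conic5 p q r s t \<noteq> 0" by auto
  fix a b
  show "conic5 p q r s t \<noteq> lin a * lin b"
  proof
    assume e: "conic5 p q r s t = lin a * lin b"
    hence ab: "a \<noteq> 0" "b \<noteq> 0" using nz0 by auto
    have v: "a \<odot> y = 0 \<or> b \<odot> y = 0" if "ev (conic5 p q r s t) y = 0" for y
      using that by (simp add: e)
    have A: "\<not> (a \<odot> u = 0 \<and> a \<odot> v = 0 \<and> a \<odot> w = 0)" "\<not> (b \<odot> u = 0 \<and> b \<odot> v = 0 \<and> b \<odot> w = 0)"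
      if "br u v w \<noteq> 0" for u v w
      using orth_br_eq_0[OF ab(1)] orth_br_eq_0[OF ab(2)] that by blast+
    have "a \<odot> p = 0 \<or> b \<odot> p = 0" "a \<odot> q = 0 \<or> b \<odot> q = 0" "a \<odot> r = 0 \<or> b \<odot> r = 0"
      "a \<odot> s = 0 \<or> b \<odot> s = 0" "a \<odot> t = 0 \<or> b \<odot> t = 0"
      by (simp_all only: v ev_conic5_self)
    with A[OF nz(1)] A[OF nz(2)] A[OF nz(3)] A[OF nz(4)] A[OF nz(5)] A[OF nz(6)] A[OF nz(7)]
      A[OF nz(8)] A[OF nz(9)] A[OF nz(10)]
    show False by satx
  qed
qed

text \<open>Replaces the existence of a conic by one polynomial equation in the six points, which
  can be evaluated on coordinates and passes to Zariski closures.\<close>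

lemma six_on_conic_iff:
  assumes pw: "crs p q \<noteq> 0" "crs p r \<noteq> 0" "crs p s \<noteq> 0" "crs p t \<noteq> 0" "crs q r \<noteq> 0"
    "crs q s \<noteq> 0" "crs q t \<noteq> 0" "crs r s \<noteq> 0" "crs r t \<noteq> 0" "crs s t \<noteq> 0"
    and nz: "br p q r \<noteq> 0" "br p q s \<noteq> 0" "br p q t \<noteq> 0" "br p r s \<noteq> 0" "br p r t \<noteq> 0"
     "br p s t \<noteq> 0" "br q r s \<noteq> 0" "br q r t \<noteq> 0" "br q s t \<noteq> 0" "br r s t \<noteq> 0"
  shows "(\<exists>f. is_conic f \<and> ev f p = 0 \<and> ev f q = 0 \<and> ev f r = 0 \<and> ev f s = 0 \<and> ev f t = 0 \<and> ev f u = 0)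
    \<longleftrightarrow> ev (conic5 p q r s t) u = 0"
proof
  assume "\<exists>f. is_conic f \<and> ev f p = 0 \<and> ev f q = 0 \<and> ev f r = 0 \<and> ev f s = 0 \<and> ev f t = 0 \<and> ev f u = 0"
  then obtain f where f: "homogeneous 2 f" "irreducible f" "ev f p = 0" "ev f q = 0" "ev f r = 0" "ev f s = 0" "ev f t = 0" "ev f u = 0"
    by (auto simp: is_conic_def)
  obtain c where c: "f = cst c * conic5 p q r s t"
    using quad5_unique[OF f(1,3-7)] nz by metis
  moreover have "c \<noteq> 0" using c f(2) by auto
  ultimately show "ev (conic5 p q r s t) u = 0" using f(8) by simp
next
  assume "ev (conic5 p q r s t) u = 0"
  thus "\<exists>f. is_conic f \<and> ev f p = 0 \<and> ev f q = 0 \<and> ev f r = 0 \<and> ev f s = 0 \<and> ev f t = 0 \<and> ev f u = 0"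
    by (intro exI[of _ "conic5 p q r s t"]) (simp add: is_conic_def homogeneous_conic5 conic5_irreducible[OF nz])
qed

text \<open>A substitute for unique factorization. If the lines \<open>a\<close> and
  \<open>b\<close> differ, they meet in \<open>u\<close>, and \<open>v\<close> is a point of
  \<open>b\<close> off \<open>a\<close>. On the points \<open>v + k u\<close> the form
  \<open>a\<close> does not vanish while the product does, so \<open>q\<close> has three zeros on
  \<open>b\<close> and contains it.\<close>

lemma lin_dvd_cases:
  assumes e: "lin a * q = lin b * q'" and nz: "a \<noteq> 0" "b \<noteq> 0" and h: "homogeneous 2 q"
  shows "(\<exists>k. k \<noteq> 0 \<and> b = k *s a \<and> q = cst k * q') \<or> (\<exists>m. q = lin b * lin m)"
proof (cases "crs a b = 0")
  case True
  then obtain k where k: "b = k *s a" using crs_eq_0E nz by metis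
  hence "k \<noteq> 0" using nz by auto
  moreover have "lin a * (q - cst k * q') = 0" using e by (simp add: k lin_scale algebra_simps)
  hence "q = cst k * q'" using nz by simp
  ultimately show ?thesis using k by blast
next
  case False
  define u where "u = crs a b"
  obtain w where w: "br a b w \<noteq> 0" using indep_completion False by blast
  define v where "v = crs b w"
  have bu: "b \<odot> u = 0" by (simp add: u_def dot3_commute[of b])
  have bv: "b \<odot> v = 0" by (simp add: v_def dot3_commute[of b])
  have au: "a \<odot> u = 0" by (simp add: u_def dot3_commute[of a])
  have av: "a \<odot> v \<noteq> 0" using w br_rot(1)[of a b w] by (simp add: v_def br_def dot3_commute)
  have uv: "crs u v = br a b w *s b" by (simp add: u_def v_def coord_simps algebra_simps)
  have q0: "ev q (v + k *s u) = 0" for k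
  proof -
    have "ev (lin a * q) (v + k *s u) = ev (lin b * q') (v + k *s u)" using e by simp
    thus ?thesis using bu bv au av by (simp add: dot3_simps)
  qed
  have q3: "ev q v = 0" "ev q (v + u) = 0" "ev q (v - u) = 0"
    using q0[of 0] q0[of 1] q0[of "-1"] by simp_all
  have c: "crs v (v + u) = - crs u v" "crs v (v - u) = crs u v" "crs (v + u) (v - u) = 2 *s crs u v" "br v (v + u) (v - u) = 0"
    by (simp_all add: coord_simps algebra_simps)
  have nzc: "crs u v \<noteq> 0" using uv nz w by simp
  have "crs v (v + u) \<noteq> 0" "crs v (v - u) \<noteq> 0" "crs (v + u) (v - u) \<noteq> 0"
    unfolding c using nzc by simp_all
  then obtain m where m: "q = lin (crs v (v + u)) * lin m" using quad_contains_line[OF h q3] c(4) by metis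
  have "crs v (v + u) = (- br a b w) *s b" unfolding c uv by (simp add: vec_eq_iff)
  hence "q = lin b * lin ((- br a b w) *s m)" unfolding m lin_scale by (simp only: lin_scale mult_ac)
  thus ?thesis by blast
qed

section \<open>Points and forms up to scalars\<close>

definition pcl :: "complex^3 \<Rightarrow> point" where "pcl v = {c *s v | c. c \<noteq> 0}"
definition fcl :: "form \<Rightarrow> form set" where "fcl f = {form_scale c f | c. c \<noteq> 0}"

lemma self_in_fcl: "f \<in> fcl f"
  unfolding fcl_def form_scale_cst by (intro CollectI exI[of _ 1]) (simp add: cst_1)

lemma fcl_scale: "k \<noteq> 0 \<Longrightarrow> fcl (cst k * f) = fcl f"
proof (intro set_eqI iffI)
  fix g assume k: "k \<noteq> 0"
  { assume "g \<in> fcl (cst k * f)"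
    then obtain c where "c \<noteq> 0" "g = cst c * (cst k * f)" by (auto simp: fcl_def form_scale_cst)
    thus "g \<in> fcl f" using k unfolding fcl_def form_scale_cst
      by (intro CollectI exI[of _ "c * k"]) (simp add: cst_mult[symmetric] mult_ac) }
  { assume "g \<in> fcl f"
    then obtain c where "c \<noteq> 0" "g = cst c * f" by (auto simp: fcl_def form_scale_cst)
    moreover have "cst c = cst (c / k) * cst k" using k by (simp add: cst_mult)
    ultimately show "g \<in> fcl (cst k * f)" using k unfolding fcl_def form_scale_cst
      by (intro CollectI exI[of _ "c / k"]) (simp add: mult_ac) }
qed

lemma fclE:
  assumes "g \<in> fcl f" obtains c where "c \<noteq> 0" "g = cst c * f"
  using assms by (auto simp: fcl_def form_scale_cst)

lemma fcl_eq_iff: "g \<in> fcl f \<longleftrightarrow> fcl g = fcl f"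
proof
  assume "g \<in> fcl f"
  then obtain c where "c \<noteq> 0" "g = cst c * f" by (rule fclE)
  thus "fcl g = fcl f" by (simp add: fcl_scale)
next
  assume "fcl g = fcl f"
  thus "g \<in> fcl f" using self_in_fcl[of g] by simp
qed

lemma cubic_space_iff: "C \<in> cubic_space \<longleftrightarrow> (\<exists>f. homogeneous 3 f \<and> f \<noteq> 0 \<and> C = fcl f)"
  unfolding cubic_space_def proj_space_def fcl_def by auto

lemma fcl_in_cubic_space_iff: "fcl f \<in> cubic_space \<longleftrightarrow> homogeneous 3 f \<and> f \<noteq> 0"
proof
  assume "fcl f \<in> cubic_space"
  then obtain g where g: "homogeneous 3 g" "g \<noteq> 0" "fcl f = fcl g" unfolding cubic_space_iff by blast
  hence "f \<in> fcl g" using self_in_fcl[of f] by simp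
  then obtain c where "c \<noteq> 0" "f = cst c * g" by (rule fclE)
  thus "homogeneous 3 f \<and> f \<noteq> 0" using g by (auto intro: homogeneous_cst_mult)
qed (auto simp: cubic_space_iff)

lemma proj_planeE:
  assumes "P \<in> proj_plane" obtains v where "v \<noteq> 0" "P = pcl v"
  using assms by (auto simp: proj_plane_def proj_space_def pcl_def)

lemma pcl_in_proj_plane: "v \<noteq> 0 \<Longrightarrow> pcl v \<in> proj_plane"
  by (auto simp: proj_plane_def proj_space_def pcl_def)

lemma self_in_pcl: "v \<in> pcl v" by (auto simp: pcl_def intro: exI[of _ 1])

lemma pcl_eq_iff:
  assumes "u \<noteq> 0" "v \<noteq> 0"
  shows "pcl u = pcl v \<longleftrightarrow> crs u v = 0"
proof
  assume "pcl u = pcl v"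
  then obtain c where "u = c *s v" using self_in_pcl[of u] by (auto simp: pcl_def)
  thus "crs u v = 0" by simp
next
  assume "crs u v = 0"
  then obtain k where k: "v = k *s u" using crs_eq_0E assms by metis
  hence "k \<noteq> 0" using assms by auto
  have "\<exists>d. c *s u = d *s v \<and> d \<noteq> 0" if "c \<noteq> 0" for c
    by (intro exI[of _ "c / k"]) (use that k \<open>k \<noteq> 0\<close> in \<open>simp add: vec_scale_assoc\<close>)
  moreover have "\<exists>d. c *s v = d *s u \<and> d \<noteq> 0" if "c \<noteq> 0" for c
    by (intro exI[of _ "c * k"]) (use that k \<open>k \<noteq> 0\<close> in \<open>simp add: vec_scale_assoc\<close>)
  ultimately show "pcl u = pcl v" unfolding pcl_def by auto
qed

lemma vanishes_at_pcl: "homogeneous d f \<Longrightarrow> vanishes_at f (pcl v) \<longleftrightarrow> ev f v = 0"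
  unfolding vanishes_at_def pcl_def ev_def[symmetric]
  using ev_scale[of d f] by (auto intro: exI[of _ 1])

lemma configs_pcl_iff:
  assumes "\<And>i. v i \<noteq> 0"
  shows "(\<lambda>i. pcl (v i)) \<in> configs \<longleftrightarrow> (\<forall>i j. i \<noteq> j \<longrightarrow> crs (v i) (v j) \<noteq> 0)"
  using assms by (auto simp: configs_def inj_def pcl_in_proj_plane pcl_eq_iff)

lemma configsE:
  assumes "p \<in> configs"
  obtains v where "\<And>i. v i \<noteq> 0" "p = (\<lambda>i. pcl (v i))" "\<And>i j. i \<noteq> j \<Longrightarrow> crs (v i) (v j) \<noteq> 0"
proof -
  have "\<exists>v. v \<noteq> 0 \<and> p i = pcl v" for i
  proof -
    have "p i \<in> proj_plane" using assms by (simp add: configs_def)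
    then obtain v where "v \<noteq> 0" "p i = pcl v" by (rule proj_planeE)
    thus ?thesis by blast
  qed
  hence "\<forall>i. \<exists>v. v \<noteq> 0 \<and> p i = pcl v" by (rule allI)
  from choice[OF this] obtain v where v: "\<And>i. v i \<noteq> 0" "\<And>i. p i = pcl (v i)" by blast
  hence p: "p = (\<lambda>i. pcl (v i))" by (intro ext)
  have "\<forall>i j. i \<noteq> j \<longrightarrow> crs (v i) (v j) \<noteq> 0"
    using configs_pcl_iff[of v] v(1) assms unfolding p by simp
  thus ?thesis using that[OF v(1) p] by simp
qed

section \<open>Derivatives of forms\<close>

lemma partial_deriv_superset:
  assumes "finite A" "ks F \<subseteq> A"
  shows "partial_deriv v F = (\<Sum>m\<in>A. Poly_Mapping.single (m - Poly_Mapping.single v 1)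
        (of_nat (lk m v) * lk F m))"
  unfolding partial_deriv_def using assms
  by (intro sum.mono_neutral_left) (auto simp: in_keys_iff)

lemma partial_deriv_add: "partial_deriv v (F + G) = partial_deriv v F + partial_deriv v G"
proof -
  have "ks (F + G) \<subseteq> ks F \<union> ks G" by (rule Poly_Mapping.keys_add)
  thus ?thesis
    by (subst (1 2 3) partial_deriv_superset[of "ks F \<union> ks G"])
       (auto simp: lookup_add sum.distrib single_add algebra_simps)
qed

lemma partial_deriv_0 [simp]: "partial_deriv v 0 = 0" by (simp add: partial_deriv_def)

lemma partial_deriv_sum: "partial_deriv v (sum f A) = (\<Sum>a\<in>A. partial_deriv v (f a))"
  by (induction A rule: infinite_finite_induct) (auto simp: partial_deriv_add)

lemma partial_deriv_single: "partial_deriv v (Poly_Mapping.single m c)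
    = Poly_Mapping.single (m - Poly_Mapping.single v 1) (of_nat (lk m v) * c)"
  by (subst partial_deriv_superset[of "{m}"]) auto

lemma partial_deriv_mult: "partial_deriv v (F * G) = partial_deriv v F * G + F * partial_deriv v G"
proof -
  have s: "partial_deriv v (Poly_Mapping.single (m + n) (a * b))
    = partial_deriv v (Poly_Mapping.single m a) * Poly_Mapping.single n b
      + Poly_Mapping.single m a * partial_deriv v (Poly_Mapping.single n b)"
    for m n :: "'a \<Rightarrow>\<^sub>0 nat" and a b :: complex
  proof -
    \<comment> \<open>Subtraction of exponents is truncated; where this would spoil the equation,
      the exponent is 0 and with it the coefficient.\<close>
    have e: "m - Poly_Mapping.single v 1 + n = m + n - Poly_Mapping.single v 1" if "lk m v \<noteq> 0" for m n :: "'a \<Rightarrow>\<^sub>0 nat"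
      using that by (intro poly_mapping_eqI) (auto simp: lookup_add lookup_minus lookup_single when_def)
    have 1: "Poly_Mapping.single (m - Poly_Mapping.single v 1 + n) (of_nat (lk m v) * a * b)
      = Poly_Mapping.single (m + n - Poly_Mapping.single v 1) (of_nat (lk m v) * a * b)"
      using e[of m n] by (cases "lk m v = 0") (simp_all del: One_nat_def)
    have 2: "Poly_Mapping.single (m + (n - Poly_Mapping.single v 1)) (a * (of_nat (lk n v) * b))
      = Poly_Mapping.single (m + n - Poly_Mapping.single v 1) (of_nat (lk n v) * a * b)"
      using e[of n m] by (cases "lk n v = 0") (simp_all add: ac_simps del: One_nat_def)
    show ?thesis unfolding partial_deriv_single mult_single 1 2
      by (simp add: lookup_add single_add[symmetric] algebra_simps)
  qed
  have "partial_deriv v (F * G) = partial_deriv v (\<Sum>m\<in>ks F. \<Sum>n\<in>ks G. Poly_Mapping.single (m + n) (lk F m * lk G n))"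
    by (subst (1) cpoly_eq_sum_single[of F], subst (1) cpoly_eq_sum_single[of G])
       (simp add: sum_product mult_single)
  also have "\<dots> = partial_deriv v (\<Sum>m\<in>ks F. Poly_Mapping.single m (lk F m)) * (\<Sum>n\<in>ks G. Poly_Mapping.single n (lk G n))
      + (\<Sum>m\<in>ks F. Poly_Mapping.single m (lk F m)) * partial_deriv v (\<Sum>n\<in>ks G. Poly_Mapping.single n (lk G n))"
    unfolding partial_deriv_sum s sum_product sum.distrib ..
  finally show ?thesis by (simp only: cpoly_eq_sum_single[symmetric])
qed

lemma partial_deriv_cst [simp]: "partial_deriv v (cst c) = 0"
  by (simp add: cst_def partial_deriv_single)

lemma partial_deriv_lin [simp]: "partial_deriv j (lin a) = cst (a $ j)"
proof -
  have "partial_deriv j (lin a) = (\<Sum>i\<in>UNIV. if i = j then cst (a $ j) else 0)"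
    unfolding lin_def partial_deriv_sum partial_deriv_single
    by (intro sum.cong) (auto simp: lookup_single when_def cst_def)
  thus ?thesis by simp
qed

lemma partial_deriv_uminus: "partial_deriv v (- F) = - partial_deriv v F"
proof -
  have "partial_deriv v F + partial_deriv v (- F) = 0"
    by (simp add: partial_deriv_add[symmetric])
  thus ?thesis by (simp add: eq_neg_iff_add_eq_0 add.commute)
qed

lemma partial_deriv_diff: "partial_deriv v (F - G) = partial_deriv v F - partial_deriv v G"
  using partial_deriv_add[of v F "- G"] by (simp add: partial_deriv_uminus)

lemma homogeneous_partial_deriv:
  assumes "homogeneous (Suc d) F" shows "homogeneous d (partial_deriv v F)"
  unfolding partial_deriv_def
proof (intro homogeneous_sum)
  fix m assume "m \<in> ks F"
  hence m: "mdeg m = Suc d" using assms by (simp add: homogeneous_iff)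
  show "homogeneous d (Poly_Mapping.single (m - Poly_Mapping.single v 1) (of_nat (lk m v) * lk F m))"
  proof (cases "lk m v = 0")
    case False
    have "m = Poly_Mapping.single v 1 + (m - Poly_Mapping.single v 1)"
      using False by (intro poly_mapping_eqI) (auto simp: lookup_add lookup_minus lookup_single when_def)
    hence "mdeg m = 1 + mdeg (m - Poly_Mapping.single v 1)" by (metis mdeg_add mdeg_single)
    thus ?thesis using m by (intro homogeneous_single) simp
  qed simp
qed

definition grad :: "form \<Rightarrow> complex^3 \<Rightarrow> complex^3"
  where "grad f x = (\<chi> j. ev (partial_deriv j f) x)"

lemma grad_simps:
  "grad (f + g) x = grad f x + grad g x" "grad (f - g) x = grad f x - grad g x"
  "grad (f * g) x = ev g x *s grad f x + ev f x *s grad g x" "grad (lin a) x = a" "grad (cst c) x = 0"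
  by (simp_all add: grad_def vec_eq_iff partial_deriv_add partial_deriv_diff partial_deriv_mult)

lemma euler:
  assumes "homogeneous d f" shows "grad f x \<odot> x = of_nat d * ev f x"
  using assms
proof (induction rule: homogeneous_induct)
  case (single m c)
  have "of_nat (lk m j) * monom_val (($) x) (m - Poly_Mapping.single j 1) * x $ j
    = of_nat (lk m j) * monom_val (($) x) m" for j
  proof (cases "lk m j = 0")
    case False
    have "m = Poly_Mapping.single j 1 + (m - Poly_Mapping.single j 1)"
      using False by (intro poly_mapping_eqI) (auto simp: lookup_add lookup_minus lookup_single when_def)
    hence "monom_val (($) x) m = x $ j * monom_val (($) x) (m - Poly_Mapping.single j 1)"
      by (metis monom_val_add monom_val_single power_one_right)
    thus ?thesis by simp
  qed simp
  note m = this
  have "grad (Poly_Mapping.single m c) x \<odot> x =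
    c * (of_nat (lk m 1) * monom_val (($) x) (m - Poly_Mapping.single 1 1) * x $ 1)
    + c * (of_nat (lk m 2) * monom_val (($) x) (m - Poly_Mapping.single 2 1) * x $ 2)
    + c * (of_nat (lk m 3) * monom_val (($) x) (m - Poly_Mapping.single 3 1) * x $ 3)"
    unfolding grad_def dot3_def partial_deriv_single vec_lambda_beta ev_def eval_single by (simp only: mult_ac)
  hence "grad (Poly_Mapping.single m c) x \<odot> x = (of_nat (lk m 1) + of_nat (lk m 2) + of_nat (lk m 3)) * c * monom_val (($) x) m"
    unfolding m by (simp add: algebra_simps)
  moreover have "mdeg m = lk m 1 + lk m 2 + lk m 3"
    by (subst mdeg_superset[of UNIV]) (auto simp: sum_3)
  ultimately show ?case using single by (simp add: ev_def eval_single algebra_simps)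
next
  case zero show ?case by (simp add: grad_def dot3_def)
next
  case (add F G) thus ?case by (simp add: grad_simps dot3_simps algebra_simps)
qed

text \<open>Euler's relation derives the vanishing of the form from that of its gradient.\<close>

lemma singular_formI:
  assumes "homogeneous 3 f" "x \<noteq> 0" "grad f x = 0"
  shows "singular_form f"
proof -
  have "3 * ev f x = 0" using euler[OF assms(1), of x] assms(3) by (simp add: dot3_simps)
  thus ?thesis using assms unfolding singular_form_def
    by (intro exI[of _ x]) (simp add: grad_def vec_eq_iff ev_def)
qed

lemma singular_formE:
  assumes "singular_form f" obtains x where "x \<noteq> 0" "ev f x = 0" "grad f x = 0"
  using assms by (auto simp: singular_form_def grad_def vec_eq_iff ev_def)

text \<open>Polarizing Euler's relation determines the sum of the two mixed terms; these are equal
  because second derivatives commute.\<close>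

lemma grad_quad:
  assumes "homogeneous 2 q" shows "grad q p \<odot> x = 2 * bil q p x"
proof -
  have l: "\<exists>b. partial_deriv j q = lin b" for j
    using homogeneous_partial_deriv[of 1 q j] assms homogeneous_1E by (metis Suc_1)
  then obtain b where b: "\<And>j. partial_deriv j q = lin (b j)" by metis
  have add: "grad q (y + z) = grad q y + grad q z" for y z
    by (simp add: grad_def b vec_eq_iff dot3_simps)
  have e: "grad q y \<odot> y = 2 * ev q y" for y using euler[OF assms] by simp
  have "grad q p \<odot> x + grad q x \<odot> p = (grad q (p + x) \<odot> (p + x)) - grad q p \<odot> p - grad q x \<odot> x"
    unfolding add dot3_simps by simp
  also have "\<dots> = 2 * (ev q (p + x) - ev q p - ev q x)" unfolding e by (simp add: algebra_simps)
  also have "\<dots> = 2 * (2 * bil q p x)" by (simp add: bil_def)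
  finally have "grad q p \<odot> x + grad q x \<odot> p = 2 * (2 * bil q p x)" .
  moreover have "grad q p \<odot> x = grad q x \<odot> p"
  proof -
    have comm: "partial_deriv i (partial_deriv j q) = partial_deriv j (partial_deriv i q)" for i j
      unfolding partial_deriv_def[of _ q] partial_deriv_sum partial_deriv_single
      by (intro sum.cong refl arg_cong2[where f=Poly_Mapping.single] poly_mapping_eqI)
         (auto simp: lookup_minus lookup_single when_def)
    have "cst (b j $ i) = cst (b i $ j)" for i j
      using comm[of i j] by (simp add: b)
    hence "b j $ i = b i $ j" for i j by (metis ev_simps(7))
    hence "b 1 $ 2 = b 2 $ 1" "b 1 $ 3 = b 3 $ 1" "b 2 $ 3 = b 3 $ 2" by blast+
    thus ?thesis by (simp add: grad_def b dot3_def algebra_simps)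
  qed
  ultimately show ?thesis by simp
qed

text \<open>For a cubic the gradient is quadratic, and this polarization of it is the Hessian matrix
  at \<open>p\<close> applied to \<open>v\<close>.\<close>

definition hess :: "form \<Rightarrow> complex^3 \<Rightarrow> complex^3 \<Rightarrow> complex^3"
  where "hess f p v = grad f (p + v) - grad f p - grad f v"

lemma grad_cubic_line:
  assumes "homogeneous 3 f"
  shows "grad f (p + e *s v) = grad f p + e *s hess f p v + (e^2) *s grad f v"
proof -
  have h: "homogeneous 2 (partial_deriv j f)" for j
    using homogeneous_partial_deriv[of 2 f] assms by (simp add: numeral_3_eq_3 numeral_2_eq_2)
  have "ev (partial_deriv j f) (p + e *s v) = ev (partial_deriv j f) p
      + e * (2 * bil (partial_deriv j f) p v) + e^2 * ev (partial_deriv j f) v" for j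
    using ev_quad_expand(1)[OF h, of j 1 p e v] by simp
  moreover have "2 * bil (partial_deriv j f) p v = ev (partial_deriv j f) (p + v) - ev (partial_deriv j f) p - ev (partial_deriv j f) v" for j
    by (simp add: bil_def)
  ultimately show ?thesis by (simp only: grad_def hess_def vec_eq_iff vec_lambda_beta vector_add_component vector_minus_component vector_smult_component) blast
qed

section \<open>Lower bounds for the multiplicity of the discriminant\<close>

abbreviation Rl :: "(3 \<Rightarrow>\<^sub>0 nat) cpoly \<Rightarrow> form \<Rightarrow> form \<Rightarrow> complex poly" where "Rl \<equiv> restrict_to_line"

lemma lk_cst_mult: "lk (cst c * f) m = c * lk f m"
  unfolding cst_def mult_map_scale_conv_mult[symmetric] by (subst map.rep_eq) (simp add: when_def)

lemma poly_Rl: "poly (Rl F f g) t = eval F (lk (f + cst t * g))"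
proof -
  have "(\<lambda>m. lk f m + t * lk g m) = lk (f + cst t * g)" by (rule ext) (simp add: lookup_add lk_cst_mult)
  thus ?thesis unfolding restrict_to_line_def poly_eval_in by simp
qed

section \<open>Polynomial dependence on a parameter\<close>

definition polyfun :: "(complex \<Rightarrow> complex) \<Rightarrow> bool"
  where "polyfun \<phi> \<longleftrightarrow> (\<exists>P. \<forall>s. \<phi> s = poly P s)"

lemma polyfun_const [intro!, simp]: "polyfun (\<lambda>s. c)" unfolding polyfun_def by (intro exI[of _ "[:c:]"]) simp
lemma polyfun_id [intro!, simp]: "polyfun (\<lambda>s. s)" unfolding polyfun_def by (intro exI[of _ "[:0, 1:]"]) simp
lemma polyfun_add [intro!]: "polyfun a \<Longrightarrow> polyfun b \<Longrightarrow> polyfun (\<lambda>s. a s + b s)"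
  unfolding polyfun_def using poly_add by metis
lemma polyfun_diff [intro!]: "polyfun a \<Longrightarrow> polyfun b \<Longrightarrow> polyfun (\<lambda>s. a s - b s)"
  unfolding polyfun_def using poly_diff by metis
lemma polyfun_mult [intro!]: "polyfun a \<Longrightarrow> polyfun b \<Longrightarrow> polyfun (\<lambda>s. a s * b s)"
  unfolding polyfun_def using poly_mult by metis
lemma polyfun_power [intro!]: "polyfun a \<Longrightarrow> polyfun (\<lambda>s. a s ^ n)"
  by (induction n) (auto simp: power_Suc)
lemma polyfun_sum [intro!]: "(\<And>i. i \<in> A \<Longrightarrow> polyfun (a i)) \<Longrightarrow> polyfun (\<lambda>s. \<Sum>i\<in>A. a i s)"
  by (induction A rule: infinite_finite_induct) auto
lemma polyfun_prod [intro!]: "(\<And>i. i \<in> A \<Longrightarrow> polyfun (a i)) \<Longrightarrow> polyfun (\<lambda>s. \<Prod>i\<in>A. a i s)"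
  by (induction A rule: infinite_finite_induct) auto

lemma polyfun_eval: "(\<And>v. polyfun (\<lambda>s. x s v)) \<Longrightarrow> polyfun (\<lambda>s. eval F (x s))"
  unfolding eval_def eval_in_def by auto

lemma polyfun_ev: "(\<And>i. polyfun (\<lambda>s. x s $ i)) \<Longrightarrow> polyfun (\<lambda>s. ev F (x s))"
  unfolding ev_def by (rule polyfun_eval)

text \<open>The replacement for limits: the product of the two polynomials vanishes everywhere, and
  \<open>d\<close> is not the zero polynomial.\<close>

lemma polyfun_zero:
  assumes "polyfun a" "polyfun d" "d s1 \<noteq> 0" "\<And>s. d s \<noteq> 0 \<Longrightarrow> a s = 0"
  shows "a s = 0"
proof -
  obtain A D where AD: "\<And>s. a s = poly A s" "\<And>s. d s = poly D s" using assms(1,2) by (auto simp: polyfun_def)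
  have "poly (A * D) s = 0" for s using assms(4)[of s] AD by auto
  hence "A * D = 0" by (metis poly_all_0_iff_0)
  moreover have "D \<noteq> 0" using assms(3) AD(2)[of s1] by auto
  ultimately show ?thesis using AD by simp
qed

text \<open>A family of polynomials in \<open>t\<close> whose coefficients depend polynomially on a parameter; the flag
  \<open>B\<close> asks that the coefficient of \<open>t^j\<close> have degree at most \<open>j\<close> in the parameter.\<close>

definition polyfam :: "bool \<Rightarrow> (complex \<Rightarrow> complex poly) \<Rightarrow> bool"
  where "polyfam B A \<longleftrightarrow> (\<exists>N. \<forall>s. degree (A s) \<le> N) \<and>
    (\<forall>j. \<exists>P. (B \<longrightarrow> degree P \<le> j) \<and> (\<forall>s. coeff (A s) j = poly P s))"

lemma polyfamI:
  assumes "\<And>s. degree (A s) \<le> N" "\<And>j. \<exists>P. (B \<longrightarrow> degree P \<le> j) \<and> (\<forall>s. coeff (A s) j = poly P s)"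
  shows "polyfam B A" using assms by (auto simp: polyfam_def)

lemma polyfam_add:
  assumes "polyfam B A" "polyfam B A'" shows "polyfam B (\<lambda>s. A s + A' s)"
proof -
  obtain N N' where N: "\<And>s. degree (A s) \<le> N" "\<And>s. degree (A' s) \<le> N'"
    using assms by (auto simp: polyfam_def)
  show ?thesis
  proof (rule polyfamI)
    show "degree (A s + A' s) \<le> max N N'" for s
      using N[of s] by (intro degree_add_le) auto
    fix j
    obtain P P' where "(B \<longrightarrow> degree P \<le> j) \<and> (\<forall>s. coeff (A s) j = poly P s)"
      "(B \<longrightarrow> degree P' \<le> j) \<and> (\<forall>s. coeff (A' s) j = poly P' s)"
      using assms unfolding polyfam_def by meson
    thus "\<exists>P. (B \<longrightarrow> degree P \<le> j) \<and> (\<forall>s. coeff (A s + A' s) j = poly P s)"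
      by (intro exI[of _ "P + P'"]) (auto intro: degree_add_le)
  qed
qed

lemma polyfam_const: "polyfam B (\<lambda>s. [:c:])"
proof (rule polyfamI[of _ 0])
  show "\<exists>P. (B \<longrightarrow> degree P \<le> j) \<and> (\<forall>s. coeff [:c:] j = poly P s)" for j
    by (intro exI[of _ "[:coeff [:c:] j:]"]) simp
qed simp

lemma polyfam_mult:
  assumes "polyfam B A" "polyfam B A'" shows "polyfam B (\<lambda>s. A s * A' s)"
proof -
  obtain N N' where N: "\<And>s. degree (A s) \<le> N" "\<And>s. degree (A' s) \<le> N'"
    using assms by (auto simp: polyfam_def)
  show ?thesis
  proof (rule polyfamI)
    show "degree (A s * A' s) \<le> N + N'" for s
      using N[of s] degree_mult_le[of "A s" "A' s"] by linarith
    fix j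
    have "\<forall>j. \<exists>P. (B \<longrightarrow> degree P \<le> j) \<and> (\<forall>s. coeff (A s) j = poly P s)"
      "\<forall>j. \<exists>P. (B \<longrightarrow> degree P \<le> j) \<and> (\<forall>s. coeff (A' s) j = poly P s)"
      using assms by (auto simp: polyfam_def)
    from this[THEN choice] obtain P P' where P: "\<And>j. B \<Longrightarrow> degree (P j) \<le> j" "\<And>j s. coeff (A s) j = poly (P j) s"
      and P': "\<And>j. B \<Longrightarrow> degree (P' j) \<le> j" "\<And>j s. coeff (A' s) j = poly (P' j) s" by blast
    have "degree (P i * P' (j - i)) \<le> j" if "B" "i \<le> j" for i
      using degree_mult_le[of "P i" "P' (j - i)"] P(1)[of i] P'(1)[of "j - i"] that by linarith
    hence "B \<Longrightarrow> degree (\<Sum>i\<le>j. P i * P' (j - i)) \<le> j" by (intro degree_sum_le) auto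
    thus "\<exists>P. (B \<longrightarrow> degree P \<le> j) \<and> (\<forall>s. coeff (A s * A' s) j = poly P s)"
      by (intro exI[of _ "\<Sum>i\<le>j. P i * P' (j - i)"]) (simp add: coeff_mult poly_sum P(2) P'(2))
  qed
qed

lemma polyfam_eval_in:
  assumes "\<And>v. polyfam B (\<lambda>s. X s v)"
  shows "polyfam B (\<lambda>s. eval_in (\<lambda>c. [:c:]) F (X s))"
proof -
  have pw: "polyfam B (\<lambda>s. X s v ^ n)" for v n
    by (induction n) (auto intro: polyfam_mult assms polyfam_const simp: one_pCons)
  have pr: "polyfam B (\<lambda>s. \<Prod>v\<in>A. X s v ^ lk m v)" for A m
    by (induction A rule: infinite_finite_induct) (auto intro: polyfam_mult pw polyfam_const simp: one_pCons)
  have "polyfam B (\<lambda>s. \<Sum>m\<in>A. [:lk F m:] * (\<Prod>v\<in>ks m. X s v ^ lk m v))" for A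
  proof (induction A rule: infinite_finite_induct)
    case (insert m A)
    show ?case unfolding sum.insert[OF insert(1,2)]
      by (intro polyfam_add polyfam_mult polyfam_const pr insert)
  qed (use polyfam_const[of B 0] in simp_all)
  thus ?thesis unfolding eval_in_def .
qed

lemma polyfam_linear:
  assumes "polyfun a" "polyfun b" shows "polyfam False (\<lambda>s. [:a s, b s:])"
proof (rule polyfamI[of _ 1])
  show "degree [:a s, b s:] \<le> 1" for s by simp
  fix j
  have "polyfun (\<lambda>s. coeff [:a s, b s:] j)"
    using assms by (cases j; cases "j - 1") (auto simp: coeff_pCons split: nat.split)
  thus "\<exists>P. (False \<longrightarrow> degree P \<le> j) \<and> (\<forall>s. coeff [:a s, b s:] j = poly P s)"
    by (auto simp: polyfun_def)
qed

lemma polyfam_coeff: "polyfam B A \<Longrightarrow> polyfun (\<lambda>s. coeff (A s) j)"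
  unfolding polyfam_def polyfun_def by blast

section \<open>The ideal of the discriminant at nodal cubics\<close>

lemma discriminant_idealD:
  assumes F: "F \<in> discriminant_ideal" and f: "homogeneous 3 f" "singular_form f"
  shows "eval F (lk f) = 0"
proof -
  have nz: "eval F (lk f) = 0" if "homogeneous 3 f" "singular_form f" "f \<noteq> 0" for f
  proof -
    have "fcl f \<in> discriminant" using that self_in_fcl[of f] by (auto simp: discriminant_def fcl_in_cubic_space_iff)
    thus ?thesis using F self_in_fcl[of f] by (auto simp: discriminant_ideal_def)
  qed
  show ?thesis
  proof (cases "f = 0")
    case True
    \<comment> \<open>The zero form is not a point of the discriminant, but the arcs used below may
      pass through it. It is the value at \<open>s = 0\<close> of \<open>s\<close> times the triple
      line \<open>h\<close>, which is singular for all other \<open>s\<close>.\<close>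
    define a :: "complex^3" where "a = axis 1 1"
    have a: "a \<noteq> 0" by (simp add: a_def)
    define h where "h = lin a * (lin a * lin a)"
    have h: "homogeneous 3 h" unfolding h_def
      using homogeneous_mult[OF homogeneous_lin homogeneous_lin_mult] by (simp add: numeral_3_eq_3 numeral_2_eq_2)
    have x: "(axis 2 1 :: complex^3) \<noteq> 0" by simp
    have ax: "a \<odot> axis 2 1 = 0" by (simp add: a_def dot3_def axis_def)
    have pf: "polyfun (\<lambda>s. eval F (lk (cst s * h)))"
      by (intro polyfun_eval) (auto simp: lk_cst_mult)
    have "eval F (lk (cst s * h)) = 0" for s
    proof (rule polyfun_zero[OF pf, of "\<lambda>s. s" 1])
      fix s :: complex assume "s \<noteq> 0"
      moreover have "grad (cst s * h) (axis 2 1) = 0" by (simp add: h_def grad_simps ax)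
      ultimately show "eval F (lk (cst s * h)) = 0"
        using a by (intro nz singular_formI[OF _ x] homogeneous_cst_mult h) (auto simp: h_def)
    qed auto
    from this[of 0] show ?thesis using True by simp
  qed (use nz f in blast)
qed

text \<open>The condition that the hypersurface \<open>F\<close> has multiplicity at least
  \<open>n\<close> at \<open>f\<close>, tested on all lines through \<open>f\<close>. In this form
  it is a system of equations and therefore passes to limits.\<close>

definition vanish_upto :: "nat \<Rightarrow> (3 \<Rightarrow>\<^sub>0 nat) cpoly \<Rightarrow> form \<Rightarrow> bool"
  where "vanish_upto n F f \<longleftrightarrow> (\<forall>g j. homogeneous 3 g \<longrightarrow> j < n \<longrightarrow> coeff (Rl F f g) j = 0)"

lemma coeff_Rl_0: "coeff (Rl F f g) 0 = eval F (lk f)"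
  using poly_Rl[of F f g 0] by (simp add: poly_0_coeff_0)

text \<open>The leading form of \<open>F\<close> at \<open>f\<close> vanishes on the tangent cone of the discriminant: the arc
  \<open>f + e (h - e (...))\<close> obtained by correcting \<open>f + e h\<close> to be singular at \<open>p + e v\<close> stays inside
  the discriminant.\<close>

lemma node_step:
  assumes F: "F \<in> discriminant_ideal" and f: "homogeneous 3 f" and van: "vanish_upto n F f"
    and p: "grad f p = 0" "lz \<odot> p = 1" "lz \<odot> v = 0"
    and h: "homogeneous 3 h" "hess f p v + grad h p = 0"
  shows "coeff (Rl F f h) n = 0"
proof -
  define A where "A = grad f v + hess h p v"
  define B where "B = grad h v"
  \<comment> \<open>Put \<open>X = A + e B\<close> and \<open>y = p + e v\<close>. As
    \<open>lz\<close> takes the value 1 at \<open>y\<close>, the gradient of the cubic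
    \<open>lz^2 r\<close> at \<open>y\<close> is \<open>2 (r \<odot> y) lz + r\<close>. It equals
    \<open>X\<close> for \<open>r = X - 2/3 (X \<odot> y) lz\<close>, whose coefficients in
    \<open>e\<close> are \<open>r0\<close>, \<open>r1\<close>, \<open>r2\<close>.\<close>
  define r0 where "r0 = A - (2/3 * (A \<odot> p)) *s lz"
  define r1 where "r1 = B - (2/3 * (A \<odot> v + B \<odot> p)) *s lz"
  define r2 where "r2 = (- (2/3 * (B \<odot> v))) *s lz"
  define rr where "rr e = r0 + e *s r1 + (e^2) *s r2" for e
  define R where "R e = lin lz * (lin lz * lin (rr e))" for e
  define H where "H e = h - cst e * R e" for e
  have c3: "homogeneous 3 (lin a * (lin b * lin c))" for a b c
    using homogeneous_mult[OF homogeneous_lin homogeneous_lin_mult] by (simp add: numeral_3_eq_3 numeral_2_eq_2)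
  have H3: "homogeneous 3 (H e)" for e unfolding H_def R_def
    by (intro homogeneous_diff homogeneous_cst_mult h c3)
  have zero: "eval F (lk (f + cst e * H e)) = 0" for e
  proof (rule discriminant_idealD[OF F])
    show h3: "homogeneous 3 (f + cst e * H e)" by (intro homogeneous_add homogeneous_cst_mult f H3)
    define y where "y = p + e *s v"
    have ly: "lz \<odot> y = 1" using p by (simp add: y_def dot3_simps)
    have y: "y \<noteq> 0" using ly by (auto simp: dot3_simps)
    define w where "w = grad f y + e *s grad h y"
    have hp: "grad h p = - hess f p v" using h(2) by (simp add: add.commute eq_neg_iff_add_eq_0)
    \<comment> \<open>The terms of order 0 and 1 in \<open>e\<close> cancel: the first because
      \<open>p\<close> is singular on \<open>f\<close>, the second by the condition linking
      \<open>h\<close> and \<open>v\<close>.\<close>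
    have w: "w = (e^2) *s (A + e *s B)"
      unfolding w_def y_def grad_cubic_line[OF f] grad_cubic_line[OF h(1)] A_def B_def hp p(1)
      by (simp add: vec_eq_iff algebra_simps power2_eq_square)
    have rw: "(e^2) *s rr e = w - (2/3 * (w \<odot> y)) *s lz"
      unfolding w rr_def r0_def r1_def r2_def y_def dot3_simps
      by (simp add: vec_eq_iff algebra_simps power2_eq_square)
    have ry: "e^2 * (rr e \<odot> y) = (w \<odot> y) / 3"
      using arg_cong[OF rw, of "\<lambda>z. z \<odot> y"] by (simp add: dot3_simps ly)
    have "grad (f + cst e * H e) y = w - (e^2) *s (2 * (rr e \<odot> y) *s lz + rr e)"
      unfolding w_def H_def R_def grad_simps
      by (simp add: ly vec_eq_iff algebra_simps power2_eq_square)
    also have "\<dots> = w - ((2 * (e^2 * (rr e \<odot> y))) *s lz + (e^2) *s rr e)"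
      by (simp add: vec_eq_iff algebra_simps)
    also have "\<dots> = 0" unfolding ry rw by (simp add: vec_eq_iff algebra_simps)
    finally show "singular_form (f + cst e * H e)" by (rule singular_formI[OF h3 y])
  qed
  have Hpf: "polyfun (\<lambda>e. lk (H e) m)" for m
  proof -
    have "lk (H e) m = lk h m - e * (lk (lin lz * (lin lz * lin r0)) m + e * lk (lin lz * (lin lz * lin r1)) m
        + e^2 * lk (lin lz * (lin lz * lin r2)) m)" for e
    proof -
      have "R e = lin lz * (lin lz * lin r0) + cst e * (lin lz * (lin lz * lin r1)) + cst (e^2) * (lin lz * (lin lz * lin r2))"
        unfolding R_def rr_def by (rule form_eqI) (simp add: dot3_simps algebra_simps)
      thus ?thesis unfolding H_def by (simp add: lookup_minus lookup_add lk_cst_mult)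
    qed
    thus ?thesis by auto
  qed
  have "polyfam False (\<lambda>e. [:lk f m, lk (H e) m:])" for m by (intro polyfam_linear Hpf) auto
  hence fam: "polyfam False (\<lambda>e. Rl F f (H e))" unfolding restrict_to_line_def by (rule polyfam_eval_in)
  obtain N where N: "\<And>e. degree (Rl F f (H e)) \<le> N" using fam by (auto simp: polyfam_def)
  have "\<forall>j. \<exists>P. \<forall>e. coeff (Rl F f (H e)) j = poly P e" using fam by (auto simp: polyfam_def)
  from choice[OF this] obtain P where P: "\<And>j e. coeff (Rl F f (H e)) j = poly (P j) e" by blast
  have P0: "P j = 0" if "j < n" for j
    using van H3 that P[of _ j] unfolding vanish_upto_def by (metis poly_all_0_iff_0)
  \<comment> \<open>The value of \<open>F\<close> along the arc, hence identically zero. Since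
    \<open>P j = 0\<close> for \<open>j < n\<close>, its coefficient of \<open>e^n\<close> is the
    constant term of \<open>P n\<close>, that is, coefficient \<open>n\<close> in the direction
    \<open>H 0 = h\<close>.\<close>
  define S where "S = (\<Sum>j\<le>N + n. Polynomial.monom 1 j * P j)"
  have "poly S e = 0" for e
  proof -
    have "poly S e = (\<Sum>j\<le>N + n. coeff (Rl F f (H e)) j * e ^ j)"
      by (simp add: S_def poly_sum poly_monom P mult.commute)
    also have "\<dots> = poly (Rl F f (H e)) e"
      unfolding poly_altdef by (intro sum.mono_neutral_right) (use N[of e] in \<open>auto simp: coeff_eq_0\<close>)
    finally show ?thesis using zero[of e] by (simp add: poly_Rl)
  qed
  hence "S = 0" by (metis poly_all_0_iff_0)
  hence "0 = coeff S n" by simp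
  also have "\<dots> = (\<Sum>j\<le>N + n. if j = n then coeff (P n) 0 else 0)"
    unfolding S_def coeff_sum
    by (intro sum.cong refl) (use P0 in \<open>auto simp: coeff_monom_mult linorder_neq_iff\<close>)
  also have "\<dots> = poly (P n) 0" by (simp add: poly_0_coeff_0)
  also have "\<dots> = coeff (Rl F f h) n" using P[of 0 n] by (simp add: H_def)
  finally show ?thesis by simp
qed

text \<open>A form of degree \<open>n\<close> vanishing on \<open>n + 1\<close> hyperplanes is zero.\<close>

lemma hyperplanes_step:
  fixes p :: "nat \<Rightarrow> complex^3" and d :: "nat \<Rightarrow> form"
  assumes van: "vanish_upto n F f"
    and d: "\<And>i. i \<le> n \<Longrightarrow> homogeneous 3 (d i)"
      "\<And>i j. i \<le> n \<Longrightarrow> j \<le> n \<Longrightarrow> ev (d i) (p j) = (if i = j then 1 else 0)"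
    and hyp: "\<And>h i. i \<le> n \<Longrightarrow> homogeneous 3 h \<Longrightarrow> ev h (p i) = 0 \<Longrightarrow> coeff (Rl F f h) n = 0"
  shows "vanish_upto (Suc n) F f"
  unfolding vanish_upto_def
proof (intro allI impI)
  fix g :: form and j assume g: "homogeneous 3 g" and j: "j < Suc n"
  have "coeff (Rl F f g) n = 0"
  proof (cases "\<exists>i\<le>n. ev g (p i) = 0")
    case True thus ?thesis using hyp g by blast
  next
    case False
    \<comment> \<open>The denominators make the line \<open>g + s g'\<close> meet the hyperplane of
      \<open>p i\<close> at \<open>s = - (i + 1)\<close>. These are \<open>n + 1\<close> distinct
      roots of the coefficient of \<open>t^n\<close>, which has degree at most \<open>n\<close> in
      \<open>s\<close>.\<close>
    define g' where "g' = (\<Sum>i\<le>n. cst (ev g (p i) / of_nat (Suc i)) * d i)"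
    have g': "homogeneous 3 g'" unfolding g'_def by (intro homogeneous_sum homogeneous_cst_mult d) simp
    have eg': "ev g' (p i) = ev g (p i) / of_nat (Suc i)" if "i \<le> n" for i
    proof -
      have "ev g' (p i) = (\<Sum>k\<le>n. if k = i then ev g (p i) / of_nat (Suc i) else 0)"
        unfolding g'_def ev_simps by (intro sum.cong) (auto simp: d(2) that)
      thus ?thesis using that by simp
    qed
    have "polyfam True (\<lambda>s. [:lk f m, lk g m + s * lk g' m:])" for m
    proof (rule polyfamI[of _ 1])
      fix j show "\<exists>P. (True \<longrightarrow> degree P \<le> j) \<and> (\<forall>s. coeff [:lk f m, lk g m + s * lk g' m:] j = poly P s)"
      proof (cases j)
        case 0 thus ?thesis by (intro exI[of _ "[:lk f m:]"]) simp
      next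
        case (Suc k)
        show ?thesis
        proof (cases k)
          case 0 thus ?thesis using Suc by (intro exI[of _ "[:lk g m, lk g' m:]"]) simp
        next
          case (Suc l) thus ?thesis using \<open>j = Suc k\<close> by (intro exI[of _ 0]) simp
        qed
      qed
    qed simp
    hence "polyfam True (\<lambda>s. eval_in (\<lambda>c. [:c:]) F (\<lambda>m. [:lk f m, lk g m + s * lk g' m:]))"
      by (rule polyfam_eval_in)
    moreover have "(\<lambda>m. [:lk f m, lk g m + s * lk g' m:]) = (\<lambda>m. [:lk f m, lk (g + cst s * g') m:])" for s
      by (rule ext) (simp add: lookup_add lk_cst_mult)
    ultimately have "polyfam True (\<lambda>s. Rl F f (g + cst s * g'))" unfolding restrict_to_line_def by simp
    then obtain P where P: "degree P \<le> n" "\<And>s. coeff (Rl F f (g + cst s * g')) n = poly P s"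
      unfolding polyfam_def by blast
    have "poly P (- of_nat (Suc i)) = 0" if "i \<le> n" for i
    proof -
      have "ev (g + cst (- of_nat (Suc i)) * g') (p i) = 0"
        using eg'[OF that] by (simp add: field_simps del: of_nat_Suc)
      thus ?thesis unfolding P(2)[symmetric] by (intro hyp[OF that] homogeneous_add homogeneous_cst_mult g g')
    qed
    hence sub: "(\<lambda>i. - of_nat (Suc i)) ` {..n} \<subseteq> {x. poly P x = 0}" by auto
    have "P = 0"
    proof (rule ccontr)
      assume "P \<noteq> 0"
      have "card ((\<lambda>i. - of_nat (Suc i) :: complex) ` {..n}) \<le> card {x. poly P x = 0}"
        using sub \<open>P \<noteq> 0\<close> by (intro card_mono poly_roots_finite)
      also have "\<dots> \<le> n" using card_poly_roots_bound[OF \<open>P \<noteq> 0\<close>] P(1) by linarith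
      finally show False by (subst (asm) card_image) (auto simp: inj_on_def simp del: of_nat_Suc)
    qed
    thus ?thesis using P(2)[of 0] by simp
  qed
  thus "coeff (Rl F f g) j = 0" using van g j unfolding vanish_upto_def by (cases "j = n") auto
qed

lemma homogeneous_lin3: "homogeneous 3 (lin a * (lin b * lin c))"
  using homogeneous_mult[OF homogeneous_lin homogeneous_lin_mult] by (simp add: numeral_3_eq_3 numeral_2_eq_2)

lemma homogeneous_lin_quad: "homogeneous 2 q \<Longrightarrow> homogeneous 3 (lin a * q)"
  using homogeneous_mult[OF homogeneous_lin, of 2 q a] by (simp add: numeral_3_eq_3 numeral_2_eq_2)

text \<open>At the node \<open>p1\<close> every cubic \<open>h\<close> through \<open>p1\<close> is
  admissible in \<open>node_step\<close>: the Hessian can be made to cancel the gradient of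
  \<open>h\<close>. Against \<open>p1\<close> the required equation holds by Euler's relation, so
  only the equations against \<open>p2\<close> and \<open>w\<close> have to be solved for
  \<open>v\<close>.\<close>

lemma line_conic_node:
  assumes F: "F \<in> discriminant_ideal" and q: "homogeneous 2 q" and van: "vanish_upto n F (lin a * q)"
    and a: "a \<noteq> 0" "a \<odot> p1 = 0" "a \<odot> p2 = 0" and e: "ev q p1 = 0"
    and i: "crs p1 p2 \<noteq> 0" "bil q p1 p2 \<noteq> 0"
    and h: "homogeneous 3 h" "ev h p1 = 0"
  shows "coeff (Rl F (lin a * q) h) n = 0"
proof -
  obtain w where w: "br p1 p2 w \<noteq> 0" using indep_completion i(1) by blast
  have aw: "a \<odot> w \<noteq> 0" using orth_br_eq_0[OF a] w by blast
  \<comment> \<open>Pairing with \<open>p2\<close>, where \<open>a\<close> vanishes, determines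
    \<open>t\<close>; pairing with \<open>w\<close> then prescribes the value \<open>u\<close> of
    \<open>bil q p1 v\<close>, and \<open>s\<close> is chosen to attain it.\<close>
  define t where "t = - (grad h p1 \<odot> p2) / (2 * bil q p1 p2) / (a \<odot> w)"
  define u where "u = - (grad h p1 \<odot> w + t * (a \<odot> w) * 2 * bil q p1 w) / (2 * (a \<odot> w))"
  define s where "s = (u - t * bil q p1 w) / bil q p1 p2"
  define v where "v = s *s p2 + t *s w"
  define lz where "lz = (1 / br p1 p2 w) *s crs p2 w"
  have lz: "lz \<odot> p1 = 1" "lz \<odot> v = 0"
    using w br_rot(1)[of p1 p2 w] by (simp_all add: lz_def v_def dot3_simps br_def[symmetric])
  have av: "a \<odot> v = t * (a \<odot> w)" using a by (simp add: v_def dot3_simps)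
  have bv: "bil q p1 v = u" using i by (simp add: v_def bil_simps q s_def)
  have f: "homogeneous 3 (lin a * q)" by (rule homogeneous_lin_quad[OF q])
  have g0: "grad (lin a * q) p1 = 0" using a e by (simp add: grad_simps)
  have qadd: "grad q (x + y) = grad q x + grad q y" for x y
  proof (rule dot_basis_eqI[OF w])
  qed (simp_all add: dot3_simps grad_quad[OF q] bil_simps q algebra_simps)
  have hs: "hess (lin a * q) p1 v = (2 * bil q p1 v) *s a + (a \<odot> v) *s grad q p1"
  proof -
    have "2 * bil q p1 v = ev q (p1 + v) - ev q p1 - ev q v" by (simp add: bil_def)
    hence "ev q (p1 + v) = 2 * bil q p1 v + ev q v" using e by simp
    thus ?thesis unfolding hess_def grad_simps qadd using a e
      by (simp add: dot3_simps qadd vec_eq_iff algebra_simps)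
  qed
  have "hess (lin a * q) p1 v + grad h p1 = 0"
  proof (rule dot_basis_eqI[OF w])
    show "(hess (lin a * q) p1 v + grad h p1) \<odot> p1 = 0 \<odot> p1"
      unfolding hs using a(2) euler[OF h(1), of p1] h(2) by (simp add: dot3_simps grad_quad[OF q] bil_diag[OF q] e)
    show "(hess (lin a * q) p1 v + grad h p1) \<odot> p2 = 0 \<odot> p2"
      unfolding hs using a(3) i aw by (simp add: dot3_simps grad_quad[OF q] av t_def)
    show "(hess (lin a * q) p1 v + grad h p1) \<odot> w = 0 \<odot> w"
      unfolding hs dot3_simps grad_quad[OF q] av bv using aw by (simp add: u_def field_simps)
  qed
  from node_step[OF F f van g0 lz h(1) this] show ?thesis .
qed

lemma vanish_upto_singular:
  assumes "F \<in> discriminant_ideal" "homogeneous 3 f" "singular_form f"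
  shows "vanish_upto 1 F f"
  using discriminant_idealD[OF assms] by (simp add: vanish_upto_def coeff_Rl_0)

text \<open>The two intersection points of line and quadric are nodes. The linear part of
  \<open>F\<close> vanishes on two distinct hyperplanes and is therefore zero; cubes of coordinate
  forms dual to the two points show that the hyperplanes are distinct.\<close>

lemma vanish_upto_secant:
  assumes F: "F \<in> discriminant_ideal" and q: "homogeneous 2 q"
    and a: "a \<noteq> 0" "a \<odot> p1 = 0" "a \<odot> p2 = 0" and e: "ev q p1 = 0" "ev q p2 = 0"
    and i: "crs p1 p2 \<noteq> 0" "bil q p1 p2 \<noteq> 0"
  shows "vanish_upto 2 F (lin a * q)"
proof -
  have "p1 \<noteq> 0" using i(1) by (auto simp: coord_simps)
  moreover have "grad (lin a * q) p1 = 0" using a e by (simp add: grad_simps)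
  ultimately have s: "singular_form (lin a * q)" by (intro singular_formI[OF homogeneous_lin_quad[OF q]])
  have v1: "vanish_upto 1 F (lin a * q)" by (rule vanish_upto_singular[OF F homogeneous_lin_quad[OF q] s])
  obtain w where w: "br p1 p2 w \<noteq> 0" using indep_completion i(1) by blast
  define l where "l i = (1 / br p1 p2 w) *s (if i = (0::nat) then crs p2 w else crs w p1)" for i
  define p where "p i = (if i = (0::nat) then p1 else p2)" for i
  have lp: "l i \<odot> p j = (if i = j then 1 else 0)" if "i \<le> 1" "j \<le> 1" for i j
    using that w br_rot(1)[of p1 p2 w] br_rot(2)[of p1 p2 w]
    by (auto simp: l_def p_def dot3_simps br_def[symmetric] le_Suc_eq)
  have "vanish_upto (Suc 1) F (lin a * q)"
  proof (rule hyperplanes_step[OF v1, of "\<lambda>i. lin (l i) * (lin (l i) * lin (l i))" p])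
    fix h i assume "i \<le> (1::nat)" "homogeneous 3 h" "ev h (p i) = 0"
    moreover have "crs p2 p1 \<noteq> 0" using i(1) crs_eq_0_swap by blast
    moreover have "bil q p2 p1 \<noteq> 0" using i(2) bil_commute[OF q] by simp
    ultimately show "coeff (Rl F (lin a * q) h) 1 = 0"
      using line_conic_node[OF F q v1 a e(1) i, of h] line_conic_node[OF F q v1 a(1,3,2) e(2), of h]
      by (cases "i = 0") (auto simp: p_def)
  qed (use lp in \<open>auto intro: homogeneous_lin3 simp del: One_nat_def\<close>)
  thus ?thesis by (simp add: numeral_2_eq_2)
qed

lemma bil_lin_lin: "bil (lin a * lin b) x y = ((a \<odot> x) * (b \<odot> y) + (a \<odot> y) * (b \<odot> x)) / 2"
  by (simp add: bil_def dot3_simps algebra_simps)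

text \<open>Any two sides already give order 2. The quadratic part then vanishes on the three
  hyperplanes that belong to the vertices.\<close>

lemma vanish_upto_triangle:
  assumes F: "F \<in> discriminant_ideal" and n: "br a b c \<noteq> 0"
  shows "vanish_upto 3 F (lin a * (lin b * lin c))"
proof -
  define pa where "pa = crs b c"
  define pb where "pb = crs c a"
  define pc where "pc = crs a b"
  have dots: "a \<odot> pa = br a b c" "b \<odot> pb = br a b c" "c \<odot> pc = br a b c"
    "a \<odot> pb = 0" "a \<odot> pc = 0" "b \<odot> pa = 0" "b \<odot> pc = 0" "c \<odot> pa = 0" "c \<odot> pb = 0"
    by (simp_all add: pa_def pb_def pc_def coord_simps algebra_simps)
  have brp: "br pa pb pc = (br a b c)^2"
    by (simp add: pa_def pb_def pc_def coord_simps algebra_simps power2_eq_square)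
  hence "br pa pb pc \<noteq> 0" using n by simp
  from crs_nz_of_br[OF this] crs_eq_0_swap
  have cp: "crs pa pb \<noteq> 0" "crs pb pc \<noteq> 0" "crs pc pa \<noteq> 0" by blast+
  have abc: "a \<noteq> 0" "b \<noteq> 0" "c \<noteq> 0" using n by (auto simp: coord_simps)
  have v2: "vanish_upto 2 F (lin a * (lin b * lin c))"
    by (rule vanish_upto_secant[OF F homogeneous_lin_mult abc(1) dots(4,5) _ _ cp(2)])
       (use dots n in \<open>simp_all add: bil_lin_lin\<close>)
  \<comment> \<open>The vertex \<open>pa\<close> does not lie on \<open>a\<close>, so the factor
    \<open>b\<close>, which passes through it, is moved to the front before the result on nodes is
    applied.\<close>
  have e1: "lin a * (lin b * lin c) = lin b * (lin c * lin a)"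
    "lin a * (lin b * lin c) = lin c * (lin a * lin b)" by (simp_all add: mult_ac)
  define p where "p i = (if i = (0::nat) then pa else if i = 1 then pb else pc)" for i
  define l where "l i = (1 / br a b c) *s (if i = (0::nat) then a else if i = 1 then b else c)" for i
  have lp: "l i \<odot> p j = (if i = j then 1 else 0)" if "i \<le> 2" "j \<le> 2" for i j
    using that n dots by (auto simp: l_def p_def dot3_simps)
  have "vanish_upto (Suc 2) F (lin a * (lin b * lin c))"
  proof (rule hyperplanes_step[OF v2, of "\<lambda>i. lin (l i) * (lin (l i) * lin (l i))" p])
    fix h i assume i: "i \<le> (2::nat)" and h: "homogeneous 3 h" "ev h (p i) = 0"
    from i consider "i = 0" | "i = 1" | "i = 2" by linarith
    thus "coeff (Rl F (lin a * (lin b * lin c)) h) 2 = 0"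
    proof cases
      case 1
      show ?thesis unfolding e1(1)
        by (rule line_conic_node[OF F homogeneous_lin_mult v2[unfolded e1(1)] abc(2) dots(6,7)])
           (use 1 h dots n cp crs_eq_0_swap in \<open>auto simp: p_def bil_lin_lin\<close>)
    next
      case 2
      show ?thesis
        by (rule line_conic_node[OF F homogeneous_lin_mult v2 abc(1) dots(4,5)])
           (use 2 h dots n cp crs_eq_0_swap in \<open>auto simp: p_def bil_lin_lin\<close>)
    next
      case 3
      show ?thesis
        by (rule line_conic_node[OF F homogeneous_lin_mult v2 abc(1) dots(5,4)])
           (use 3 h dots n cp crs_eq_0_swap in \<open>auto simp: p_def bil_lin_lin\<close>)
    qed
  qed (use lp in \<open>auto intro: homogeneous_lin3\<close>)
  thus ?thesis by (simp add: numeral_3_eq_3 numeral_2_eq_2)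
qed

text \<open>The quadratic formula for \<open>q\<close> on the line \<open>u v\<close>, whose
  discriminant is nonzero by assumption. If \<open>q\<close> vanishes at \<open>u\<close> the
  formula degenerates, and \<open>u\<close> itself is one of the two zeros.\<close>

lemma secant_points:
  assumes q: "homogeneous 2 q" and i: "crs u v \<noteq> 0" and D: "(bil q u v)^2 \<noteq> ev q u * ev q v"
  obtains p1 p2 where "crs p1 p2 \<noteq> 0" "ev q p1 = 0" "ev q p2 = 0" "bil q p1 p2 \<noteq> 0"
    "\<And>a. a \<odot> u = 0 \<Longrightarrow> a \<odot> v = 0 \<Longrightarrow> a \<odot> p1 = 0 \<and> a \<odot> p2 = 0"
proof -
  define B where "B = bil q u v"
  define dd where "dd = csqrt (B^2 - ev q u * ev q v)"
  have dd: "dd^2 = B^2 - ev q u * ev q v" by (simp add: dd_def)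
  have dnz: "dd \<noteq> 0" using D by (auto simp: dd_def B_def)
  have cr: "crs (a *s u + b *s v) (c *s u + d *s v) = (a * d - b * c) *s crs u v" for a b c d
    by (simp add: coord_simps algebra_simps)
  have bl: "bil q (a *s u + b *s v) (c *s u + d *s v) = a * c * ev q u + b * d * ev q v + (a * d + b * c) * B" for a b c d
    by (simp add: bil_simps q bil_diag[OF q] B_def bil_commute[OF q, of v u] algebra_simps)
  have ev: "ev q (a *s u + b *s v) = a^2 * ev q u + b^2 * ev q v + 2 * a * b * B" for a b
    using ev_quad_expand(1)[OF q] by (simp add: B_def)
  show ?thesis
  proof (cases "ev q u = 0")
    case False
    define p where "p e = (e * dd - B) *s u + ev q u *s v" for e
    have z: "ev q (p e) = 0" if "e^2 = 1" for e
    proof -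
      have "ev q (p e) = ev q u * (e^2 * dd^2 - B^2 + ev q u * ev q v)"
        unfolding p_def ev by (simp add: power2_eq_square algebra_simps)
      thus ?thesis unfolding that dd by simp
    qed
    have "bil q (p 1) (p (- 1)) = ev q u * (ev q u * ev q v - B^2 - dd^2)"
      unfolding p_def bl by (simp add: power2_eq_square algebra_simps)
    also have "\<dots> = ev q u * (- (2 * dd^2))" unfolding dd by (simp add: algebra_simps)
    finally have b: "bil q (p 1) (p (- 1)) \<noteq> 0" using False dnz by simp
    show ?thesis
    proof (rule that[of "p 1" "p (- 1)"])
      show "crs (p 1) (p (- 1)) \<noteq> 0" unfolding p_def cr using False dnz i by (simp add: algebra_simps)
    qed (use z[of 1] z[of "-1"] b in \<open>simp_all add: p_def dot3_simps\<close>)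
  next
    case True
    hence Bnz: "B \<noteq> 0" using D by (auto simp: B_def)
    let ?p = "(- ev q v / 2) *s u + B *s v"
    have e: "ev q ?p = 0" unfolding ev using True by (simp add: power2_eq_square)
    have bb: "bil q (1 *s u + 0 *s v) ?p = B^2" unfolding bl using True by (simp add: power2_eq_square)
    have cc: "crs (1 *s u + 0 *s v) ?p = B *s crs u v" unfolding cr by simp
    show ?thesis
    proof (rule that[of u ?p])
      show "crs u ?p \<noteq> 0" using cc Bnz i by simp
      show "bil q u ?p \<noteq> 0" using bb Bnz by simp
    qed (use e True in \<open>simp_all add: dot3_simps\<close>)
  qed
qed

section \<open>Specialization to tangent and concurrent positions\<close>

definition formfam :: "(complex \<Rightarrow> form) \<Rightarrow> bool"
  where "formfam A \<longleftrightarrow> (\<exists>K. finite K \<and> (\<forall>s. ks (A s) \<subseteq> K)) \<and> (\<forall>m. polyfun (\<lambda>s. lk (A s) m))"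

lemma formfam_const: "formfam (\<lambda>s. f)"
  unfolding formfam_def by (intro conjI exI[of _ "ks f"]) auto

lemma formfam_add: "formfam A \<Longrightarrow> formfam B \<Longrightarrow> formfam (\<lambda>s. A s + B s)"
  unfolding formfam_def
proof (elim conjE exE, intro conjI)
  fix K L assume "finite K" "\<forall>s. ks (A s) \<subseteq> K" "finite L" "\<forall>s. ks (B s) \<subseteq> L"
  thus "\<exists>K. finite K \<and> (\<forall>s. ks (A s + B s) \<subseteq> K)"
    by (intro exI[of _ "K \<union> L"] conjI finite_UnI allI order_trans[OF Poly_Mapping.keys_add] Un_mono) auto
qed (auto simp: lookup_add)

text \<open>The finite support common to all parameters turns each coefficient of the product into a
  sum whose range does not depend on \<open>s\<close>.\<close>

lemma formfam_mult: assumes "formfam A" "formfam B" shows "formfam (\<lambda>s. A s * B s)"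
proof -
  obtain K L where K: "finite K" "\<And>s. ks (A s) \<subseteq> K" and L: "finite L" "\<And>s. ks (B s) \<subseteq> L"
    using assms unfolding formfam_def by blast
  have ex: "f = (\<Sum>m\<in>K. Poly_Mapping.single m (lk f m))" if "finite K" "ks f \<subseteq> K" for f :: form and K
    by (subst (1) cpoly_eq_sum_single[of f]) (use that in \<open>auto intro!: sum.mono_neutral_left simp: in_keys_iff\<close>)
  have l: "lk (A s * B s) m = (\<Sum>k\<in>K. \<Sum>l\<in>L. if k + l = m then lk (A s) k * lk (B s) l else 0)" for s m
    by (subst ex[OF K], subst ex[OF L]) (auto simp: sum_product mult_single lookup_sum lookup_single when_def intro!: sum.cong)
  have "polyfun (\<lambda>s. lk (A s * B s) m)" for m
  proof -
    have "polyfun (\<lambda>s. if k + l = m then lk (A s) k * lk (B s) l else 0)" for k l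
      using assms by (cases "k + l = m") (auto simp: formfam_def)
    thus ?thesis unfolding l by auto
  qed
  moreover have "ks (A s * B s) \<subseteq> (\<lambda>(k, l). k + l) ` (K \<times> L)" for s
  proof
    fix x assume "x \<in> ks (A s * B s)"
    with Poly_Mapping.keys_mult[of "A s" "B s"] obtain a b where "x = a + b" "a \<in> ks (A s)" "b \<in> ks (B s)"
      by auto
    thus "x \<in> (\<lambda>(k, l). k + l) ` (K \<times> L)" using K(2)[of s] L(2)[of s]
      by (intro image_eqI[of _ _ "(a, b)"]) auto
  qed
  ultimately show ?thesis unfolding formfam_def
    using K(1) L(1) by (intro conjI exI[of _ "(\<lambda>(k, l). k + l) ` (K \<times> L)"]) auto
qed

lemma formfam_cst: "polyfun a \<Longrightarrow> formfam (\<lambda>s. cst (a s))"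
  unfolding formfam_def
proof (intro conjI allI)
  show "\<exists>K. finite K \<and> (\<forall>s. ks (cst (a s)) \<subseteq> K)" by (intro exI[of _ "{0}"]) (auto simp: cst_def)
  show "polyfun (\<lambda>s. lk (cst (a s)) m)" if "polyfun a" for m
    using that by (cases "m = 0") (auto simp: cst_def lookup_single when_def)
qed

lemma formfam_lin:
  fixes x :: "complex \<Rightarrow> complex^3"
  assumes "\<And>i. polyfun (\<lambda>s. x s $ i)" shows "formfam (\<lambda>s. lin (x s))"
proof -
  have "lin (x s) = cst (x s $ 1) * lin (axis 1 1) + cst (x s $ 2) * lin (axis 2 1) + cst (x s $ 3) * lin (axis 3 1)" for s
    by (rule form_eqI) (simp add: dot3_def axis_def)
  thus ?thesis using assms by (auto intro!: formfam_add formfam_mult formfam_cst formfam_const)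
qed

text \<open>The coefficients in question are polynomials in \<open>s\<close>, so their vanishing
  extends to the zeros of \<open>d\<close>, in particular to \<open>s = 0\<close>.\<close>

lemma vanish_upto_limit:
  assumes A: "formfam A" and d: "polyfun d" "d 1 \<noteq> 0"
    and v: "\<And>s. d s \<noteq> 0 \<Longrightarrow> vanish_upto n F (A s)"
  shows "vanish_upto n F (A 0)"
  unfolding vanish_upto_def
proof (intro allI impI)
  fix g :: form and j assume g: "homogeneous 3 g" "j < n"
  have "polyfam False (\<lambda>s. [:lk (A s) m, lk g m:])" for m
    by (rule polyfam_linear) (use A in \<open>auto simp: formfam_def\<close>)
  hence "polyfam False (\<lambda>s. Rl F (A s) g)" unfolding restrict_to_line_def by (rule polyfam_eval_in)
  hence "polyfun (\<lambda>s. coeff (Rl F (A s) g) j)" by (rule polyfam_coeff)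
  thus "coeff (Rl F (A 0) g) j = 0"
    by (rule polyfun_zero[OF _ d]) (use v g in \<open>auto simp: vanish_upto_def\<close>)
qed

lemma orth_basis:
  assumes "(a::complex^3) \<noteq> 0" obtains u v where "a = crs u v"
proof -
  obtain w where w: "a \<odot> w = 1"
  proof -
    obtain i where "a $ i \<noteq> 0" using assms by (auto simp: vec_eq_iff)
    hence "a \<odot> ((1 / a $ i) *s axis i 1) = 1"
      using exhaust_3[of i] by (auto simp: dot3_def axis_def)
    thus ?thesis using that by blast
  qed
  have "w \<noteq> 0" using w by (auto simp: dot3_simps)
  then obtain k where k: "crs w k \<noteq> 0"
  proof -
    obtain i where i: "w $ i \<noteq> 0" using \<open>w \<noteq> 0\<close> by (auto simp: vec_eq_iff)
    have "crs w (axis (i + 1) 1) \<noteq> 0"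
      using i exhaust_3[of i] by (auto simp: coord_simps axis_def)
    thus ?thesis using that by blast
  qed
  obtain l where l: "br w k l \<noteq> 0" using indep_completion[OF k] .
  define u where "u = k - (a \<odot> k) *s w"
  define v where "v = l - (a \<odot> l) *s w"
  have "a \<odot> u = 0" "a \<odot> v = 0" using w by (simp_all add: u_def v_def dot3_simps)
  moreover have "br w u v = br w k l" by (simp add: u_def v_def coord_simps algebra_simps)
  hence "crs u v \<noteq> 0" using l crs_nz_of_br[of w u v] by simp
  ultimately obtain c where "a = c *s crs u v" using orth_crs by metis
  thus ?thesis using that[of "c *s u" v] by simp
qed

text \<open>Two points spanning the line are moved to \<open>e1\<close> and \<open>e2\<close>, and
  the quadric to the product of the first two coordinates. \<open>D s\<close> is, up to a constant,
  the discriminant of the quadric restricted to the moving line; where it is nonzero, the two points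
  stay independent and the line is a secant. At \<open>s = 1\<close> its value is 1/4.\<close>

lemma vanish_upto_line_quad:
  assumes F: "F \<in> discriminant_ideal" and q: "homogeneous 2 q" and a: "a \<noteq> 0"
  shows "vanish_upto 2 F (lin a * q)"
proof -
  obtain u v where uv: "a = crs u v" using orth_basis a by blast
  define e1 e2 :: "complex^3" where "e1 = axis 1 1" and "e2 = axis 2 1"
  define U where "U s = u + s *s (e1 - u)" for s
  define V where "V s = v + s *s (e2 - v)" for s
  define Q where "Q s = q + cst s * (lin e1 * lin e2 - q)" for s
  define D where "D s = (bil (Q s) (U s) (V s))^2 - ev (Q s) (U s) * ev (Q s) (V s)" for s
  have pU: "polyfun (\<lambda>s. U s $ i)" "polyfun (\<lambda>s. V s $ i)" for i
    by (auto simp: U_def V_def)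
  have pQ: "polyfun (\<lambda>s. ev (Q s) (x s))" if "\<And>i. polyfun (\<lambda>s. x s $ i)" for x :: "complex \<Rightarrow> complex^3"
    unfolding Q_def ev_simps using polyfun_ev[OF that] that by (auto simp: dot3_def)
  have pD: "polyfun D"
    unfolding D_def bil_def divide_inverse
    by (intro polyfun_diff polyfun_power polyfun_mult pQ pU polyfun_const) (auto simp: pU)
  have Q2: "homogeneous 2 (Q s)" for s unfolding Q_def
    by (intro homogeneous_add homogeneous_cst_mult homogeneous_diff homogeneous_lin_mult q)
  have one: "U 1 = e1" "V 1 = e2" "Q 1 = lin e1 * lin e2" by (simp_all add: U_def V_def Q_def cst_1)
  have "D 1 \<noteq> 0" unfolding D_def one bil_lin_lin by (simp add: e1_def e2_def dot3_def axis_def)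
  moreover have "formfam (\<lambda>s. lin (crs (U s) (V s)) * Q s)"
  proof (intro formfam_mult)
    show "formfam (\<lambda>s. lin (crs (U s) (V s)))"
    proof (rule formfam_lin)
      show "polyfun (\<lambda>s. crs (U s) (V s) $ i)" for i
        using exhaust_3[of i] by (auto simp: crs_def intro!: polyfun_diff polyfun_mult pU)
    qed
    show "formfam Q" unfolding Q_def by (intro formfam_add formfam_mult formfam_const formfam_cst) auto
  qed
  moreover have "vanish_upto 2 F (lin (crs (U s) (V s)) * Q s)" if "D s \<noteq> 0" for s
  proof -
    have c: "crs (U s) (V s) \<noteq> 0"
    proof
      assume c: "crs (U s) (V s) = 0"
      have "D s = 0"
      proof (cases "U s = 0")
        case True
        have "bil (Q s) 0 (V s) = 0" using bil_scale_left[OF Q2, of s 0 0 "V s"] by simp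
        moreover have "ev (Q s) 0 = 0" using ev_scale[OF Q2, of s 0 0] by simp
        ultimately show ?thesis using True by (simp add: D_def)
      next
        case False
        then obtain k where "V s = k *s U s" using crs_eq_0E c by blast
        thus ?thesis unfolding D_def
          by (simp add: bil_simps Q2 bil_diag[OF Q2] ev_scale[OF Q2] power2_eq_square)
      qed
      thus False using that by simp
    qed
    have "(bil (Q s) (U s) (V s))^2 \<noteq> ev (Q s) (U s) * ev (Q s) (V s)" using that by (simp add: D_def)
    from secant_points[OF Q2 c this] obtain p1 p2 where p: "crs p1 p2 \<noteq> 0" "ev (Q s) p1 = 0" "ev (Q s) p2 = 0" "bil (Q s) p1 p2 \<noteq> 0"
      "\<And>a. a \<odot> U s = 0 \<Longrightarrow> a \<odot> V s = 0 \<Longrightarrow> a \<odot> p1 = 0 \<and> a \<odot> p2 = 0" by blast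
    show ?thesis
      by (rule vanish_upto_secant[OF F Q2 c _ _ p(2,3,1,4)]) (use p(5)[of "crs (U s) (V s)"] in simp_all)
  qed
  ultimately have "vanish_upto 2 F (lin (crs (U 0) (V 0)) * Q 0)" by (intro vanish_upto_limit[where A="\<lambda>s. lin (crs (U s) (V s)) * Q s", OF _ pD])
  thus ?thesis by (simp add: U_def V_def Q_def uv)
qed

text \<open>The lines are interpolated linearly to the coordinate triangle, where their bracket is
  nonzero.\<close>

lemma vanish_upto_three_lines:
  assumes F: "F \<in> discriminant_ideal"
  shows "vanish_upto 3 F (lin a * (lin b * lin c))"
proof -
  define e :: "3 \<Rightarrow> complex^3" where "e i = axis i 1" for i
  define A where "A x i s = x + s *s (e i - x)" for x i s
  have pA: "polyfun (\<lambda>s. A x i s $ j)" for x i j by (auto simp: A_def)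
  have "polyfun (\<lambda>s. br (A a 1 s) (A b 2 s) (A c 3 s))"
    unfolding br_def dot3_def crs_def vector_3 by (intro polyfun_add polyfun_mult polyfun_diff pA)
  moreover have "br (A a 1 1) (A b 2 1) (A c 3 1) \<noteq> 0"
    by (simp add: A_def e_def coord_simps axis_def)
  moreover have "formfam (\<lambda>s. lin (A a 1 s) * (lin (A b 2 s) * lin (A c 3 s)))"
    by (intro formfam_mult formfam_lin pA)
  ultimately have "vanish_upto 3 F (lin (A a 1 0) * (lin (A b 2 0) * lin (A c 3 0)))"
    by (intro vanish_upto_limit[where d="\<lambda>s. br (A a 1 s) (A b 2 s) (A c 3 s)"
          and A="\<lambda>s. lin (A a 1 s) * (lin (A b 2 s) * lin (A c 3 s))"] vanish_upto_triangle F)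
  thus ?thesis by (simp add: A_def)
qed

section \<open>The discriminant as a Sylvester determinant\<close>

lemma partial_deriv_commute:
  "partial_deriv i (partial_deriv j q) = partial_deriv j (partial_deriv i q)"
  unfolding partial_deriv_def[of _ q] partial_deriv_sum partial_deriv_single
  by (intro sum.cong refl arg_cong2[where f=Poly_Mapping.single] poly_mapping_eqI)
     (auto simp: lookup_minus lookup_single when_def)

text \<open>The symmetric trilinear form of a cubic form.\<close>

definition tens :: "form \<Rightarrow> complex^3 \<Rightarrow> complex^3 \<Rightarrow> complex^3 \<Rightarrow> complex"
  where "tens f a b c = (hess f b c \<odot> a) / 6"

context
  fixes f :: form assumes f: "homogeneous 3 f"
begin

private lemma f2: "homogeneous 2 (partial_deriv j f)"
  using homogeneous_partial_deriv[of 2 f] f by (simp add: numeral_3_eq_3 numeral_2_eq_2)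

private lemma hess_bil: "hess f b c $ j = 2 * bil (partial_deriv j f) b c"
  by (simp add: hess_def grad_def bil_def)

lemma tens_bil: "tens f a b c = (a$1 * bil (partial_deriv 1 f) b c + a$2 * bil (partial_deriv 2 f) b c
    + a$3 * bil (partial_deriv 3 f) b c) / 3"
  by (simp add: tens_def dot3_def hess_bil algebra_simps)

lemma tens_add1: "tens f (a + a') b c = tens f a b c + tens f a' b c"
  and tens_scale1: "tens f (k *s a) b c = k * tens f a b c"
  and tens_add2: "tens f a (b + b') c = tens f a b c + tens f a b' c"
  and tens_scale2: "tens f a (k *s b) c = k * tens f a b c"
  and tens_sym23: "tens f a c b = tens f a b c"
  by (simp_all add: tens_bil bil_simps[OF f2] bil_commute[OF f2, of _ c b] add_divide_distrib algebra_simps)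

lemma tens_sym12: "tens f b a c = tens f a b c"
proof -
  have e: "2 * bil (partial_deriv j f) x c
    = ev (partial_deriv 1 (partial_deriv j f)) c * x$1 + ev (partial_deriv 2 (partial_deriv j f)) c * x$2
      + ev (partial_deriv 3 (partial_deriv j f)) c * x$3" for j x
    using grad_quad[OF f2, of j c x] bil_commute[OF f2, of j c x] by (simp add: grad_def dot3_def)
  have t: "6 * tens f x y c = x$1 * (2 * bil (partial_deriv 1 f) y c) + x$2 * (2 * bil (partial_deriv 2 f) y c)
    + x$3 * (2 * bil (partial_deriv 3 f) y c)" for x y by (simp add: tens_bil algebra_simps)
  have "6 * tens f b a c = 6 * tens f a b c" unfolding t e
    by (simp add: partial_deriv_commute[of 2 1] partial_deriv_commute[of 3 1] partial_deriv_commute[of 3 2] algebra_simps)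
  thus ?thesis by simp
qed

lemma tens_add3: "tens f a b (c + c') = tens f a b c + tens f a b c'"
  and tens_scale3: "tens f a b (k *s c) = k * tens f a b c"
  by (simp_all add: tens_sym23[of a b] tens_add2 tens_scale2)

lemma tens_grad: "tens f a y y = (grad f y \<odot> a) / 3"
proof -
  have "ev (partial_deriv j f) y = bil (partial_deriv j f) y y" for j by (simp add: bil_diag[OF f2])
  thus ?thesis by (simp add: tens_bil grad_def dot3_def algebra_simps)
qed

lemma tens_diag: "tens f y y y = ev f y"
  using euler[OF f, of y] by (simp add: tens_grad)

text \<open>An expression through values alone exhibits the trilinear form as linear in the
  coefficients of \<open>f\<close>; \<open>tens_coeff\<close> copies it.\<close>

lemma tens_polar: "tens f a b c = (ev f (a + b + c) - ev f (a + b) - ev f (b + c) - ev f (a + c)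
    + ev f a + ev f b + ev f c) / 6"
proof -
  have p: "tens f b a x = tens f a b x" "tens f c a x = tens f a c x" "tens f c b x = tens f b c x" for x
    using tens_sym12 by blast+
  have q: "tens f x b a = tens f x a b" "tens f x c a = tens f x a c" "tens f x c b = tens f x b c" for x
    using tens_sym23 by blast+
  have "tens f a c b = tens f a b c" "tens f b a c = tens f a b c" "tens f b c a = tens f a b c"
    using p q by metis+
  thus ?thesis unfolding tens_diag[symmetric] tens_add1 tens_add2 tens_add3 p q
    by (simp add: p q field_simps)
qed

end

section \<open>The coefficients of a cubic as variables\<close>

definition cubic_monoms :: "(3 \<Rightarrow>\<^sub>0 nat) set" where "cubic_monoms = {m. mdeg m = 3}"

lemma finite_cubic_monoms: "finite cubic_monoms"
proof -
  have md: "mdeg m = lk m 1 + lk m 2 + lk m 3" for m :: "3 \<Rightarrow>\<^sub>0 nat"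
    by (subst mdeg_superset[of UNIV]) (auto simp: sum_3)
  have inj: "inj_on (\<lambda>m::3 \<Rightarrow>\<^sub>0 nat. (lk m 1, lk m 2, lk m 3)) cubic_monoms"
    by (auto simp: inj_on_def intro!: poly_mapping_eqI) (metis exhaust_3)
  have "(\<lambda>m::3 \<Rightarrow>\<^sub>0 nat. (lk m 1, lk m 2, lk m 3)) ` cubic_monoms \<subseteq> {..3} \<times> {..3} \<times> {..3}"
    by (auto simp: cubic_monoms_def md)
  hence "finite ((\<lambda>m::3 \<Rightarrow>\<^sub>0 nat. (lk m 1, lk m 2, lk m 3)) ` cubic_monoms)"
    by (rule finite_subset) auto
  thus ?thesis using inj finite_imageD by blast
qed

type_synonym coeff_poly = "(3 \<Rightarrow>\<^sub>0 nat) cpoly"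

text \<open>The value at \<open>x\<close>, and the trilinear form, as linear forms in the coefficients of a cubic.\<close>

definition eval_coeff :: "complex^3 \<Rightarrow> coeff_poly"
  where "eval_coeff x = (\<Sum>m\<in>cubic_monoms. Poly_Mapping.single (Poly_Mapping.single m 1) (monom_val (($) x) m))"

definition tens_coeff :: "complex^3 \<Rightarrow> complex^3 \<Rightarrow> complex^3 \<Rightarrow> coeff_poly"
  where "tens_coeff a b c = Poly_Mapping.single 0 (1/6) * (eval_coeff (a + b + c) - eval_coeff (a + b)
    - eval_coeff (b + c) - eval_coeff (a + c) + eval_coeff a + eval_coeff b + eval_coeff c)"

lemma eval_eval_coeff: "homogeneous 3 f \<Longrightarrow> eval (eval_coeff x) (lk f) = ev f x"
proof -
  assume f: "homogeneous 3 f"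
  have "eval (eval_coeff x) (lk f) = (\<Sum>m\<in>cubic_monoms. lk f m * monom_val (($) x) m)"
    by (simp add: eval_coeff_def eval_simps eval_single monom_val_single mult.commute)
  also have "\<dots> = ev f x"
    unfolding ev_def eval_def eval_in_alt using f finite_cubic_monoms
    by (intro sum.mono_neutral_right) (auto simp: cubic_monoms_def homogeneous_iff in_keys_iff)
  finally show ?thesis .
qed

lemma eval_tens_coeff: "homogeneous 3 f \<Longrightarrow> eval (tens_coeff a b c) (lk f) = tens f a b c"
  by (simp add: tens_coeff_def eval_simps eval_single monom_val_0 eval_eval_coeff tens_polar)

lemma homogeneous_eval_coeff: "homogeneous 1 (eval_coeff x)"
  unfolding eval_coeff_def by (intro homogeneous_sum homogeneous_single) simp

lemma homogeneous_tens_coeff: "homogeneous 1 (tens_coeff a b c)"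
proof -
  have "homogeneous 0 (Poly_Mapping.single 0 (1/6) :: coeff_poly)" by (rule homogeneous_single) simp
  from homogeneous_mult[OF this] show ?thesis unfolding tens_coeff_def
    by (metis (no_types, lifting) add_0 homogeneous_add homogeneous_diff homogeneous_eval_coeff)
qed

text \<open>\<open>cdet T i j k\<close> is the determinant whose columns are the first column of \<open>T _ _ i\<close>, the second
  of \<open>T _ _ j\<close> and the third of \<open>T _ _ k\<close>; \<open>jac T c\<close> is the array of coefficients of the derivative
  in direction \<open>c\<close> of the Jacobian determinant of the three quadrics \<open>T a\<close>.\<close>

definition cdet :: "(3 \<Rightarrow> 3 \<Rightarrow> 3 \<Rightarrow> 'r::comm_ring_1) \<Rightarrow> 3 \<Rightarrow> 3 \<Rightarrow> 3 \<Rightarrow> 'r"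
  where "cdet T i j k = T 1 1 i * (T 2 2 j * T 3 3 k - T 3 2 j * T 2 3 k)
    - T 2 1 i * (T 1 2 j * T 3 3 k - T 3 2 j * T 1 3 k)
    + T 3 1 i * (T 1 2 j * T 2 3 k - T 2 2 j * T 1 3 k)"

definition jac :: "(3 \<Rightarrow> 3 \<Rightarrow> 3 \<Rightarrow> 'r::comm_ring_1) \<Rightarrow> 3 \<Rightarrow> 3 \<Rightarrow> 3 \<Rightarrow> 'r"
  where "jac T c i j = cdet T c i j + cdet T i c j + cdet T i j c"

text \<open>Column \<open>(True, b)\<close> belongs to the monomial \<open>x\<^sub>b\<^sup>2\<close>, column \<open>(False, b)\<close> to the product of the
  other two variables; the indices \<open>b + 1\<close> and \<open>b + 2\<close> are taken modulo 3.\<close>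

definition quad_row :: "(3 \<Rightarrow> 3 \<Rightarrow> 'r::comm_ring_1) \<Rightarrow> bool \<times> 3 \<Rightarrow> 'r"
  where "quad_row q s = (if fst s then q (snd s) (snd s)
    else q (snd s + 1) (snd s + 2) + q (snd s + 2) (snd s + 1))"

text \<open>Sylvester's matrix for the resultant of three ternary quadrics, here up to constants the
  partial derivatives of a cubic: three rows for the quadrics, three for the derivatives of their
  Jacobian determinant. Its determinant has degree \<open>3 * 1 + 3 * 3 = 12\<close> in the
  coefficients, the degree of the discriminant.\<close>

definition sylv :: "(3 \<Rightarrow> 3 \<Rightarrow> 3 \<Rightarrow> 'r::comm_ring_1) \<Rightarrow> 'r^(bool \<times> 3)^(bool \<times> 3)"
  where "sylv T = (\<chi> r s. quad_row (if fst r then jac T (snd r) else T (snd r)) s)"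

lemma mod3 [simp]: "(4::3) = 1" "(5::3) = 2" by simp_all

lemma sum_bool_3: "(\<Sum>s\<in>(UNIV :: (bool \<times> 3) set). g s)
    = g (True, 1) + g (True, 2) + g (True, 3) + g (False, 1) + g (False, 2) + g (False, 3)"
proof -
  have "(\<Sum>s\<in>(UNIV :: (bool \<times> 3) set). g s) = (\<Sum>r\<in>UNIV. \<Sum>a\<in>UNIV. g (r, a))"
    unfolding UNIV_Times_UNIV[symmetric] by (simp add: sum.cartesian_product)
  thus ?thesis by (simp add: UNIV_bool sum_3 algebra_simps)
qed

text \<open>The letters are the entries of two symmetric matrices \<open>H\<close> and
  \<open>G\<close>; the conclusion says that the derivative of the determinant at \<open>H\<close>
  in direction \<open>G\<close> is zero. As \<open>H\<close> kills \<open>(x, y, z)\<close>,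
  \<open>z^2\<close> times its adjugate is \<open>m\<close> times the matrix of products of the
  coordinates, so the derivative is a multiple of the value of \<open>G\<close> at that
  vector.\<close>

lemma jac_vanish_aux:
  fixes a b c d e f x y z g1 g2 g3 g12 g13 g23 :: complex
  assumes h: "a * x + b * y + c * z = 0" "b * x + d * y + e * z = 0" "c * x + e * y + f * z = 0"
    and g: "g1 * x^2 + g2 * y^2 + g3 * z^2 + 2 * g12 * x * y + 2 * g13 * x * z + 2 * g23 * y * z = 0"
    and z: "z \<noteq> 0"
  shows "g1 * (d * f - e^2) + g2 * (a * f - c^2) + g3 * (a * d - b^2) + 2 * g12 * (c * e - b * f)
    + 2 * g13 * (b * e - c * d) + 2 * g23 * (b * c - a * e) = 0"
proof -
  define m where "m = a * d - b^2"
  have "z^2 * (d * f - e^2) = m * x^2" "z^2 * (a * f - c^2) = m * y^2"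
    "z^2 * (c * e - b * f) = m * x * y" "z * (b * e - c * d) = m * x" "z * (b * c - a * e) = m * y"
    unfolding m_def using h by algebra+
  hence "z^2 * (g1 * (d * f - e^2) + g2 * (a * f - c^2) + g3 * (a * d - b^2) + 2 * g12 * (c * e - b * f)
    + 2 * g13 * (b * e - c * d) + 2 * g23 * (b * c - a * e))
    = m * (g1 * x^2 + g2 * y^2 + g3 * z^2 + 2 * g12 * x * y + 2 * g13 * x * z + 2 * g23 * y * z)"
    unfolding m_def[symmetric] by algebra
  thus ?thesis using g z by simp
qed

text \<open>If the matrix \<open>H\<close> with entries \<open>\<Sum>\<^sub>c T a b c x\<^sub>c\<close> kills \<open>x \<noteq> 0\<close>, its adjugate is a multiple of
  \<open>x x\<^sup>t\<close>, so the derivatives of \<open>det H\<close> vanish at \<open>x\<close> along with the quadrics.\<close>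

lemma sylv_det_eq_0:
  fixes T :: "3 \<Rightarrow> 3 \<Rightarrow> 3 \<Rightarrow> complex" and x :: "complex^3"
  assumes s: "\<And>a b c. T b a c = T a b c" "\<And>a b c. T a c b = T a b c"
    and q: "\<And>a. (\<Sum>i\<in>UNIV. \<Sum>j\<in>UNIV. T a i j * x$i * x$j) = 0" and x: "x \<noteq> 0"
  shows "det (sylv T) = 0"
proof -
  define H where "H a b = T a b 1 * x$1 + T a b 2 * x$2 + T a b 3 * x$3" for a b
  have Hs: "H b a = H a b" for a b using s(1) by (simp add: H_def)
  have Hx: "H a 1 * x$1 + H a 2 * x$2 + H a 3 * x$3 = 0" for a
    using q[of a] s(2)[of a] by (simp add: H_def sum_3 algebra_simps)
  have J: "(\<Sum>i\<in>UNIV. \<Sum>j\<in>UNIV. jac T c i j * x$i * x$j) = 0" for c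
  proof -
    define D where "D = T 1 1 c * (H 2 2 * H 3 3 - (H 2 3)^2) + T 2 2 c * (H 1 1 * H 3 3 - (H 1 3)^2)
      + T 3 3 c * (H 1 1 * H 2 2 - (H 1 2)^2) + 2 * T 1 2 c * (H 1 3 * H 2 3 - H 1 2 * H 3 3)
      + 2 * T 1 3 c * (H 1 2 * H 2 3 - H 1 3 * H 2 2) + 2 * T 2 3 c * (H 1 2 * H 1 3 - H 1 1 * H 2 3)"
    have e: "(\<Sum>i\<in>UNIV. \<Sum>j\<in>UNIV. jac T c i j * x$i * x$j) = D"
    proof -
      have c1: "(\<Sum>i\<in>UNIV. \<Sum>j\<in>UNIV. cdet T c i j * x$i * x$j) =
        T 1 1 c * (H 2 2 * H 3 3 - H 3 2 * H 2 3) - T 2 1 c * (H 1 2 * H 3 3 - H 3 2 * H 1 3)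
        + T 3 1 c * (H 1 2 * H 2 3 - H 2 2 * H 1 3)"
        by (simp add: cdet_def H_def sum_3 algebra_simps)
      have c2: "(\<Sum>i\<in>UNIV. \<Sum>j\<in>UNIV. cdet T i c j * x$i * x$j) =
        H 1 1 * (T 2 2 c * H 3 3 - T 3 2 c * H 2 3) - H 2 1 * (T 1 2 c * H 3 3 - T 3 2 c * H 1 3)
        + H 3 1 * (T 1 2 c * H 2 3 - T 2 2 c * H 1 3)"
        by (simp add: cdet_def H_def sum_3 algebra_simps)
      have c3: "(\<Sum>i\<in>UNIV. \<Sum>j\<in>UNIV. cdet T i j c * x$i * x$j) =
        H 1 1 * (H 2 2 * T 3 3 c - H 3 2 * T 2 3 c) - H 2 1 * (H 1 2 * T 3 3 c - H 3 2 * T 1 3 c)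
        + H 3 1 * (H 1 2 * T 2 3 c - H 2 2 * T 1 3 c)"
        by (simp add: cdet_def H_def sum_3 algebra_simps)
      have t: "T 2 1 c = T 1 2 c" "T 3 1 c = T 1 3 c" "T 3 2 c = T 2 3 c" using s(1) by blast+
      have h: "H 2 1 = H 1 2" "H 3 1 = H 1 3" "H 3 2 = H 2 3" using Hs by blast+
      have "(\<Sum>i\<in>UNIV. \<Sum>j\<in>UNIV. jac T c i j * x$i * x$j)
        = (\<Sum>i\<in>UNIV. \<Sum>j\<in>UNIV. cdet T c i j * x$i * x$j) + (\<Sum>i\<in>UNIV. \<Sum>j\<in>UNIV. cdet T i c j * x$i * x$j)
          + (\<Sum>i\<in>UNIV. \<Sum>j\<in>UNIV. cdet T i j c * x$i * x$j)"
        by (simp add: jac_def distrib_right sum.distrib)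
      also have "\<dots> = D" unfolding c1 c2 c3 D_def t h by (simp add: algebra_simps power2_eq_square)
      finally show ?thesis .
    qed
    have "T c i j = T i j c" for i j using s by metis
    hence g: "T 1 1 c * (x$1)^2 + T 2 2 c * (x$2)^2 + T 3 3 c * (x$3)^2 + 2 * T 1 2 c * x$1 * x$2
      + 2 * T 1 3 c * x$1 * x$3 + 2 * T 2 3 c * x$2 * x$3 = 0"
      using q[of c] s(1)[of 1 2 c] s(1)[of 1 3 c] s(1)[of 2 3 c]
      by (simp add: sum_3 power2_eq_square algebra_simps)
    have h: "H 1 1 * x$1 + H 1 2 * x$2 + H 1 3 * x$3 = 0" "H 1 2 * x$1 + H 2 2 * x$2 + H 2 3 * x$3 = 0"
      "H 1 3 * x$1 + H 2 3 * x$2 + H 3 3 * x$3 = 0"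
      using Hx[of 1] Hx[of 2] Hx[of 3] Hs[of 1 2] Hs[of 1 3] Hs[of 2 3] by simp_all
    \<comment> \<open>The auxiliary lemma cancels the last coordinate; the other two cases permute
      the variables.\<close>
    from x consider "x$3 \<noteq> 0" | "x$2 \<noteq> 0" | "x$1 \<noteq> 0" by (auto simp: vec_eq_iff forall_3)
    hence "D = 0"
    proof cases
      case 1 from jac_vanish_aux[OF h g 1] show ?thesis by (simp add: D_def)
    next
      case 2
      show ?thesis using jac_vanish_aux[of "H 1 1" "x$1" "H 1 3" "x$3" "H 1 2" "x$2" "H 3 3" "H 2 3" "H 2 2"
            "T 1 1 c" "T 3 3 c" "T 2 2 c" "T 1 3 c" "T 1 2 c" "T 2 3 c"] h g 2
        by (simp add: D_def algebra_simps)
    next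
      case 3
      show ?thesis using jac_vanish_aux[of "H 3 3" "x$3" "H 2 3" "x$2" "H 1 3" "x$1" "H 2 2" "H 1 2" "H 1 1"
            "T 3 3 c" "T 2 2 c" "T 1 1 c" "T 2 3 c" "T 1 3 c" "T 1 2 c"] h g 3
        by (simp add: D_def algebra_simps)
    qed
    thus ?thesis using e by simp
  qed
  \<comment> \<open>The quadratic monomials of \<open>x\<close>, in the order of the columns, form
    the kernel vector.\<close>
  define v :: "complex^(bool \<times> 3)" where "v = (\<chi> s. if fst s then (x$snd s)^2 else x$(snd s + 1) * x$(snd s + 2))"
  have row: "(\<Sum>s\<in>UNIV. quad_row p s * v$s) = (\<Sum>i\<in>UNIV. \<Sum>j\<in>UNIV. p i j * x$i * x$j)" for p
    by (simp add: sum_bool_3 v_def quad_row_def sum_3 power2_eq_square algebra_simps)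
  have "sylv T *v v = 0"
    by (simp add: matrix_vector_mult_def sylv_def vec_eq_iff row q J)
  moreover have "v \<noteq> 0"
  proof
    assume "v = 0"
    hence "v $ (True, i) = 0" for i by simp
    hence "x $ i = 0" for i by (simp add: v_def)
    thus False using x by (simp add: vec_eq_iff)
  qed
  ultimately show ?thesis
    by (metis invertible_det_nz invertible_def matrix_left_invertible_ker)
qed

text \<open>The matrix consists of 2 by 2 blocks, one for each second index. A unipotent row
  operation \<open>L\<close> clears one off-diagonal entry of each block, after which only the
  identity permutation contributes to the determinant.\<close>

lemma det_block_diagonal:
  fixes A :: "complex^(bool \<times> 3)^(bool \<times> 3)"
  assumes z: "\<And>r s a b. a \<noteq> b \<Longrightarrow> A $ (r, a) $ (s, b) = 0" and nz: "\<And>a. A $ (False, a) $ (False, a) \<noteq> 0"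
  shows "det A = (\<Prod>a\<in>UNIV. A $ (False, a) $ (False, a) * A $ (True, a) $ (True, a)
    - A $ (False, a) $ (True, a) * A $ (True, a) $ (False, a))"
proof -
  have tri: "det B = (\<Prod>i\<in>UNIV. B $ i $ i)"
    if B: "\<And>i j. B $ i $ j \<noteq> 0 \<Longrightarrow> j = i \<or> snd j = snd i \<and> fst i = k \<and> fst j = (\<not> k)"
    for B :: "complex^(bool \<times> 3)^(bool \<times> 3)" and k
  proof -
    have "(\<Prod>i\<in>UNIV. B $ i $ p i) = 0" if p: "p permutes UNIV" "p \<noteq> id" for p
    proof (rule ccontr)
      assume "(\<Prod>i\<in>UNIV. B $ i $ p i) \<noteq> 0"
      hence n: "B $ i $ p i \<noteq> 0" for i by (cases i) simp
      have 1: "p (\<not> k, a) = (\<not> k, a)" for a using B[OF n[of "(\<not> k, a)"]] by auto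
      have "p (k, a) = (k, a)" for a
      proof (rule ccontr)
        assume "p (k, a) \<noteq> (k, a)"
        hence "p (k, a) = (\<not> k, a)" using B[OF n[of "(k, a)"]] by (cases "p (k, a)") auto
        hence "p (k, a) = p (\<not> k, a)" using 1 by simp
        thus False using p(1) by (metis Pair_inject permutes_def)
      qed
      with 1 have "p (r, a) = (r, a)" for r a by (cases "r = k") auto
      hence "p i = i" for i by (cases i) simp
      thus False using p(2) by (simp add: fun_eq_iff)
    qed
    hence "det B = (\<Sum>p\<in>{id}. of_int (sign p) * (\<Prod>i\<in>UNIV. B $ i $ p i))"
      unfolding det_def by (intro sum.mono_neutral_right) (auto simp: permutes_id finite_permutations)
    thus ?thesis by (simp add: sign_id)
  qed
  define l where "l i = (if fst i then - A $ (True, snd i) $ (False, snd i) / A $ (False, snd i) $ (False, snd i) else 0)" for i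
  define L :: "complex^(bool \<times> 3)^(bool \<times> 3)"
    where "L = (\<chi> i j. (if j = i then 1 else 0) + (if j = (False, snd i) then l i else 0))"
  have dL: "det L = 1"
  proof -
    have "det L = (\<Prod>i\<in>UNIV. L $ i $ i)"
      by (rule tri[of _ True]) (auto simp: L_def l_def split: if_splits)
    also have "\<dots> = 1" by (rule prod.neutral) (auto simp: L_def l_def)
    finally show ?thesis .
  qed
  have LA: "(L ** A) $ i $ j = A $ i $ j + l i * A $ (False, snd i) $ j" for i j
    by (simp add: matrix_matrix_mult_def L_def distrib_right sum.distrib if_distrib[of "\<lambda>x. x * _"] cong: if_cong)
  have "det (L ** A) = (\<Prod>i\<in>UNIV. (L ** A) $ i $ i)"
  proof (rule tri[of _ False])
    fix i j assume n: "(L ** A) $ i $ j \<noteq> 0"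
    have s: "snd i = snd j"
    proof (rule ccontr)
      assume "snd i \<noteq> snd j"
      hence "A $ (r, snd i) $ j = 0" for r using z[of "snd i" "snd j" r "fst j"] by simp
      from this[of "fst i"] this[of False] n show False by (simp add: LA)
    qed
    show "j = i \<or> snd j = snd i \<and> fst i = False \<and> fst j = (\<not> False)"
    proof (cases "fst i \<and> \<not> fst j")
      case True
      then obtain b where ij: "i = (True, b)" "j = (False, b)" using s by (cases i; cases j) auto
      have "(L ** A) $ i $ j = 0" unfolding LA ij by (simp add: l_def nz)
      thus ?thesis using n by simp
    next
      case False thus ?thesis using s by (auto simp: prod_eq_iff)
    qed
  qed
  also have "\<dots> = (\<Prod>r\<in>UNIV. \<Prod>a\<in>UNIV. (L ** A) $ (r, a) $ (r, a))"
    unfolding UNIV_Times_UNIV[symmetric] by (simp add: prod.cartesian_product)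
  also have "\<dots> = (\<Prod>a\<in>UNIV. (L ** A) $ (False, a) $ (False, a)) * (\<Prod>a\<in>UNIV. (L ** A) $ (True, a) $ (True, a))"
    by (simp add: UNIV_bool)
  also have "\<dots> = (\<Prod>a\<in>UNIV. A $ (False, a) $ (False, a) * A $ (True, a) $ (True, a)
    - A $ (False, a) $ (True, a) * A $ (True, a) $ (False, a))"
    unfolding prod.distrib[symmetric] using nz by (intro prod.cong) (simp_all add: LA l_def field_simps)
  finally show ?thesis by (simp add: det_mul dL)
qed

text \<open>The discriminant of \<open>x y z + s\<^sub>1 x\<^sup>3 + s\<^sub>2 y\<^sup>3 + s\<^sub>3 z\<^sup>3\<close>.\<close>

lemma det_sylv_hesse:
  fixes s :: "3 \<Rightarrow> complex"
  assumes T: "\<And>i j k. T i j k = (if i \<noteq> j \<and> j \<noteq> k \<and> i \<noteq> k then 1/6 else if i = j \<and> j = k then s i else 0)"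
  shows "det (sylv T) = - (s 1 * s 2 * s 3 * (1/27 + s 1 * s 2 * s 3)^3)"
proof -
  have n: "(1::3) \<noteq> 2" "(1::3) \<noteq> 3" "(2::3) \<noteq> 3" by simp_all
  have v: "T 1 1 1 = s 1" "T 1 1 2 = 0" "T 1 1 3 = 0"
    "T 1 2 1 = 0" "T 1 2 2 = 0" "T 1 2 3 = 1/6"
    "T 1 3 1 = 0" "T 1 3 2 = 1/6" "T 1 3 3 = 0"
    "T 2 1 1 = 0" "T 2 1 2 = 0" "T 2 1 3 = 1/6"
    "T 2 2 1 = 0" "T 2 2 2 = s 2" "T 2 2 3 = 0"
    "T 2 3 1 = 1/6" "T 2 3 2 = 0" "T 2 3 3 = 0"
    "T 3 1 1 = 0" "T 3 1 2 = 1/6" "T 3 1 3 = 0"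
    "T 3 2 1 = 1/6" "T 3 2 2 = 0" "T 3 2 3 = 0"
    "T 3 3 1 = 0" "T 3 3 2 = 0" "T 3 3 3 = s 3"
    by (simp_all add: T)
  have e: "sylv T $ (r, a) $ (t, b) = (if a = b then (if r then (if t then - s a / 12 else s 1 * s 2 * s 3 + 1/108)
      else if t then s a else 1/3) else 0)" for r t a b
    using exhaust_3[of a] exhaust_3[of b]
    by (cases r; cases t; elim disjE) (simp_all add: sylv_def quad_row_def jac_def cdet_def v n)
  have "det (sylv T) = (\<Prod>a\<in>UNIV. sylv T $ (False, a) $ (False, a) * sylv T $ (True, a) $ (True, a)
    - sylv T $ (False, a) $ (True, a) * sylv T $ (True, a) $ (False, a))"
    by (rule det_block_diagonal) (simp_all add: e)
  also have "\<dots> = (\<Prod>a\<in>UNIV. - s a * (1/27 + s 1 * s 2 * s 3))"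
    by (intro prod.cong refl) (simp add: e field_simps)
  also have "\<dots> = - (s 1 * s 2 * s 3 * (1/27 + s 1 * s 2 * s 3)^3)"
  proof -
    have "(\<Prod>a\<in>UNIV. - s a * K) = - (s 1 * s 2 * s 3 * K^3)" for K
      unfolding UNIV_3 by (simp add: n power3_eq_cube)
    thus ?thesis .
  qed
  finally show ?thesis .
qed

text \<open>The discriminant computed in the coordinates of the basis \<open>e\<close>. With the
  basis as a parameter, each reducible cubic can be treated in coordinates adapted to it, without a
  transformation law.\<close>

definition disc :: "(3 \<Rightarrow> complex^3) \<Rightarrow> coeff_poly"
  where "disc e = det (sylv (\<lambda>i j k. tens_coeff (e i) (e j) (e k)))"

lemma det_hom:
  fixes A :: "'a::comm_ring_1^'n::finite^'n" and h :: "'a \<Rightarrow> 'b::comm_ring_1"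
  assumes "ring_hom1 h"
  shows "h (det A) = det (\<chi> i j. h (A $ i $ j))"
proof -
  note h = ring_hom1D[OF assms]
  have neg: "h (- a) = - h a" for a using h(2)[of a "- a"] h(4) by (simp add: eq_neg_iff_add_eq_0 add.commute)
  have sg: "h (of_int (sign p)) = of_int (sign p)" for p :: "'n \<Rightarrow> 'n"
    by (cases "evenperm p") (simp_all add: sign_def h neg)
  have pr: "h (\<Prod>i\<in>S. A $ i $ p i) = (\<Prod>i\<in>S. h (A $ i $ p i))" for S p
    by (induction S rule: infinite_finite_induct) (auto simp: h)
  have "h (\<Sum>p\<in>S. of_int (sign p) * (\<Prod>i\<in>UNIV. A $ i $ p i))
    = (\<Sum>p\<in>S. of_int (sign p) * (\<Prod>i\<in>UNIV. h (A $ i $ p i)))" for S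
    by (induction S rule: infinite_finite_induct) (auto simp: h sg pr)
  thus ?thesis by (simp add: det_def)
qed

lemma sylv_hom:
  assumes "ring_hom1 h"
  shows "(\<chi> r s. h (sylv T $ r $ s)) = sylv (\<lambda>i j k. h (T i j k))"
proof -
  note h = ring_hom1D[OF assms]
  have neg: "h (- a) = - h a" for a using h(2)[of a "- a"] h(4) by (simp add: eq_neg_iff_add_eq_0 add.commute)
  have dif: "h (a - b) = h a - h b" for a b using h(2)[of a "- b"] by (simp add: neg)
  show ?thesis
    by (simp add: sylv_def vec_eq_iff quad_row_def jac_def cdet_def h dif)
qed

lemma ring_hom1_eval: "ring_hom1 (\<lambda>F. eval F y)"
  by (simp add: ring_hom1_def eval_simps)

lemma eval_disc:
  assumes "homogeneous 3 f"
  shows "eval (disc e) (lk f) = det (sylv (\<lambda>i j k. tens f (e i) (e j) (e k)))"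
  unfolding disc_def det_hom[OF ring_hom1_eval] sylv_hom[OF ring_hom1_eval]
  by (simp add: eval_tens_coeff[OF assms])

lemma homogeneous_prod:
  assumes "\<And>i. i \<in> A \<Longrightarrow> homogeneous (d i) (f i)"
  shows "homogeneous (\<Sum>i\<in>A. d i) (\<Prod>i\<in>A. f i)"
  using assms
proof (induction A rule: infinite_finite_induct)
  case (insert x A) thus ?case by (auto intro: homogeneous_mult)
qed (auto simp: single_one[symmetric] simp del: single_one intro: homogeneous_single)

lemma homogeneous_disc: "\<exists>d. homogeneous d (disc e)"
proof -
  define T where "T i j k = tens_coeff (e i) (e j) (e k)" for i j k
  have T: "homogeneous 1 (T i j k)" for i j k unfolding T_def by (rule homogeneous_tens_coeff)
  have h3: "homogeneous 3 (T i j k * (T a b c * T l m n - T a' b' c' * T l' m' n'))"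
    for i j k a b c l m n a' b' c' l' m' n'
    using homogeneous_mult[OF T[of i j k] homogeneous_diff[OF homogeneous_mult[OF T[of a b c] T[of l m n]] homogeneous_mult[OF T[of a' b' c'] T[of l' m' n']]]]
    by (simp add: numeral_3_eq_3)
  have c: "homogeneous 3 (cdet T i j k)" for i j k unfolding cdet_def
    by (intro homogeneous_add homogeneous_diff h3)
  have "homogeneous (if fst r then 3 else 1) (sylv T $ r $ s)" for r s
    by (auto simp: sylv_def quad_row_def jac_def intro!: homogeneous_add c T[simplified])
  hence p: "homogeneous (\<Sum>r\<in>(UNIV :: (bool \<times> 3) set). if fst r then 3 else 1) (\<Prod>r\<in>UNIV. sylv T $ r $ p r)" for p
    by (intro homogeneous_prod)
  have "homogeneous (\<Sum>r\<in>(UNIV :: (bool \<times> 3) set). if fst r then 3 else 1) (of_int (sign p) * (\<Prod>r\<in>UNIV. sylv T $ r $ p r))" for p :: "bool \<times> 3 \<Rightarrow> bool \<times> 3"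
    using p[of p] by (cases "evenperm p") (auto simp: sign_def intro: homogeneous_uminus)
  hence "homogeneous (\<Sum>r\<in>(UNIV :: (bool \<times> 3) set). if fst r then 3 else 1) (det (sylv T))"
    unfolding det_def by (intro homogeneous_sum)
  thus ?thesis unfolding disc_def T_def by blast
qed

lemma disc_in_ideal:
  assumes e: "br (e 1) (e 2) (e 3) \<noteq> 0"
  shows "disc e \<in> discriminant_ideal"
proof -
  have zero: "eval (disc e) (lk f) = 0" if f: "homogeneous 3 f" and sing: "singular_form f" for f
  proof -
    obtain y where y: "y \<noteq> 0" "grad f y = 0" using singular_formE[OF sing] by blast
    define x :: "complex^3" where "x = vector [br y (e 2) (e 3) / br (e 1) (e 2) (e 3),
      br (e 1) y (e 3) / br (e 1) (e 2) (e 3), br (e 1) (e 2) y / br (e 1) (e 2) (e 3)]"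
    have yx: "y = (x$1) *s e 1 + (x$2) *s e 2 + (x$3) *s e 3"
      unfolding x_def vector_3 by (rule basis_expand[OF e])
    have "(\<Sum>i\<in>UNIV. \<Sum>j\<in>UNIV. tens f (e a) (e i) (e j) * x$i * x$j) = tens f (e a) y y" for a
      unfolding yx by (simp add: sum_3 tens_add2[OF f] tens_add3[OF f] tens_scale2[OF f] tens_scale3[OF f] algebra_simps)
    hence q: "(\<Sum>i\<in>UNIV. \<Sum>j\<in>UNIV. tens f (e a) (e i) (e j) * x$i * x$j) = 0" for a
      using y(2) by (simp add: tens_grad[OF f] dot3_simps)
    have "x \<noteq> 0" using yx y(1) by auto
    from sylv_det_eq_0[OF tens_sym12[OF f] tens_sym23[OF f] q this]
    show ?thesis unfolding eval_disc[OF f] .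
  qed
  have cub: "homogeneous 3 f \<and> singular_form f" if "C \<in> discriminant" "f \<in> C" for C f
  proof -
    from that obtain g h where g: "C = fcl h" "homogeneous 3 h" "g \<in> C" "singular_form g"
      by (auto simp: discriminant_def cubic_space_iff)
    hence "fcl g = fcl h" "fcl f = fcl h" using that fcl_eq_iff by auto
    then obtain c where c: "c \<noteq> 0" "f = cst c * g" using fclE[of f g] fcl_eq_iff[of f g] by auto
    obtain c' where c': "c' \<noteq> 0" "g = cst c' * h" using fclE[of g h] g by auto
    have g3: "homogeneous 3 g" unfolding c' by (intro homogeneous_cst_mult g)
    obtain y where "y \<noteq> 0" "ev g y = 0" "grad g y = 0" using singular_formE[OF g(4)] by blast
    hence "singular_form f" unfolding c
      by (intro singular_formI[of _ y] homogeneous_cst_mult g3) (simp_all add: grad_simps)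
    thus ?thesis unfolding c by (auto intro: homogeneous_cst_mult g3)
  qed
  have "eval (disc e) (lk f) = 0" if "C \<in> discriminant" "f \<in> C" for C f
    using zero cub[OF that] by simp
  thus ?thesis using homogeneous_disc[of e] by (simp add: discriminant_ideal_def)
qed

section \<open>Multiplicities of the discriminant at reducible cubics\<close>

lemma order_ge:
  assumes "p \<noteq> 0" "\<And>j. j < n \<Longrightarrow> coeff p j = 0"
  shows "n \<le> order 0 (p :: complex poly)"
proof -
  have "Polynomial.monom 1 n dvd p" using assms(2) by (simp add: monom_1_dvd_iff')
  hence "[:- 0, 1:] ^ n dvd p" by (simp add: monom_altdef)
  thus ?thesis using assms(1) order_divides by blast
qed

lemma order_le:
  assumes "coeff (p :: complex poly) n \<noteq> 0" shows "order 0 p \<le> n"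
proof (rule ccontr)
  assume "\<not> order 0 p \<le> n"
  moreover have "Polynomial.monom 1 (order 0 p) dvd p" using order_1[of 0 p] by (simp add: monom_altdef)
  ultimately show False using assms by (simp add: monom_1_dvd_iff')
qed

lemma line_intersection_mult_ge:
  assumes "\<And>F. F \<in> discriminant_ideal \<Longrightarrow> vanish_upto n F f" "homogeneous 3 g"
  shows "line_intersection_mult f g \<ge> enat n"
  unfolding line_intersection_mult_def
  by (rule INF_greatest) (use assms in \<open>auto intro!: order_ge simp: vanish_upto_def\<close>)

text \<open>Homogeneity of \<open>F\<close> trades a factor of \<open>f\<close> for one of the
  direction \<open>g\<close>, so the condition depends only on the projective point.\<close>

lemma vanish_upto_scale:
  assumes v: "vanish_upto n F f" and c: "c \<noteq> 0" and F: "homogeneous d F"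
  shows "vanish_upto n F (cst c * f)"
  unfolding vanish_upto_def
proof (intro allI impI)
  fix g :: form and j assume g: "homogeneous 3 g" "j < n"
  have "poly (Rl F (cst c * f) g) t = poly (Polynomial.smult (c ^ d) (Rl F f (cst (1 / c) * g))) t" for t
  proof -
    have e: "lk (cst c * f + cst t * g) = (\<lambda>m. c * lk (f + cst t * (cst (1 / c) * g)) m)"
      by (intro ext) (simp only: lookup_add lk_cst_mult, use c in \<open>simp add: field_simps\<close>)
    show ?thesis unfolding poly_smult poly_Rl e eval_scale[OF F] ..
  qed
  hence "Rl F (cst c * f) g = Polynomial.smult (c ^ d) (Rl F f (cst (1 / c) * g))"
    by (metis poly_eq_poly_eq_iff ext)
  thus "coeff (Rl F (cst c * f) g) j = 0"
    using v g homogeneous_cst_mult[OF g(1)] by (simp add: vanish_upto_def)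
qed

section \<open>Cubics of Hesse type and exact multiplicities\<close>

definition dual :: "(3 \<Rightarrow> complex^3) \<Rightarrow> 3 \<Rightarrow> complex^3"
  where "dual e i = (1 / br (e 1) (e 2) (e 3)) *s crs (e (i + 1)) (e (i + 2))"

lemma dual_dot:
  assumes "br (e 1) (e 2) (e 3) \<noteq> 0"
  shows "dual e i \<odot> e j = (if i = j then 1 else 0)"
  using assms exhaust_3[of i] exhaust_3[of j]
    br_rot(1)[of "e 1" "e 2" "e 3"] br_rot(2)[of "e 1" "e 2" "e 3"]
  by (elim disjE) (simp_all add: dual_def dot3_simps br_def[symmetric])

text \<open>The cubic \<open>x y z + s1 x^3 + s2 y^3 + s3 z^3\<close> in the coordinates of
  \<open>e\<close>. The family contains the triangle, for parameters 0, 0, 0, and a conic with a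
  secant line \<open>z (x y + z^2)\<close>, for parameters 0, 0, 1; its discriminant is
  explicit.\<close>

definition hesse :: "(3 \<Rightarrow> complex^3) \<Rightarrow> complex \<Rightarrow> complex \<Rightarrow> complex \<Rightarrow> form"
  where "hesse e s1 s2 s3 = lin (dual e 1) * (lin (dual e 2) * lin (dual e 3))
    + cst s1 * (lin (dual e 1) * (lin (dual e 1) * lin (dual e 1)))
    + cst s2 * (lin (dual e 2) * (lin (dual e 2) * lin (dual e 2)))
    + cst s3 * (lin (dual e 3) * (lin (dual e 3) * lin (dual e 3)))"

lemma homogeneous_hesse: "homogeneous 3 (hesse e s1 s2 s3)"
  unfolding hesse_def by (intro homogeneous_add homogeneous_cst_mult homogeneous_lin3)

lemma eval_disc_hesse:
  assumes e: "br (e 1) (e 2) (e 3) \<noteq> 0"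
  shows "eval (disc e) (lk (hesse e s1 s2 s3)) = - (s1 * s2 * s3 * (1/27 + s1 * s2 * s3)^3)"
proof -
  have n: "(1::3) \<noteq> 2" "(1::3) \<noteq> 3" "(2::3) \<noteq> 3" by simp_all
  define s where "s i = (if i = 1 then s1 else if i = 2 then s2 else s3)" for i :: 3
  have v: "ev (hesse e s1 s2 s3) x = (dual e 1 \<odot> x) * (dual e 2 \<odot> x) * (dual e 3 \<odot> x)
      + s 1 * (dual e 1 \<odot> x)^3 + s 2 * (dual e 2 \<odot> x)^3 + s 3 * (dual e 3 \<odot> x)^3" for x
    by (simp add: hesse_def s_def n power3_eq_cube mult.assoc)
  have d: "dual e 1 \<odot> e 1 = 1" "dual e 1 \<odot> e 2 = 0" "dual e 1 \<odot> e 3 = 0"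
    "dual e 2 \<odot> e 1 = 0" "dual e 2 \<odot> e 2 = 1" "dual e 2 \<odot> e 3 = 0"
    "dual e 3 \<odot> e 1 = 0" "dual e 3 \<odot> e 2 = 0" "dual e 3 \<odot> e 3 = 1"
    by (simp_all add: dual_dot[OF e] n)
  have "tens (hesse e s1 s2 s3) (e i) (e j) (e k)
    = (if i \<noteq> j \<and> j \<noteq> k \<and> i \<noteq> k then 1/6 else if i = j \<and> j = k then s i else 0)" for i j k
    unfolding tens_polar[OF homogeneous_hesse] v dot3_simps
    using exhaust_3[of i] exhaust_3[of j] exhaust_3[of k]
    by (elim disjE) (simp_all add: d n)
  from det_sylv_hesse[OF this] show ?thesis
    unfolding eval_disc[OF homogeneous_hesse] using n by (simp add: s_def)
qed

lemma hesse_line: "hesse e a b c + cst t * (hesse e a' b' c' - hesse e 0 0 0) = hesse e (a + t * a') (b + t * b') (c + t * c')"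
  by (rule form_eqI) (simp add: hesse_def algebra_simps)

text \<open>Ensures that the \<open>LEAST\<close> in \<open>mult_discriminant\<close> is taken over
  a nonempty set. The second point is the cubic \<open>hesse e 1 1 1\<close>, at which
  \<open>disc e\<close> does not vanish.\<close>

lemma finite_intersection_exists:
  assumes f: "homogeneous 3 f" "f \<noteq> 0" and v: "\<And>F. F \<in> discriminant_ideal \<Longrightarrow> vanish_upto (Suc n) F f"
  obtains g k where "homogeneous 3 g" "g \<noteq> 0" "fcl g \<noteq> fcl f" "line_intersection_mult f g = enat k"
proof -
  define e :: "3 \<Rightarrow> complex^3" where "e i = axis i 1" for i
  have e: "br (e 1) (e 2) (e 3) \<noteq> 0" by (simp add: e_def coord_simps axis_def)
  define g where "g = hesse e 1 1 1"
  have g: "homogeneous 3 g" unfolding g_def by (rule homogeneous_hesse)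
  have F: "disc e \<in> discriminant_ideal" by (rule disc_in_ideal[OF e])
  obtain d where d: "homogeneous d (disc e)" using homogeneous_disc by blast
  have gn: "eval (disc e) (lk g) \<noteq> 0" unfolding g_def eval_disc_hesse[OF e] by simp
  have f0: "eval (disc e) (lk f) = 0" using v[OF F] g unfolding vanish_upto_def coeff_Rl_0[symmetric, of _ f g] by blast
  have sc: "eval (disc e) (lk (cst c * h)) = c ^ d * eval (disc e) (lk h)" for c h
  proof -
    have "lk (cst c * h) = (\<lambda>m. c * lk h m)" by (rule ext) (simp add: lk_cst_mult)
    thus ?thesis using eval_scale[OF d] by simp
  qed
  have g0: "g \<noteq> 0"
  proof
    assume "g = 0"
    hence "g = cst 0 * f" by simp
    hence "eval (disc e) (lk g) = 0 ^ d * eval (disc e) (lk f)" by (simp only: sc)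
    thus False using gn f0 by simp
  qed
  have ne: "fcl g \<noteq> fcl f"
  proof
    assume "fcl g = fcl f"
    then obtain c where "g = cst c * f" using fclE fcl_eq_iff by metis
    thus False using gn f0 by (simp add: sc)
  qed
  have "Rl (disc e) f g \<noteq> 0"
  proof
    assume z: "Rl (disc e) f g = 0"
    \<comment> \<open>By homogeneity, vanishing at all \<open>f + t g\<close> gives vanishing at
      \<open>g + s f\<close> for nonzero \<open>s\<close>, and then at \<open>g\<close>
      itself.\<close>
    have pf: "polyfun (\<lambda>s. eval (disc e) (lk (g + cst s * f)))"
      by (intro polyfun_eval) (auto simp: lookup_add lk_cst_mult)
    have "eval (disc e) (lk (g + cst 0 * f)) = 0"
    proof (rule polyfun_zero[OF pf, of "\<lambda>s. s" 1])
      fix s :: complex assume s: "s \<noteq> 0"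
      have "g + cst s * f = cst s * (f + cst (1 / s) * g)"
        using s by (intro form_eqI) (simp add: field_simps)
      hence "eval (disc e) (lk (g + cst s * f)) = s ^ d * poly (Rl (disc e) f g) (1 / s)"
        by (simp only: sc poly_Rl)
      thus "eval (disc e) (lk (g + cst s * f)) = 0" using z by simp
    qed auto
    thus False using gn by simp
  qed
  hence "line_intersection_mult f g \<le> enat (order 0 (Rl (disc e) f g))"
    unfolding line_intersection_mult_def using F by (intro INF_lower) auto
  then obtain k where "line_intersection_mult f g = enat k" by (metis enat_ile)
  thus ?thesis using that g g0 ne by blast
qed

lemma mult_discriminant_ge:
  assumes f: "homogeneous 3 f" "f \<noteq> 0" and v: "\<And>F. F \<in> discriminant_ideal \<Longrightarrow> vanish_upto (Suc n) F f"
  shows "mult_discriminant (fcl f) \<ge> Suc n"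
proof -
  obtain g k where g: "homogeneous 3 g" "g \<noteq> 0" "fcl g \<noteq> fcl f" "line_intersection_mult f g = enat k"
    using finite_intersection_exists[OF assms] by blast
  have ex: "\<exists>k. \<exists>f'\<in>fcl f. \<exists>C'\<in>cubic_space - {fcl f}. \<exists>g\<in>C'. line_intersection_mult f' g = enat k"
    using g self_in_fcl fcl_in_cubic_space_iff by blast
  have "Suc n \<le> k" if k: "\<exists>f'\<in>fcl f. \<exists>C'\<in>cubic_space - {fcl f}. \<exists>g\<in>C'. line_intersection_mult f' g = enat k" for k
  proof -
    from k obtain f' C' g' where k': "f' \<in> fcl f" "C' \<in> cubic_space" "g' \<in> C'" "line_intersection_mult f' g' = enat k" by blast
    obtain c where c: "c \<noteq> 0" "f' = cst c * f" using fclE[OF k'(1)] by blast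
    have "homogeneous 3 g'" using k'(2,3) by (auto simp: cubic_space_iff elim!: fclE intro: homogeneous_cst_mult)
    moreover have "vanish_upto (Suc n) F f'" if "F \<in> discriminant_ideal" for F
      using vanish_upto_scale[OF v[OF that] c(1)] that c(2) by (auto simp: discriminant_ideal_def)
    ultimately have "enat (Suc n) \<le> enat k" using line_intersection_mult_ge k'(4) by metis
    thus ?thesis by simp
  qed
  thus ?thesis unfolding mult_discriminant_def using LeastI_ex[OF ex] by blast
qed

text \<open>On a pencil of Hesse type whose three parameters multiply to \<open>t^(n+1)\<close>, the
  discriminant is \<open>- t^(n+1) (1/27 + t^(n+1))^3\<close>, of order exactly \<open>n + 1\<close>
  at 0. The values at \<open>e 1\<close> separate \<open>g\<close> from \<open>f\<close>, because
  \<open>a = 0\<close> and \<open>a'\<close> is nonzero.\<close>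

lemma mult_discriminant_le:
  assumes e: "br (e 1) (e 2) (e 3) \<noteq> 0" and f: "f = hesse e a b c" and a: "a = 0"
    and n: "\<And>t. (a + t * a') * (b + t * b') * (c + t * c') = t ^ Suc n" and a': "a' \<noteq> 0"
    and v: "\<And>F. F \<in> discriminant_ideal \<Longrightarrow> vanish_upto (Suc n) F f"
  shows "mult_discriminant (fcl f) \<le> Suc n"
proof -
  define g where "g = hesse e a' b' c' - hesse e 0 0 0"
  have g: "homogeneous 3 g" unfolding g_def by (intro homogeneous_diff homogeneous_hesse)
  have eg: "ev g (e 1) = a'" by (simp add: g_def hesse_def dual_dot[OF e])
  have ef: "ev f (e 1) = 0" by (simp add: f a hesse_def dual_dot[OF e])
  have g0: "g \<noteq> 0" using eg a' by auto
  have ne: "fcl g \<noteq> fcl f"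
  proof
    assume "fcl g = fcl f"
    then obtain c where "g = cst c * f" using fclE fcl_eq_iff by metis
    thus False using eg ef a' by simp
  qed
  define p where "p = - (Polynomial.monom 1 (Suc n) * ([:1/27:] + Polynomial.monom 1 (Suc n)) ^ 3 :: complex poly)"
  have "poly (Rl (disc e) f g) t = poly p t" for t
    unfolding poly_Rl f g_def hesse_line eval_disc_hesse[OF e] n p_def by (simp add: poly_monom)
  hence Rp: "Rl (disc e) f g = p" by (metis poly_eq_poly_eq_iff ext)
  have "coeff p (Suc n) = - coeff (([:1/27:] + Polynomial.monom 1 (Suc n)) ^ 3) 0"
    by (simp add: p_def coeff_monom_mult)
  also have "\<dots> = - ((1/27)^3)" by (simp add: poly_0_coeff_0[symmetric] poly_monom)
  finally have cp: "coeff p (Suc n) \<noteq> 0" by simp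
  hence "p \<noteq> 0" by auto
  hence "line_intersection_mult f g \<le> enat (order 0 (Rl (disc e) f g))"
    unfolding line_intersection_mult_def using disc_in_ideal[OF e] Rp by (intro INF_lower) auto
  also have "\<dots> \<le> enat (Suc n)" unfolding Rp using order_le[OF cp] by simp
  finally have "line_intersection_mult f g = enat (Suc n)"
    using line_intersection_mult_ge[of "Suc n" f g, OF v g] by simp
  thus ?thesis unfolding mult_discriminant_def
    using ne g g0 self_in_fcl fcl_in_cubic_space_iff by (intro Least_le) blast
qed

lemma mult_line_quad_ge:
  assumes "a \<noteq> 0" "homogeneous 2 q" "q \<noteq> 0" shows "mult_discriminant (fcl (lin a * q)) \<ge> 2"
  using mult_discriminant_ge[of "lin a * q" 1] assms vanish_upto_line_quad
  by (simp add: homogeneous_lin_quad numeral_2_eq_2)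

lemma mult_three_lines_ge:
  assumes "a \<noteq> 0" "b \<noteq> 0" "c \<noteq> 0" shows "mult_discriminant (fcl (lin a * (lin b * lin c))) \<ge> 3"
proof -
  have "Suc 2 \<le> mult_discriminant (fcl (lin a * (lin b * lin c)))"
    by (rule mult_discriminant_ge[OF homogeneous_lin3])
       (use assms vanish_upto_three_lines in \<open>simp_all add: numeral_3_eq_3 numeral_2_eq_2\<close>)
  thus ?thesis by simp
qed

lemma mult_triangle:
  assumes n: "br a b c \<noteq> 0" shows "mult_discriminant (fcl (lin a * (lin b * lin c))) = 3"
proof -
  define e :: "3 \<Rightarrow> complex^3" where "e i = (if i = 1 then crs b c else if i = 2 then crs c a else crs a b)" for i
  have be: "br (e 1) (e 2) (e 3) = (br a b c)^2"
    by (simp add: e_def coord_simps algebra_simps power2_eq_square)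
  hence e: "br (e 1) (e 2) (e 3) \<noteq> 0" using n by simp
  have "dual e 1 = (1 / br a b c) *s a" "dual e 2 = (1 / br a b c) *s b" "dual e 3 = (1 / br a b c) *s c"
  proof -
    have "crs (e 2) (e 3) = br a b c *s a" "crs (e 3) (e 1) = br a b c *s b" "crs (e 1) (e 2) = br a b c *s c"
      by (simp_all add: e_def coord_simps algebra_simps)
    thus "dual e 1 = (1 / br a b c) *s a" "dual e 2 = (1 / br a b c) *s b" "dual e 3 = (1 / br a b c) *s c"
      using n by (simp_all add: dual_def be vec_scale_assoc power2_eq_square)
  qed
  hence f: "cst (1 / (br a b c)^3) * (lin a * (lin b * lin c)) = hesse e 0 0 0"
    by (intro form_eqI) (simp add: hesse_def dot3_simps power3_eq_cube)
  have nz: "a \<noteq> 0" "b \<noteq> 0" "c \<noteq> 0" using n by (auto simp: coord_simps)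
  have "mult_discriminant (fcl (hesse e 0 0 0)) \<le> Suc 2"
  \<comment> \<open>The pencil \<open>x y z + t (x^3 + y^3 + z^3)\<close>, whose parameters multiply
    to \<open>t^3\<close>.\<close>
  proof (rule mult_discriminant_le[OF e refl refl, of 1 0 1 0 1])
    fix F assume "F \<in> discriminant_ideal"
    thus "vanish_upto (Suc 2) F (hesse e 0 0 0)"
      using vanish_upto_three_lines[of F "dual e 1" "dual e 2" "dual e 3"]
      by (simp add: hesse_def numeral_3_eq_3 numeral_2_eq_2)
  qed (simp_all add: power_Suc numeral_2_eq_2)
  moreover have "fcl (hesse e 0 0 0) = fcl (lin a * (lin b * lin c))"
    unfolding f[symmetric] using n by (intro fcl_scale) simp
  ultimately show ?thesis using mult_three_lines_ge[OF nz] by simp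
qed

text \<open>In the coordinates given by two points of a conic and the intersection of their tangents, the
  conic is \<open>z\<^sup>2 = const x y\<close>.\<close>

lemma conic_normal_form:
  assumes q: "homogeneous 2 q" "irreducible q"
    and p: "crs p1 p2 \<noteq> 0" "ev q p1 = 0" "ev q p2 = 0" "bil q p1 p2 \<noteq> 0"
  obtains w where "br p1 p2 w \<noteq> 0" "ev q w \<noteq> 0"
    "\<And>x y z. ev q (x *s p1 + y *s p2 + z *s w) = z^2 * ev q w + 2 * x * y * bil q p1 p2"
proof -
  define w where "w = crs (grad q p1) (grad q p2)"
  have b1: "bil q p1 w = 0" "bil q p2 w = 0"
    using grad_quad[OF q(1), of p1 w] grad_quad[OF q(1), of p2 w] crs_dot[of "grad q p1" "grad q p2"]
    by (simp_all add: w_def dot3_commute)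
  have wnz: "w \<noteq> 0"
  proof
    assume "w = 0"
    have "grad q p1 \<noteq> 0" using grad_quad[OF q(1), of p1 p2] p(4) by (auto simp: dot3_simps)
    then obtain k where k: "grad q p2 = k *s grad q p1" using crs_eq_0E \<open>w = 0\<close> unfolding w_def by metis
    have "grad q p2 \<odot> p2 = 0" using grad_quad[OF q(1), of p2 p2] p(3) by (simp add: bil_diag[OF q(1)])
    hence "k = 0" using grad_quad[OF q(1), of p1 p2] p(4) by (simp add: k dot3_simps)
    hence "grad q p2 \<odot> p1 = 0" using k by (simp add: dot3_simps)
    thus False using grad_quad[OF q(1), of p2 p1] p(4) bil_commute[OF q(1), of p1 p2] by simp
  qed
  have bw: "br p1 p2 w \<noteq> 0"
  proof
    assume "br p1 p2 w = 0"
    then obtain s t where w: "w = s *s p1 + t *s p2" using span_indep[OF p(1)] by blast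
    have "t = 0" using b1(1) p unfolding w by (simp add: bil_simps q bil_diag[OF q(1)])
    moreover have "s = 0" using b1(2) p bil_commute[OF q(1), of p1 p2] unfolding w by (simp add: bil_simps q bil_diag[OF q(1)])
    ultimately show False using wnz w by simp
  qed
  define B where "B = bil q p1 p2"
  have ex: "ev q (x *s p1 + y *s p2 + z *s w) = z^2 * ev q w + 2 * x * y * B" for x y z
    unfolding ev_quad_expand(2)[OF q(1)] using p b1 by (simp add: B_def)
  have coo: "x = (br x p2 w / br p1 p2 w) *s p1 + (br p1 x w / br p1 p2 w) *s p2 + (br p1 p2 x / br p1 p2 w) *s w" for x
    by (rule basis_expand[OF bw])
  have qw: "ev q w \<noteq> 0"
  proof
    assume z: "ev q w = 0"
    have "ev q x = ev (lin (crs p2 w) * lin ((2 * B / (br p1 p2 w)^2) *s crs w p1)) x" for x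
    proof -
      have "ev q x = 2 * (br x p2 w / br p1 p2 w) * (br p1 x w / br p1 p2 w) * B"
        using arg_cong[OF coo[of x], of "ev q"] unfolding ex z by simp
      thus ?thesis using br_rot(1)[of x p2 w] br_rot(2)[of p1 x w]
        by (simp add: dot3_simps br_def[symmetric] power2_eq_square)
    qed
    hence "q = lin (crs p2 w) * lin ((2 * B / (br p1 p2 w)^2) *s crs w p1)" by (rule form_eqI)
    thus False using irreducible_quadD[OF q(2)] by blast
  qed
  show ?thesis by (rule that[OF bw qw]) (simp add: ex B_def)
qed

lemma mult_line_conic_secant:
  assumes q: "homogeneous 2 q" "irreducible q" and a: "a \<noteq> 0" "a \<odot> u = 0" "a \<odot> v = 0"
    and i: "crs u v \<noteq> 0" and D: "(bil q u v)^2 \<noteq> ev q u * ev q v"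
  shows "mult_discriminant (fcl (lin a * q)) = 2"
proof -
  obtain p1 p2 where p: "crs p1 p2 \<noteq> 0" "ev q p1 = 0" "ev q p2 = 0" "bil q p1 p2 \<noteq> 0"
      "\<And>a. a \<odot> u = 0 \<Longrightarrow> a \<odot> v = 0 \<Longrightarrow> a \<odot> p1 = 0 \<and> a \<odot> p2 = 0"
    using secant_points[OF q(1) i D] by blast
  have ap: "a \<odot> p1 = 0" "a \<odot> p2 = 0" using p(5) a by blast+
  obtain w where bw: "br p1 p2 w \<noteq> 0" and qw: "ev q w \<noteq> 0"
    and ex0: "\<And>x y z. ev q (x *s p1 + y *s p2 + z *s w) = z^2 * ev q w + 2 * x * y * bil q p1 p2"
    using conic_normal_form[OF q p(1-4)] by blast
  define B where "B = bil q p1 p2"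
  have ex: "ev q (x *s p1 + y *s p2 + z *s w) = z^2 * ev q w + 2 * x * y * B" for x y z
    unfolding B_def by (rule ex0)
  have aw: "a \<odot> w \<noteq> 0" using orth_br_eq_0[OF a(1) ap] bw by blast
  \<comment> \<open>Rescaling \<open>p1\<close> by \<open>k\<close> turns the conic into
    \<open>ev q w\<close> times \<open>z^2 + x y\<close>; together with the line, a multiple of
    \<open>z\<close>, it becomes a multiple of \<open>hesse e 0 0 1\<close>.\<close>
  define k where "k = ev q w / (2 * B)"
  have kB: "2 * k * B = ev q w" and k0: "k \<noteq> 0" using p(4) qw by (simp_all add: k_def B_def)
  define e where "e i = (if i = 1 then k *s p1 else if i = 2 then p2 else w)" for i :: 3
  have be: "br (e 1) (e 2) (e 3) = k * br p1 p2 w"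
    by (simp add: e_def coord_simps algebra_simps)
  hence e: "br (e 1) (e 2) (e 3) \<noteq> 0" using k0 bw by simp
  define K where "K = (a \<odot> w) * ev q w"
  have K: "K \<noteq> 0" using aw qw by (simp add: K_def)
  have f: "lin a * q = cst K * hesse e 0 0 1"
  proof (rule form_eqI)
    fix x
    define x1 x2 x3 where "x1 = dual e 1 \<odot> x" and "x2 = dual e 2 \<odot> x" and "x3 = dual e 3 \<odot> x"
    have xs: "x = x1 *s e 1 + x2 *s e 2 + x3 *s e 3"
      unfolding x1_def x2_def x3_def
      using basis_expand[OF e, of x] br_rot(1)[of x "e 2" "e 3"] br_rot(2)[of "e 1" x "e 3"]
      by (simp add: dual_def dot3_simps br_def[symmetric])
    have "x = (x1 * k) *s p1 + x2 *s p2 + x3 *s w"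
      unfolding xs by (simp add: e_def vec_scale_assoc)
    hence e: "ev q x = x3^2 * ev q w + 2 * (x1 * k) * x2 * B" "a \<odot> x = x3 * (a \<odot> w)"
      using ex[of "x1 * k" x2 x3] ap by (simp_all add: dot3_simps)
    have m: "2 * (x1 * k) * x2 * B = x1 * x2 * ev q w" unfolding kB[symmetric] by (simp add: mult_ac)
    show "ev (lin a * q) x = ev (cst K * hesse e 0 0 1) x"
      unfolding ev_simps ev_lin e m hesse_def K_def x1_def[symmetric] x2_def[symmetric] x3_def[symmetric]
      by (simp add: power2_eq_square algebra_simps)
  qed
  have "mult_discriminant (fcl (hesse e 0 0 1)) \<le> Suc 1"
  \<comment> \<open>The pencil \<open>z (x y + z^2) + t (x^3 + y^3)\<close>, whose parameters
    multiply to \<open>t^2\<close>.\<close>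
  proof (rule mult_discriminant_le[OF e refl refl, of 1 0 1 1 0])
    fix F assume F: "F \<in> discriminant_ideal"
    have "cst (1 / K) * (lin a * q) = hesse e 0 0 1" unfolding f using K
      by (intro form_eqI) simp
    thus "vanish_upto (Suc 1) F (hesse e 0 0 1)"
      using vanish_upto_scale[OF vanish_upto_line_quad[OF F q(1) a(1)], of "1 / K"] K F
      by (auto simp: discriminant_ideal_def numeral_2_eq_2)
  qed (simp_all add: power2_eq_square)
  moreover have "fcl (lin a * q) = fcl (hesse e 0 0 1)" unfolding f by (rule fcl_scale[OF K])
  moreover have "q \<noteq> 0" using q(2) by auto
  ultimately show ?thesis using mult_line_quad_ge[OF a(1) q(1)] by simp
qed

section \<open>Reducible cubics through a configuration\<close>

lemma realizations_pcl_iff: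
  assumes "\<And>i. v i \<noteq> 0"
  shows "(\<lambda>i. pcl (v i)) \<in> realizations (I, J) \<longleftrightarrow> (\<forall>i j. i \<noteq> j \<longrightarrow> crs (v i) (v j) \<noteq> 0) \<and>
    (\<forall>T. T \<in> I \<longleftrightarrow> card T = 3 \<and> (\<exists>a. a \<noteq> 0 \<and> (\<forall>i\<in>T. a \<odot> v i = 0))) \<and>
    (\<forall>S. S \<in> J \<longleftrightarrow> card S = 6 \<and> (\<exists>q. is_conic q \<and> (\<forall>i\<in>S. ev q (v i) = 0)))"
proof -
  have l: "(\<exists>f. is_line f \<and> (\<forall>i\<in>T. vanishes_at f (pcl (v i)))) \<longleftrightarrow> (\<exists>a. a \<noteq> 0 \<and> (\<forall>i\<in>T. a \<odot> v i = 0))" for T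
  proof
    assume "\<exists>f. is_line f \<and> (\<forall>i\<in>T. vanishes_at f (pcl (v i)))"
    then obtain f where f: "homogeneous 1 f" "f \<noteq> 0" "\<And>i. i \<in> T \<Longrightarrow> vanishes_at f (pcl (v i))"
      by (auto simp: is_line_def)
    obtain a where a: "f = lin a" using homogeneous_1E f(1) by blast
    hence "a \<noteq> 0" using f(2) by auto
    moreover have "\<forall>i\<in>T. a \<odot> v i = 0" using f(3) vanishes_at_pcl[OF f(1)] by (simp add: a)
    ultimately show "\<exists>a. a \<noteq> 0 \<and> (\<forall>i\<in>T. a \<odot> v i = 0)" by blast
  next
    assume "\<exists>a. a \<noteq> 0 \<and> (\<forall>i\<in>T. a \<odot> v i = 0)"
    then obtain a where a: "a \<noteq> 0" "\<forall>i\<in>T. a \<odot> v i = 0" by blast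
    thus "\<exists>f. is_line f \<and> (\<forall>i\<in>T. vanishes_at f (pcl (v i)))"
      by (intro exI[of _ "lin a"]) (simp add: is_line_def vanishes_at_pcl[OF homogeneous_lin] del: One_nat_def)
  qed
  have c: "(\<exists>f. is_conic f \<and> (\<forall>i\<in>S. vanishes_at f (pcl (v i)))) \<longleftrightarrow> (\<exists>q. is_conic q \<and> (\<forall>i\<in>S. ev q (v i) = 0))" for S
  proof -
    have "is_conic f \<and> (\<forall>i\<in>S. vanishes_at f (pcl (v i))) \<longleftrightarrow> is_conic f \<and> (\<forall>i\<in>S. ev f (v i) = 0)" for f
      using vanishes_at_pcl[of 2 f] by (auto simp: is_conic_def)
    thus ?thesis by simp
  qed
  have "(\<lambda>i. pcl (v i)) \<in> realizations (I, J) \<longleftrightarrow> (\<lambda>i. pcl (v i)) \<in> configs \<and>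
    I = {T. card T = 3 \<and> (\<exists>a. a \<noteq> 0 \<and> (\<forall>i\<in>T. a \<odot> v i = 0))} \<and>
    J = {S. card S = 6 \<and> (\<exists>q. is_conic q \<and> (\<forall>i\<in>S. ev q (v i) = 0))}"
    unfolding realizations_def mem_Collect_eq l c fst_conv snd_conv ..
  thus ?thesis unfolding configs_pcl_iff[OF assms] set_eq_iff mem_Collect_eq .
qed

text \<open>The cubics \<open>C\<^sub>T\<close> and \<open>C\<^sub>T\<^sub>'\<close> built on two collinear triples (see below) coincide iff \<open>T'\<close> is in
  \<open>cubic_class I T\<close>; the triples outside \<open>own_triples I J\<close> give cubics that already come from a
  conic through six points.\<close>

definition cubic_class :: "8 set set \<Rightarrow> 8 set \<Rightarrow> 8 set set"
  where "cubic_class I T = {T' \<in> I. T' = T \<or> T \<inter> T' = {} \<or> - (T \<union> T') \<in> I}"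

definition own_triples :: "8 set set \<Rightarrow> 8 set set \<Rightarrow> 8 set set"
  where "own_triples I J = {T \<in> I. \<forall>S\<in>J. T \<union> S \<noteq> UNIV}"

text \<open>The sum of the multiplicities when no tangency or concurrence occurs. A class with one
  triple is a line and an irreducible conic; a larger class is a cubic made of three lines.\<close>

definition generic_m :: "8 set set \<Rightarrow> 8 set set \<Rightarrow> nat"
  where "generic_m I J = 2 * card J + (\<Sum>K\<in>cubic_class I ` own_triples I J. if card K = 1 then 2 else 3)"

lemma card_Compl8: "card (- (A :: 8 set)) = 8 - card A"
  by (simp add: Compl_eq_Diff_UNIV card_Diff_subset)

lemma two_of_card: "card A \<ge> 2 \<Longrightarrow> \<exists>i\<in>A. \<exists>j\<in>A. i \<noteq> j"
proof (rule ccontr)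
  assume "2 \<le> card A" and n: "\<not> (\<exists>i\<in>A. \<exists>j\<in>A. i \<noteq> j)"
  then obtain i where "i \<in> A" by fastforce
  hence "A \<subseteq> {i}" using n by blast
  hence "card A \<le> 1" using card_mono[of "{i}" A] by simp
  thus False using \<open>2 \<le> card A\<close> by simp
qed

section \<open>Lines and conics through the points of a Bezoutian configuration\<close>

locale bezout_config =
  fixes v :: "8 \<Rightarrow> complex^3" and I J :: "8 set set"
  assumes indep: "i \<noteq> j \<Longrightarrow> crs (v i) (v j) \<noteq> 0"
    and I_iff: "T \<in> I \<longleftrightarrow> card T = 3 \<and> (\<exists>a. a \<noteq> 0 \<and> (\<forall>i\<in>T. a \<odot> v i = 0))"
    and J_iff: "S \<in> J \<longleftrightarrow> card S = 6 \<and> (\<exists>q. is_conic q \<and> (\<forall>i\<in>S. ev q (v i) = 0))"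
    and bezI: "T \<in> I \<Longrightarrow> T' \<in> I \<Longrightarrow> T \<noteq> T' \<Longrightarrow> card (T \<inter> T') \<le> 1"
    and bezJ: "S \<in> J \<Longrightarrow> S' \<in> J \<Longrightarrow> S \<noteq> S' \<Longrightarrow> card (S \<inter> S') \<le> 4"
begin

definition on_line :: "complex^3 \<Rightarrow> 8 set" where "on_line a = {i. a \<odot> v i = 0}"
definition on_curve :: "form \<Rightarrow> 8 set" where "on_curve q = {i. ev q (v i) = 0}"

lemma v_nz: "v i \<noteq> 0"
  using indep[of i "i + 1"] by (auto simp: coord_simps)

lemma cardI: "T \<in> I \<Longrightarrow> card T = 3" using I_iff by blast
lemma cardJ: "S \<in> J \<Longrightarrow> card S = 6" using J_iff by blast

text \<open>Four points on a line would contain two different collinear triples with two common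
  points.\<close>

lemma on_line_card: assumes "a \<noteq> 0" shows "card (on_line a) \<le> 3"
proof (rule ccontr)
  assume "\<not> card (on_line a) \<le> 3"
  then obtain U where U: "U \<subseteq> on_line a" "card U = 4" using obtain_subset_with_card_n[of 4 "on_line a"] by auto
  obtain x y where xy: "x \<in> U" "y \<in> U" "x \<noteq> y" using two_of_card[of U] U by auto
  have sub: "U - {z} \<in> I" if "z \<in> U" for z
    unfolding I_iff using U assms that by (auto simp: on_line_def)
  have "U - {x} \<noteq> U - {y}" using xy by blast
  from bezI[OF sub[OF xy(1)] sub[OF xy(2)] this] have "card (U - {x, y}) \<le> 1"
    by (metis Diff_insert Int_Diff Int_absorb Diff_Int_distrib2 Diff_Int2 Diff_insert2)
  moreover have "card (U - {x, y}) = 2" using xy U by (simp add: card_Diff_subset)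
  ultimately show False by simp
qed

lemma on_curve_card: assumes "is_conic q" shows "card (on_curve q) \<le> 6"
proof (rule ccontr)
  assume "\<not> card (on_curve q) \<le> 6"
  then obtain U where U: "U \<subseteq> on_curve q" "card U = 7" using obtain_subset_with_card_n[of 7 "on_curve q"] by auto
  obtain x y where xy: "x \<in> U" "y \<in> U" "x \<noteq> y" using two_of_card[of U] U by auto
  have sub: "U - {z} \<in> J" if "z \<in> U" for z
    unfolding J_iff using U assms that by (auto simp: on_curve_def)
  have "U - {x} \<noteq> U - {y}" using xy by blast
  from bezJ[OF sub[OF xy(1)] sub[OF xy(2)] this] have "card ((U - {x}) \<inter> (U - {y})) \<le> 4" .
  moreover have "(U - {x}) \<inter> (U - {y}) = U - {x, y}" by blast
  moreover have "card (U - {x, y}) = 5" using xy U by (simp add: card_Diff_subset)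
  ultimately show False by simp
qed

lemma on_line_subset: assumes "T \<in> I" "a \<noteq> 0" "T \<subseteq> on_line a" shows "on_line a = T"
  using card_seteq[of "on_line a" T] on_line_card[OF assms(2)] cardI[OF assms(1)] assms(3) by auto

lemma on_line_in_I: "a \<noteq> 0 \<Longrightarrow> T \<subseteq> on_line a \<Longrightarrow> card T = 3 \<Longrightarrow> T \<in> I"
  unfolding I_iff on_line_def by blast

lemma on_curve_subset: assumes "S \<in> J" "is_conic q" "S \<subseteq> on_curve q" shows "on_curve q = S"
  using card_seteq[of "on_curve q" S] on_curve_card[OF assms(2)] cardJ[OF assms(1)] assms(3) by auto

lemma line_unique:
  assumes "i \<noteq> j" "a \<noteq> 0" "b \<noteq> 0" "{i, j} \<subseteq> on_line a" "{i, j} \<subseteq> on_line b"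
  obtains k where "k \<noteq> 0" "a = k *s b"
proof -
  obtain k where k: "a = k *s crs (v i) (v j)" using orth_crs[OF indep[OF assms(1)], of a] assms by (auto simp: on_line_def)
  obtain l where l: "b = l *s crs (v i) (v j)" using orth_crs[OF indep[OF assms(1)], of b] assms by (auto simp: on_line_def)
  have nz: "k \<noteq> 0" "l \<noteq> 0" using k l assms by auto
  hence "a = (k / l) *s b" by (simp add: k l vec_scale_assoc)
  thus ?thesis using that[of "k / l"] nz by simp
qed

lemma br_iff: assumes "i \<noteq> j" "i \<noteq> k" "j \<noteq> k" shows "br (v i) (v j) (v k) = 0 \<longleftrightarrow> {i, j, k} \<in> I"
proof
  assume "br (v i) (v j) (v k) = 0"
  thus "{i, j, k} \<in> I" using assms indep[OF assms(1)]
    by (intro on_line_in_I[of "crs (v i) (v j)"]) (auto simp: on_line_def br_def)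
next
  assume "{i, j, k} \<in> I"
  then obtain a where "a \<noteq> 0" "\<forall>l\<in>{i, j, k}. a \<odot> v l = 0" by (auto simp: I_iff)
  thus "br (v i) (v j) (v k) = 0" using orth_br_eq_0[of a] by simp
qed

definition la :: "8 set \<Rightarrow> complex^3" where "la T = (SOME a. a \<noteq> 0 \<and> (\<forall>i\<in>T. a \<odot> v i = 0))"
definition qc :: "8 set \<Rightarrow> form" where "qc S = (SOME q. is_conic q \<and> (\<forall>i\<in>S. ev q (v i) = 0))"

lemma la: assumes "T \<in> I" shows "la T \<noteq> 0" "on_line (la T) = T"
proof -
  have "\<exists>a. a \<noteq> 0 \<and> (\<forall>i\<in>T. a \<odot> v i = 0)" using assms I_iff by blast
  from someI_ex[OF this, folded la_def] have l: "la T \<noteq> 0" "T \<subseteq> on_line (la T)" by (auto simp: on_line_def)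
  thus "la T \<noteq> 0" "on_line (la T) = T" using on_line_subset[OF assms l] by auto
qed

lemma qc: assumes "S \<in> J" shows "is_conic (qc S)" "on_curve (qc S) = S"
proof -
  have "\<exists>q. is_conic q \<and> (\<forall>i\<in>S. ev q (v i) = 0)" using assms J_iff by blast
  from someI_ex[OF this, folded qc_def] have l: "is_conic (qc S)" "S \<subseteq> on_curve (qc S)" by (auto simp: on_curve_def)
  thus "is_conic (qc S)" "on_curve (qc S) = S" using on_curve_subset[OF assms l] by auto
qed

lemma is_conicD: "is_conic q \<Longrightarrow> homogeneous 2 q" "is_conic q \<Longrightarrow> irreducible q" "is_conic q \<Longrightarrow> q \<noteq> 0"
  by (auto simp: is_conic_def)

lemma la_unique:
  assumes "T \<in> I" "T' \<in> I" "la T' = k *s la T" shows "T' = T"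
proof -
  have "k \<noteq> 0" using la(1)[OF assms(2)] assms(3) by auto
  hence "on_line (la T') = on_line (la T)" by (auto simp: on_line_def assms(3) dot3_simps)
  thus ?thesis unfolding la(2)[OF assms(1)] la(2)[OF assms(2)] .
qed

definition partner :: "8 set \<Rightarrow> bool" where "partner T \<longleftrightarrow> (\<exists>T'\<in>I. T \<inter> T' = {})"

lemma residual_conic5:
  assumes T: "T \<in> I" and np: "\<not> partner T" and s: "distinct [a, b, c, d, e]" "{a, b, c, d, e} = - T"
  shows "irreducible (conic5 (v a) (v b) (v c) (v d) (v e))"
    and "homogeneous 2 q \<Longrightarrow> - T \<subseteq> on_curve q \<Longrightarrow> \<exists>k. q = cst k * conic5 (v a) (v b) (v c) (v d) (v e)"
proof -
  have n: "{x, y, z} \<notin> I" if "x \<in> - T" "y \<in> - T" "z \<in> - T" for x y z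
  proof
    assume "{x, y, z} \<in> I"
    moreover have "T \<inter> {x, y, z} = {}" using that by simp
    ultimately show False using np unfolding partner_def by blast
  qed
  have m: "a \<in> - T" "b \<in> - T" "c \<in> - T" "d \<in> - T" "e \<in> - T"
    unfolding s(2)[symmetric] by simp_all
  have br: "br (v x) (v y) (v z) \<noteq> 0" if "x \<in> - T" "y \<in> - T" "z \<in> - T" "x \<noteq> y" "x \<noteq> z" "y \<noteq> z" for x y z
    using br_iff[OF that(4-6)] n[OF that(1-3)] by blast
  show "irreducible (conic5 (v a) (v b) (v c) (v d) (v e))"
    by (rule conic5_irreducible) (rule br; use m s(1) in simp)+
  assume q: "homogeneous 2 q" "- T \<subseteq> on_curve q"
  hence z: "ev q (v x) = 0" if "x \<in> - T" for x using that by (auto simp: on_curve_def)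
  obtain k where "q = cst k * conic5 (v a) (v b) (v c) (v d) (v e)"
    by (rule quad5_unique[OF q(1), of "v a" "v b" "v c" "v d" "v e"]) ((rule z br; use m s(1) in simp)+, blast)
  thus "\<exists>k. q = cst k * conic5 (v a) (v b) (v c) (v d) (v e)" by blast
qed

lemma residual_line_pair:
  assumes T: "T \<in> I" "T' \<in> I" "T \<inter> T' = {}" and q: "homogeneous 2 q" "- T \<subseteq> on_curve q"
    and s: "- (T \<union> T') = {d, e}" "d \<noteq> e"
  shows "\<exists>k. q = cst k * (lin (la T') * lin (crs (v d) (v e)))"
proof -
  obtain a b c where abc: "T' = {a, b, c}" "a \<noteq> b" "a \<noteq> c" "b \<noteq> c"
    using cardI[OF T(2)] by (metis card_3_iff)
  have sub: "{a, b, c, d, e} \<subseteq> - T" using s T(3) abc(1) by blast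
  hence z: "ev q (v x) = 0" if "x \<in> {a, b, c, d, e}" for x using that q(2) by (auto simp: on_curve_def)
  have dn: "d \<notin> T'" "e \<notin> T'" using s(1) by blast+
  have brn: "br (v a) (v b) (v x) \<noteq> 0" if "x \<notin> T'" for x
  proof
    assume "br (v a) (v b) (v x) = 0"
    moreover have "x \<noteq> a" "x \<noteq> b" using that abc by auto
    ultimately have I: "{a, b, x} \<in> I" using br_iff[of a b x] abc(2) by metis
    have "{a, b, x} \<noteq> T'" using that by blast
    moreover have "{a, b} \<subseteq> {a, b, x} \<inter> T'" using abc(1) by blast
    hence "card {a, b} \<le> card ({a, b, x} \<inter> T')" by (intro card_mono) auto
    ultimately show False using bezI[OF I T(2)] abc(2) by simp
  qed
  have "br (v a) (v b) (v c) = 0" using br_iff[of a b c] abc T(2) by simp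
  then obtain k where k: "q = cst k * (lin (crs (v a) (v b)) * lin (crs (v d) (v e)))"
    using quad_line_unique[OF q(1), of "v a" "v b" "v c" "v d" "v e"] z brn dn abc s(2) indep by (metis insertCI)
  have "{a, b} \<subseteq> on_line (crs (v a) (v b))" by (auto simp: on_line_def)
  moreover have "{a, b} \<subseteq> on_line (la T')" using la(2)[OF T(2)] abc by auto
  ultimately obtain l where "crs (v a) (v b) = l *s la T'"
    using line_unique[OF abc(2) indep[OF abc(2)] la(1)[OF T(2)]] by metis
  hence "q = cst (k * l) * (lin (la T') * lin (crs (v d) (v e)))"
    unfolding k by (simp add: lin_scale cst_mult[symmetric] mult_ac)
  thus ?thesis by blast
qed

text \<open>Either no three of the five points off \<open>T\<close> are collinear, and
  \<open>conic5\<close> is the only quadric through them, or three of them form a triple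
  \<open>T'\<close>, and the only quadric is the line of \<open>T'\<close> times the line through
  the remaining two.\<close>

lemma residual_ex:
  assumes T: "T \<in> I"
  shows "\<exists>q. homogeneous 2 q \<and> q \<noteq> 0 \<and> - T \<subseteq> on_curve q \<and>
    (\<forall>q'. homogeneous 2 q' \<longrightarrow> - T \<subseteq> on_curve q' \<longrightarrow> (\<exists>k. q' = cst k * q))"
proof (cases "partner T")
  case True
  then obtain T' where T': "T' \<in> I" "T \<inter> T' = {}" by (auto simp: partner_def)
  have "card (T \<union> T') = 6" using cardI T T' by (subst card_Un_disjoint) auto
  hence "card (- (T \<union> T')) = 2" by (simp only: card_Compl8)
  then obtain d e where de: "- (T \<union> T') = {d, e}" "d \<noteq> e" by (metis card_2_iff)
  define q where "q = lin (la T') * lin (crs (v d) (v e))"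
  have "homogeneous 2 q" unfolding q_def by (rule homogeneous_lin_mult)
  moreover have "q \<noteq> 0" using la(1)[OF T'(1)] indep[OF de(2)] by (simp add: q_def)
  moreover have "- T \<subseteq> on_curve q"
  proof
    fix i assume "i \<in> - T"
    hence "i \<in> T' \<or> i = d \<or> i = e" using de(1) by blast
    moreover have "i \<in> T' \<Longrightarrow> la T' \<odot> v i = 0" using la(2)[OF T'(1)] by (auto simp: on_line_def)
    ultimately show "i \<in> on_curve q" by (auto simp: on_curve_def q_def)
  qed
  moreover have "\<exists>k. q' = cst k * q" if "homogeneous 2 q'" "- T \<subseteq> on_curve q'" for q'
    using residual_line_pair[OF T T' that de] by (simp add: q_def)
  ultimately show ?thesis by blast
next
  case False
  have "card (- T) = 5" using cardI[OF T] by (simp add: card_Compl8)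
  then obtain l where l: "set l = - T" "distinct l" "length l = 5"
    using finite_distinct_list[of "- T"] distinct_card by (metis finite)
  then obtain a b c d e where "l = [a, b, c, d, e]"
    by (auto simp: length_Suc_conv numeral_eq_Suc)
  hence s: "distinct [a, b, c, d, e]" "{a, b, c, d, e} = - T" using l by auto
  define q where "q = conic5 (v a) (v b) (v c) (v d) (v e)"
  have "- T \<subseteq> on_curve q" unfolding s(2)[symmetric] by (auto simp: on_curve_def q_def)
  moreover have "irreducible q" using residual_conic5(1)[OF T False s] by (simp add: q_def)
  moreover have "\<exists>k. q' = cst k * q" if "homogeneous 2 q'" "- T \<subseteq> on_curve q'" for q'
    using residual_conic5(2)[OF T False s that] by (simp add: q_def)
  moreover have "homogeneous 2 q" unfolding q_def by (rule homogeneous_conic5)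
  ultimately show ?thesis by auto
qed

definition qT :: "8 set \<Rightarrow> form"
  where "qT T = (SOME q. homogeneous 2 q \<and> q \<noteq> 0 \<and> - T \<subseteq> on_curve q \<and>
    (\<forall>q'. homogeneous 2 q' \<longrightarrow> - T \<subseteq> on_curve q' \<longrightarrow> (\<exists>k. q' = cst k * q)))"

lemma qT:
  assumes "T \<in> I"
  shows "homogeneous 2 (qT T)" "qT T \<noteq> 0" "- T \<subseteq> on_curve (qT T)"
    "homogeneous 2 q' \<Longrightarrow> - T \<subseteq> on_curve q' \<Longrightarrow> \<exists>k. q' = cst k * qT T"
  using someI_ex[OF residual_ex[OF assms], folded qT_def] by blast+

definition bS :: "8 set \<Rightarrow> complex^3" where "bS S = (SOME b. b \<noteq> 0 \<and> - S \<subseteq> on_line b)"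

lemma bS: assumes "S \<in> J" shows "bS S \<noteq> 0" "- S \<subseteq> on_line (bS S)"
proof -
  have "card (- S) = 2" using cardJ[OF assms] by (simp only: card_Compl8)
  then obtain d e where de: "- S = {d, e}" "d \<noteq> e" by (metis card_2_iff)
  have "\<exists>b. b \<noteq> 0 \<and> - S \<subseteq> on_line b"
    by (rule exI[of _ "crs (v d) (v e)"]) (use de indep[OF de(2)] in \<open>auto simp: on_line_def\<close>)
  from someI_ex[OF this, folded bS_def] show "bS S \<noteq> 0" "- S \<subseteq> on_line (bS S)" by auto
qed

definition cT :: "8 set \<Rightarrow> form set" where "cT T = fcl (lin (la T) * qT T)"
definition cS :: "8 set \<Rightarrow> form set" where "cS S = fcl (lin (bS S) * qc S)"

lemma cT_eqI:
  assumes T: "T \<in> I" and q: "homogeneous 2 q" "q \<noteq> 0" "- T \<subseteq> on_curve q"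
    and a: "a = k *s la T" "a \<noteq> 0"
  shows "fcl (lin a * q) = cT T"
proof -
  obtain c where c: "q = cst c * qT T" using qT(4)[OF T q(1,3)] by blast
  have nz: "c \<noteq> 0" "k \<noteq> 0" using c q(2) a by auto
  have "lin a * q = cst (k * c) * (lin (la T) * qT T)"
    by (simp add: a c lin_scale cst_mult[symmetric] mult_ac)
  thus ?thesis unfolding cT_def using fcl_scale[of "k * c"] nz by simp
qed

section \<open>The reducible cubics and when they coincide\<close>

definition red_cubics :: "form set set"
  where "red_cubics = {C \<in> cubics_through (\<lambda>i. pcl (v i)). reducible_cubic C}"

lemma red_cubics_iff:
  "C \<in> red_cubics \<longleftrightarrow> (\<exists>a q. a \<noteq> 0 \<and> homogeneous 2 q \<and> q \<noteq> 0 \<and> C = fcl (lin a * q) \<and> on_line a \<union> on_curve q = UNIV)"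
proof
  assume C: "C \<in> red_cubics"
  hence "C \<in> fcl ` ({f. homogeneous 3 f \<and> (\<forall>i. vanishes_at f (pcl (v i)))} - {0})"
    unfolding red_cubics_def cubics_through_def proj_space_def fcl_def by blast
  then obtain f where f: "homogeneous 3 f" "f \<noteq> 0" "C = fcl f" "\<And>i. vanishes_at f (pcl (v i))" by blast
  hence f4: "ev f (v i) = 0" for i using vanishes_at_pcl[OF f(1)] by blast
  from C obtain g where g: "g \<in> C" "\<not> irreducible g" unfolding red_cubics_def reducible_cubic_def by blast
  then obtain c where c: "c \<noteq> 0" "g = cst c * f" using fclE f(3) by metis
  have g3: "homogeneous 3 g" "g \<noteq> 0" using f c by (auto intro: homogeneous_cst_mult)
  obtain a q where aq: "g = lin a * q" "homogeneous 2 q" using reducible_cubicE[OF g3 g(2)] by blast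
  have "C = fcl (lin a * q)" using fcl_eq_iff[of g f] g(1) f(3) aq(1) by simp
  moreover have "a \<noteq> 0" "q \<noteq> 0" using g3(2) aq by auto
  moreover have "i \<in> on_line a \<union> on_curve q" for i
  proof -
    have "ev g (v i) = 0" using f4 c by simp
    thus ?thesis by (auto simp: aq(1) on_line_def on_curve_def)
  qed
  hence "on_line a \<union> on_curve q = UNIV" by blast
  ultimately show "\<exists>a q. a \<noteq> 0 \<and> homogeneous 2 q \<and> q \<noteq> 0 \<and> C = fcl (lin a * q) \<and> on_line a \<union> on_curve q = UNIV"
    using aq(2) by blast
next
  assume "\<exists>a q. a \<noteq> 0 \<and> homogeneous 2 q \<and> q \<noteq> 0 \<and> C = fcl (lin a * q) \<and> on_line a \<union> on_curve q = UNIV"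
  then obtain a q where aq: "a \<noteq> 0" "homogeneous 2 q" "q \<noteq> 0" "C = fcl (lin a * q)" "on_line a \<union> on_curve q = UNIV" by blast
  have h: "homogeneous 3 (lin a * q)" "lin a * q \<noteq> 0" using aq homogeneous_lin_quad by auto
  have "i \<in> on_line a \<or> i \<in> on_curve q" for i using aq(5) by blast
  hence "ev (lin a * q) (v i) = 0" for i by (auto simp: on_line_def on_curve_def)
  hence "lin a * q \<in> {f. homogeneous 3 f \<and> (\<forall>i. vanishes_at f (pcl (v i)))} - {0}"
    using h vanishes_at_pcl[OF h(1)] by simp
  hence "C \<in> cubics_through (\<lambda>i. pcl (v i))"
    unfolding cubics_through_def proj_space_def aq(4) fcl_def by (rule imageI)
  moreover have "reducible_cubic C"
    unfolding reducible_cubic_def aq(4) using reducible_cubicI[OF refl aq(2) h(2)] self_in_fcl h fcl_in_cubic_space_iff by blast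
  ultimately show "C \<in> red_cubics" by (simp add: red_cubics_def)
qed

lemma red_cubics_eq: "red_cubics = cT ` I \<union> cS ` J"
proof (intro equalityI subsetI)
  fix C assume "C \<in> red_cubics"
  then obtain a q where aq: "a \<noteq> 0" "homogeneous 2 q" "q \<noteq> 0" "C = fcl (lin a * q)" "on_line a \<union> on_curve q = UNIV"
    by (auto simp: red_cubics_iff)
  have three: "fcl (lin a * q) \<in> cT ` I"
    if h: "a \<noteq> 0" "homogeneous 2 q" "q \<noteq> 0" "on_line a \<union> on_curve q = UNIV" "card (on_line a) = 3" for a q
  proof -
    have T: "on_line a \<in> I" using on_line_in_I[OF h(1) subset_refl h(5)] .
    obtain i j where ij: "i \<in> on_line a" "j \<in> on_line a" "i \<noteq> j" using two_of_card[of "on_line a"] h(5) by auto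
    obtain k where k: "a = k *s la (on_line a)"
      using line_unique[OF ij(3) h(1) la(1)[OF T]] la(2)[OF T] ij by (metis empty_subsetI insert_subset)
    have "- on_line a \<subseteq> on_curve q" using h(4) by blast
    from cT_eqI[OF T h(2,3) this k h(1)] T show ?thesis by blast
  qed
  show "C \<in> cT ` I \<union> cS ` J"
  proof (cases "card (on_line a) = 3")
    case True thus ?thesis using three aq by simp
  next
    case False
    \<comment> \<open>With at most two points on the line, the quadric carries at least six. An
      irreducible one then gives a sextuple of \<open>J\<close>, a reducible one another line that
      contains a triple.\<close>
    hence c2: "card (on_line a) \<le> 2" using on_line_card[OF aq(1)] by linarith
    have sub: "- on_line a \<subseteq> on_curve q" using aq(5) by blast
    have c6: "card (on_curve q) \<ge> 6"
      using card_mono[OF _ sub] c2 by (simp add: card_Compl8)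
    show ?thesis
    proof (cases "irreducible q")
      case True
      hence q: "is_conic q" using aq(2) by (simp add: is_conic_def)
      have c6': "card (on_curve q) = 6" using on_curve_card[OF q] c6 by simp
      hence S: "on_curve q \<in> J" unfolding J_iff using q by (auto simp: on_curve_def)
      have e: "- on_line a = on_curve q"
        by (rule card_seteq[OF _ sub]) (use c2 c6' in \<open>simp_all add: card_Compl8\<close>)
      have "card (- on_curve q) = 2" using c6' by (simp add: card_Compl8)
      then obtain i j where ij: "- on_curve q = {i, j}" "i \<noteq> j" by (metis card_2_iff)
      have "{i, j} \<subseteq> on_line a" "{i, j} \<subseteq> on_line (bS (on_curve q))" using ij e bS(2)[OF S] by auto
      then obtain k where k: "k \<noteq> 0" "a = k *s bS (on_curve q)" using line_unique[OF ij(2) aq(1) bS(1)[OF S]] by metis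
      have "\<exists>l. q = cst l * qc (on_curve q)"
      proof -
        obtain U where U: "U \<subseteq> on_curve q" "card U = 5" using obtain_subset_with_card_n[of 5 "on_curve q"] c6' by auto
        then obtain l where l: "set l = U" "distinct l" "length l = 5"
          using finite_distinct_list[of U] distinct_card by (metis finite)
        then obtain p1 p2 p3 p4 p5 where "l = [p1, p2, p3, p4, p5]"
          by (auto simp: length_Suc_conv numeral_eq_Suc)
        hence s: "distinct [p1, p2, p3, p4, p5]" "{p1, p2, p3, p4, p5} = U" using l by auto
        have z: "ev q (v x) = 0" if "x \<in> U" for x using that U by (auto simp: on_curve_def)
        have br: "br (v x) (v y) (v z) \<noteq> 0" if "x \<in> U" "y \<in> U" "z \<in> U" "x \<noteq> y" "x \<noteq> z" "y \<noteq> z" for x y z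
          using irreducible_no_collinear[OF True aq(2)] z indep that by blast
        have m: "p1 \<in> U" "p2 \<in> U" "p3 \<in> U" "p4 \<in> U" "p5 \<in> U" using s(2) by auto
        have un: "\<exists>k. f = cst k * conic5 (v p1) (v p2) (v p3) (v p4) (v p5)"
          if f: "homogeneous 2 f" "U \<subseteq> on_curve f" for f
        proof -
          have zf: "ev f (v x) = 0" if "x \<in> U" for x using that f by (auto simp: on_curve_def)
          obtain k where "f = cst k * conic5 (v p1) (v p2) (v p3) (v p4) (v p5)"
            by (rule quad5_unique[OF f(1), of "v p1" "v p2" "v p3" "v p4" "v p5"]) ((rule zf br; use m s(1) in simp)+, blast)
          thus ?thesis by blast
        qed
        obtain k1 where k1: "q = cst k1 * conic5 (v p1) (v p2) (v p3) (v p4) (v p5)" using un[OF aq(2) U(1)] by blast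
        obtain k2 where k2: "qc (on_curve q) = cst k2 * conic5 (v p1) (v p2) (v p3) (v p4) (v p5)"
          using un[OF is_conicD(1)[OF qc(1)[OF S]]] qc(2)[OF S] U(1) by auto
        have "k2 \<noteq> 0" using k2 is_conicD(3)[OF qc(1)[OF S]] by auto
        hence "q = cst (k1 / k2) * qc (on_curve q)" unfolding k2 by (subst k1) (simp add: mult.assoc[symmetric] cst_mult)
        thus ?thesis by blast
      qed
      then obtain l where l: "q = cst l * qc (on_curve q)" by blast
      have "l \<noteq> 0" using l aq(3) by auto
      have "lin a * q = cst (k * l) * (lin (bS (on_curve q)) * qc (on_curve q))"
        by (subst l, subst k(2)) (simp add: lin_scale cst_mult[symmetric] mult_ac)
      hence "C = cS (on_curve q)" unfolding aq(4) cS_def using fcl_scale[of "k * l"] k(1) \<open>l \<noteq> 0\<close> by simp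
      thus ?thesis using S by blast
    next
      case False
      then obtain b c where q: "q = lin b * lin c" using irreducible_quadI[OF aq(2,3)] by blast
      have nz: "b \<noteq> 0" "c \<noteq> 0" using q aq(3) by auto
      have un: "on_curve q = on_line b \<union> on_line c" by (auto simp: on_curve_def on_line_def q)
      have "card (on_curve q) \<le> card (on_line b) + card (on_line c)" unfolding un by (rule card_Un_le)
      \<comment> \<open>Six points lie on two lines that carry at most three each, so
        \<open>b\<close> carries exactly three and can take over the role of
        \<open>a\<close>.\<close>
      hence b3: "card (on_line b) = 3" using c6 on_line_card[OF nz(1)] on_line_card[OF nz(2)] by linarith
      have "on_curve (lin a * lin c) = on_line a \<union> on_line c" by (auto simp: on_curve_def on_line_def)
      hence "on_line b \<union> on_curve (lin a * lin c) = UNIV" using aq(5) un by blast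
      from three[OF nz(1) homogeneous_lin_mult _ this b3]
      have "fcl (lin b * (lin a * lin c)) \<in> cT ` I" using aq(1) nz by simp
      moreover have "lin b * (lin a * lin c) = lin a * q" by (simp add: q mult_ac)
      ultimately show ?thesis using aq(4) by simp
    qed
  qed
next
  fix C assume "C \<in> cT ` I \<union> cS ` J"
  thus "C \<in> red_cubics"
  proof
    assume "C \<in> cT ` I"
    then obtain T where T: "T \<in> I" "C = cT T" by blast
    have "on_line (la T) \<union> on_curve (qT T) = UNIV" using la(2)[OF T(1)] qT(3)[OF T(1)] by blast
    thus ?thesis unfolding red_cubics_iff T(2) cT_def using la(1)[OF T(1)] qT(1,2)[OF T(1)] by blast
  next
    assume "C \<in> cS ` J"
    then obtain S where S: "S \<in> J" "C = cS S" by blast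
    have "on_line (bS S) \<union> on_curve (qc S) = UNIV" using bS(2)[OF S(1)] qc(2)[OF S(1)] by blast
    thus ?thesis unfolding red_cubics_iff S(2) cS_def using bS(1)[OF S(1)] is_conicD[OF qc(1)[OF S(1)]] by blast
  qed
qed

lemma fcl_eqE:
  assumes "fcl f = fcl g" obtains c where "c \<noteq> 0" "f = cst c * g"
  using fclE[of f g] fcl_eq_iff[of f g] assms by blast

text \<open>If the cubics agree and the lines differ, the line of \<open>T'\<close> divides the
  residual quadric of \<open>T\<close>, and the third line contains all points off \<open>T\<close>
  and \<open>T'\<close>. When the triples share a point, these are three points, so they form a
  triple.\<close>

lemma cT_eq_iff:
  assumes T: "T \<in> I" "T' \<in> I"
  shows "cT T = cT T' \<longleftrightarrow> T' = T \<or> T \<inter> T' = {} \<or> - (T \<union> T') \<in> I"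
proof
  assume "cT T = cT T'"
  then obtain c where c: "c \<noteq> 0" "lin (la T) * qT T = cst c * (lin (la T') * qT T')"
    unfolding cT_def by (rule fcl_eqE)
  hence e: "lin (la T) * qT T = lin (la T') * (cst c * qT T')" by (simp add: mult_ac)
  from lin_dvd_cases[OF e la(1)[OF T(1)] la(1)[OF T(2)] qT(1)[OF T(1)]]
  show "T' = T \<or> T \<inter> T' = {} \<or> - (T \<union> T') \<in> I"
  proof
    assume "\<exists>k. k \<noteq> 0 \<and> la T' = k *s la T \<and> qT T = cst k * (cst c * qT T')"
    thus ?thesis using la_unique[OF T] by blast
  next
    assume "\<exists>m. qT T = lin (la T') * lin m"
    then obtain m where m: "qT T = lin (la T') * lin m" by blast
    have mnz: "m \<noteq> 0" using m qT(2)[OF T(1)] by auto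
    have sub: "- (T \<union> T') \<subseteq> on_line m"
    proof
      fix i assume i: "i \<in> - (T \<union> T')"
      hence "ev (qT T) (v i) = 0" using qT(3)[OF T(1)] by (auto simp: on_curve_def)
      moreover have "la T' \<odot> v i \<noteq> 0" using la(2)[OF T(2)] i by (auto simp: on_line_def)
      ultimately show "i \<in> on_line m" by (simp add: m on_line_def)
    qed
    show ?thesis
    proof (cases "T' = T \<or> T \<inter> T' = {}")
      case False
      hence "card (T \<inter> T') \<noteq> 0" by simp
      moreover have "card (T \<inter> T') \<le> 1" using bezI[OF T] False by blast
      ultimately have "card (T \<inter> T') = 1" by linarith
      hence "card (T \<union> T') = 5" using card_Un_Int[of T T'] cardI T by simp
      hence "card (- (T \<union> T')) = 3" by (simp only: card_Compl8)
      thus ?thesis using on_line_in_I[OF mnz sub] by blast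
    qed blast
  qed
next
  have three: "cT T = fcl (lin (la T) * (lin (la T') * lin b))"
    if "T \<in> I" "T' \<in> I" "b \<noteq> 0" "- (T \<union> T') \<subseteq> on_line b" for T T' b
  proof -
    have "- T \<subseteq> on_curve (lin (la T') * lin b)"
      using that(4) la(2)[OF that(2)] by (auto simp: on_curve_def on_line_def)
    from cT_eqI[OF that(1) homogeneous_lin_mult _ this, of "la T" 1] show ?thesis
      using la(1)[OF that(1)] la(1)[OF that(2)] that(3) by simp
  qed
  have eq: "cT T = cT T'" if b: "b \<noteq> 0" "- (T \<union> T') \<subseteq> on_line b" for b
    using three[OF T b] three[OF T(2,1) b(1)] b(2) by (simp add: Un_commute mult_ac)
  assume "T' = T \<or> T \<inter> T' = {} \<or> - (T \<union> T') \<in> I"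
  thus "cT T = cT T'"
  proof (elim disjE)
    assume d: "T \<inter> T' = {}"
    have "card (T \<union> T') = 6" using cardI T d by (subst card_Un_disjoint) auto
    hence "card (- (T \<union> T')) = 2" by (simp only: card_Compl8)
    then obtain d e where de: "- (T \<union> T') = {d, e}" "d \<noteq> e" by (metis card_2_iff)
    have "{d, e} \<subseteq> on_line (crs (v d) (v e))" by (simp add: on_line_def)
    from eq[OF indep[OF de(2)], unfolded de(1), OF this] show ?thesis .
  next
    assume I: "- (T \<union> T') \<in> I"
    show ?thesis by (rule eq[OF la(1)[OF I]]) (simp only: la(2)[OF I] subset_refl)
  qed simp
qed

lemma cS_inj: assumes "S \<in> J" "S' \<in> J" "cS S = cS S'" shows "S = S'"
proof -
  obtain c where c: "c \<noteq> 0" "lin (bS S) * qc S = cst c * (lin (bS S') * qc S')"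
    using fcl_eqE assms(3) unfolding cS_def by blast
  hence e: "lin (bS S) * qc S = lin (bS S') * (cst c * qc S')" by (simp add: mult_ac)
  have n: "qc S \<noteq> lin a * lin b" for a b using irreducible_quadD is_conicD(2)[OF qc(1)[OF assms(1)]] by blast
  obtain k where "k \<noteq> 0" "qc S = cst k * (cst c * qc S')"
    using lin_dvd_cases[OF e bS(1)[OF assms(1)] bS(1)[OF assms(2)] is_conicD(1)[OF qc(1)[OF assms(1)]]] n by blast
  hence "on_curve (qc S) = on_curve (qc S')" using c(1) by (auto simp: on_curve_def)
  thus ?thesis using qc(2) assms by simp
qed

text \<open>If \<open>T\<close> and \<open>S\<close> cover all labels, the two points off
  \<open>S\<close> lie on the line of \<open>T\<close>, so both constructions use that line, and the
  conic of \<open>S\<close> is the residual quadric of \<open>T\<close>. Conversely, an irreducible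
  conic leaves the two lines as the only matching factors.\<close>

lemma cT_eq_cS_iff: assumes T: "T \<in> I" and S: "S \<in> J" shows "cT T = cS S \<longleftrightarrow> T \<union> S = UNIV"
proof
  assume "cT T = cS S"
  then obtain c where c: "c \<noteq> 0" "lin (bS S) * qc S = cst c * (lin (la T) * qT T)"
    using fcl_eqE[of "lin (bS S) * qc S"] unfolding cS_def cT_def by metis
  hence e: "lin (bS S) * qc S = lin (la T) * (cst c * qT T)" by (simp add: mult_ac)
  have n: "qc S \<noteq> lin a * lin b" for a b using irreducible_quadD is_conicD(2)[OF qc(1)[OF S]] by blast
  obtain k where "la T = k *s bS S"
    using lin_dvd_cases[OF e bS(1)[OF S] la(1)[OF T] is_conicD(1)[OF qc(1)[OF S]]] n by blast
  hence "on_line (bS S) \<subseteq> on_line (la T)" by (auto simp: on_line_def dot3_simps)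
  thus "T \<union> S = UNIV" using bS(2)[OF S] la(2)[OF T] by blast
next
  assume u: "T \<union> S = UNIV"
  have "card (- S) = 2" using cardJ[OF S] by (simp only: card_Compl8)
  then obtain d e where de: "- S = {d, e}" "d \<noteq> e" by (metis card_2_iff)
  have "{d, e} \<subseteq> on_line (bS S)" "{d, e} \<subseteq> on_line (la T)"
    using de bS(2)[OF S] la(2)[OF T] u by auto
  then obtain k where k: "bS S = k *s la T" using line_unique[OF de(2) bS(1)[OF S] la(1)[OF T]] by metis
  have "- T \<subseteq> on_curve (qc S)" using qc(2)[OF S] u by blast
  from cT_eqI[OF T is_conicD(1,3)[OF qc(1)[OF S]] this k bS(1)[OF S]]
  show "cT T = cS S" by (simp add: cS_def)
qed

section \<open>Multiplicities of these cubics and their sum\<close>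

lemma mult_cS_ge: "S \<in> J \<Longrightarrow> mult_discriminant (cS S) \<ge> 2"
  unfolding cS_def using bS(1) is_conicD qc(1) by (intro mult_line_quad_ge) auto

lemma mult_cT_ge: "T \<in> I \<Longrightarrow> mult_discriminant (cT T) \<ge> 2"
  unfolding cT_def using la(1) qT by (intro mult_line_quad_ge) auto

lemma cT_partner:
  assumes T: "T \<in> I" "T' \<in> I" "T \<inter> T' = {}" and de: "- (T \<union> T') = {d, e}" "d \<noteq> e"
  shows "cT T = fcl (lin (la T) * (lin (la T') * lin (crs (v d) (v e))))"
proof -
  have "- T \<subseteq> on_curve (lin (la T') * lin (crs (v d) (v e)))"
  proof
    fix i assume "i \<in> - T"
    hence "i \<in> T' \<or> i = d \<or> i = e" using de(1) by blast
    moreover have "i \<in> T' \<Longrightarrow> la T' \<odot> v i = 0" using la(2)[OF T(2)] by (auto simp: on_line_def)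
    ultimately show "i \<in> on_curve (lin (la T') * lin (crs (v d) (v e)))" by (auto simp: on_curve_def)
  qed
  from cT_eqI[OF T(1) homogeneous_lin_mult _ this, of "la T" 1] show ?thesis
    using la(1)[OF T(1)] la(1)[OF T(2)] indep[OF de(2)] by simp
qed

lemma mult_cT_ge_partner:
  assumes T: "T \<in> I" "partner T" shows "mult_discriminant (cT T) \<ge> 3"
proof -
  obtain T' where T': "T' \<in> I" "T \<inter> T' = {}" using T by (auto simp: partner_def)
  have "card (T \<union> T') = 6" using cardI T T' by (subst card_Un_disjoint) auto
  hence "card (- (T \<union> T')) = 2" by (simp only: card_Compl8)
  then obtain d e where de: "- (T \<union> T') = {d, e}" "d \<noteq> e" by (metis card_2_iff)
  show ?thesis unfolding cT_partner[OF T(1) T' de]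
    by (rule mult_three_lines_ge[OF la(1)[OF T(1)] la(1)[OF T'(1)] indep[OF de(2)]])
qed

text \<open>A further member of the class is disjoint from \<open>T\<close>, or its union with
  \<open>T\<close> has a complement in \<open>I\<close> that is disjoint from \<open>T\<close>; both
  alternatives provide a partner.\<close>

lemma card_cubic_class: assumes "T \<in> I" shows "card (cubic_class I T) = 1 \<longleftrightarrow> \<not> partner T"
proof
  assume "card (cubic_class I T) = 1"
  then obtain K where K: "cubic_class I T = {K}" by (metis card_1_singletonE)
  show "\<not> partner T"
  proof
    assume "partner T"
    then obtain T' where T': "T' \<in> I" "T \<inter> T' = {}" by (auto simp: partner_def)
    hence "T' \<in> cubic_class I T" "T \<in> cubic_class I T" using assms by (auto simp: cubic_class_def)
    hence "T' = T" using K by auto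
    thus False using T'(2) cardI[OF assms] by auto
  qed
next
  assume np: "\<not> partner T"
  have "cubic_class I T = {T}"
    using np assms unfolding cubic_class_def partner_def by auto
  thus "card (cubic_class I T) = 1" by simp
qed

lemma cubic_class_eq: assumes "T \<in> I" shows "cubic_class I T = {T' \<in> I. cT T' = cT T}"
  unfolding cubic_class_def using cT_eq_iff[OF assms] by auto

text \<open>Lists every reducible cubic exactly once: the sextuples give distinct cubics, the
  triples outside \<open>own_triples\<close> repeat some of them, and the other triples are grouped
  into classes with a common cubic.\<close>

lemma m_config_sum:
  "m_config (\<lambda>i. pcl (v i)) = (\<Sum>S\<in>J. mult_discriminant (cS S))
    + (\<Sum>K\<in>cubic_class I ` own_triples I J. mult_discriminant (cT (SOME T. T \<in> K)))"
proof -
  let ?O = "own_triples I J"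
  have sub: "?O \<subseteq> I" by (auto simp: own_triples_def)
  have rep: "(SOME T'. T' \<in> cubic_class I T) \<in> I" "cT (SOME T'. T' \<in> cubic_class I T) = cT T" if "T \<in> I" for T
  proof -
    have "T \<in> cubic_class I T" using that by (simp add: cubic_class_eq)
    hence "(SOME T'. T' \<in> cubic_class I T) \<in> cubic_class I T" by (rule someI)
    thus "(SOME T'. T' \<in> cubic_class I T) \<in> I" "cT (SOME T'. T' \<in> cubic_class I T) = cT T"
      unfolding cubic_class_eq[OF that] by auto
  qed
  have img: "cT ` ?O = (\<lambda>K. cT (SOME T. T \<in> K)) ` (cubic_class I ` ?O)"
    unfolding image_image using rep sub by (intro image_cong) auto
  have inj: "inj_on (\<lambda>K. cT (SOME T. T \<in> K)) (cubic_class I ` ?O)"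
  proof (rule inj_onI)
    fix K K' assume K: "K \<in> cubic_class I ` ?O" "K' \<in> cubic_class I ` ?O" "cT (SOME T. T \<in> K) = cT (SOME T. T \<in> K')"
    then obtain T T' where T: "T \<in> ?O" "T' \<in> ?O" "K = cubic_class I T" "K' = cubic_class I T'" by blast
    hence TI: "T \<in> I" "T' \<in> I" using sub by auto
    have "cT T = cT T'" using K(3) rep(2)[OF TI(1)] rep(2)[OF TI(2)] unfolding T by simp
    thus "K = K'" unfolding T cubic_class_eq[OF TI(1)] cubic_class_eq[OF TI(2)] by simp
  qed
  have "red_cubics = cS ` J \<union> cT ` ?O"
  proof -
    have "cT T \<in> cS ` J \<union> cT ` ?O" if TI: "T \<in> I" for T
    proof (cases "T \<in> ?O")
      case False
      then obtain S where "S \<in> J" "T \<union> S = UNIV" using TI by (auto simp: own_triples_def)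
      thus ?thesis using cT_eq_cS_iff[OF TI] by blast
    qed simp
    thus ?thesis unfolding red_cubics_eq using sub by auto
  qed
  moreover have "cS ` J \<inter> cT ` ?O = {}"
  proof (rule ccontr)
    assume "cS ` J \<inter> cT ` ?O \<noteq> {}"
    then obtain S T where "S \<in> J" "T \<in> ?O" "cT T = cS S" by force
    thus False using cT_eq_cS_iff[of T S] by (auto simp: own_triples_def)
  qed
  ultimately have "m_config (\<lambda>i. pcl (v i)) = sum mult_discriminant (cS ` J) + sum mult_discriminant (cT ` ?O)"
    unfolding m_config_def red_cubics_def[symmetric] by (simp add: sum.union_disjoint)
  also have "sum mult_discriminant (cS ` J) = (\<Sum>S\<in>J. mult_discriminant (cS S))"
    by (subst sum.reindex) (simp_all add: inj_on_def cS_inj)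
  also have "sum mult_discriminant (cT ` ?O) = (\<Sum>K\<in>cubic_class I ` ?O. mult_discriminant (cT (SOME T. T \<in> K)))"
    unfolding img by (subst sum.reindex[OF inj]) simp
  finally show ?thesis .
qed

lemma class_rep:
  assumes "K \<in> cubic_class I ` own_triples I J"
  obtains T where "T \<in> own_triples I J" "T \<in> I" "cT (SOME T. T \<in> K) = cT T" "card K = 1 \<longleftrightarrow> \<not> partner T"
proof -
  obtain T where T: "T \<in> own_triples I J" "K = cubic_class I T" using assms by blast
  have TI: "T \<in> I" using T(1) by (simp add: own_triples_def)
  have "T \<in> K" using TI T by (simp add: cubic_class_eq)
  hence "(SOME T. T \<in> K) \<in> K" by (rule someI)
  hence "cT (SOME T. T \<in> K) = cT T" unfolding T(2) cubic_class_eq[OF TI] by simp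
  thus ?thesis using that[OF T(1) TI] card_cubic_class[OF TI] T(2) by simp
qed

lemma m_config_ge: "generic_m I J \<le> m_config (\<lambda>i. pcl (v i))"
proof -
  have "2 * card J \<le> (\<Sum>S\<in>J. mult_discriminant (cS S))"
    using sum_mono[of J "\<lambda>_. 2" "\<lambda>S. mult_discriminant (cS S)"] mult_cS_ge by (simp add: mult.commute)
  moreover have "(\<Sum>K\<in>cubic_class I ` own_triples I J. if card K = 1 then 2 else 3)
    \<le> (\<Sum>K\<in>cubic_class I ` own_triples I J. mult_discriminant (cT (SOME T. T \<in> K)))"
  proof (rule sum_mono)
    fix K assume "K \<in> cubic_class I ` own_triples I J"
    then obtain T where "T \<in> I" "cT (SOME T. T \<in> K) = cT T" "card K = 1 \<longleftrightarrow> \<not> partner T" by (rule class_rep)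
    thus "(if card K = 1 then 2 else 3) \<le> mult_discriminant (cT (SOME T. T \<in> K))"
      using mult_cT_ge mult_cT_ge_partner by simp
  qed
  ultimately show ?thesis unfolding generic_m_def m_config_sum by linarith
qed

lemma m_config_eq:
  assumes S: "\<And>S. S \<in> J \<Longrightarrow> mult_discriminant (cS S) = 2"
    and T: "\<And>T. T \<in> own_triples I J \<Longrightarrow> mult_discriminant (cT T) = (if partner T then 3 else 2)"
  shows "m_config (\<lambda>i. pcl (v i)) = generic_m I J"
proof -
  have "(\<Sum>K\<in>cubic_class I ` own_triples I J. mult_discriminant (cT (SOME T. T \<in> K)))
    = (\<Sum>K\<in>cubic_class I ` own_triples I J. if card K = 1 then 2 else 3)"
  proof (rule sum.cong[OF refl])
    fix K assume "K \<in> cubic_class I ` own_triples I J"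
    then obtain T' where "T' \<in> own_triples I J" "cT (SOME T. T \<in> K) = cT T'" "card K = 1 \<longleftrightarrow> \<not> partner T'" by (rule class_rep)
    thus "mult_discriminant (cT (SOME T. T \<in> K)) = (if card K = 1 then 2 else 3)" using T by simp
  qed
  thus ?thesis unfolding generic_m_def m_config_sum using S by simp
qed

text \<open>The restriction of the conic through five points to the line \<open>a b\<close> has nonzero discriminant, i.e. the
  conic and the line are not tangent.\<close>

definition secant :: "8 \<Rightarrow> 8 \<Rightarrow> 8 \<Rightarrow> 8 \<Rightarrow> 8 \<Rightarrow> 8 \<Rightarrow> 8 \<Rightarrow> bool"
  where "secant s1 s2 s3 s4 s5 a b \<longleftrightarrow> (let Q = conic5 (v s1) (v s2) (v s3) (v s4) (v s5) in
    (ev Q (v a + v b) - ev Q (v a) - ev Q (v b))^2 \<noteq> 4 * ev Q (v a) * ev Q (v b))"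

lemma secantD:
  assumes "secant s1 s2 s3 s4 s5 a b" "q = cst k * conic5 (v s1) (v s2) (v s3) (v s4) (v s5)" "q \<noteq> 0"
  shows "(bil q (v a) (v b))^2 \<noteq> ev q (v a) * ev q (v b)"
proof
  define Q where "Q = conic5 (v s1) (v s2) (v s3) (v s4) (v s5)"
  have k: "k \<noteq> 0" using assms by auto
  have "bil q (v a) (v b) = k * bil Q (v a) (v b)" by (simp add: assms(2) Q_def bil_def algebra_simps)
  moreover assume "(bil q (v a) (v b))^2 = ev q (v a) * ev q (v b)"
  ultimately have "(bil Q (v a) (v b))^2 = ev Q (v a) * ev Q (v b)"
    using k by (simp add: assms(2) Q_def[symmetric] power_mult_distrib power2_eq_square)
  moreover have "ev Q (v a + v b) - ev Q (v a) - ev Q (v b) = 2 * bil Q (v a) (v b)" by (simp add: bil_def)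
  ultimately show False using assms(1) by (simp add: secant_def Let_def Q_def[symmetric] power_mult_distrib)
qed

lemma mult_cS_secant:
  assumes S: "S \<in> J" and s: "distinct [s1, s2, s3, s4, s5]" "{s1, s2, s3, s4, s5} \<subseteq> S"
    and ab: "a \<noteq> b" "a \<notin> S" "b \<notin> S" and sec: "secant s1 s2 s3 s4 s5 a b"
  shows "mult_discriminant (cS S) = 2"
proof -
  have q: "homogeneous 2 (qc S)" "irreducible (qc S)" using is_conicD qc(1)[OF S] by auto
  have z: "ev (qc S) (v x) = 0" if "x \<in> {s1, s2, s3, s4, s5}" for x
    using qc(2)[OF S] s(2) that by (auto simp: on_curve_def)
  have br: "br (v x) (v y) (v w) \<noteq> 0" if "x \<in> {s1, s2, s3, s4, s5}" "y \<in> {s1, s2, s3, s4, s5}" "w \<in> {s1, s2, s3, s4, s5}"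
    "x \<noteq> y" "x \<noteq> w" "y \<noteq> w" for x y w
    using irreducible_no_collinear[OF q(2,1) z[OF that(1)] z[OF that(2)] z[OF that(3)]] indep that(4-6) by blast
  obtain k where k: "qc S = cst k * conic5 (v s1) (v s2) (v s3) (v s4) (v s5)"
    by (rule quad5_unique[OF q(1), of "v s1" "v s2" "v s3" "v s4" "v s5"]) ((rule z br; use s(1) in simp)+, blast)
  have "qc S \<noteq> 0" using q(2) by auto
  from secantD[OF sec k this] have D: "(bil (qc S) (v a) (v b))^2 \<noteq> ev (qc S) (v a) * ev (qc S) (v b)" .
  have "bS S \<odot> v a = 0" "bS S \<odot> v b = 0" using bS(2)[OF S] ab by (auto simp: on_line_def)
  thus ?thesis unfolding cS_def
    by (intro mult_line_conic_secant[OF q bS(1)[OF S] _ _ indep[OF ab(1)] D])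
qed

lemma mult_cT_secant:
  assumes T: "T \<in> I" and np: "\<not> partner T" and s: "distinct [s1, s2, s3, s4, s5]" "{s1, s2, s3, s4, s5} = - T"
    and ab: "a \<noteq> b" "a \<in> T" "b \<in> T" and sec: "secant s1 s2 s3 s4 s5 a b"
  shows "mult_discriminant (cT T) = 2"
proof -
  obtain k where k: "qT T = cst k * conic5 (v s1) (v s2) (v s3) (v s4) (v s5)"
    using residual_conic5(2)[OF T np s qT(1,3)[OF T]] by blast
  from secantD[OF sec k qT(2)[OF T]] have D: "(bil (qT T) (v a) (v b))^2 \<noteq> ev (qT T) (v a) * ev (qT T) (v b)" .
  have irr: "irreducible (qT T)"
  proof (rule irreducible_quadI[OF qT(1,2)[OF T]])
    fix b c
    have "k \<noteq> 0" using k qT(2)[OF T] by auto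
    hence "conic5 (v s1) (v s2) (v s3) (v s4) (v s5) = cst (1 / k) * qT T"
      by (simp add: k mult.assoc[symmetric] cst_mult cst_1)
    moreover have "conic5 (v s1) (v s2) (v s3) (v s4) (v s5) \<noteq> lin ((1 / k) *s b) * lin c"
      using irreducible_quadD[OF residual_conic5(1)[OF T np s]] .
    ultimately show "qT T \<noteq> lin b * lin c" by (auto simp: lin_scale mult_ac)
  qed
  have "la T \<odot> v a = 0" "la T \<odot> v b = 0" using la(2)[OF T] ab by (auto simp: on_line_def)
  thus ?thesis unfolding cT_def
    by (intro mult_line_conic_secant[OF qT(1)[OF T] irr la(1)[OF T] _ _ indep[OF ab(1)] D])
qed

lemma mult_cT_triangle:
  assumes T: "T \<in> I" "T' \<in> I" "T \<inter> T' = {}" and ab: "a \<in> T" "b \<in> T" "a \<noteq> b" and cd: "c \<in> T'" "d \<in> T'" "c \<noteq> d"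
    and ef: "e \<notin> T \<union> T'" "f \<notin> T \<union> T'" "e \<noteq> f"
    and nz: "br (crs (v a) (v b)) (crs (v c) (v d)) (crs (v e) (v f)) \<noteq> 0"
  shows "mult_discriminant (cT T) = 3"
proof -
  have "card (T \<union> T') = 6" using cardI T by (subst card_Un_disjoint) auto
  hence "card (- (T \<union> T')) = 2" by (simp only: card_Compl8)
  moreover have "{e, f} \<subseteq> - (T \<union> T')" using ef by blast
  ultimately have ef': "- (T \<union> T') = {e, f}" using ef(3) card_seteq[of "- (T \<union> T')" "{e, f}"] by simp
  obtain k where k: "crs (v a) (v b) = k *s la T"
    using line_unique[OF ab(3) indep[OF ab(3)] la(1)[OF T(1)]] la(2)[OF T(1)] ab by (auto simp: on_line_def)
  obtain l where l: "crs (v c) (v d) = l *s la T'"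
    using line_unique[OF cd(3) indep[OF cd(3)] la(1)[OF T(2)]] la(2)[OF T(2)] cd by (auto simp: on_line_def)
  have "br (la T) (la T') (crs (v e) (v f)) \<noteq> 0"
    using nz by (auto simp: k l br_def dot3_simps)
  from mult_triangle[OF this] show ?thesis unfolding cT_partner[OF T ef' ef(3)] .
qed

end

lemma bezout_configI:
  assumes "p \<in> realizations (I, J)" "bezoutian (I, J)"
  obtains v where "bezout_config v I J" "p = (\<lambda>i. pcl (v i))"
proof -
  have "p \<in> configs" using assms(1) by (simp add: realizations_def)
  then obtain v where v: "\<And>i. v i \<noteq> 0" "p = (\<lambda>i. pcl (v i))" by (rule configsE) auto
  have "bezout_config v I J"
    using assms unfolding v(2) realizations_pcl_iff[OF v(1)] bezoutian_def by unfold_locales auto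
  thus ?thesis using that v(2) by blast
qed

lemma m_quatroid_eqI:
  assumes b: "bezoutian (I, J)" and p: "p \<in> realizations (I, J)" "m_config p = generic_m I J"
  shows "m_quatroid (I, J) = generic_m I J"
  unfolding m_quatroid_def
proof (rule Least_equality)
  show "\<exists>p\<in>realizations (I, J). generic_m I J = m_config p" using p by metis
  fix k assume "\<exists>p\<in>realizations (I, J). k = m_config p"
  then obtain p where p: "p \<in> realizations (I, J)" "k = m_config p" by blast
  obtain v where "bezout_config v I J" "p = (\<lambda>i. pcl (v i))" using bezout_configI[OF p(1) b] by blast
  thus "generic_m I J \<le> k" using bezout_config.m_config_ge p(2) by simp
qed

unbundle no Formal_Power_Series.fps_syntax

section \<open>Labelled configurations given by lists\<close>

text \<open>Labels \<open>1, \<dots>, 8\<close> as natural numbers, so that incidences can be computed with lists.\<close>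

abbreviation lab :: "nat \<Rightarrow> 8" where "lab \<equiv> of_nat"

definition unlab :: "8 \<Rightarrow> nat" where "unlab = inv_into {1..8} lab"

lemma bij_lab: "bij_betw lab {1..8} UNIV"
proof -
  have "UNIV = lab ` {1..8}"
  proof -
    have "i \<in> lab ` {1..8}" for i :: 8
    proof (cases i)
      case (of_int z)
      hence z: "0 \<le> z" "z < 8" by simp_all
      show ?thesis
      proof (cases "z = 0")
        case True thus ?thesis using of_int by (intro image_eqI[of _ _ 8]) auto
      next
        case False
        hence "i = lab (nat z)" "nat z \<in> {1..8}" using z of_int by auto
        thus ?thesis by blast
      qed
    qed
    thus ?thesis by blast
  qed
  moreover from this have "inj_on lab {1..8}" by (intro eq_card_imp_inj_on) auto
  ultimately show ?thesis by (simp add: bij_betw_def)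
qed

lemma lab_unlab [simp]: "lab (unlab i) = i"
  unfolding unlab_def using bij_lab by (metis UNIV_I bij_betw_imp_surj_on f_inv_into_f)

lemma unlab_lab: "k \<in> {1..8} \<Longrightarrow> unlab (lab k) = k"
  unfolding unlab_def using bij_lab by (metis bij_betw_imp_inj_on inv_into_f_f)

lemma unlab_range: "unlab i \<in> {1..8}"
  unfolding unlab_def using bij_lab by (metis UNIV_I bij_betw_imp_surj_on inv_into_into)

lemma lab_eq_iff: "k \<in> {1..8} \<Longrightarrow> l \<in> {1..8} \<Longrightarrow> lab k = lab l \<longleftrightarrow> k = l"
  using bij_lab by (metis bij_betw_imp_inj_on inj_on_eq_iff)

definition lset :: "nat list \<Rightarrow> 8 set" where "lset l = lab ` set l"
definition lsets :: "nat list list \<Rightarrow> 8 set set" where "lsets ls = lset ` set ls"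

text \<open>Each set of \<open>n\<close> labels is represented by one list, in increasing order, so
  equality of sets becomes equality of lists.\<close>

definition subs :: "nat \<Rightarrow> nat list list"
  where "subs n = filter (\<lambda>l. length l = n) (subseqs [1..<9])"

lemma subs_props:
  assumes "l \<in> set (subs n)"
  shows "length l = n" "distinct l" "set l \<subseteq> {1..8}"
proof -
  have l: "l \<in> set (subseqs [1..<9])" "length l = n" using assms by (auto simp: subs_def)
  show "length l = n" "distinct l" using l(2) subseqs_distinctD[OF l(1)] by simp_all
  have "set l \<in> Pow (set [1..<9])" using l(1) subseqs_powset[of "[1..<9::nat]"] by blast
  thus "set l \<subseteq> {1..8}" by auto
qed

lemma subs_inj: "l \<in> set (subs n) \<Longrightarrow> l' \<in> set (subs n') \<Longrightarrow> set l = set l' \<Longrightarrow> l = l'"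
  using distinct_set_subseqs[of "[1..<9::nat]"] by (auto simp: subs_def distinct_map inj_on_def)

lemma lset_inj:
  assumes "set l \<subseteq> {1..8}" "set l' \<subseteq> {1..8}" "lset l \<subseteq> lset l'" shows "set l \<subseteq> set l'"
proof
  fix x assume x: "x \<in> set l"
  hence "lab x \<in> lset l'" using assms(3) by (auto simp: lset_def)
  then obtain y where y: "y \<in> set l'" "lab x = lab y" by (auto simp: lset_def)
  hence "x = y" using lab_eq_iff[of x y] x assms(1,2) by blast
  thus "x \<in> set l'" using y by simp
qed

lemma lset_eq_iff: "set l \<subseteq> {1..8} \<Longrightarrow> set l' \<subseteq> {1..8} \<Longrightarrow> lset l = lset l' \<longleftrightarrow> set l = set l'"
  using lset_inj[of l l'] lset_inj[of l' l] unfolding lset_def by blast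

lemma card_lset: "set l \<subseteq> {1..8} \<Longrightarrow> card (lset l) = card (set l)"
  unfolding lset_def using bij_lab by (intro card_image) (metis bij_betw_imp_inj_on inj_on_subset)

lemma lset_Int: "set l \<subseteq> {1..8} \<Longrightarrow> set l' \<subseteq> {1..8} \<Longrightarrow> lset l \<inter> lset l' = lab ` (set l \<inter> set l')"
  unfolding lset_def using bij_lab by (metis bij_betw_imp_inj_on inj_on_image_Int)

lemma ex_subs: fixes T :: "8 set" assumes "card T = n" shows "\<exists>l\<in>set (subs n). lset l = T"
proof -
  have "unlab ` T \<in> Pow (set [1..<9])" using unlab_range by (auto simp: image_subset_iff less_eq_Suc_le)
  then obtain l where l: "l \<in> set (subseqs [1..<9])" "set l = unlab ` T"
    using subseqs_powset[of "[1..<9::nat]"] by (metis (no_types, lifting) image_iff)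
  have T: "lset l = T" by (simp add: lset_def l(2) image_image)
  have "set l \<subseteq> {1..8}" using l(2) unlab_range by auto
  hence "length l = n"
    using card_lset[of l] T assms distinct_card[OF subseqs_distinctD[OF l(1)]] by simp
  thus ?thesis using l(1) T by (auto simp: subs_def)
qed

lemma lset_in_lsets_iff:
  assumes "l \<in> set (subs n)" "set ls \<subseteq> set (subs n)"
  shows "lset l \<in> lsets ls \<longleftrightarrow> l \<in> set ls"
proof
  assume "lset l \<in> lsets ls"
  then obtain l' where l': "l' \<in> set ls" "lset l = lset l'" by (auto simp: lsets_def)
  hence l'': "l' \<in> set (subs n)" using assms(2) by blast
  have "set l = set l'" using l'(2) lset_eq_iff[OF subs_props(3)[OF assms(1)] subs_props(3)[OF l'']] by blast
  hence "l = l'" by (rule subs_inj[OF assms(1) l''])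
  thus "l \<in> set ls" using l'(1) by simp
qed (auto simp: lsets_def)

definition br3 :: "(nat \<Rightarrow> complex^3) \<Rightarrow> nat list \<Rightarrow> complex"
  where "br3 u l = br (u (l!0)) (u (l!1)) (u (l!2))"

definition con6 :: "(nat \<Rightarrow> complex^3) \<Rightarrow> nat list \<Rightarrow> complex"
  where "con6 u l = ev (conic5 (u (l!0)) (u (l!1)) (u (l!2)) (u (l!3)) (u (l!4))) (u (l!5))"

definition has_triple :: "nat list list \<Rightarrow> nat list \<Rightarrow> bool"
  where "has_triple Is l \<longleftrightarrow> (\<exists>t\<in>set Is. set t \<subseteq> set l)"

text \<open>The last clause extends every pair of labels to a non-collinear triple. In a
  configuration satisfying \<open>config_ok\<close> its bracket is nonzero, which makes the two
  points distinct.\<close>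

definition good_lists :: "nat list list \<Rightarrow> nat list list \<Rightarrow> bool"
  where "good_lists Is Js \<longleftrightarrow> set Is \<subseteq> set (subs 3) \<and> set Js \<subseteq> set (subs 6) \<and>
    (\<forall>l\<in>set Js. \<not> has_triple Is l) \<and>
    (\<forall>p\<in>set (subs 2). \<exists>l\<in>set (subs 3). l \<notin> set Is \<and> set p \<subseteq> set l)"

text \<open>Sextuples containing a collinear triple are exempt from the second condition: they lie
  on no irreducible conic, although \<open>con6\<close> vanishes for instance on two collinear
  triples.\<close>

definition config_ok :: "(nat \<Rightarrow> complex^3) \<Rightarrow> nat list list \<Rightarrow> nat list list \<Rightarrow> bool"
  where "config_ok u Is Js \<longleftrightarrow> (\<forall>l\<in>set (subs 3). br3 u l = 0 \<longleftrightarrow> l \<in> set Is) \<and>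
    (\<forall>l\<in>set (subs 6). has_triple Is l \<or> (con6 u l = 0 \<longleftrightarrow> l \<in> set Js))"

definition relab :: "(nat \<Rightarrow> complex^3) \<Rightarrow> 8 \<Rightarrow> complex^3" where "relab u i = u (unlab i)"

lemma relab_lab: "k \<in> {1..8} \<Longrightarrow> relab u (lab k) = u k" by (simp add: relab_def unlab_lab)

lemma config_ok_indep:
  assumes g: "good_lists Is Js" and c: "config_ok u Is Js" and ij: "i \<noteq> j"
  shows "crs (relab u i) (relab u j) \<noteq> 0"
proof -
  have "card {i, j} = 2" using ij by simp
  then obtain p where p: "p \<in> set (subs 2)" "lset p = {i, j}" using ex_subs by blast
  then obtain l where l: "l \<in> set (subs 3)" "l \<notin> set Is" "set p \<subseteq> set l"
    using g by (auto simp: good_lists_def)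
  have b: "br3 u l \<noteq> 0" using c l by (auto simp: config_ok_def)
  obtain x y z where xyz: "l = [x, y, z]" using subs_props(1)[OF l(1)] by (auto simp: length_Suc_conv numeral_eq_Suc)
  have k: "unlab i \<in> set l" "unlab j \<in> set l" "unlab i \<noteq> unlab j"
  proof -
    have "i \<in> lset p" "j \<in> lset p" using p(2) by auto
    moreover have "k \<in> lset p \<Longrightarrow> unlab k \<in> set p" for k using unlab_lab subs_props(3)[OF p(1)] by (auto simp: lset_def)
    ultimately show "unlab i \<in> set l" "unlab j \<in> set l" using l(3) by auto
    show "unlab i \<noteq> unlab j" using ij by (metis lab_unlab)
  qed
  have n: "crs (u x) (u y) \<noteq> 0" "crs (u x) (u z) \<noteq> 0" "crs (u y) (u z) \<noteq> 0"
    using crs_nz_of_br b by (auto simp: br3_def xyz)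
  hence "crs (u y) (u x) \<noteq> 0" "crs (u z) (u x) \<noteq> 0" "crs (u z) (u y) \<noteq> 0"
    using crs_eq_0_swap by blast+
  thus ?thesis using n k by (auto simp: xyz relab_def)
qed

lemma config_ok_realization:
  assumes g: "good_lists Is Js" and c: "config_ok u Is Js"
  shows "(\<lambda>i. pcl (relab u i)) \<in> realizations (lsets Is, lsets Js)"
proof -
  let ?w = "relab u"
  note ind = config_ok_indep[OF g c]
  have nz: "?w i \<noteq> 0" for i using ind[of i "i + 1"] by (auto simp: coord_simps)
  have gI: "set Is \<subseteq> set (subs 3)" and gJ: "set Js \<subseteq> set (subs 6)" and gn: "\<And>l. l \<in> set Js \<Longrightarrow> \<not> has_triple Is l"
    using g by (auto simp: good_lists_def)
  have cI: "card T = 3" if "T \<in> lsets Is" for T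
    using that gI subs_props[of _ 3] card_lset distinct_card by (fastforce simp: lsets_def)
  have cJ: "card S = 6" if "S \<in> lsets Js" for S
    using that gJ subs_props[of _ 6] card_lset distinct_card by (fastforce simp: lsets_def)
  have ln: "(\<exists>a. a \<noteq> 0 \<and> (\<forall>i\<in>lset l. a \<odot> ?w i = 0)) \<longleftrightarrow> br3 u l = 0" if l: "l \<in> set (subs 3)" for l
  proof -
    obtain x y z where xyz: "l = [x, y, z]" using subs_props(1)[OF l] by (auto simp: length_Suc_conv numeral_eq_Suc)
    have r: "x \<in> {1..8}" "y \<in> {1..8}" "z \<in> {1..8}" "x \<noteq> y" using subs_props(2,3)[OF l] by (auto simp: xyz)
    have e: "(\<forall>i\<in>lset l. a \<odot> ?w i = 0) \<longleftrightarrow> a \<odot> u x = 0 \<and> a \<odot> u y = 0 \<and> a \<odot> u z = 0" for a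
      unfolding lset_def xyz using r by (simp add: relab_lab)
    have "crs (u x) (u y) \<noteq> 0" using ind[of "lab x" "lab y"] r lab_eq_iff[of x y] by (simp add: relab_lab)
    thus ?thesis unfolding e unfolding br3_def xyz
      using orth_br_eq_0[of _ "u x" "u y" "u z"] by (auto simp: br_def intro!: exI[of _ "crs (u x) (u y)"])
  qed
  have cn: "(\<exists>q. is_conic q \<and> (\<forall>i\<in>lset l. ev q (?w i) = 0)) \<longleftrightarrow> \<not> has_triple Is l \<and> con6 u l = 0"
    if l: "l \<in> set (subs 6)" for l
  proof -
    obtain a b c' d e f where xyz: "l = [a, b, c', d, e, f]" using subs_props(1)[OF l] by (auto simp: length_Suc_conv numeral_eq_Suc)
    have r: "set l \<subseteq> {1..8}" "distinct l" using subs_props(2,3)[OF l] by auto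
    have ev: "(\<forall>i\<in>lset l. ev q (?w i) = 0) \<longleftrightarrow> ev q (u a) = 0 \<and> ev q (u b) = 0 \<and> ev q (u c') = 0
      \<and> ev q (u d) = 0 \<and> ev q (u e) = 0 \<and> ev q (u f) = 0" for q
      unfolding lset_def xyz using r(1) by (simp add: relab_lab xyz)
    have pw: "crs (u x) (u y) \<noteq> 0" if "x \<in> set l" "y \<in> set l" "x \<noteq> y" for x y
    proof -
      have "x \<in> {1..8}" "y \<in> {1..8}" using that r by auto
      thus ?thesis using ind[of "lab x" "lab y"] lab_eq_iff[of x y] that(3) by (simp add: relab_lab)
    qed
    have tri: "\<exists>t\<in>set (subs 3). set t = {x, y, z}" if "x \<in> set l" "y \<in> set l" "z \<in> set l" "x \<noteq> y" "x \<noteq> z" "y \<noteq> z" for x y z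
    proof -
      have s: "set [x, y, z] \<subseteq> {1..8}" using that r(1) by auto
      have "card (lset [x, y, z]) = 3" using card_lset[OF s] that by simp
      then obtain t where t: "t \<in> set (subs 3)" "lset t = lset [x, y, z]" using ex_subs by blast
      hence "set t = set [x, y, z]" using lset_eq_iff[OF subs_props(3)[OF t(1)] s] by blast
      thus ?thesis using t(1) by auto
    qed
    have brt: "br (u x) (u y) (u z) = 0 \<longleftrightarrow> (\<exists>t\<in>set Is. set t = {x, y, z})"
      if h: "x \<in> set l" "y \<in> set l" "z \<in> set l" "x \<noteq> y" "x \<noteq> z" "y \<noteq> z" for x y z
    proof -
      obtain t where t: "t \<in> set (subs 3)" "set t = {x, y, z}" using tri[OF h] by blast
      have "t' = t" if "t' \<in> set Is" "set t' = {x, y, z}" for t'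
        using subs_inj[of t' 3 t 3] that t gI by auto
      hence e: "(\<exists>t\<in>set Is. set t = {x, y, z}) \<longleftrightarrow> t \<in> set Is" using t by blast
      obtain i j k where ijk: "t = [i, j, k]" using subs_props(1)[OF t(1)] by (auto simp: length_Suc_conv numeral_eq_Suc)
      have dt: "i \<noteq> j" "i \<noteq> k" "j \<noteq> k" using subs_props(2)[OF t(1)] by (auto simp: ijk)
      have "x \<in> {i, j, k}" "y \<in> {i, j, k}" "z \<in> {i, j, k}" using t(2) by (auto simp: ijk)
      hence "br (u x) (u y) (u z) = 0 \<longleftrightarrow> br (u i) (u j) (u k) = 0"
        using h(4-6) br_perms_eq_0[of "u i" "u j" "u k"] br_perms_eq_0[of "u x" "u y" "u z"] by auto
      moreover have "br (u i) (u j) (u k) = 0 \<longleftrightarrow> t \<in> set Is"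
        using c t(1) by (auto simp: config_ok_def br3_def ijk)
      ultimately show ?thesis using e by blast
    qed
    show ?thesis
    proof (cases "has_triple Is l")
      case True
      then obtain t where t: "t \<in> set Is" "set t \<subseteq> set l" by (auto simp: has_triple_def)
      hence t3: "t \<in> set (subs 3)" using gI by blast
      obtain i j k where ijk: "t = [i, j, k]" using subs_props(1)[OF t3] by (auto simp: length_Suc_conv numeral_eq_Suc)
      have d: "i \<noteq> j" "i \<noteq> k" "j \<noteq> k" "i \<in> set l" "j \<in> set l" "k \<in> set l"
        using subs_props(2)[OF t3] t(2) by (auto simp: ijk)
      have "br (u i) (u j) (u k) = 0" using c t3 t(1) by (auto simp: config_ok_def br3_def ijk)
      hence "\<not> (\<exists>q. is_conic q \<and> ev q (u i) = 0 \<and> ev q (u j) = 0 \<and> ev q (u k) = 0)"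
        using irreducible_no_collinear pw d by (metis is_conic_def)
      moreover have "ev q (u i) = 0 \<and> ev q (u j) = 0 \<and> ev q (u k) = 0" if "\<forall>i\<in>lset l. ev q (?w i) = 0" for q
      proof -
        have "x \<in> set l \<Longrightarrow> ev q (u x) = 0" for x using that r(1) by (auto simp: lset_def relab_lab subset_iff)
        thus ?thesis using d by blast
      qed
      ultimately show ?thesis using True by blast
    next
      case False
      have brn: "br (u x) (u y) (u z) \<noteq> 0" if h: "x \<in> set l" "y \<in> set l" "z \<in> set l" "x \<noteq> y" "x \<noteq> z" "y \<noteq> z" for x y z
        using False brt[OF h] h by (auto simp: has_triple_def)
      show ?thesis unfolding ev unfolding con6_def
        using False six_on_conic_iff[of "u a" "u b" "u c'" "u d" "u e" "u f"] pw brn r(2)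
        by (simp add: xyz)
    qed
  qed
  have "T \<in> lsets Is \<longleftrightarrow> card T = 3 \<and> (\<exists>a. a \<noteq> 0 \<and> (\<forall>i\<in>T. a \<odot> ?w i = 0))" for T
  proof (cases "card T = 3")
    case True
    then obtain l where l: "l \<in> set (subs 3)" "T = lset l" using ex_subs by blast
    show ?thesis unfolding l(2) lset_in_lsets_iff[OF l(1) gI] ln[OF l(1)]
      using c l True by (auto simp: config_ok_def)
  qed (use cI in blast)
  moreover have "S \<in> lsets Js \<longleftrightarrow> card S = 6 \<and> (\<exists>q. is_conic q \<and> (\<forall>i\<in>S. ev q (?w i) = 0))" for S
  proof (cases "card S = 6")
    case True
    then obtain l where l: "l \<in> set (subs 6)" "S = lset l" using ex_subs by blast
    show ?thesis unfolding l(2) lset_in_lsets_iff[OF l(1) gJ] cn[OF l(1)]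
      using c l True gn[of l] by (auto simp: config_ok_def)
  qed (use cJ in blast)
  ultimately show ?thesis unfolding realizations_pcl_iff[OF nz] using ind by blast
qed

section \<open>Closures of realization spaces\<close>

lemma bij_image_mem_iff: "bij \<sigma> \<Longrightarrow> \<sigma> ` A \<in> (`) \<sigma> ` X \<longleftrightarrow> A \<in> X"
  by (auto simp: bij_def inj_image_eq_iff)

lemma realizations_permute:
  assumes b: "bij \<sigma>" and r: "(\<lambda>i. pcl (w (\<sigma> i))) \<in> realizations (I, J)" and nz: "\<And>i. w i \<noteq> 0"
  shows "(\<lambda>i. pcl (w i)) \<in> realizations (permute \<sigma> (I, J))"
proof -
  note R = r[unfolded realizations_pcl_iff[of "\<lambda>i. w (\<sigma> i)", OF nz]]
  have s: "\<exists>i. j = \<sigma> i" for j using b by (metis bij_pointE)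
  have im: "\<exists>U. T = \<sigma> ` U" for T using b by (metis bij_def image_vimage_eq inf_top.right_neutral surj_image_vimage_eq)
  have c: "card (\<sigma> ` U) = card U" for U using b by (metis bij_def card_image inj_on_subset subset_UNIV)
  have "crs (w i) (w j) \<noteq> 0" if "i \<noteq> j" for i j
  proof -
    obtain i' j' where ij: "i = \<sigma> i'" "j = \<sigma> j'" using s by metis
    hence "i' \<noteq> j'" using that by auto
    thus ?thesis using R unfolding ij by blast
  qed
  moreover have "T \<in> (`) \<sigma> ` I \<longleftrightarrow> card T = 3 \<and> (\<exists>a. a \<noteq> 0 \<and> (\<forall>i\<in>T. a \<odot> w i = 0))" for T
  proof -
    obtain U where U: "T = \<sigma> ` U" using im by blast
    show ?thesis unfolding U bij_image_mem_iff[OF b] c using R by simp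
  qed
  moreover have "T \<in> (`) \<sigma> ` J \<longleftrightarrow> card T = 6 \<and> (\<exists>q. is_conic q \<and> (\<forall>i\<in>T. ev q (w i) = 0))" for T
  proof -
    obtain U where U: "T = \<sigma> ` U" using im by blast
    show ?thesis unfolding U bij_image_mem_iff[OF b] c using R by simp
  qed
  ultimately show ?thesis unfolding permute_def fst_conv snd_conv realizations_pcl_iff[OF nz] by blast
qed

text \<open>A polynomial vanishing on \<open>S\<close> vanishes along the curve wherever
  \<open>d\<close> is nonzero, hence also at \<open>s = 0\<close>. Vanishing at \<open>p\<close> is
  tested on all representatives, so a curve is requested through each of them.\<close>

lemma closure_by_curves:
  assumes p: "p \<in> configs"
    and curve: "\<And>x. (\<forall>i. x i \<in> p i) \<Longrightarrow> \<exists>w d. (\<forall>i j. polyfun (\<lambda>s. w s i $ j)) \<and> (w 0 = x) \<and>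
      polyfun d \<and> d 1 \<noteq> 0 \<and> (\<forall>s. d s \<noteq> 0 \<longrightarrow> (\<lambda>i. pcl (w s i)) \<in> S)"
  shows "p \<in> zariski_closure S"
  unfolding zariski_closure_def
proof (intro CollectI conjI allI impI p)
  fix d F assume van: "\<forall>q\<in>S. vanishes_at_config F q"
  show "vanishes_at_config F p"
    unfolding vanishes_at_config_def
  proof (intro allI impI)
    fix x :: "8 \<Rightarrow> complex^3" assume "\<forall>i. x i \<in> p i"
    then obtain w :: "complex \<Rightarrow> 8 \<Rightarrow> complex^3" and D where w: "\<And>i j. polyfun (\<lambda>s. w s i $ j)" "w 0 = x" "polyfun D" "D 1 \<noteq> 0"
      "\<And>s. D s \<noteq> 0 \<Longrightarrow> (\<lambda>i. pcl (w s i)) \<in> S" using curve by blast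
    have pf: "polyfun (\<lambda>s. eval F (\<lambda>(i, j). w s i $ j))"
      by (rule polyfun_eval) (use w(1) in \<open>auto split: prod.split\<close>)
    have "eval F (\<lambda>(i, j). w 0 i $ j) = 0"
    proof (rule polyfun_zero[OF pf w(3,4)])
      fix s assume "D s \<noteq> 0"
      hence "vanishes_at_config F (\<lambda>i. pcl (w s i))" using w(5) van by blast
      thus "eval F (\<lambda>(i, j). w s i $ j) = 0" unfolding vanishes_at_config_def using self_in_pcl by blast
    qed
    thus "eval F (\<lambda>(i, j). x i $ j) = 0" using w(2) by simp
  qed
qed

lemma polyfun_br:
  fixes a b c :: "complex \<Rightarrow> complex^3"
  assumes "\<And>j. polyfun (\<lambda>s. a s $ j)" "\<And>j. polyfun (\<lambda>s. b s $ j)" "\<And>j. polyfun (\<lambda>s. c s $ j)"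
  shows "polyfun (\<lambda>s. br (a s) (b s) (c s))"
  unfolding br_def dot3_def crs_def vector_3 by (intro polyfun_add polyfun_mult polyfun_diff assms)

text \<open>\<open>d\<close> is the product of all brackets and conic conditions that must not
  vanish. It is nonzero at \<open>s = 1\<close>, while the required equations hold along the whole
  curve.\<close>

lemma generic_member:
  fixes u :: "complex \<Rightarrow> nat \<Rightarrow> complex^3"
  assumes pf: "\<And>k j. polyfun (\<lambda>s. u s k $ j)" and one: "config_ok (u 1) Is Js"
    and I: "\<And>s l. l \<in> set Is \<Longrightarrow> br3 (u s) l = 0" and J: "\<And>s l. l \<in> set Js \<Longrightarrow> con6 (u s) l = 0"
  shows "\<exists>d. polyfun d \<and> d 1 \<noteq> 0 \<and> (\<forall>s. d s \<noteq> 0 \<longrightarrow> config_ok (u s) Is Js)"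
proof -
  define A where "A = set (subs 3) - set Is"
  define B where "B = {l \<in> set (subs 6). \<not> has_triple Is l \<and> l \<notin> set Js}"
  define d where "d s = (\<Prod>l\<in>A. br3 (u s) l) * (\<Prod>l\<in>B. con6 (u s) l)" for s
  have fin: "finite A" "finite B" by (auto simp: A_def B_def)
  have b3: "polyfun (\<lambda>s. br3 (u s) l)" for l unfolding br3_def by (intro polyfun_br pf)
  have c6: "polyfun (\<lambda>s. con6 (u s) l)" for l unfolding con6_def ev_conic5
    by (intro polyfun_diff polyfun_mult polyfun_br pf)
  have "polyfun d" unfolding d_def by (intro polyfun_mult polyfun_prod b3 c6)
  moreover have "d 1 \<noteq> 0" using one fin by (auto simp: d_def config_ok_def A_def B_def)
  moreover have "config_ok (u s) Is Js" if "d s \<noteq> 0" for s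
  proof -
    have "br3 (u s) l \<noteq> 0" if "l \<in> A" for l using \<open>d s \<noteq> 0\<close> that fin by (auto simp: d_def)
    moreover have "con6 (u s) l \<noteq> 0" if "l \<in> B" for l using \<open>d s \<noteq> 0\<close> that fin by (auto simp: d_def)
    ultimately show ?thesis unfolding config_ok_def using I J by (auto simp: A_def B_def)
  qed
  ultimately show ?thesis by blast
qed

section \<open>Collinearity and the conic condition as closed conditions\<close>

definition cvar :: "8 \<Rightarrow> 3 \<Rightarrow> (8 \<times> 3) cpoly" where "cvar i j = Poly_Mapping.single (Poly_Mapping.single (i, j) 1) 1"

definition bra_poly :: "8 \<Rightarrow> 8 \<Rightarrow> 8 \<Rightarrow> (8 \<times> 3) cpoly"
  where "bra_poly a b c = (cvar a 2 * cvar b 3 - cvar a 3 * cvar b 2) * cvar c 1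
    + (cvar a 3 * cvar b 1 - cvar a 1 * cvar b 3) * cvar c 2 + (cvar a 1 * cvar b 2 - cvar a 2 * cvar b 1) * cvar c 3"

lemma eval_cvar: "eval (cvar i j) (\<lambda>(i, j). x i $ j) = x i $ j"
  by (simp add: cvar_def eval_single monom_val_single)

lemma eval_bra_poly: "eval (bra_poly a b c) (\<lambda>(i, j). x i $ j) = br (x a) (x b) (x c)"
  unfolding bra_poly_def eval_simps eval_cvar br_def dot3_def crs_def vector_3 ..

lemma multihomogeneous_add: "multihomogeneous d F \<Longrightarrow> multihomogeneous d G \<Longrightarrow> multihomogeneous d (F + G)"
  using Poly_Mapping.keys_add[of F G] unfolding multihomogeneous_def by blast

lemma multihomogeneous_diff: "multihomogeneous d F \<Longrightarrow> multihomogeneous d G \<Longrightarrow> multihomogeneous d (F - G)"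
  using multihomogeneous_add[of d F "- G"] by (simp add: multihomogeneous_def in_keys_iff)

lemma multihomogeneous_mult:
  assumes "multihomogeneous d F" "multihomogeneous e G" shows "multihomogeneous (\<lambda>i. d i + e i) (F * G)"
  unfolding multihomogeneous_def
proof (intro ballI allI)
  fix m i assume "m \<in> ks (F * G)"
  with Poly_Mapping.keys_mult[of F G] obtain a b where "m = a + b" "a \<in> ks F" "b \<in> ks G" by auto
  thus "(\<Sum>j\<in>UNIV. lk m (i, j)) = d i + e i"
    using assms by (simp add: multihomogeneous_def lookup_add sum.distrib)
qed

lemma multihomogeneous_cvar: "multihomogeneous (\<lambda>k. if k = i then 1 else 0) (cvar i j)"
  unfolding multihomogeneous_def
proof (intro ballI allI)
  fix m k assume "m \<in> ks (cvar i j)"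
  hence m: "m = Poly_Mapping.single (i, j) 1" by (simp add: cvar_def)
  have "(\<Sum>j'\<in>UNIV. lk m (k, j')) = (\<Sum>j'\<in>UNIV. if j' = j then (if k = i then 1 else 0) else 0)"
    unfolding m by (intro sum.cong) (auto simp: lookup_single when_def)
  thus "(\<Sum>j'\<in>UNIV. lk m (k, j')) = (if k = i then 1 else 0)" by simp
qed

definition pdeg :: "8 \<Rightarrow> 8 \<Rightarrow> nat" where "pdeg i k = (if k = i then 1 else 0)"

lemma multihomogeneous_bra: "multihomogeneous (\<lambda>k. pdeg a k + pdeg b k + pdeg c k) (bra_poly a b c)"
proof -
  have v: "multihomogeneous (pdeg i) (cvar i j)" for i j using multihomogeneous_cvar unfolding pdeg_def .
  have 2: "multihomogeneous (\<lambda>k. pdeg a k + pdeg b k) (cvar a i * cvar b j)" for i j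
    by (rule multihomogeneous_mult[OF v v])
  show ?thesis unfolding bra_poly_def
    by (intro multihomogeneous_add multihomogeneous_mult[OF multihomogeneous_diff[OF 2 2] v])
qed

lemma closure_vanish:
  assumes F: "multihomogeneous d F"
    and p: "(\<lambda>i. pcl (v i)) \<in> zariski_closure S" and S: "S \<subseteq> configs"
    and z: "\<And>x. (\<lambda>i. pcl (x i)) \<in> S \<Longrightarrow> (\<And>i. x i \<noteq> 0) \<Longrightarrow> eval F (\<lambda>(i, j). x i $ j) = 0"
  shows "eval F (\<lambda>(i, j). v i $ j) = 0"
proof -
  have "vanishes_at_config F q" if q: "q \<in> S" for q
    unfolding vanishes_at_config_def
  proof (intro allI impI)
    fix x :: "8 \<Rightarrow> complex^3" assume x: "\<forall>i. x i \<in> q i"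
    have "q \<in> configs" using q S by blast
    then obtain w where w: "\<And>i. w i \<noteq> 0" "q = (\<lambda>i. pcl (w i))" by (rule configsE) auto
    have nz: "x i \<noteq> 0" and e: "pcl (x i) = q i" for i
    proof -
      obtain c where c: "c \<noteq> 0" "x i = c *s w i" using x w(2) by (auto simp: pcl_def)
      show nz: "x i \<noteq> 0" using c w(1)[of i] by simp
      show "pcl (x i) = q i" unfolding w(2) using pcl_eq_iff[OF nz w(1)] c by simp
    qed
    have "(\<lambda>i. pcl (x i)) \<in> S" using q e by simp
    thus "eval F (\<lambda>(i, j). x i $ j) = 0" using z nz by blast
  qed
  hence "vanishes_at_config F (\<lambda>i. pcl (v i))" using p F unfolding zariski_closure_def by blast
  thus ?thesis unfolding vanishes_at_config_def using self_in_pcl by blast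
qed

lemma realizations_configs: "realizations Q \<subseteq> configs" by (auto simp: realizations_def)

lemma realizationsD:
  assumes r: "(\<lambda>i. pcl (x i)) \<in> realizations (I, J)" and nz: "\<And>i. x i \<noteq> 0"
  shows "i \<noteq> j \<Longrightarrow> crs (x i) (x j) \<noteq> 0"
    and "T \<in> I \<Longrightarrow> \<exists>a. a \<noteq> 0 \<and> (\<forall>i\<in>T. a \<odot> x i = 0)"
    and "S \<in> J \<Longrightarrow> \<exists>q. is_conic q \<and> (\<forall>i\<in>S. ev q (x i) = 0)"
  using r unfolding realizations_pcl_iff[of x, OF nz] by simp_all

lemma closure_collinear:
  assumes p: "(\<lambda>i. pcl (v i)) \<in> zariski_closure (realizations (I, J))" and T: "{a, b, c} \<in> I"
  shows "br (v a) (v b) (v c) = 0"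
proof -
  have "eval (bra_poly a b c) (\<lambda>(i, j). v i $ j) = 0"
  proof (rule closure_vanish[OF multihomogeneous_bra p realizations_configs])
    fix x :: "8 \<Rightarrow> complex^3" assume r: "(\<lambda>i. pcl (x i)) \<in> realizations (I, J)" and nz: "\<And>i. x i \<noteq> 0"
    obtain l where "l \<noteq> 0" "\<forall>i\<in>{a, b, c}. l \<odot> x i = 0" using realizationsD(2)[OF r nz T] by blast
    thus "eval (bra_poly a b c) (\<lambda>(i, j). x i $ j) = 0" unfolding eval_bra_poly using orth_br_eq_0[of l] by simp
  qed
  thus ?thesis unfolding eval_bra_poly .
qed

text \<open>The condition for six points is multihomogeneous: in both of its products every point
  occurs in exactly two brackets.\<close>

lemma closure_conic:
  assumes p: "(\<lambda>i. pcl (v i)) \<in> zariski_closure (realizations (I, J))" and S: "{p1, p2, p3, p4, p5, p6} \<in> J"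
    and d: "distinct [p1, p2, p3, p4, p5, p6]"
  shows "ev (conic5 (v p1) (v p2) (v p3) (v p4) (v p5)) (v p6) = 0"
proof -
  define F where "F = bra_poly p1 p3 p5 * bra_poly p2 p4 p5 * (bra_poly p1 p2 p6 * bra_poly p3 p4 p6)
    - bra_poly p1 p2 p5 * bra_poly p3 p4 p5 * (bra_poly p1 p3 p6 * bra_poly p2 p4 p6)"
  have eF: "eval F (\<lambda>(i, j). x i $ j) = ev (conic5 (x p1) (x p2) (x p3) (x p4) (x p5)) (x p6)" for x
    unfolding F_def eval_simps eval_bra_poly ev_conic5 ..
  have m4: "multihomogeneous (\<lambda>k. (pdeg a1 k + pdeg a2 k + pdeg a3 k) + (pdeg b1 k + pdeg b2 k + pdeg b3 k)
      + ((pdeg c1 k + pdeg c2 k + pdeg c3 k) + (pdeg e1 k + pdeg e2 k + pdeg e3 k)))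
    (bra_poly a1 a2 a3 * bra_poly b1 b2 b3 * (bra_poly c1 c2 c3 * bra_poly e1 e2 e3))" for a1 a2 a3 b1 b2 b3 c1 c2 c3 e1 e2 e3
    by (intro multihomogeneous_mult multihomogeneous_bra)
  have mh: "multihomogeneous (\<lambda>k. (pdeg p1 k + pdeg p2 k + pdeg p3 k + pdeg p4 k + pdeg p5 k + pdeg p6 k) + (pdeg p1 k + pdeg p2 k + pdeg p3 k + pdeg p4 k + pdeg p5 k + pdeg p6 k)) F"
    unfolding F_def
    by (rule multihomogeneous_diff)
       (use m4[of p1 p3 p5 p2 p4 p5 p1 p2 p6 p3 p4 p6] m4[of p1 p2 p5 p3 p4 p5 p1 p3 p6 p2 p4 p6] in \<open>simp_all add: algebra_simps\<close>)
  have "eval F (\<lambda>(i, j). v i $ j) = 0"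
  proof (rule closure_vanish[OF mh p realizations_configs])
    fix x :: "8 \<Rightarrow> complex^3" assume r: "(\<lambda>i. pcl (x i)) \<in> realizations (I, J)" and nz: "\<And>i. x i \<noteq> 0"
    obtain q where q: "is_conic q" "\<forall>i\<in>{p1, p2, p3, p4, p5, p6}. ev q (x i) = 0"
      using realizationsD(3)[OF r nz S] by blast
    have ind: "crs (x i) (x j) \<noteq> 0" if "i \<noteq> j" for i j by (rule realizationsD(1)[OF r nz that])
    have q2: "homogeneous 2 q" "irreducible q" using q(1) by (auto simp: is_conic_def)
    have br: "br (x i) (x j) (x k) \<noteq> 0" if "i \<in> {p1, p2, p3, p4, p5}" "j \<in> {p1, p2, p3, p4, p5}" "k \<in> {p1, p2, p3, p4, p5}"
       "i \<noteq> j" "i \<noteq> k" "j \<noteq> k" for i j k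
      by (rule irreducible_no_collinear[OF q2(2,1)]) (use q(2) ind that in auto)
    have "\<exists>f. is_conic f \<and> ev f (x p1) = 0 \<and> ev f (x p2) = 0 \<and> ev f (x p3) = 0 \<and> ev f (x p4) = 0 \<and> ev f (x p5) = 0 \<and> ev f (x p6) = 0"
      using q by blast
    thus "eval F (\<lambda>(i, j). x i $ j) = 0" unfolding eF
      by (subst (asm) six_on_conic_iff) (rule ind br; use d in simp)+
  qed
  thus ?thesis unfolding eF .
qed

section \<open>The quatroids 10 and 77\<close>

lemma list_perm:
  assumes l: "length l = 8" "distinct (l :: 8 list)"
  shows "bij (\<lambda>i. l ! (unlab i - 1))" "k \<in> {1..8} \<Longrightarrow> l ! (unlab (lab k) - 1) = l ! (k - 1)"
proof -
  have "inj (\<lambda>i. l ! (unlab i - 1))"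
  proof (rule injI)
    fix i j assume e: "l ! (unlab i - 1) = l ! (unlab j - 1)"
    have r: "unlab i \<in> {1..8}" "unlab j \<in> {1..8}" using unlab_range by auto
    have "unlab i - 1 = unlab j - 1" using e l r by (subst (asm) nth_eq_iff_index_eq) auto
    hence "unlab i = unlab j" using r by auto
    thus "i = j" by (metis lab_unlab)
  qed
  thus "bij (\<lambda>i. l ! (unlab i - 1))" by (simp add: bij_def finite_UNIV_inj_surj)
qed (simp add: unlab_lab)

lemma one_to_eight: "k \<in> {1..8} \<longleftrightarrow> k = 1 \<or> k = 2 \<or> k = 3 \<or> k = 4 \<or> k = 5 \<or> k = 6 \<or> k = 7 \<or> k = (8::nat)"
  by auto

section \<open>Curves along which the incidences persist\<close>

lemma interpolate:
  fixes a b :: "complex^3" shows "polyfun (\<lambda>s. (a + s *s (b - a)) $ j)" by auto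

lemma collinear_combination:
  assumes "crs a b \<noteq> 0" "br a b c = 0" shows "\<exists>s t. c = s *s a + t *s b"
  using span_indep[OF assms] by blast

text \<open>The points 3, 5 and 8 are combinations of two others on their lines. Interpolating the
  free points and the coefficients of these combinations linearly keeps all three collinearities for
  every parameter.\<close>

lemma curve77:
  assumes "\<And>x. x \<in> {u, w} \<Longrightarrow> crs (x 1) (x 2) \<noteq> 0 \<and> crs (x 1) (x 4) \<noteq> 0 \<and> crs (x 6) (x 7) \<noteq> 0 \<and>
     br3 x [1, 2, 3] = 0 \<and> br3 x [1, 4, 5] = 0 \<and> br3 x [6, 7, 8] = 0"
  shows "\<exists>c :: complex \<Rightarrow> nat \<Rightarrow> complex^3. (\<forall>k j. polyfun (\<lambda>s. c s k $ j)) \<and> (\<forall>k\<in>{1..8}. c 0 k = u k) \<and> (\<forall>k\<in>{1..8}. c 1 k = w k) \<and>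
    (\<forall>s. br3 (c s) [1, 2, 3] = 0 \<and> br3 (c s) [1, 4, 5] = 0 \<and> br3 (c s) [6, 7, 8] = 0)"
proof -
  have ex: "\<exists>s t. x 3 = s *s x 1 + t *s x 2" "\<exists>s t. x 5 = s *s x 1 + t *s x 4" "\<exists>s t. x 8 = s *s x 6 + t *s x 7"
    if "x \<in> {u, w}" for x
    using assms[OF that] collinear_combination by (auto simp: br3_def)
  obtain a1 a2 where a: "u 3 = a1 *s u 1 + a2 *s u 2" using ex(1)[of u] by blast
  obtain b1 b2 where b: "w 3 = b1 *s w 1 + b2 *s w 2" using ex(1)[of w] by blast
  obtain c1 c2 where c: "u 5 = c1 *s u 1 + c2 *s u 4" using ex(2)[of u] by blast
  obtain d1 d2 where d: "w 5 = d1 *s w 1 + d2 *s w 4" using ex(2)[of w] by blast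
  obtain e1 e2 where e: "u 8 = e1 *s u 6 + e2 *s u 7" using ex(3)[of u] by blast
  obtain f1 f2 where f: "w 8 = f1 *s w 6 + f2 *s w 7" using ex(3)[of w] by blast
  define x where "x s k = u k + s *s (w k - u k)" for s k
  define y where "y p q s = p + s * (q - p)" for p q s :: complex
  define C where "C s k = (if k = 3 then y a1 b1 s *s x s 1 + y a2 b2 s *s x s 2
    else if k = 5 then y c1 d1 s *s x s 1 + y c2 d2 s *s x s 4
    else if k = 8 then y e1 f1 s *s x s 6 + y e2 f2 s *s x s 7 else x s k)" for s and k :: nat
  have px: "polyfun (\<lambda>s. x s k $ j)" for k j unfolding x_def by (rule interpolate)
  have py: "polyfun (y p q)" for p q unfolding y_def by auto
  have "polyfun (\<lambda>s. C s k $ j)" for k j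
    unfolding C_def by (cases "k = 3"; cases "k = 5"; cases "k = 8") (auto intro!: polyfun_add polyfun_mult px py)
  moreover have "C 0 k = u k" "C 1 k = w k" for k
    by (simp_all add: C_def x_def y_def a b c d e f)
  moreover have "br p q (s *s p + t *s q) = 0" for p q :: "complex^3" and s t by (simp add: br_linear)
  hence "br3 (C s) [1, 2, 3] = 0 \<and> br3 (C s) [1, 4, 5] = 0 \<and> br3 (C s) [6, 7, 8] = 0" for s
    by (simp add: br3_def C_def)
  ultimately show ?thesis by (intro exI[of _ C]) simp
qed

text \<open>The parametrization of a conic by binary quadratic forms, with vector coefficients
  \<open>p\<close>, \<open>q\<close>, \<open>r\<close>. It is polynomial in the coefficients and in
  the parameters, so that both can be interpolated.\<close>

definition veronese :: "complex^3 \<Rightarrow> complex^3 \<Rightarrow> complex^3 \<Rightarrow> complex \<Rightarrow> complex \<Rightarrow> complex^3"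
  where "veronese p q r a b = (a^2) *s p + (b^2) *s q + (a * b) *s r"

lemma br_veronese: "br (veronese p q r a1 b1) (veronese p q r a2 b2) (veronese p q r a3 b3)
    = - br p q r * ((a1 * b2 - a2 * b1) * (a2 * b3 - a3 * b2) * (a1 * b3 - a3 * b1))"
  by (simp add: veronese_def coord_simps algebra_simps power2_eq_square)

text \<open>Each bracket is a fixed multiple of a product of three 2 by 2 minors of the parameters,
  and the two products in \<open>ev_conic5\<close> involve the same twelve minors. No independence
  of \<open>p\<close>, \<open>q\<close>, \<open>r\<close> enters, so the identity holds on all of an
  interpolating curve.\<close>

lemma conic5_veronese:
  "ev (conic5 (veronese p q r a1 b1) (veronese p q r a2 b2) (veronese p q r a3 b3) (veronese p q r a4 b4) (veronese p q r a5 b5))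
    (veronese p q r a6 b6) = 0"
proof -
  define m where "m i j = (fst i * snd j - fst j * snd i)" for i j :: "complex \<times> complex"
  have b: "br (veronese p q r a1 b1) (veronese p q r a2 b2) (veronese p q r a3 b3)
    = - br p q r * (m (a1, b1) (a2, b2) * m (a2, b2) (a3, b3) * m (a1, b1) (a3, b3))" for a1 b1 a2 b2 a3 b3
    by (simp add: m_def br_veronese)
  show ?thesis unfolding ev_conic5 b by (simp add: mult_ac)
qed

text \<open>In normal form the conic reads \<open>x y = k z^2\<close> and is parametrized by
  \<open>x = a^2\<close>, \<open>y = k b^2\<close>, \<open>z = a b\<close>. The given vectors
  themselves are reached, not just their projective classes, which is why square roots are
  extracted.\<close>

lemma veronese_param:
  assumes q: "homogeneous 2 q" "irreducible q" and p: "ev q p1 = 0" "ev q p2 = 0" "crs p1 p2 \<noteq> 0"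
  obtains u v w where "\<And>x. ev q x = 0 \<Longrightarrow> \<exists>a b. x = veronese u v w a b"
proof -
  \<comment> \<open>Otherwise \<open>p1 + p2\<close> would be a third zero of the irreducible
    quadric on the line \<open>p1 p2\<close>.\<close>
  have B: "bil q p1 p2 \<noteq> 0"
  proof
    assume B: "bil q p1 p2 = 0"
    have "ev q (1 *s p1 + 1 *s p2) = 0" unfolding ev_quad_expand(1)[OF q(1)] using p B by simp
    hence z: "ev q (p1 + p2) = 0" by simp
    have "crs p1 (p1 + p2) = crs p1 p2" "crs p2 (p1 + p2) = - crs p1 p2" "br p1 p2 (p1 + p2) = 0"
      by (simp_all add: coord_simps algebra_simps)
    thus False using irreducible_no_collinear[OF q(2,1) p(1,2) z p(3)] p(3) by simp
  qed
  obtain w where w: "br p1 p2 w \<noteq> 0" "ev q w \<noteq> 0"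
    "\<And>x y z. ev q (x *s p1 + y *s p2 + z *s w) = z^2 * ev q w + 2 * x * y * bil q p1 p2"
    using conic_normal_form[OF q p(3,1,2) B] by blast
  define k where "k = - ev q w / (2 * bil q p1 p2)"
  have k: "k \<noteq> 0" using w(2) B by (simp add: k_def)
  show ?thesis
  proof (rule that[of p1 "k *s p2" w])
    fix X assume X: "ev q X = 0"
    obtain x y z where xyz: "X = x *s p1 + y *s p2 + z *s w" using basis_expand[OF w(1), of X] by blast
    have "z^2 * ev q w + 2 * x * y * bil q p1 p2 = 0" using X unfolding xyz w(3) .
    hence xy: "x * y = k * z^2" using B by (simp add: k_def field_simps eq_neg_iff_add_eq_0)
    show "\<exists>a b. X = veronese p1 (k *s p2) w a b"
    proof (cases "x = 0")
      case True
      hence z: "z = 0" using xy k by simp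
      have "(csqrt (y / k))^2 * k = y" using k by simp
      thus ?thesis unfolding xyz veronese_def True z
        by (intro exI[of _ 0] exI[of _ "csqrt (y / k)"]) (simp add: vec_scale_assoc)
    next
      case False
      have c: "csqrt x \<noteq> 0" using False by simp
      have 1: "(csqrt x)^2 = x" by simp
      have "(z / csqrt x)^2 * k = z^2 * k / x" by (simp add: power_divide)
      also have "\<dots> = y" using xy False by (simp add: field_simps)
      finally have 2: "(z / csqrt x)^2 * k = y" .
      have 3: "csqrt x * (z / csqrt x) = z" using c by simp
      show ?thesis unfolding xyz veronese_def
        by (intro exI[of _ "csqrt x"] exI[of _ "z / csqrt x"]) (simp only: vec_scale_assoc 1 2 3)
    qed
  qed
qed

text \<open>A linear interpolation of the parametrizations of the two conics and of the parameters
  of the six points keeps these on a common quadric. The point 3 stays on its line as a combination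
  of 1 and 2 with interpolated coefficients.\<close>

lemma curve10:
  assumes "\<And>x. x \<in> {u, w} \<Longrightarrow> crs (x 1) (x 2) \<noteq> 0 \<and> crs (x 1) (x 4) \<noteq> 0 \<and> br3 x [1, 2, 3] = 0 \<and>
    (\<exists>q. is_conic q \<and> (\<forall>k\<in>{1, 4, 5, 6, 7, 8}. ev q (x k) = 0))"
  shows "\<exists>c :: complex \<Rightarrow> nat \<Rightarrow> complex^3. (\<forall>k j. polyfun (\<lambda>s. c s k $ j)) \<and> (\<forall>k\<in>{1..8}. c 0 k = u k) \<and> (\<forall>k\<in>{1..8}. c 1 k = w k) \<and>
    (\<forall>s. br3 (c s) [1, 2, 3] = 0 \<and> con6 (c s) [1, 4, 5, 6, 7, 8] = 0)"
proof -
  have ex: "\<exists>p q r a b. \<forall>k\<in>{1, 4, 5, 6, 7, 8}. x k = veronese p q r (a k) (b k)" if x: "x \<in> {u, w}" for x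
  proof -
    obtain f where f: "is_conic f" "\<And>k. k \<in> {1, 4, 5, 6, 7, 8} \<Longrightarrow> ev f (x k) = 0" using assms[OF x] by blast
    have f2: "homogeneous 2 f" "irreducible f" using f(1) by (auto simp: is_conic_def)
    have z: "ev f (x 1) = 0" "ev f (x 4) = 0" by (auto intro!: f(2))
    obtain p q r where pqr: "\<And>y. ev f y = 0 \<Longrightarrow> \<exists>a b. y = veronese p q r a b"
      using veronese_param[OF f2 z] assms[OF x] by metis
    have "\<forall>k\<in>{1, 4, 5, 6, 7, 8}. \<exists>ab. x k = veronese p q r (fst ab) (snd ab)"
      using pqr f(2) by fastforce
    from bchoice[OF this] obtain g where "\<forall>k\<in>{1, 4, 5, 6, 7, 8}. x k = veronese p q r (fst (g k)) (snd (g k))" by blast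
    thus ?thesis by (intro exI[of _ p] exI[of _ q] exI[of _ r] exI[of _ "\<lambda>k. fst (g k)"] exI[of _ "\<lambda>k. snd (g k)"])
  qed
  have ex2: "\<exists>s t. x 3 = s *s x 1 + t *s x 2" if "x \<in> {u, w}" for x
    using assms[OF that] collinear_combination by (auto simp: br3_def)
  obtain p q r a b where U: "\<forall>k\<in>{1, 4, 5, 6, 7, 8}. u k = veronese p q r (a k) (b k)" using ex[of u] by blast
  obtain p' q' r' a' b' where W: "\<forall>k\<in>{1, 4, 5, 6, 7, 8}. w k = veronese p' q' r' (a' k) (b' k)" using ex[of w] by blast
  obtain a1 a2 where u3: "u 3 = a1 *s u 1 + a2 *s u 2" using ex2[of u] by blast
  obtain b1 b2 where w3: "w 3 = b1 *s w 1 + b2 *s w 2" using ex2[of w] by blast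
  define X where "X x x' s = x + s *s (x' - x)" for x x' :: "complex^3" and s
  define y where "y p q s = p + s * (q - p)" for p q s :: complex
  define V where "V s k = veronese (X p p' s) (X q q' s) (X r r' s) (y (a k) (a' k) s) (y (b k) (b' k) s)" for s k
  define C where "C s k = (if k = 2 then X (u 2) (w 2) s
    else if k = 3 then y a1 b1 s *s V s 1 + y a2 b2 s *s X (u 2) (w 2) s else V s k)" for s and k :: nat
  have pX: "polyfun (\<lambda>s. X x x' s $ j)" for x x' j unfolding X_def by (rule interpolate)
  have py: "polyfun (y p q)" for p q unfolding y_def by auto
  have pV: "polyfun (\<lambda>s. V s k $ j)" for k j unfolding V_def veronese_def
    by (auto intro!: polyfun_add polyfun_mult polyfun_power pX py)
  have "polyfun (\<lambda>s. C s k $ j)" for k j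
    unfolding C_def by (cases "k = 2"; cases "k = 3") (auto intro!: polyfun_add polyfun_mult pX py pV)
  moreover have "C 0 k = u k" "C 1 k = w k" if "k \<in> {1..8}" for k
    using that U W unfolding one_to_eight by (auto simp: C_def X_def y_def V_def u3 w3)
  moreover have "br p q (s *s p + t *s q) = 0" for p q :: "complex^3" and s t by (simp add: br_linear)
  hence "br3 (C s) [1, 2, 3] = 0" for s by (simp add: br3_def C_def)
  moreover have "con6 (C s) [1, 4, 5, 6, 7, 8] = 0" for s
    by (simp add: con6_def C_def V_def conic5_veronese)
  ultimately show ?thesis by (intro exI[of _ C]) simp
qed

lemma config_ok_cong:
  assumes "\<And>k. k \<in> {1..8} \<Longrightarrow> u k = w k"
  shows "config_ok u Is Js \<longleftrightarrow> config_ok w Is Js"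
proof -
  have r: "u (l ! i) = w (l ! i)" if "l \<in> set (subs n)" "i < n" for l n i
  proof (rule assms)
    have "l ! i \<in> set l" using subs_props(1)[OF that(1)] that(2) by (intro nth_mem) simp
    thus "l ! i \<in> {1..8}" using subs_props(3)[OF that(1)] by blast
  qed
  have "br3 u l = br3 w l" if "l \<in> set (subs 3)" for l using r[OF that] by (simp add: br3_def)
  moreover have "con6 u l = con6 w l" if "l \<in> set (subs 6)" for l using r[OF that] by (simp add: con6_def)
  ultimately show ?thesis by (simp add: config_ok_def)
qed

lemma configs_reps:
  assumes p: "p \<in> configs" and x: "\<And>i. x i \<in> p i"
  shows "x i \<noteq> 0" "(\<lambda>i. pcl (x i)) = p"
proof -
  obtain w where w: "\<And>i. w i \<noteq> 0" "p = (\<lambda>i. pcl (w i))" using p by (rule configsE) auto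
  have *: "x i \<noteq> 0 \<and> pcl (x i) = p i" for i
  proof -
    obtain c where c: "c \<noteq> 0" "x i = c *s w i" using x[of i] w(2) by (auto simp: pcl_def)
    have nz: "x i \<noteq> 0" using c w(1)[of i] by simp
    thus ?thesis unfolding w(2) using pcl_eq_iff[OF nz w(1)] c by simp
  qed
  show "x i \<noteq> 0" using * by blast
  show "(\<lambda>i. pcl (x i)) = p" using * by auto
qed

text \<open>The list \<open>l\<close> names the labels of \<open>p\<close> that play the roles 1 to
  8 of the model; list positions start at 0, hence the shift by one.\<close>

lemma closure_permuted:
  fixes l :: "8 list"
  assumes l: "length l = 8" "distinct l" and g: "good_lists Is Js" and p: "p \<in> configs"
    and c: "\<And>x. (\<forall>i. x i \<in> p i) \<Longrightarrow> \<exists>c :: complex \<Rightarrow> nat \<Rightarrow> complex^3. (\<forall>k j. polyfun (\<lambda>s. c s k $ j)) \<and>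
      (\<forall>k\<in>{1..8}. c 0 k = x (l ! (k - 1))) \<and> config_ok (c 1) Is Js \<and>
      (\<forall>s. (\<forall>t\<in>set Is. br3 (c s) t = 0) \<and> (\<forall>t\<in>set Js. con6 (c s) t = 0))"
  shows "p \<in> zariski_closure (realizations (permute (\<lambda>i. l ! (unlab i - 1)) (lsets Is, lsets Js)))"
proof (rule closure_by_curves[OF p])
  fix x :: "8 \<Rightarrow> complex^3" assume "\<forall>i. x i \<in> p i"
  from c[OF this] obtain c :: "complex \<Rightarrow> nat \<Rightarrow> complex^3" where c: "\<And>k j. polyfun (\<lambda>s. c s k $ j)"
    "\<And>k. k \<in> {1..8} \<Longrightarrow> c 0 k = x (l ! (k - 1))" "config_ok (c 1) Is Js"
    "\<And>s t. t \<in> set Is \<Longrightarrow> br3 (c s) t = 0" "\<And>s t. t \<in> set Js \<Longrightarrow> con6 (c s) t = 0" by blast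
  define \<sigma> where "\<sigma> i = l ! (unlab i - 1)" for i :: 8
  have b: "bij \<sigma>" unfolding \<sigma>_def by (rule list_perm[OF l])
  obtain d where d: "polyfun d" "d 1 \<noteq> 0" "\<And>s. d s \<noteq> 0 \<Longrightarrow> config_ok (c s) Is Js"
    using generic_member[OF c(1,3-5)] by blast
  define w where "w s i = c s (unlab (inv \<sigma> i))" for s i
  have "w 0 i = x i" for i
  proof -
    have "w 0 i = x (\<sigma> (inv \<sigma> i))" unfolding w_def \<sigma>_def by (rule c(2)[OF unlab_range])
    thus ?thesis using b by (simp add: bij_is_surj surj_f_inv_f)
  qed
  moreover have "(\<lambda>i. pcl (w s i)) \<in> realizations (permute \<sigma> (lsets Is, lsets Js))" if ds: "d s \<noteq> 0" for s
  proof (rule realizations_permute[OF b])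
    have ws: "w s (\<sigma> i) = relab (c s) i" for i using b by (simp add: w_def relab_def bij_is_inj inv_f_f)
    show "(\<lambda>i. pcl (w s (\<sigma> i))) \<in> realizations (lsets Is, lsets Js)"
      unfolding ws by (rule config_ok_realization[OF g d(3)[OF ds]])
    fix i
    have "crs (relab (c s) (inv \<sigma> i)) (relab (c s) (inv \<sigma> i + 1)) \<noteq> 0"
      by (rule config_ok_indep[OF g d(3)[OF ds]]) simp
    thus "w s i \<noteq> 0" unfolding w_def relab_def by (auto simp: coord_simps)
  qed
  moreover have "polyfun (\<lambda>s. w s i $ j)" for i j unfolding w_def by (rule c(1))
  ultimately show "\<exists>w d. (\<forall>i j. polyfun (\<lambda>s. w s i $ j)) \<and> w 0 = x \<and> polyfun d \<and> d 1 \<noteq> 0 \<and>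
      (\<forall>s. d s \<noteq> 0 \<longrightarrow> (\<lambda>i. pcl (w s i)) \<in> realizations (permute (\<lambda>i. l ! (unlab i - 1)) (lsets Is, lsets Js)))"
    using d(1,2) unfolding \<sigma>_def[symmetric] by (intro exI[of _ w] exI[of _ d]) auto
qed

section \<open>Patterns sufficient for lying below number 77 or number 10\<close>

abbreviation I77 :: "nat list list" where "I77 \<equiv> [[1, 2, 3], [1, 4, 5], [6, 7, 8]]"
abbreviation I10 :: "nat list list" where "I10 \<equiv> [[1, 2, 3]]"
abbreviation J10 :: "nat list list" where "J10 \<equiv> [[1, 4, 5, 6, 7, 8]]"

lemma collinear_br:
  assumes "a \<noteq> 0 \<and> (\<forall>i\<in>{x, y, z}. a \<odot> (w :: 8 \<Rightarrow> complex^3) i = 0)" shows "br (w x) (w y) (w z) = 0"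
  using orth_br_eq_0[of a] assms by simp

lemma config_ok_crs:
  assumes g: "good_lists Is Js" and w: "config_ok w Is Js" and k: "k \<in> {1..8}" "m \<in> {1..8}" "k \<noteq> m"
  shows "crs (w k) (w m) \<noteq> 0"
  using config_ok_indep[OF g w, of "lab k" "lab m"] lab_eq_iff[OF k(1,2)] k by (simp add: relab_lab)

definition pattern77 :: "8 set set \<Rightarrow> bool"
  where "pattern77 I \<longleftrightarrow> (\<exists>T1\<in>I. \<exists>T2\<in>I. \<exists>T3\<in>I. card (T1 \<inter> T2) = 1 \<and> T1 \<inter> T3 = {} \<and> T2 \<inter> T3 = {})"

definition pattern10 :: "8 set set \<Rightarrow> 8 set set \<Rightarrow> bool"
  where "pattern10 I J \<longleftrightarrow> (\<exists>T\<in>I. \<exists>S\<in>J. card (T \<inter> S) = 1)"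

lemma list_of_set: assumes "card (A :: 8 set) = n" shows "\<exists>l. length l = n \<and> distinct l \<and> set l = A"
  using finite_distinct_list[of A] assms distinct_card by (metis finite)

lemma preceq77I:
  assumes c3: "\<And>T. T \<in> I \<Longrightarrow> card T = 3" and pat: "pattern77 I"
    and g: "good_lists I77 []" and w: "config_ok w I77 []"
  shows "quatroid_preceq (I, J) (lsets I77, lsets [])"
proof -
  obtain T1 T2 T3 where T: "T1 \<in> I" "T2 \<in> I" "T3 \<in> I" "card (T1 \<inter> T2) = 1" "T1 \<inter> T3 = {}" "T2 \<inter> T3 = {}"
    using pat by (auto simp: pattern77_def)
  obtain a where a: "T1 \<inter> T2 = {a}" using T(4) by (metis card_1_singletonE)
  have "a \<in> T1" "a \<in> T2" using a by auto
  hence "card (T1 - {a}) = 2" "card (T2 - {a}) = 2" using c3[OF T(1)] c3[OF T(2)] by simp_all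
  then obtain b c d e where bcde: "T1 - {a} = {b, c}" "b \<noteq> c" "T2 - {a} = {d, e}" "d \<noteq> e"
    by (metis card_2_iff)
  obtain f h k where fhk: "T3 = {f, h, k}" "f \<noteq> h" "f \<noteq> k" "h \<noteq> k" using c3[OF T(3)] by (metis card_3_iff)
  have T1: "T1 = {a, b, c}" and T2: "T2 = {a, d, e}" using bcde a by auto
  \<comment> \<open>The triples \<open>T1\<close>, \<open>T2\<close>, \<open>T3\<close> take the
    roles 123, 145, 678. Their union has \<open>1 + 2 + 2 + 3 = 8\<close> elements, so all labels
    are used.\<close>
  define l where "l = [a, b, c, d, e, f, h, k]"
  have dist: "distinct l" unfolding l_def using bcde fhk a T(5,6) T1 T2 by auto
  have len: "length l = 8" by (simp add: l_def)
  have "p \<in> zariski_closure (realizations (permute (\<lambda>i. l ! (unlab i - 1)) (lsets I77, lsets [])))"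
    if p: "p \<in> realizations (I, J)" for p
  proof -
    have pc: "p \<in> configs" using p by (simp add: realizations_def)
    show ?thesis
    proof (rule closure_permuted[OF len dist g pc])
      fix x :: "8 \<Rightarrow> complex^3" assume x: "\<forall>i. x i \<in> p i"
      have nz: "x i \<noteq> 0" for i by (rule configs_reps(1)[OF pc]) (use x in blast)
      have r: "(\<lambda>i. pcl (x i)) \<in> realizations (I, J)" using configs_reps(2)[OF pc, of x] x p by simp
      define u where "u k = x (l ! (k - 1))" for k
      have ul: "u (Suc 0) = x a" "u 1 = x a" "u 2 = x b" "u 3 = x c" "u 4 = x d" "u 5 = x e" "u 6 = x f" "u 7 = x h" "u 8 = x k"
        by (simp_all add: u_def l_def)
      have col: "br (x i) (x j) (x k) = 0" if "{i, j, k} \<in> I" for i j k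
        using realizationsD(2)[OF r nz that] collinear_br by blast
      have "\<exists>c :: complex \<Rightarrow> nat \<Rightarrow> complex^3. (\<forall>k j. polyfun (\<lambda>s. c s k $ j)) \<and> (\<forall>k\<in>{1..8}. c 0 k = u k) \<and> (\<forall>k\<in>{1..8}. c 1 k = w k) \<and>
        (\<forall>s. br3 (c s) [1, 2, 3] = 0 \<and> br3 (c s) [1, 4, 5] = 0 \<and> br3 (c s) [6, 7, 8] = 0)"
      proof (rule curve77)
        fix y assume "y \<in> {u, w}"
        then consider "y = u" | "y = w" by blast
        thus "crs (y 1) (y 2) \<noteq> 0 \<and> crs (y 1) (y 4) \<noteq> 0 \<and> crs (y 6) (y 7) \<noteq> 0 \<and>
          br3 y [1, 2, 3] = 0 \<and> br3 y [1, 4, 5] = 0 \<and> br3 y [6, 7, 8] = 0"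
        proof cases
          case 1
          show ?thesis unfolding 1 using realizationsD(1)[OF r nz] dist col T T1 T2 fhk(1)
            by (simp add: br3_def ul l_def)
        next
          case 2
          have "br3 w t = 0" if "t \<in> set I77" for t
          proof -
            have "t \<in> set (subs 3)" using g that unfolding good_lists_def by blast
            thus ?thesis using w that unfolding config_ok_def by blast
          qed
          thus ?thesis unfolding 2 using config_ok_crs[OF g w] by simp
        qed
      qed
      then obtain c :: "complex \<Rightarrow> nat \<Rightarrow> complex^3" where c: "\<And>k j. polyfun (\<lambda>s. c s k $ j)" "\<And>k. k \<in> {1..8} \<Longrightarrow> c 0 k = u k"
        "\<And>k. k \<in> {1..8} \<Longrightarrow> c 1 k = w k" "\<And>s. br3 (c s) [1, 2, 3] = 0 \<and> br3 (c s) [1, 4, 5] = 0 \<and> br3 (c s) [6, 7, 8] = 0" by blast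
      have "config_ok (c 1) I77 []" using w config_ok_cong[where u="c 1" and w=w, OF c(3)] by simp
      thus "\<exists>c :: complex \<Rightarrow> nat \<Rightarrow> complex^3. (\<forall>k j. polyfun (\<lambda>s. c s k $ j)) \<and> (\<forall>k\<in>{1..8}. c 0 k = x (l ! (k - 1))) \<and> config_ok (c 1) I77 [] \<and>
          (\<forall>s. (\<forall>t\<in>set I77. br3 (c s) t = 0) \<and> (\<forall>t\<in>set []. con6 (c s) t = 0))"
        using c(1,2,4) unfolding u_def by (intro exI[of _ c]) simp
    qed
  qed
  hence "quatroid_le (I, J) (permute (\<lambda>i. l ! (unlab i - 1)) (lsets I77, lsets []))"
    unfolding quatroid_le_def by blast
  thus ?thesis unfolding quatroid_preceq_def using list_perm(1)[OF len dist] by blast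
qed

lemma preceq10I:
  assumes c3: "\<And>T. T \<in> I \<Longrightarrow> card T = 3" and c6: "\<And>S. S \<in> J \<Longrightarrow> card S = 6" and pat: "pattern10 I J"
    and g: "good_lists I10 J10" and w: "config_ok w I10 J10"
  shows "quatroid_preceq (I, J) (lsets I10, lsets J10)"
proof -
  obtain T S where T: "T \<in> I" "S \<in> J" "card (T \<inter> S) = 1" using pat by (auto simp: pattern10_def)
  obtain a where a: "T \<inter> S = {a}" using T(3) by (metis card_1_singletonE)
  have "a \<in> T" "a \<in> S" using a by auto
  hence "card (T - {a}) = 2" "card (S - {a}) = 5" using c3[OF T(1)] c6[OF T(2)] by simp_all
  then obtain b c where bc: "T - {a} = {b, c}" "b \<noteq> c" by (metis card_2_iff)
  obtain m where m: "length m = 5" "distinct m" "set m = S - {a}" using list_of_set[OF \<open>card (S - {a}) = 5\<close>] by blast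
  then obtain d e f h k where mm: "m = [d, e, f, h, k]" by (auto simp: length_Suc_conv numeral_eq_Suc)
  have Teq: "T = {a, b, c}" and Seq: "S = {a, d, e, f, h, k}" using bc a m(3) mm by auto
  define l where "l = [a, b, c, d, e, f, h, k]"
  have bn: "b \<notin> S" "c \<notin> S" using a bc by auto
  have dist: "distinct l" unfolding l_def using bc m(2,3) bn mm Seq by auto
  have len: "length l = 8" by (simp add: l_def)
  have "p \<in> zariski_closure (realizations (permute (\<lambda>i. l ! (unlab i - 1)) (lsets I10, lsets J10)))"
    if p: "p \<in> realizations (I, J)" for p
  proof -
    have pc: "p \<in> configs" using p by (simp add: realizations_def)
    show ?thesis
    proof (rule closure_permuted[OF len dist g pc])
      fix x :: "8 \<Rightarrow> complex^3" assume x: "\<forall>i. x i \<in> p i"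
      have nz: "x i \<noteq> 0" for i by (rule configs_reps(1)[OF pc]) (use x in blast)
      have r: "(\<lambda>i. pcl (x i)) \<in> realizations (I, J)" using configs_reps(2)[OF pc, of x] x p by simp
      define u where "u k = x (l ! (k - 1))" for k
      have ul: "u (Suc 0) = x a" "u 1 = x a" "u 2 = x b" "u 3 = x c" "u 4 = x d" "u 5 = x e" "u 6 = x f" "u 7 = x h" "u 8 = x k"
        by (simp_all add: u_def l_def)
      have col: "br (x a) (x b) (x c) = 0"
        using realizationsD(2)[OF r nz T(1)] collinear_br unfolding Teq by blast
      obtain q where q: "is_conic q" "\<forall>i\<in>S. ev q (x i) = 0" using realizationsD(3)[OF r nz T(2)] by blast
      have "\<exists>c :: complex \<Rightarrow> nat \<Rightarrow> complex^3. (\<forall>k j. polyfun (\<lambda>s. c s k $ j)) \<and> (\<forall>k\<in>{1..8}. c 0 k = u k) \<and> (\<forall>k\<in>{1..8}. c 1 k = w k) \<and>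
        (\<forall>s. br3 (c s) [1, 2, 3] = 0 \<and> con6 (c s) [1, 4, 5, 6, 7, 8] = 0)"
      proof (rule curve10)
        fix y assume "y \<in> {u, w}"
        then consider "y = u" | "y = w" by blast
        thus "crs (y 1) (y 2) \<noteq> 0 \<and> crs (y 1) (y 4) \<noteq> 0 \<and> br3 y [1, 2, 3] = 0 \<and>
          (\<exists>q. is_conic q \<and> (\<forall>k\<in>{1, 4, 5, 6, 7, 8}. ev q (y k) = 0))"
        proof cases
          case 1
          have "\<forall>k\<in>{1, 4, 5, 6, 7, 8}. ev q (u k) = 0" using q(2) Seq ul by simp
          thus ?thesis unfolding 1 using realizationsD(1)[OF r nz] dist col q(1)
            by (auto simp: br3_def ul l_def)
        next
          case 2
          have m3: "[1, 2, 3] \<in> set (subs 3)" "[1, 4, 5, 6, 7, 8] \<in> set (subs 6)"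
            using g unfolding good_lists_def by auto
          have "br3 w [1, 2, 3] = 0" using w m3 unfolding config_ok_def by simp
          moreover have "\<exists>q. is_conic q \<and> (\<forall>i\<in>lset [1, 4, 5, 6, 7, 8]. ev q (relab w i) = 0)"
          proof (rule realizationsD(3)[OF config_ok_realization[OF g w]])
            show "relab w i \<noteq> 0" for i using config_ok_indep[OF g w, of i "i + 1"] by (auto simp: coord_simps)
            show "lset [1, 4, 5, 6, 7, 8] \<in> lsets J10" by (simp add: lsets_def)
          qed
          then obtain q where q: "is_conic q" "\<forall>i\<in>lset [1, 4, 5, 6, 7, 8]. ev q (relab w i) = 0" by blast
          have "\<forall>k\<in>{1, 4, 5, 6, 7, 8}. ev q (w k) = 0"
          proof
            fix k :: nat assume k: "k \<in> {1, 4, 5, 6, 7, 8}"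
            hence "k \<in> {1..8}" "k \<in> set [1, 4, 5, 6, 7, 8]" by auto
            hence "lab k \<in> lset [1, 4, 5, 6, 7, 8]" "relab w (lab k) = w k"
              unfolding lset_def by (blast, intro relab_lab)
            thus "ev q (w k) = 0" using q(2) by metis
          qed
          ultimately show ?thesis unfolding 2 using config_ok_crs[OF g w] q(1) by auto
        qed
      qed
      then obtain c :: "complex \<Rightarrow> nat \<Rightarrow> complex^3" where c: "\<And>k j. polyfun (\<lambda>s. c s k $ j)" "\<And>k. k \<in> {1..8} \<Longrightarrow> c 0 k = u k"
        "\<And>k. k \<in> {1..8} \<Longrightarrow> c 1 k = w k" "\<And>s. br3 (c s) [1, 2, 3] = 0 \<and> con6 (c s) [1, 4, 5, 6, 7, 8] = 0" by blast
      have "config_ok (c 1) I10 J10" using w config_ok_cong[where u="c 1" and w=w, OF c(3)] by simp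
      thus "\<exists>c :: complex \<Rightarrow> nat \<Rightarrow> complex^3. (\<forall>k j. polyfun (\<lambda>s. c s k $ j)) \<and> (\<forall>k\<in>{1..8}. c 0 k = x (l ! (k - 1))) \<and> config_ok (c 1) I10 J10 \<and>
          (\<forall>s. (\<forall>t\<in>set I10. br3 (c s) t = 0) \<and> (\<forall>t\<in>set J10. con6 (c s) t = 0))"
        using c(1,2,4) unfolding u_def by (intro exI[of _ c]) simp
    qed
  qed
  hence "quatroid_le (I, J) (permute (\<lambda>i. l ! (unlab i - 1)) (lsets I10, lsets J10))"
    unfolding quatroid_le_def by blast
  thus ?thesis unfolding quatroid_preceq_def using list_perm(1)[OF len dist] by blast
qed

lemma pattern77I:
  "T1 \<in> I \<Longrightarrow> T2 \<in> I \<Longrightarrow> T3 \<in> I \<Longrightarrow> card (T1 \<inter> T2) = 1 \<Longrightarrow> T1 \<inter> T3 = {} \<Longrightarrow> T2 \<inter> T3 = {} \<Longrightarrow> pattern77 I"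
  unfolding pattern77_def by blast

section \<open>Patterns forced by the order\<close>

context bezout_config
begin

lemma preceq_closure:
  assumes "quatroid_preceq (I, J) Q"
  obtains \<sigma> where "bij \<sigma>" "(\<lambda>i. pcl (v i)) \<in> zariski_closure (realizations (permute \<sigma> Q))"
proof -
  have "(\<lambda>i. pcl (v i)) \<in> realizations (I, J)"
    unfolding realizations_pcl_iff[of v, OF v_nz] using indep I_iff J_iff by blast
  thus ?thesis using assms that unfolding quatroid_preceq_def quatroid_le_def by blast
qed

lemma closure_triple:
  assumes "bij \<sigma>" "(\<lambda>i. pcl (v i)) \<in> zariski_closure (realizations (permute \<sigma> (I', J')))"
    "{a, b, c} \<in> I'" "a \<noteq> b" "a \<noteq> c" "b \<noteq> c"
  shows "{\<sigma> a, \<sigma> b, \<sigma> c} \<in> I"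
proof -
  have "\<sigma> ` {a, b, c} \<in> (`) \<sigma> ` I'" using assms(3) by (rule imageI)
  hence "br (v (\<sigma> a)) (v (\<sigma> b)) (v (\<sigma> c)) = 0"
    using closure_collinear[of v "(`) \<sigma> ` I'" "(`) \<sigma> ` J'"] assms(2) unfolding permute_def by simp
  moreover have "\<sigma> a \<noteq> \<sigma> b" "\<sigma> a \<noteq> \<sigma> c" "\<sigma> b \<noteq> \<sigma> c"
    using assms(1,4-6) by (auto simp: bij_def inj_eq)
  ultimately show ?thesis using br_iff by blast
qed

lemma preceq77D:
  assumes "quatroid_preceq (I, J) ({{1, 2, 3}, {1, 4, 5}, {6, 7, 8}}, {})" shows "pattern77 I"
proof -
  obtain \<sigma> where b: "bij \<sigma>" and p: "(\<lambda>i. pcl (v i)) \<in> zariski_closure (realizations (permute \<sigma> ({{1, 2, 3}, {1, 4, 5}, {6, 7, 8}}, {})))"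
    using preceq_closure[OF assms] by blast
  have inj: "\<sigma> i = \<sigma> j \<longleftrightarrow> i = j" for i j using b by (auto simp: bij_def inj_eq)
  have I: "{\<sigma> 1, \<sigma> 2, \<sigma> 3} \<in> I" "{\<sigma> 1, \<sigma> 4, \<sigma> 5} \<in> I" "{\<sigma> 6, \<sigma> 7, \<sigma> 8} \<in> I"
    by (rule closure_triple[OF b p]; simp)+
  have 1: "{\<sigma> 1, \<sigma> 2, \<sigma> 3} \<inter> {\<sigma> 1, \<sigma> 4, \<sigma> 5} = {\<sigma> 1}" by (auto simp: inj)
  have 2: "{\<sigma> 1, \<sigma> 2, \<sigma> 3} \<inter> {\<sigma> 6, \<sigma> 7, \<sigma> 8} = {}" "{\<sigma> 1, \<sigma> 4, \<sigma> 5} \<inter> {\<sigma> 6, \<sigma> 7, \<sigma> 8} = {}" by (auto simp: inj)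
  have 3: "card ({\<sigma> 1, \<sigma> 2, \<sigma> 3} \<inter> {\<sigma> 1, \<sigma> 4, \<sigma> 5}) = 1" unfolding 1 by (rule is_singleton_altdef[THEN iffD1]) (rule is_singletonI)
  show ?thesis by (rule pattern77I[OF I 3 2])
qed

text \<open>If \<open>S\<close> contains a collinear triple \<open>U\<close>, its points are placed
  as \<open>p\<close>, \<open>q\<close>, \<open>t\<close>, so that the second product of the conic
  condition vanishes. In the first product three brackets contain exactly two points of
  \<open>U\<close> and are nonzero, so the fourth vanishes and the other three points are
  collinear.\<close>

lemma conic_or_two_lines:
  assumes d: "card S = 6"
    and z: "\<And>p1 p2 p3 p4 p5 p6. S = {p1, p2, p3, p4, p5, p6} \<Longrightarrow> distinct [p1, p2, p3, p4, p5, p6] \<Longrightarrow>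
      ev (conic5 (v p1) (v p2) (v p3) (v p4) (v p5)) (v p6) = 0"
  shows "S \<in> J \<or> (\<exists>U\<in>I. \<exists>U'\<in>I. U \<inter> U' = {} \<and> U \<union> U' = S)"
proof (cases "\<exists>U\<in>I. U \<subseteq> S")
  case True
  then obtain U where U: "U \<in> I" "U \<subseteq> S" by blast
  obtain p q t where pqt: "U = {p, q, t}" "p \<noteq> q" "p \<noteq> t" "q \<noteq> t" using cardI[OF U(1)] by (metis card_3_iff)
  have "card (S - U) = 3" using d U cardI[OF U(1)] by (simp add: card_Diff_subset)
  then obtain r s x where rsx: "S - U = {r, s, x}" "r \<noteq> s" "r \<noteq> x" "s \<noteq> x" by (metis card_3_iff)
  have S: "S = {p, q, r, s, t, x}" using U(2) pqt(1) rsx(1) by auto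
  have n: "r \<notin> U" "s \<notin> U" "x \<notin> U" using rsx(1) by auto
  have dis: "distinct [p, q, r, s, t, x]" using pqt rsx n by auto
  have nI: "{i, j, k} \<notin> I" if "i \<in> U" "j \<in> U" "k \<notin> U" "i \<noteq> j" for i j k
  proof
    assume I: "{i, j, k} \<in> I"
    have "{i, j} \<subseteq> {i, j, k} \<inter> U" using that by auto
    hence "card {i, j} \<le> card ({i, j, k} \<inter> U)" by (intro card_mono) auto
    moreover have "{i, j, k} \<noteq> U" using that by auto
    ultimately show False using bezI[OF I U(1)] that(4) by simp
  qed
  have "br (v p) (v q) (v t) = 0" using br_iff[of p q t] pqt U(1) by simp
  moreover have "ev (conic5 (v p) (v q) (v r) (v s) (v t)) (v x) = 0" by (rule z[OF S dis])
  moreover have "br (v p) (v r) (v t) \<noteq> 0" using br_iff[of p t r] nI[of p t r] pqt n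
    br_perms_eq_0[of "v p" "v r" "v t"] dis by auto
  moreover have "br (v q) (v s) (v t) \<noteq> 0" using br_iff[of q t s] nI[of q t s] pqt n
    br_perms_eq_0[of "v q" "v s" "v t"] dis by auto
  moreover have "br (v p) (v q) (v x) \<noteq> 0" using br_iff[of p q x] nI[of p q x] pqt n dis by auto
  ultimately have "br (v r) (v s) (v x) = 0" by (simp add: ev_conic5)
  hence "{r, s, x} \<in> I" using br_iff[of r s x] rsx by simp
  thus ?thesis using U rsx(1) by blast
next
  case False
  obtain m where m: "length m = 6" "distinct m" "set m = S" using list_of_set[OF d] by blast
  then obtain p q r s t x where mm: "m = [p, q, r, s, t, x]" by (auto simp: length_Suc_conv numeral_eq_Suc)
  have S: "S = {p, q, r, s, t, x}" using m mm by auto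
  have dis: "distinct [p, q, r, s, t, x]" using m mm by simp
  have brn: "br (v i) (v j) (v k) \<noteq> 0" if "i \<in> S" "j \<in> S" "k \<in> S" "i \<noteq> j" "i \<noteq> k" "j \<noteq> k" for i j k
    using br_iff[OF that(4-6)] False that(1-3) by auto
  have mem: "p \<in> S" "q \<in> S" "r \<in> S" "s \<in> S" "t \<in> S" using S by auto
  have "\<exists>f. is_conic f \<and> ev f (v p) = 0 \<and> ev f (v q) = 0 \<and> ev f (v r) = 0 \<and> ev f (v s) = 0 \<and> ev f (v t) = 0 \<and> ev f (v x) = 0"
    by (subst six_on_conic_iff) (rule indep brn z[OF S dis]; use dis mem in simp)+
  hence "S \<in> J" unfolding J_iff S using d[unfolded S] by auto
  thus ?thesis by blast
qed

lemma preceq10D: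
  assumes "quatroid_preceq (I, J) ({{1, 2, 3}}, {{1, 4, 5, 6, 7, 8}})" shows "pattern10 I J \<or> pattern77 I"
proof -
  obtain \<sigma> where b: "bij \<sigma>" and p: "(\<lambda>i. pcl (v i)) \<in> zariski_closure (realizations (permute \<sigma> ({{1, 2, 3}}, {{1, 4, 5, 6, 7, 8}})))"
    using preceq_closure[OF assms] by blast
  have inj: "\<sigma> i = \<sigma> j \<longleftrightarrow> i = j" for i j using b by (auto simp: bij_def inj_eq)
  define T where "T = {\<sigma> 1, \<sigma> 2, \<sigma> 3}"
  define S where "S = {\<sigma> 1, \<sigma> 4, \<sigma> 5, \<sigma> 6, \<sigma> 7, \<sigma> 8}"
  have T: "T \<in> I" unfolding T_def by (rule closure_triple[OF b p]; simp)
  have TS: "T \<inter> S = {\<sigma> 1}" unfolding T_def S_def by (auto simp: inj)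
  have c6: "card S = 6" unfolding S_def by (simp add: inj)
  have pm: "permute \<sigma> ({{1, 2, 3}}, {{1, 4, 5, 6, 7, 8}}) = ({T}, {S})"
    by (simp add: permute_def T_def S_def)
  have "S \<in> J \<or> (\<exists>U\<in>I. \<exists>U'\<in>I. U \<inter> U' = {} \<and> U \<union> U' = S)"
    by (rule conic_or_two_lines[OF c6]) (rule closure_conic[OF p[unfolded pm]]; simp)
  thus ?thesis
  proof
    assume "S \<in> J"
    moreover have "card (T \<inter> S) = 1" by (simp add: TS)
    ultimately have "pattern10 I J" unfolding pattern10_def using T by blast
    thus ?thesis ..
  next
    assume "\<exists>U\<in>I. \<exists>U'\<in>I. U \<inter> U' = {} \<and> U \<union> U' = S"
    then obtain U U' where U: "U \<in> I" "U' \<in> I" "U \<inter> U' = {}" "U \<union> U' = S" by blast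
    have "(T \<inter> U) \<union> (T \<inter> U') = T \<inter> S" unfolding U(4)[symmetric] by (rule Int_Un_distrib[symmetric])
    moreover have "(T \<inter> U) \<inter> (T \<inter> U') = {}" using U(3) by blast
    ultimately have split: "(T \<inter> U) \<union> (T \<inter> U') = {\<sigma> 1}" "(T \<inter> U) \<inter> (T \<inter> U') = {}" unfolding TS by simp_all
    \<comment> \<open>The common point of \<open>T\<close> and \<open>S\<close> lies on exactly one
      of the two lines. That triple and \<open>T\<close> are the ones that share a point, and the
      other triple is disjoint from both.\<close>
    hence "T \<inter> U = {\<sigma> 1} \<and> T \<inter> U' = {} \<or> T \<inter> U' = {\<sigma> 1} \<and> T \<inter> U = {}"
      using subset_singleton_iff[of "T \<inter> U" "\<sigma> 1"] subset_singleton_iff[of "T \<inter> U'" "\<sigma> 1"] by auto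
    moreover have "U' \<inter> U = {}" using U(3) by blast
    ultimately have "pattern77 I" using pattern77I[OF T U(1,2) _ _ U(3)] pattern77I[OF T U(2,1)] by (elim disjE conjE) simp_all
    thus ?thesis ..
  qed
qed

end

section \<open>Certificates\<close>

definition meet :: "nat list \<Rightarrow> nat list \<Rightarrow> nat list" where "meet l l' = filter (\<lambda>k. k \<in> set l') l"

definition outside :: "nat list \<Rightarrow> nat list" where "outside l = filter (\<lambda>k. k \<notin> set l) [1, 2, 3, 4, 5, 6, 7, 8]"

lemma upt_1_9: "[1..<9] = [1, 2, 3, 4, 5, 6, 7, 8 :: nat]" by (simp add: upt_rec)

lemma filter_in_subseqs: "filter P l \<in> set (subseqs l)"
  by (induction l) (auto simp: Let_def)

lemma outside_subs: assumes "length (outside l) = n" shows "outside l \<in> set (subs n)"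
proof -
  have "outside l \<in> set (subseqs [1..<9])" unfolding outside_def upt_1_9 by (rule filter_in_subseqs)
  thus ?thesis using assms by (simp only: subs_def set_filter mem_Collect_eq)
qed

lemma lset_outside: assumes "set l \<subseteq> {1..8}" shows "lset (outside l) = - lset l"
proof -
  have "set (outside l) = {1..8} - set l" unfolding outside_def upt_1_9[symmetric] by auto
  hence "lset (outside l) = lab ` {1..8} - lab ` set l" unfolding lset_def
    using inj_on_image_set_diff[of lab "{1..8}" "{1..8}" "set l"] bij_lab assms by (auto simp: bij_betw_def)
  thus ?thesis using bij_lab by (auto simp: bij_betw_def lset_def)
qed

lemma lset_append: "lset (l @ l') = lset l \<union> lset l'" by (auto simp: lset_def)

lemma card_lset_meet:
  assumes "l \<in> set (subs n)" "l' \<in> set (subs n')" shows "card (lset l \<inter> lset l') = length (meet l l')"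
proof -
  have m: "set (meet l l') = set l \<inter> set l'" "distinct (meet l l')" "set (meet l l') \<subseteq> {1..8}"
    using subs_props(2,3)[OF assms(1)] by (auto simp: meet_def)
  have "lset l \<inter> lset l' = lset (meet l l')"
    using lset_Int[OF subs_props(3)[OF assms(1)] subs_props(3)[OF assms(2)]] by (simp add: lset_def m(1))
  thus ?thesis using card_lset[OF m(3)] distinct_card[OF m(2)] by simp
qed

lemma lset_disjoint_iff:
  assumes "l \<in> set (subs n)" "l' \<in> set (subs n')" shows "lset l \<inter> lset l' = {} \<longleftrightarrow> meet l l' = []"
  using card_lset_meet[OF assms] by (metis card_0_eq finite length_0_conv)

lemma lset_Un_UNIV_iff:
  assumes "l \<in> set (subs n)" "l' \<in> set (subs n')" shows "lset l \<union> lset l' = UNIV \<longleftrightarrow> outside (l @ l') = []"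
proof -
  have "lset (outside (l @ l')) = - (lset l \<union> lset l')"
    using lset_outside[of "l @ l'"] subs_props(3)[OF assms(1)] subs_props(3)[OF assms(2)] by (simp add: lset_append)
  moreover have "lset k = {} \<longleftrightarrow> k = []" for k by (simp add: lset_def)
  ultimately show ?thesis by auto
qed

section \<open>The count and the patterns on lists\<close>

definition clsL :: "nat list list \<Rightarrow> nat list \<Rightarrow> nat list list"
  where "clsL Is t = filter (\<lambda>t'. t' = t \<or> meet t t' = [] \<or> outside (t @ t') \<in> set Is) Is"

definition ownL :: "nat list list \<Rightarrow> nat list list \<Rightarrow> nat list list"
  where "ownL Is Js = filter (\<lambda>t. list_all (\<lambda>s. outside (t @ s) \<noteq> []) Js) Is"

text \<open>All classes are sublists of the one list \<open>Is\<close>, so equal classes are equal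
  lists and \<open>remdups\<close> keeps one copy of each.\<close>

definition genericL :: "nat list list \<Rightarrow> nat list list \<Rightarrow> nat"
  where "genericL Is Js = 2 * length Js +
    sum_list (map (\<lambda>K. if length K = 1 then 2 else 3) (remdups (map (clsL Is) (ownL Is Js))))"

definition pattern77L :: "nat list list \<Rightarrow> bool"
  where "pattern77L Is \<longleftrightarrow> (\<exists>t1\<in>set Is. \<exists>t2\<in>set Is. \<exists>t3\<in>set Is. length (meet t1 t2) = 1 \<and> meet t1 t3 = [] \<and> meet t2 t3 = [])"

definition pattern10L :: "nat list list \<Rightarrow> nat list list \<Rightarrow> bool"
  where "pattern10L Is Js \<longleftrightarrow> (\<exists>t\<in>set Is. \<exists>s\<in>set Js. length (meet t s) = 1)"

definition bezoutianL :: "nat list list \<Rightarrow> nat list list \<Rightarrow> bool"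
  where "bezoutianL Is Js \<longleftrightarrow> good_lists Is Js \<and> distinct Is \<and> distinct Js \<and>
    (\<forall>t\<in>set Is. \<forall>t'\<in>set Is. t \<noteq> t' \<longrightarrow> length (meet t t') \<le> 1) \<and>
    (\<forall>s\<in>set Js. \<forall>s'\<in>set Js. s \<noteq> s' \<longrightarrow> length (meet s s') \<le> 4)"

lemma good_listsD:
  assumes "good_lists Is Js"
  shows "t \<in> set Is \<Longrightarrow> t \<in> set (subs 3)" "s \<in> set Js \<Longrightarrow> s \<in> set (subs 6)"
  using assms by (auto simp: good_lists_def)

lemma bezoutianL_sound:
  assumes "bezoutianL Is Js" shows "bezoutian (lsets Is, lsets Js)"
proof -
  have g: "good_lists Is Js" and
    bI: "\<And>t t'. t \<in> set Is \<Longrightarrow> t' \<in> set Is \<Longrightarrow> t \<noteq> t' \<Longrightarrow> length (meet t t') \<le> 1" and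
    bJ: "\<And>t t'. t \<in> set Js \<Longrightarrow> t' \<in> set Js \<Longrightarrow> t \<noteq> t' \<Longrightarrow> length (meet t t') \<le> 4"
    using assms by (simp_all add: bezoutianL_def)
  have "card (lset t \<inter> lset t') \<le> 1" if "t \<in> set Is" "t' \<in> set Is" "lset t \<noteq> lset t'" for t t'
    unfolding card_lset_meet[OF good_listsD(1)[OF g that(1)] good_listsD(1)[OF g that(2)]]
    by (rule bI[OF that(1,2)]) (use that(3) in auto)
  moreover have "card (lset t \<inter> lset t') \<le> 4" if "t \<in> set Js" "t' \<in> set Js" "lset t \<noteq> lset t'" for t t'
    unfolding card_lset_meet[OF good_listsD(2)[OF g that(1)] good_listsD(2)[OF g that(2)]]
    by (rule bJ[OF that(1,2)]) (use that(3) in auto)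
  ultimately show ?thesis unfolding bezoutian_def lsets_def by auto
qed

lemma lsets_card:
  assumes "good_lists Is Js"
  shows "T \<in> lsets Is \<Longrightarrow> card T = 3" "S \<in> lsets Js \<Longrightarrow> card S = 6"
proof -
  have c: "card (lset l) = n" if "l \<in> set (subs n)" for l n
    using subs_props[OF that] card_lset distinct_card[of l] by simp
  show "T \<in> lsets Is \<Longrightarrow> card T = 3" "S \<in> lsets Js \<Longrightarrow> card S = 6"
    unfolding lsets_def using c good_listsD[OF assms] by auto
qed

lemma pattern77L_iff:
  assumes "good_lists Is Js" shows "pattern77 (lsets Is) \<longleftrightarrow> pattern77L Is"
proof -
  have e: "card (lset t \<inter> lset t') = length (meet t t')" "lset t \<inter> lset t' = {} \<longleftrightarrow> meet t t' = []"
    if "t \<in> set Is" "t' \<in> set Is" for t t'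
    by (rule card_lset_meet[OF good_listsD(1)[OF assms that(1)] good_listsD(1)[OF assms that(2)]]
      lset_disjoint_iff[OF good_listsD(1)[OF assms that(1)] good_listsD(1)[OF assms that(2)]])+
  show ?thesis unfolding pattern77_def pattern77L_def lsets_def by (simp add: e)
qed

lemma pattern10L_iff:
  assumes "good_lists Is Js" shows "pattern10 (lsets Is) (lsets Js) \<longleftrightarrow> pattern10L Is Js"
proof -
  have e: "card (lset t \<inter> lset s) = length (meet t s)" if "t \<in> set Is" "s \<in> set Js" for t s
    by (rule card_lset_meet[OF good_listsD(1)[OF assms that(1)] good_listsD(2)[OF assms that(2)]])
  show ?thesis unfolding pattern10_def pattern10L_def lsets_def by (simp add: e)
qed

lemma inj_on_lset: "inj_on lset (set (subs n))"
  by (rule inj_onI) (metis subs_inj lset_eq_iff subs_props(3))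

lemma genericL_eq:
  assumes b: "bezoutianL Is Js" shows "generic_m (lsets Is) (lsets Js) = genericL Is Js"
proof -
  have g: "good_lists Is Js" and d: "distinct Is" "distinct Js" using b by (simp_all add: bezoutianL_def)
  note gI = good_listsD(1)[OF g] and gJ = good_listsD(2)[OF g]
  have iI: "inj_on lset (set Is)" by (rule inj_on_subset[OF inj_on_lset[of 3]]) (use gI in blast)
  have iJ: "inj_on lset (set Js)" by (rule inj_on_subset[OF inj_on_lset[of 6]]) (use gJ in blast)
  have own: "own_triples (lsets Is) (lsets Js) = lset ` set (ownL Is Js)"
  proof -
    have e: "lset t \<union> lset s = UNIV \<longleftrightarrow> outside (t @ s) = []" if "t \<in> set Is" "s \<in> set Js" for t s
      by (rule lset_Un_UNIV_iff[OF gI[OF that(1)] gJ[OF that(2)]])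
    show ?thesis unfolding own_triples_def ownL_def lsets_def by (auto simp: e list_all_iff)
  qed
  have cls: "cubic_class (lsets Is) (lset t) = lset ` set (clsL Is t)" if t: "t \<in> set Is" for t
  proof -
    have e: "lset t' = lset t \<longleftrightarrow> t' = t" "lset t \<inter> lset t' = {} \<longleftrightarrow> meet t t' = []"
      "- (lset t \<union> lset t') \<in> lsets Is \<longleftrightarrow> outside (t @ t') \<in> set Is" if t': "t' \<in> set Is" for t'
    proof -
      show "lset t' = lset t \<longleftrightarrow> t' = t" using iI t t' by (auto simp: inj_on_def)
      show "lset t \<inter> lset t' = {} \<longleftrightarrow> meet t t' = []" by (rule lset_disjoint_iff[OF gI[OF t] gI[OF t']])
      have s: "set (t @ t') \<subseteq> {1..8}" using subs_props(3)[OF gI[OF t]] subs_props(3)[OF gI[OF t']] by simp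
      have e: "lset (outside (t @ t')) = - (lset t \<union> lset t')" using lset_outside[OF s] by (simp add: lset_append)
      show "- (lset t \<union> lset t') \<in> lsets Is \<longleftrightarrow> outside (t @ t') \<in> set Is"
      proof
        assume "- (lset t \<union> lset t') \<in> lsets Is"
        then obtain w where w: "w \<in> set Is" "lset (outside (t @ t')) = lset w" unfolding e lsets_def by auto
        have o: "outside (t @ t') \<in> set (subs (length (outside (t @ t'))))" by (rule outside_subs) simp
        have "set (outside (t @ t')) = set w"
          using w(2) lset_eq_iff[OF subs_props(3)[OF o] subs_props(3)[OF gI[OF w(1)]]] by blast
        hence "outside (t @ t') = w" by (rule subs_inj[OF o gI[OF w(1)]])
        thus "outside (t @ t') \<in> set Is" using w(1) by simp
      next
        assume "outside (t @ t') \<in> set Is"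
        thus "- (lset t \<union> lset t') \<in> lsets Is" unfolding e[symmetric] lsets_def by blast
      qed
    qed
    have "{T' \<in> lsets Is. P T'} = lset ` {t' \<in> set Is. P (lset t')}" for P by (auto simp: lsets_def)
    moreover have "{t' \<in> set Is. lset t' = lset t \<or> lset t \<inter> lset t' = {} \<or> - (lset t \<union> lset t') \<in> lsets Is} = set (clsL Is t)"
      using e by (auto simp: clsL_def simp del: Compl_Un)
    ultimately show ?thesis unfolding cubic_class_def by simp
  qed
  let ?X = "map (clsL Is) (ownL Is Js)"
  have sub: "set K \<subseteq> set Is" "distinct K" if "K \<in> set ?X" for K using that d by (auto simp: clsL_def)
  have img: "cubic_class (lsets Is) ` own_triples (lsets Is) (lsets Js) = (\<lambda>K. lset ` set K) ` set ?X"
    unfolding own using cls by (force simp: ownL_def)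
  have "inj_on (\<lambda>K. lset ` set K) (set ?X)"
  proof (rule inj_onI)
    fix K K' assume K: "K \<in> set ?X" "K' \<in> set ?X" "lset ` set K = lset ` set K'"
    have "set K = set K'" using K(3) inj_on_image_eq_iff[OF iI sub(1)[OF K(1)] sub(1)[OF K(2)]] by blast
    moreover obtain P P' where "K = filter P Is" "K' = filter P' Is" using K(1,2) by (auto simp: clsL_def)
    ultimately show "K = K'" by (auto intro!: filter_cong)
  qed
  hence "(\<Sum>K\<in>cubic_class (lsets Is) ` own_triples (lsets Is) (lsets Js). if card K = 1 then 2 else 3 :: nat)
    = (\<Sum>K\<in>set ?X. if card (lset ` set K) = 1 then 2 else 3)"
    unfolding img by (subst sum.reindex) (simp_all add: o_def)
  also have "\<dots> = (\<Sum>K\<in>set ?X. if length K = 1 then 2 else 3)"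
  proof (rule sum.cong[OF refl])
    fix K assume K: "K \<in> set ?X"
    have "card (lset ` set K) = length K"
      using card_image[OF inj_on_subset[OF iI sub(1)[OF K]]] distinct_card[OF sub(2)[OF K]] by simp
    thus "(if card (lset ` set K) = 1 then 2 else 3 :: nat) = (if length K = 1 then 2 else 3)" by simp
  qed
  also have "\<dots> = sum_list (map (\<lambda>K. if length K = 1 then 2 else 3) (remdups ?X))"
    by (subst sum_list_distinct_conv_sum_set) simp_all
  finally have "(\<Sum>K\<in>cubic_class (lsets Is) ` own_triples (lsets Is) (lsets Js). if card K = 1 then 2 else 3 :: nat)
    = sum_list (map (\<lambda>K. if length K = 1 then 2 else 3) (remdups ?X))" .
  moreover have "card (lsets Js) = length Js"
    unfolding lsets_def using card_image[OF iJ] distinct_card[OF d(2)] by simp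
  ultimately show ?thesis unfolding generic_m_def genericL_def by simp
qed

section \<open>Explicit coordinates over a computable ring\<close>

type_synonym 'a vec3 = "'a \<times> 'a \<times> 'a"

fun crv :: "'a::comm_ring_1 vec3 \<Rightarrow> 'a vec3 \<Rightarrow> 'a vec3"
  where "crv (a1, a2, a3) (b1, b2, b3) = (a2 * b3 - a3 * b2, a3 * b1 - a1 * b3, a1 * b2 - a2 * b1)"

fun dotv :: "'a::comm_ring_1 vec3 \<Rightarrow> 'a vec3 \<Rightarrow> 'a"
  where "dotv (a1, a2, a3) (b1, b2, b3) = a1 * b1 + a2 * b2 + a3 * b3"

fun addv :: "'a::comm_ring_1 vec3 \<Rightarrow> 'a vec3 \<Rightarrow> 'a vec3"
  where "addv (a1, a2, a3) (b1, b2, b3) = (a1 + b1, a2 + b2, a3 + b3)"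

definition brv :: "'a::comm_ring_1 vec3 \<Rightarrow> 'a vec3 \<Rightarrow> 'a vec3 \<Rightarrow> 'a"
  where "brv a b c = dotv (crv a b) c"

definition cqv :: "'a::comm_ring_1 vec3 \<Rightarrow> 'a vec3 \<Rightarrow> 'a vec3 \<Rightarrow> 'a vec3 \<Rightarrow> 'a vec3 \<Rightarrow> 'a vec3 \<Rightarrow> 'a"
  where "cqv p q r s t x = brv p r t * brv q s t * (brv p q x * brv r s x) - brv p q t * brv r s t * (brv p r x * brv q s x)"

definition pnt :: "'a vec3 list \<Rightarrow> nat \<Rightarrow> 'a vec3" where "pnt ws k = ws ! (k - 1)"

definition config_okL :: "'a::comm_ring_1 vec3 list \<Rightarrow> nat list list \<Rightarrow> nat list list \<Rightarrow> bool"
  where "config_okL ws Is Js \<longleftrightarrow>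
    list_all (\<lambda>l. brv (pnt ws (l!0)) (pnt ws (l!1)) (pnt ws (l!2)) = 0 \<longleftrightarrow> l \<in> set Is) (subs 3) \<and>
    list_all (\<lambda>l. has_triple Is l \<or> (cqv (pnt ws (l!0)) (pnt ws (l!1)) (pnt ws (l!2)) (pnt ws (l!3))
      (pnt ws (l!4)) (pnt ws (l!5)) = 0 \<longleftrightarrow> l \<in> set Js)) (subs 6)"

text \<open>\<open>d\<close> is twice the polar form at \<open>A\<close> and \<open>B\<close>, which
  keeps the comparison free of division.\<close>

definition secantL :: "'a::comm_ring_1 vec3 list \<Rightarrow> nat list \<Rightarrow> nat \<Rightarrow> nat \<Rightarrow> bool"
  where "secantL ws s a b \<longleftrightarrow> (let Q = cqv (pnt ws (s!0)) (pnt ws (s!1)) (pnt ws (s!2)) (pnt ws (s!3)) (pnt ws (s!4));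
    A = pnt ws a; B = pnt ws b; QA = Q A; QB = Q B; d = Q (addv A B) - QA - QB in d * d \<noteq> 4 * QA * QB)"

definition triangleL :: "'a::comm_ring_1 vec3 list \<Rightarrow> nat list \<Rightarrow> nat list \<Rightarrow> nat list \<Rightarrow> bool"
  where "triangleL ws t t' e \<longleftrightarrow> brv (crv (pnt ws (t!0)) (pnt ws (t!1))) (crv (pnt ws (t'!0)) (pnt ws (t'!1)))
    (crv (pnt ws (e!0)) (pnt ws (e!1))) \<noteq> 0"

text \<open>The residual quadric of a triple is tested for tangency if no other triple is disjoint
  from it, and the three lines for concurrence otherwise. One disjoint triple suffices, since all of
  them lead to the same cubic.\<close>

definition genericityL :: "'a::comm_ring_1 vec3 list \<Rightarrow> nat list list \<Rightarrow> nat list list \<Rightarrow> bool"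
  where "genericityL ws Is Js \<longleftrightarrow> list_all (\<lambda>s. secantL ws s (outside s ! 0) (outside s ! 1)) Js \<and>
    list_all (\<lambda>t. case filter (\<lambda>t'. meet t t' = []) Is of
      [] \<Rightarrow> secantL ws (outside t) (t!0) (t!1) | t' # _ \<Rightarrow> triangleL ws t t' (outside (t @ t'))) (ownL Is Js)"

fun hv :: "('a \<Rightarrow> complex) \<Rightarrow> 'a vec3 \<Rightarrow> complex^3"
  where "hv h (a, b, c) = vector [h a, h b, h c]"

text \<open>An injective homomorphism transfers both the equations and the inequations computed over
  the small ring to the complex numbers.\<close>

context
  fixes h :: "'a::comm_ring_1 \<Rightarrow> complex"
  assumes h: "ring_hom1 h" and h0: "\<And>x. h x = 0 \<longleftrightarrow> x = 0"
begin

lemma hom: "h (a + b) = h a + h b" "h (a * b) = h a * h b" "h (a - b) = h a - h b" "h (numeral n) = numeral n"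
proof -
  show a: "h (a + b) = h a + h b" for a b using h by (simp add: ring_hom1_def)
  show "h (a * b) = h a * h b" using h by (simp add: ring_hom1_def)
  show "h (a - b) = h a - h b" using a[of "a - b" b] by (simp add: algebra_simps)
  have h1: "h 1 = 1" using h by (simp add: ring_hom1_def)
  show "h (numeral n) = numeral n" by (induction n) (simp_all only: numeral.simps a h1)
qed

lemma crs_hv: "crs (hv h a) (hv h b) = hv h (crv a b)"
  by (cases a; cases b) (simp add: crs_def vector_3 hom)

lemma br_hv: "br (hv h a) (hv h b) (hv h c) = h (brv a b c)"
  unfolding br_def crs_hv brv_def by (cases "crv a b"; cases c) (simp add: dot3_def vector_3 hom)

lemma add_hv: "hv h a + hv h b = hv h (addv a b)"
  by (cases a; cases b) (simp add: vec_eq_iff forall_3 vector_3 hom)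

lemma conic5_hv: "ev (conic5 (hv h p) (hv h q) (hv h r) (hv h s) (hv h t)) (hv h x) = h (cqv p q r s t x)"
  by (simp add: ev_conic5 br_hv cqv_def hom)

lemma config_okL_sound:
  "config_okL ws Is Js \<Longrightarrow> config_ok (\<lambda>k. hv h (pnt ws k)) Is Js"
  by (simp add: config_okL_def config_ok_def list_all_iff br3_def con6_def br_hv conic5_hv h0)

context
  fixes ws :: "'a vec3 list" and Is Js :: "nat list list"
  assumes b: "bezoutianL Is Js" and c: "config_okL ws Is Js"
begin

abbreviation "vv \<equiv> relab (\<lambda>k. hv h (pnt ws k))"

lemma good: "good_lists Is Js" using b by (simp add: bezoutianL_def)

lemma vv_lab: "k \<in> {1..8} \<Longrightarrow> vv (lab k) = hv h (pnt ws k)" by (rule relab_lab)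

lemma vv_realization: "(\<lambda>i. pcl (vv i)) \<in> realizations (lsets Is, lsets Js)"
  by (rule config_ok_realization[OF good config_okL_sound[OF c]])

lemma vv_bezout: "bezout_config vv (lsets Is) (lsets Js)"
proof -
  have ind: "crs (vv i) (vv j) \<noteq> 0" if "i \<noteq> j" for i j
    by (rule config_ok_indep[OF good config_okL_sound[OF c] that])
  have nz: "vv i \<noteq> 0" for i using ind[of i "i + 1"] by (auto simp: coord_simps)
  show ?thesis using vv_realization bezoutianL_sound[OF b]
    unfolding realizations_pcl_iff[of vv, OF nz] bezoutian_def by unfold_locales auto
qed

lemma secantL_sound:
  assumes "secantL ws s a b" "length s = 5" "set s \<subseteq> {1..8}" "a \<in> {1..8}" "b \<in> {1..8}"
  shows "bezout_config.secant vv (lab (s!0)) (lab (s!1)) (lab (s!2)) (lab (s!3)) (lab (s!4)) (lab a) (lab b)"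
proof -
  have s: "s ! i \<in> {1..8}" if "i < 5" for i using assms(2,3) that by (metis nth_mem subset_iff)
  have v: "vv (lab (s ! i)) = hv h (pnt ws (s ! i))" if "i < 5" for i by (rule vv_lab[OF s[OF that]])
  let ?Q = "cqv (pnt ws (s!0)) (pnt ws (s!1)) (pnt ws (s!2)) (pnt ws (s!3)) (pnt ws (s!4))"
  let ?d = "?Q (addv (pnt ws a) (pnt ws b)) - ?Q (pnt ws a) - ?Q (pnt ws b)"
  have "?d * ?d - 4 * ?Q (pnt ws a) * ?Q (pnt ws b) \<noteq> 0" using assms(1) by (simp add: secantL_def Let_def)
  hence "h (?d * ?d - 4 * ?Q (pnt ws a) * ?Q (pnt ws b)) \<noteq> 0" unfolding h0 .
  hence "h ?d * h ?d - 4 * h (?Q (pnt ws a)) * h (?Q (pnt ws b)) \<noteq> 0" by (simp only: hom not_False_eq_True)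
  thus ?thesis unfolding bezout_config.secant_def[OF vv_bezout] Let_def
    by (simp add: v vv_lab[OF assms(4)] vv_lab[OF assms(5)] add_hv conic5_hv hom power2_eq_square)
qed

lemma distinct_lab: assumes "set l \<subseteq> {1..8}" "distinct l" shows "distinct (map lab l)"
  using assms bij_lab by (auto simp: distinct_map bij_betw_def intro: inj_on_subset)

lemma m_config_vv:
  assumes gen: "genericityL ws Is Js"
  shows "m_config (\<lambda>i. pcl (vv i)) = generic_m (lsets Is) (lsets Js)"
proof -
  interpret bezout_config vv "lsets Is" "lsets Js" by (rule vv_bezout)
  note gI = good_listsD(1)[OF good] and gJ = good_listsD(2)[OF good]
  have mem: "lab k \<in> lset l \<longleftrightarrow> k \<in> set l" if "set l \<subseteq> {1..8}" "k \<in> {1..8}" for k l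
    using that lab_eq_iff by (auto simp: lset_def)
  have out: "set (outside l) \<subseteq> {1..8}" "distinct (outside l)" "k \<in> set (outside l) \<Longrightarrow> k \<notin> set l" for l k
  proof -
    show "set (outside l) \<subseteq> {1..8}" unfolding outside_def set_filter by auto
    show "k \<in> set (outside l) \<Longrightarrow> k \<notin> set l" unfolding outside_def set_filter by blast
    show "distinct (outside l)" unfolding outside_def by (rule distinct_filter) simp
  qed
  have len: "length (outside l) = 8 - card (lset l)" if "set l \<subseteq> {1..8}" for l
    using card_Compl8[of "lset l"] card_lset[OF out(1), of l] distinct_card[OF out(2), of l]
    by (simp add: lset_outside[OF that])
  show ?thesis
  proof (rule m_config_eq)
    fix S assume "S \<in> lsets Js"
    then obtain s where s: "s \<in> set Js" "S = lset s" by (auto simp: lsets_def)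
    note sp = subs_props[OF gJ[OF s(1)]]
    obtain s1 s2 s3 s4 s5 s6 where ss: "s = [s1, s2, s3, s4, s5, s6]" using sp(1) by (auto simp: length_Suc_conv numeral_eq_Suc)
    have c6: "card S = 6" using lsets_card(2)[OF good] s by (auto simp: lsets_def)
    have "length (outside s) = 2" using len[OF sp(3)] c6 s(2) by simp
    then obtain a b where ab: "outside s = [a, b]" by (auto simp: length_Suc_conv numeral_eq_Suc)
    have ab': "a \<in> {1..8}" "b \<in> {1..8}" "a \<noteq> b" "a \<notin> set s" "b \<notin> set s"
      using out(1)[of s] out(2)[of s] out(3)[of a s] out(3)[of b s] unfolding ab by auto
    have "secantL ws s a b" using gen s(1) ab by (auto simp: genericityL_def list_all_iff)
    hence "secantL ws [s1, s2, s3, s4, s5] a b" by (simp add: secantL_def ss)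
    from secantL_sound[OF this _ _ ab'(1,2)] sp(3)
    have sec: "secant (lab s1) (lab s2) (lab s3) (lab s4) (lab s5) (lab a) (lab b)" by (simp add: ss)
    show "mult_discriminant (cS S) = 2"
    proof (rule mult_cS_secant[OF _ _ _ _ _ _ sec])
      show "S \<in> lsets Js" by fact
      show "distinct [lab s1, lab s2, lab s3, lab s4, lab s5]"
        using distinct_lab[OF sp(3,2)] by (simp add: ss)
      show "{lab s1, lab s2, lab s3, lab s4, lab s5} \<subseteq> S" by (auto simp: s(2) ss lset_def)
      show "lab a \<noteq> lab b" using lab_eq_iff ab' by simp
      show "lab a \<notin> S" "lab b \<notin> S" using ab' mem[OF sp(3)] s(2) by auto
    qed
  next
    fix T assume T: "T \<in> own_triples (lsets Is) (lsets Js)"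
    hence TI: "T \<in> lsets Is" by (simp add: own_triples_def)
    then obtain t where t: "t \<in> set Is" "T = lset t" by (auto simp: lsets_def)
    note tp = subs_props[OF gI[OF t(1)]]
    obtain x y z where xyz: "t = [x, y, z]" using tp(1) by (auto simp: length_Suc_conv numeral_eq_Suc)
    have xy: "x \<in> {1..8}" "y \<in> {1..8}" "lab x \<in> T" "lab y \<in> T" "lab x \<noteq> lab y"
      using tp(2,3) lab_eq_iff[of x y] by (auto simp: xyz t(2) lset_def)
    have own: "t \<in> set (ownL Is Js)"
    proof -
      have "outside (t @ s) \<noteq> []" if "s \<in> set Js" for s
        using T that lset_Un_UNIV_iff[OF gI[OF t(1)] gJ[OF that]] t(2) by (auto simp: own_triples_def lsets_def)
      thus ?thesis using t(1) by (simp add: ownL_def list_all_iff)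
    qed
    have c3: "card T = 3" by (rule cardI[OF TI])
    let ?F = "filter (\<lambda>t'. meet t t' = []) Is"
    have F: "case ?F of [] \<Rightarrow> secantL ws (outside t) (t!0) (t!1) | t' # _ \<Rightarrow> triangleL ws t t' (outside (t @ t'))"
      using gen own by (auto simp: genericityL_def list_all_iff)
    show "mult_discriminant (cT T) = (if partner T then 3 else 2)"
    proof (cases ?F)
      case Nil
      have np: "\<not> partner T"
      proof
        assume "partner T"
        then obtain T' where T': "T' \<in> lsets Is" "T \<inter> T' = {}" unfolding partner_def by blast
        then obtain t' where t': "t' \<in> set Is" "T \<inter> lset t' = {}" by (auto simp: lsets_def)
        hence "meet t t' = []" using lset_disjoint_iff[OF gI[OF t(1)] gI[OF t'(1)]] t(2) by simp
        thus False using Nil t'(1) by (auto simp: filter_empty_conv)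
      qed
      have l5: "length (outside t) = 5" using len[OF tp(3)] c3 t(2) by simp
      then obtain s1 s2 s3 s4 s5 where ss: "outside t = [s1, s2, s3, s4, s5]" by (auto simp: length_Suc_conv numeral_eq_Suc)
      have "secantL ws (outside t) x y" using F Nil by (simp add: xyz)
      from secantL_sound[OF this l5 out(1) xy(1,2)]
      have sec: "secant (lab s1) (lab s2) (lab s3) (lab s4) (lab s5) (lab x) (lab y)" by (simp add: ss)
      have "mult_discriminant (cT T) = 2"
      proof (rule mult_cT_secant[OF TI np _ _ xy(5,3,4) sec])
        show "distinct [lab s1, lab s2, lab s3, lab s4, lab s5]" using distinct_lab[OF out(1,2), of t] by (simp add: ss)
        show "{lab s1, lab s2, lab s3, lab s4, lab s5} = - T"
          using lset_outside[OF tp(3)] t(2) by (simp add: ss lset_def)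
      qed
      thus ?thesis using np by simp
    next
      case (Cons t' r)
      hence "t' \<in> set ?F" by simp
      hence t': "t' \<in> set Is" "meet t t' = []" by auto
      note tp' = subs_props[OF gI[OF t'(1)]]
      have T': "lset t' \<in> lsets Is" using t'(1) by (simp add: lsets_def)
      have dis: "T \<inter> lset t' = {}" using lset_disjoint_iff[OF gI[OF t(1)] gI[OF t'(1)]] t(2) t'(2) by simp
      obtain x' y' z' where xyz': "t' = [x', y', z']" using tp'(1) by (auto simp: length_Suc_conv numeral_eq_Suc)
      have xy': "x' \<in> {1..8}" "y' \<in> {1..8}" "lab x' \<in> lset t'" "lab y' \<in> lset t'" "lab x' \<noteq> lab y'"
        using tp'(2,3) lab_eq_iff[of x' y'] by (auto simp: xyz' lset_def)
      have s: "set (t @ t') \<subseteq> {1..8}" using tp(3) tp'(3) by simp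
      have "card (T \<union> lset t') = 6" using cardI[OF TI] cardI[OF T'] dis by (subst card_Un_disjoint) auto
      hence "length (outside (t @ t')) = 2" using len[OF s] t(2) by (simp add: lset_append)
      then obtain a b where ab: "outside (t @ t') = [a, b]" by (auto simp: length_Suc_conv numeral_eq_Suc)
      have ab': "a \<in> {1..8}" "b \<in> {1..8}" "a \<noteq> b" "a \<notin> set (t @ t')" "b \<notin> set (t @ t')"
        using out(1)[of "t @ t'"] out(2)[of "t @ t'"] out(3)[of a "t @ t'"] out(3)[of b "t @ t'"] unfolding ab by auto
      have "triangleL ws t t' [a, b]" using F Cons ab by simp
      hence nz: "br (crs (vv (lab x)) (vv (lab y))) (crs (vv (lab x')) (vv (lab y'))) (crs (vv (lab a)) (vv (lab b))) \<noteq> 0"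
        unfolding vv_lab[OF xy(1)] vv_lab[OF xy(2)] vv_lab[OF xy'(1)] vv_lab[OF xy'(2)] vv_lab[OF ab'(1)] vv_lab[OF ab'(2)]
          crs_hv br_hv h0 by (simp add: triangleL_def xyz xyz')
      have "lab a \<notin> T \<union> lset t'" "lab b \<notin> T \<union> lset t'"
        using ab' mem[OF s] unfolding lset_append t(2) by blast+
      moreover have "lab a \<noteq> lab b" using lab_eq_iff ab' by simp
      ultimately have "mult_discriminant (cT T) = 3"
        by (intro mult_cT_triangle[OF TI T' dis xy(3-5) xy'(3-5) _ _ _ nz])
      moreover have "partner T" using T' dis unfolding partner_def by blast
      ultimately show ?thesis by simp
    qed
  qed
qed

end
end

section \<open>Tables of label sets\<close>

lemma subs_2: "subs 2 = [
  [1, 2], [1, 3], [1, 4], [1, 5], [1, 6], [1, 7], [1, 8], [2, 3], [2, 4], [2, 5], [2, 6], [2, 7], [2, 8],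
  [3, 4], [3, 5], [3, 6], [3, 7], [3, 8], [4, 5], [4, 6], [4, 7], [4, 8], [5, 6], [5, 7], [5, 8], [6, 7],
  [6, 8], [7, 8]]"
  by code_simp

lemma subs_3: "subs 3 = [
  [1, 2, 3], [1, 2, 4], [1, 2, 5], [1, 2, 6], [1, 2, 7], [1, 2, 8], [1, 3, 4], [1, 3, 5], [1, 3, 6], [1, 3, 7],
  [1, 3, 8], [1, 4, 5], [1, 4, 6], [1, 4, 7], [1, 4, 8], [1, 5, 6], [1, 5, 7], [1, 5, 8], [1, 6, 7], [1, 6, 8],
  [1, 7, 8], [2, 3, 4], [2, 3, 5], [2, 3, 6], [2, 3, 7], [2, 3, 8], [2, 4, 5], [2, 4, 6], [2, 4, 7], [2, 4, 8],
  [2, 5, 6], [2, 5, 7], [2, 5, 8], [2, 6, 7], [2, 6, 8], [2, 7, 8], [3, 4, 5], [3, 4, 6], [3, 4, 7], [3, 4, 8],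
  [3, 5, 6], [3, 5, 7], [3, 5, 8], [3, 6, 7], [3, 6, 8], [3, 7, 8], [4, 5, 6], [4, 5, 7], [4, 5, 8], [4, 6, 7],
  [4, 6, 8], [4, 7, 8], [5, 6, 7], [5, 6, 8], [5, 7, 8], [6, 7, 8]]"
  by code_simp

lemma subs_6: "subs 6 = [
  [1, 2, 3, 4, 5, 6], [1, 2, 3, 4, 5, 7], [1, 2, 3, 4, 5, 8], [1, 2, 3, 4, 6, 7], [1, 2, 3, 4, 6, 8],
  [1, 2, 3, 4, 7, 8], [1, 2, 3, 5, 6, 7], [1, 2, 3, 5, 6, 8], [1, 2, 3, 5, 7, 8], [1, 2, 3, 6, 7, 8],
  [1, 2, 4, 5, 6, 7], [1, 2, 4, 5, 6, 8], [1, 2, 4, 5, 7, 8], [1, 2, 4, 6, 7, 8], [1, 2, 5, 6, 7, 8],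
  [1, 3, 4, 5, 6, 7], [1, 3, 4, 5, 6, 8], [1, 3, 4, 5, 7, 8], [1, 3, 4, 6, 7, 8], [1, 3, 5, 6, 7, 8],
  [1, 4, 5, 6, 7, 8], [2, 3, 4, 5, 6, 7], [2, 3, 4, 5, 6, 8], [2, 3, 4, 5, 7, 8], [2, 3, 4, 6, 7, 8],
  [2, 3, 5, 6, 7, 8], [2, 4, 5, 6, 7, 8], [3, 4, 5, 6, 7, 8]]"
  by code_simp

text \<open>The certificates consult the subsets of sizes 2, 3 and 6; for these, evaluation uses the
  tables instead of enumerating all subsequences.\<close>

lemma subs_code [code]:
  "subs n = (if n = 2 then [
    [1, 2], [1, 3], [1, 4], [1, 5], [1, 6], [1, 7], [1, 8], [2, 3], [2, 4], [2, 5], [2, 6], [2, 7], [2, 8],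
    [3, 4], [3, 5], [3, 6], [3, 7], [3, 8], [4, 5], [4, 6], [4, 7], [4, 8], [5, 6], [5, 7], [5, 8], [6, 7],
    [6, 8], [7, 8]]
  else if n = 3 then [
    [1, 2, 3], [1, 2, 4], [1, 2, 5], [1, 2, 6], [1, 2, 7], [1, 2, 8], [1, 3, 4], [1, 3, 5], [1, 3, 6], [1, 3, 7],
    [1, 3, 8], [1, 4, 5], [1, 4, 6], [1, 4, 7], [1, 4, 8], [1, 5, 6], [1, 5, 7], [1, 5, 8], [1, 6, 7], [1, 6, 8],
    [1, 7, 8], [2, 3, 4], [2, 3, 5], [2, 3, 6], [2, 3, 7], [2, 3, 8], [2, 4, 5], [2, 4, 6], [2, 4, 7], [2, 4, 8],
    [2, 5, 6], [2, 5, 7], [2, 5, 8], [2, 6, 7], [2, 6, 8], [2, 7, 8], [3, 4, 5], [3, 4, 6], [3, 4, 7], [3, 4, 8],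
    [3, 5, 6], [3, 5, 7], [3, 5, 8], [3, 6, 7], [3, 6, 8], [3, 7, 8], [4, 5, 6], [4, 5, 7], [4, 5, 8], [4, 6, 7],
    [4, 6, 8], [4, 7, 8], [5, 6, 7], [5, 6, 8], [5, 7, 8], [6, 7, 8]]
  else if n = 6 then [
    [1, 2, 3, 4, 5, 6], [1, 2, 3, 4, 5, 7], [1, 2, 3, 4, 5, 8], [1, 2, 3, 4, 6, 7], [1, 2, 3, 4, 6, 8],
    [1, 2, 3, 4, 7, 8], [1, 2, 3, 5, 6, 7], [1, 2, 3, 5, 6, 8], [1, 2, 3, 5, 7, 8], [1, 2, 3, 6, 7, 8],
    [1, 2, 4, 5, 6, 7], [1, 2, 4, 5, 6, 8], [1, 2, 4, 5, 7, 8], [1, 2, 4, 6, 7, 8], [1, 2, 5, 6, 7, 8],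
    [1, 3, 4, 5, 6, 7], [1, 3, 4, 5, 6, 8], [1, 3, 4, 5, 7, 8], [1, 3, 4, 6, 7, 8], [1, 3, 5, 6, 7, 8],
    [1, 4, 5, 6, 7, 8], [2, 3, 4, 5, 6, 7], [2, 3, 4, 5, 6, 8], [2, 3, 4, 5, 7, 8], [2, 3, 4, 6, 7, 8],
    [2, 3, 5, 6, 7, 8], [2, 4, 5, 6, 7, 8], [3, 4, 5, 6, 7, 8]]
  else filter (\<lambda>l. length l = n) (subseqs [1..<9]))"
proof -
  consider "n = 2" | "n = 3" | "n = 6" | "n \<noteq> 2" "n \<noteq> 3" "n \<noteq> 6" by blast
  thus ?thesis
  proof cases
    case 1 thus ?thesis by (simp only: subs_2 if_True refl)
  next
    case 2
    have "(3 :: nat) \<noteq> 2" by simp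
    thus ?thesis using 2 by (simp only: subs_3 if_True if_False refl)
  next
    case 3
    have "(6 :: nat) \<noteq> 2" "(6 :: nat) \<noteq> 3" by simp_all
    thus ?thesis using 3 by (simp only: subs_6 if_True if_False refl)
  next
    case 4 thus ?thesis by (simp only: subs_def if_False)
  qed
qed

text \<open>Entries are \<open>(i, \<I>, \<J>, \<delta>, c, ws)\<close>: \<open>c\<close> is 1 or 2 if \<open>i\<close> belongs to (a) or (b), and 0 otherwise,
  and \<open>ws\<close> is an integral realization.  Number 41 is the MacLane configuration, which has no real
  realization.\<close>

type_synonym entry = "nat \<times> nat list list \<times> nat list list \<times> int \<times> nat \<times> int vec3 list"

definition entries1 :: "entry list" where "entries1 = [
    (1, [], [], 12, 0,
     [(1, -2, -2), (1, -2, 2), (1, 0, 1), (2, 1, 1), (0, 1, 2), (2, 1, 0), (1, 2, 1), (0, 2, 1)]),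
    (2, [], [[1, 2, 3, 4, 5, 6]], 10, 0,
     [(2, 1, 2), (2, 1, 1), (2, -1, -1), (1, 1, 0), (1, -1, -2), (2, -2, 1), (1, -2, 2), (1, 1, -1)]),
    (3, [], [[1, 2, 3, 4, 5, 6], [1, 2, 3, 4, 7, 8]], 8, 0,
     [(1, 0, -2), (1, -2, 2), (1, -2, 1), (1, 0, -1), (2, -1, 0), (2, -3, 3), (2, 2, -1), (2, 6, -1)]),
    (4, [], [[1, 2, 3, 4, 5, 6], [1, 2, 3, 4, 7, 8], [1, 2, 5, 6, 7, 8]], 6, 0,
     [(1, 2, 2), (1, -2, 1), (1, -2, 0), (5, -1, -1), (1, 1, 0), (1, 1, 2), (1, -1, 1), (1, 2, -1)]),
    (5, [], [[1, 2, 3, 4, 5, 6], [1, 2, 3, 4, 7, 8], [1, 2, 5, 6, 7, 8], [3, 4, 5, 6, 7, 8]], 4, 0,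
     [(0, 1, 2), (2, 1, 0), (2, 1, 1), (1, 1, 2), (1, 2, -2), (2, -2, -1), (1, 1, 0), (0, 1, 1)]),
    (8, [[1, 2, 3]], [], 10, 0,
     [(1, 0, 2), (0, 1, -2), (1, 1, 0), (2, 0, 1), (1, -2, 0), (2, -2, -1), (1, -2, -2), (2, 2, -1)]),
    (9, [[1, 2, 3]], [[1, 2, 4, 5, 6, 7]], 8, 0,
     [(1, 1, 1), (0, 1, 1), (3, 1, 1), (3, 0, -1), (3, -1, 3), (0, 0, 1), (2, -1, 0), (1, 2, 0)]),
    (10, [[1, 2, 3]], [[1, 4, 5, 6, 7, 8]], 9, 1,
     [(1, 0, -2), (1, 2, 2), (1, 1, 0), (2, 0, -1), (1, -2, -2), (0, 2, -1), (0, 1, -2), (2, -1, 2)])]"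

definition entries2 :: "entry list" where "entries2 = [
    (11, [[1, 2, 3]], [[1, 2, 4, 5, 6, 7], [1, 3, 4, 5, 6, 8]], 6, 0,
     [(1, 2, -2), (1, -2, -2), (1, 0, -2), (1, -1, 1), (1, 1, 1), (2, 1, 0), (2, -1, 0), (2, 1, -2)]),
    (12, [[1, 2, 3]], [[1, 2, 4, 5, 6, 7], [3, 4, 5, 6, 7, 8]], 7, 1,
     [(1, 2, 0), (1, 3, 0), (1, -3, 0), (1, -1, -2), (2, 1, 2), (1, 0, 1), (0, 1, 1), (3, 2, 1)]),
    (13, [[1, 2, 3]], [[1, 2, 4, 5, 6, 7], [1, 3, 4, 5, 6, 8], [2, 3, 4, 5, 7, 8]], 4, 0,
     [(3, 0, 1), (1, 2, 1), (2, 1, 1), (2, -2, -1), (2, -1, 0), (1, 1, 0), (3, -3, -2), (2, 1, -2)]),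
    (15, [[1, 2, 3], [1, 4, 5]], [], 8, 0,
     [(0, 1, 2), (1, -1, 2), (1, -2, 0), (2, -1, 2), (1, -1, 0), (2, 1, 1), (1, -2, -1), (2, 0, 1)]),
    (16, [[1, 2, 3], [1, 4, 5]], [[1, 2, 4, 6, 7, 8]], 6, 0,
     [(1, 0, -1), (1, 0, 1), (2, 0, 1), (2, 1, -2), (1, 1, -1), (1, -1, 0), (2, -2, 1), (2, -1, 2)]),
    (17, [[1, 2, 3], [1, 4, 5]], [[2, 3, 4, 5, 6, 7]], 6, 0,
     [(2, 0, 1), (0, 1, 0), (2, -1, 1), (1, 0, -1), (1, 0, 1), (0, 1, -1), (2, -1, 0), (1, -2, -2)]),
    (18, [[1, 2, 3], [1, 4, 5]], [[2, 3, 4, 6, 7, 8]], 7, 1,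
     [(1, 0, 1), (1, -1, 0), (1, 1, 2), (2, -1, 2), (1, -1, 1), (1, 2, 2), (2, 1, -2), (2, -1, -2)]),
    (19, [[1, 2, 3], [1, 4, 5]], [[1, 2, 4, 6, 7, 8], [1, 3, 5, 6, 7, 8]], 4, 0,
     [(1, -1, 1), (1, 2, 0), (2, 1, 1), (1, -2, 2), (0, 1, -1), (1, -2, -1), (1, 1, -2), (1, -1, -1)])]"

definition entries3 :: "entry list" where "entries3 = [
    (20, [[1, 2, 3], [1, 4, 5]], [[1, 2, 4, 6, 7, 8], [2, 3, 4, 5, 6, 7]], 4, 0,
     [(1, 1, 0), (1, -1, -1), (2, 0, -1), (1, 0, 1), (0, 1, -1), (0, 1, 1), (2, 2, 3), (1, -1, 1)]),
    (21, [[1, 2, 3], [1, 4, 5]], [[1, 2, 4, 6, 7, 8], [2, 3, 5, 6, 7, 8]], 5, 1,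
     [(1, -1, -1), (2, 1, 1), (3, -2, -2), (0, 1, 2), (2, -1, 0), (2, -1, 2), (2, 1, 2), (0, 1, -2)]),
    (22, [[1, 2, 3], [1, 4, 5]], [[1, 2, 4, 6, 7, 8], [1, 3, 5, 6, 7, 8], [2, 3, 4, 5, 6, 7]], 2, 0,
     [(1, 0, -1), (1, -2, -3), (0, 1, 1), (2, 2, 1), (3, 2, 0), (3, 2, 2), (2, -1, 0), (3, 0, 1)]),
    (24, [[1, 2, 3], [1, 4, 5], [1, 6, 7]], [], 6, 0,
     [(0, 1, 1), (2, -1, -1), (1, -1, -1), (2, 1, 2), (2, 0, 1), (1, 1, -1), (1, 2, 0), (2, 1, 0)]),
    (25, [[1, 2, 3], [1, 4, 5], [1, 6, 7]], [[2, 3, 4, 5, 6, 7]], 4, 0,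
     [(1, -2, 1), (2, -2, 1), (2, 2, -1), (1, -2, 2), (1, -2, -2), (1, -1, 1), (2, -1, 2), (0, 1, -2)]),
    (26, [[1, 2, 3], [1, 4, 5], [1, 6, 7]], [[2, 3, 4, 5, 6, 8]], 5, 1,
     [(0, 1, 1), (1, 1, 0), (1, 2, 1), (1, -1, -1), (1, -2, -2), (1, -1, 0), (1, 0, 1), (1, 1, -1)]),
    (28, [[1, 2, 3], [1, 4, 5], [1, 6, 7], [2, 4, 6]], [], 4, 0,
     [(0, 0, 1), (1, 0, 0), (2, 0, -1), (1, -1, 1), (2, -2, -1), (1, 2, -2), (1, 2, -1), (0, 1, 1)]),
    (29, [[1, 2, 3], [1, 4, 5], [1, 6, 7], [2, 4, 6]], [[2, 3, 4, 5, 7, 8]], 3, 1,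
     [(1, 1, -1), (2, 1, 1), (1, 0, 2), (1, 1, 0), (2, 2, -1), (0, 1, -1), (2, 1, -1), (1, 2, 2)])]"

definition entries4 :: "entry list" where "entries4 = [
    (30, [[1, 2, 3], [1, 4, 5], [1, 6, 7], [2, 4, 6], [2, 5, 7]], [], 2, 0,
     [(1, 0, 0), (2, 0, 1), (1, 0, 1), (0, 2, 1), (2, 2, 1), (1, -1, 0), (0, 1, 0), (2, 1, -2)]),
    (31, [[1, 2, 3], [1, 4, 5], [1, 6, 7], [2, 4, 6], [2, 5, 7]], [[3, 4, 5, 6, 7, 8]], 1, 1,
     [(1, -1, 0), (2, -1, -1), (0, 1, -1), (1, 0, -2), (0, 1, -2), (1, -1, 1), (2, -2, 1), (2, 0, 1)]),
    (32, [[1, 2, 3], [1, 4, 5], [1, 6, 7], [2, 4, 6], [2, 5, 7], [3, 4, 7]], [], 0, 0,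
     [(1, 0, 0), (1, -2, -1), (1, 2, 1), (1, 2, 0), (1, -2, 0), (2, 0, -1), (0, 0, 1), (1, 1, -2)]),
    (33, [[1, 2, 3], [1, 4, 5], [1, 6, 7], [2, 4, 6], [2, 5, 7], [3, 4, 7], [3, 5, 8]], [], 0, 2,
     [(0, 1, -1), (2, -1, 1), (1, 0, 0), (1, 1, 0), (1, 0, 1), (1, -2, 1), (1, -1, 0), (2, 0, 1)]),
    (34, [[1, 2, 3], [1, 4, 5], [1, 6, 7], [2, 4, 6], [2, 5, 7], [3, 4, 8]], [], 2, 2,
     [(1, -1, -2), (1, 0, -1), (1, 1, 0), (0, 1, 0), (1, 0, -2), (1, -1, -1), (0, 0, 1), (2, 1, 0)]),
    (35, [[1, 2, 3], [1, 4, 5], [1, 6, 7], [2, 4, 6], [2, 5, 7], [3, 4, 8], [5, 6, 8]], [], 1, 2,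
     [(1, 0, 0), (1, 0, -1), (1, 0, 1), (1, -1, 0), (0, 1, 0), (0, 1, -1), (1, 1, -1), (0, 1, 1)]),
    (36, [[1, 2, 3], [1, 4, 5], [1, 6, 7], [2, 4, 6], [2, 5, 7], [4, 7, 8]], [], 1, 0,
     [(1, 0, 2), (1, 1, 0), (2, 1, 2), (0, 0, 1), (1, 0, 0), (1, 1, 1), (1, 2, 0), (1, 2, -1)]),
    (37, [[1, 2, 3], [1, 4, 5], [1, 6, 7], [2, 4, 6], [2, 5, 8]], [], 3, 0,
     [(1, 1, 0), (0, 1, -1), (1, 2, -1), (1, -1, 0), (1, 2, 0), (1, 0, -1), (0, 1, 1), (1, 1, 1)])]"

definition entries5 :: "entry list" where "entries5 = [
    (38, [[1, 2, 3], [1, 4, 5], [1, 6, 7], [2, 4, 6], [2, 5, 8]], [[3, 4, 5, 6, 7, 8]], 2, 1,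
     [(0, 1, 0), (0, 1, -2), (0, 1, -1), (1, -1, 2), (1, 0, 2), (2, -1, 2), (1, 2, 1), (1, 2, -2)]),
    (39, [[1, 2, 3], [1, 4, 5], [1, 6, 7], [2, 4, 6], [2, 5, 8], [3, 5, 7]], [], 2, 0,
     [(1, -1, -1), (0, 1, 0), (1, 2, -1), (0, 0, 1), (1, -1, 2), (0, 2, 1), (1, 1, 0), (1, 0, 2)]),
    (40, [[1, 2, 3], [1, 4, 5], [1, 6, 7], [2, 4, 6], [2, 5, 8], [3, 5, 7], [3, 6, 8]], [], 1, 0,
     [(0, 1, -1), (1, -1, 0), (1, 0, -1), (2, -1, 1), (1, -1, 1), (0, 1, 1), (0, 1, -2), (1, -1, -2)]),
    (41, [[1, 2, 3], [1, 4, 5], [1, 6, 7], [2, 4, 6], [2, 5, 8], [3, 5, 7], [3, 6, 8], [4, 7, 8]], [], 0, 0,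
     []),
    (42, [[1, 2, 3], [1, 4, 5], [1, 6, 7], [2, 4, 6], [2, 5, 8], [3, 7, 8]], [], 3, 2,
     [(1, -1, 1), (1, 0, -1), (2, -1, 0), (1, -1, 0), (1, -1, -1), (0, 1, -1), (2, -1, 1), (2, -1, -2)]),
    (43, [[1, 2, 3], [1, 4, 5], [1, 6, 7], [2, 4, 6], [3, 5, 7]], [], 3, 0,
     [(0, 1, -2), (1, -1, 1), (1, 0, -1), (1, -1, 2), (1, 1, -2), (0, 0, 1), (0, 1, -1), (2, 1, 2)]),
    (44, [[1, 2, 3], [1, 4, 5], [1, 6, 7], [2, 4, 6], [3, 5, 8]], [], 4, 2,
     [(1, 0, -1), (0, 1, -1), (1, -1, 0), (1, 0, 0), (2, 0, 1), (1, 1, -1), (2, 1, -2), (1, 1, 1)]),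
    (45, [[1, 2, 3], [1, 4, 5], [1, 6, 7], [2, 4, 8]], [], 5, 0,
     [(1, -1, 0), (0, 1, 0), (2, -1, 0), (2, 0, 1), (1, 1, 1), (2, 1, -2), (1, 2, -2), (2, -1, 1)])]"

definition entries6 :: "entry list" where "entries6 = [
    (46, [[1, 2, 3], [1, 4, 5], [1, 6, 7], [2, 4, 8]], [[2, 3, 4, 5, 6, 7]], 3, 0,
     [(1, 2, 0), (1, 0, 0), (1, -1, 0), (0, 1, 1), (1, 0, -2), (0, 2, -1), (2, 2, 1), (2, 1, 1)]),
    (47, [[1, 2, 3], [1, 4, 5], [1, 6, 7], [2, 4, 8]], [[2, 3, 5, 6, 7, 8]], 4, 1,
     [(1, -1, 0), (1, 1, 1), (0, 2, 1), (1, 0, -1), (2, -1, -1), (2, -1, 1), (1, 0, 1), (0, 1, 2)]),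
    (48, [[1, 2, 3], [1, 4, 5], [1, 6, 7], [2, 4, 8], [3, 5, 8]], [], 4, 2,
     [(0, 0, 1), (2, 1, 0), (2, 1, -2), (0, 1, -1), (0, 1, 1), (2, -1, -1), (2, -1, 1), (2, 2, -1)]),
    (49, [[1, 2, 3], [1, 4, 5], [1, 6, 7], [2, 4, 8], [3, 5, 8]], [[2, 3, 4, 5, 6, 7]], 2, 2,
     [(1, 1, 0), (0, 1, -1), (1, 0, 1), (1, 0, -1), (0, 1, 1), (1, 1, -1), (1, 1, 1), (1, -1, 0)]),
    (50, [[1, 2, 3], [1, 4, 5], [1, 6, 7], [2, 4, 8], [3, 6, 8]], [], 4, 0,
     [(1, 0, 0), (1, 1, 0), (1, -2, 0), (1, 0, 1), (2, 0, 1), (1, -1, -1), (0, 1, 1), (0, 1, -1)]),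
    (51, [[1, 2, 3], [1, 4, 5], [1, 6, 7], [2, 4, 8], [3, 6, 8]], [[2, 3, 4, 5, 6, 7]], 2, 0,
     [(1, 0, 1), (0, 1, 0), (1, 1, 1), (1, 1, -1), (0, 1, -2), (1, 0, 0), (1, 0, 2), (1, -1, -1)]),
    (52, [[1, 2, 3], [1, 4, 5], [1, 6, 7], [2, 4, 8], [3, 6, 8], [5, 7, 8]], [], 3, 0,
     [(0, 1, -2), (0, 1, 0), (0, 0, 1), (1, 0, 0), (1, 1, -2), (1, -1, -1), (1, -2, 1), (1, -1, 0)]),
    (53, [[1, 2, 3], [1, 4, 5], [1, 6, 7], [2, 4, 8], [3, 6, 8], [5, 7, 8]], [[2, 3, 4, 5, 6, 7]], 1, 0,
     [(1, 1, -1), (2, 1, 1), (3, 1, 3), (1, 2, 0), (1, -1, -3), (0, 1, 0), (1, -1, -1), (1, -1, 1)])]"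

definition entries7 :: "entry list" where "entries7 = [
    (54, [[1, 2, 3], [1, 4, 5], [2, 4, 6]], [], 6, 0,
     [(2, -1, -2), (1, 2, -1), (0, 1, 0), (0, 1, -2), (1, 0, -2), (1, 1, 1), (1, 1, 0), (2, -2, -1)]),
    (55, [[1, 2, 3], [1, 4, 5], [2, 4, 6]], [[1, 2, 5, 6, 7, 8]], 4, 0,
     [(0, 0, 1), (2, -1, 2), (2, -1, 1), (2, 1, 0), (2, 1, -2), (2, 2, -1), (1, -1, 1), (1, 0, 2)]),
    (56, [[1, 2, 3], [1, 4, 5], [2, 4, 6]], [[1, 3, 5, 6, 7, 8]], 5, 1,
     [(2, 2, 1), (0, 1, 1), (2, 0, -1), (1, 2, 2), (1, 0, -1), (1, 1, 1), (1, -1, 0), (1, 2, 0)]),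
    (57, [[1, 2, 3], [1, 4, 5], [2, 4, 6]], [[1, 2, 5, 6, 7, 8], [1, 3, 4, 6, 7, 8]], 2, 0,
     [(1, -1, 0), (1, 1, 0), (1, -2, 0), (2, 0, -1), (1, 1, -1), (0, 2, 1), (0, 1, 1), (1, -1, -4)]),
    (58, [[1, 2, 3], [1, 4, 5], [2, 4, 6]], [[1, 2, 5, 6, 7, 8], [3, 4, 5, 6, 7, 8]], 3, 1,
     [(1, 0, 1), (0, 3, -1), (3, 3, 2), (3, 2, 2), (1, 2, 0), (3, -4, 4), (3, 0, -4), (1, 1, 0)]),
    (59, [[1, 2, 3], [1, 4, 5], [2, 4, 6]], [[1, 2, 5, 6, 7, 8], [1, 3, 4, 6, 7, 8], [2, 3, 4, 5, 7, 8]], 0, 0,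
     [(0, 1, 0), (1, -1, -1), (1, 0, -1), (0, 1, 2), (0, 3, 2), (2, -1, 0), (3, 0, 2), (1, -1, -2)]),
    (60, [[1, 2, 3], [1, 4, 5], [2, 4, 6], [3, 5, 6]], [], 4, 0,
     [(2, 0, -1), (0, 1, 0), (2, 1, -1), (1, 1, -2), (1, -1, 1), (1, 2, -2), (0, 0, 1), (1, -2, 0)]),
    (61, [[1, 2, 3], [1, 4, 5], [2, 4, 6], [3, 5, 6]], [[1, 2, 5, 6, 7, 8]], 2, 0,
     [(0, 1, 1), (0, 1, 2), (0, 0, 1), (1, 1, 2), (1, 0, 1), (1, 0, 0), (1, 2, 1), (2, 1, 0)])]"

definition entries8 :: "entry list" where "entries8 = [
    (62, [[1, 2, 3], [1, 4, 5], [2, 4, 6], [3, 5, 6]], [[1, 2, 5, 6, 7, 8], [1, 3, 4, 6, 7, 8]], 0, 0,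
     [(1, 0, -1), (2, 0, 1), (1, 0, 0), (1, 1, 0), (2, 1, -1), (1, -1, 1), (1, 1, 1), (1, 2, -1)]),
    (64, [[1, 2, 3], [1, 4, 5], [2, 4, 6], [3, 5, 7]], [], 5, 0,
     [(1, -1, -1), (1, -2, -2), (1, 1, 1), (2, -2, -1), (0, 0, 1), (1, 0, 1), (1, 1, 2), (1, 2, 0)]),
    (65, [[1, 2, 3], [1, 4, 5], [2, 4, 6], [3, 5, 7]], [[1, 2, 5, 6, 7, 8]], 3, 0,
     [(0, 0, 1), (1, 1, 2), (2, 2, -1), (2, -1, 1), (2, -1, -1), (1, -1, 0), (2, 0, -1), (1, -2, 2)]),
    (66, [[1, 2, 3], [1, 4, 5], [2, 4, 6], [3, 5, 7]], [[1, 2, 5, 6, 7, 8], [1, 3, 4, 6, 7, 8]], 1, 0,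
     [(3, 0, -1), (1, 1, 1), (2, -1, -2), (0, 1, 0), (3, 1, -1), (2, 1, 2), (1, -3, -3), (1, 0, 3)]),
    (67, [[1, 2, 3], [1, 4, 5], [2, 4, 6], [3, 5, 7], [6, 7, 8]], [], 5, 2,
     [(1, 1, 1), (1, 0, 1), (1, -1, 1), (1, 1, 0), (0, 0, 1), (0, 1, -1), (1, -1, -1), (1, -2, 0)]),
    (68, [[1, 2, 3], [1, 4, 5], [2, 4, 6], [3, 7, 8]], [], 6, 2,
     [(0, 1, 1), (1, 2, 2), (1, 1, 1), (1, 0, -1), (1, -1, -2), (2, 2, 1), (0, 1, -1), (1, 2, 0)]),
    (69, [[1, 2, 3], [1, 4, 5], [2, 4, 6], [3, 7, 8]], [[1, 2, 5, 6, 7, 8]], 4, 2,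
     [(1, 2, 1), (2, 1, 0), (1, -1, -1), (1, 2, 0), (1, 2, -2), (1, 1, 0), (0, 1, -1), (1, 0, -2)]),
    (70, [[1, 2, 3], [1, 4, 5], [2, 6, 7]], [], 7, 0,
     [(1, 1, 0), (1, -1, -1), (2, 0, -1), (1, 0, 1), (0, 1, -1), (2, -2, -1), (1, -1, 0), (1, 1, 1)])]"

definition entries9 :: "entry list" where "entries9 = [
    (71, [[1, 2, 3], [1, 4, 5], [2, 6, 7]], [[1, 3, 4, 6, 7, 8]], 5, 0,
     [(2, 1, -1), (1, 2, 0), (1, -1, -1), (1, 2, 1), (1, 1, 0), (2, 0, 1), (1, -2, 1), (2, 1, 1)]),
    (72, [[1, 2, 3], [1, 4, 5], [2, 6, 7]], [[3, 4, 5, 6, 7, 8]], 6, 1,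
     [(1, 2, 0), (1, 0, -2), (0, 1, 1), (1, 1, 1), (2, 3, 1), (0, 0, 1), (1, 0, 1), (2, -2, 1)]),
    (73, [[1, 2, 3], [1, 4, 5], [2, 6, 7]], [[1, 3, 4, 6, 7, 8], [2, 3, 4, 5, 6, 8]], 3, 0,
     [(0, 1, 1), (1, -1, 0), (1, 1, 2), (1, 1, 1), (1, -1, -1), (0, 1, -1), (1, -2, 1), (1, -2, 2)]),
    (74, [[1, 2, 3], [1, 4, 5], [2, 6, 7], [4, 6, 8]], [], 6, 0,
     [(1, -1, 0), (1, 0, 0), (2, -1, 0), (2, 1, 2), (1, 2, 2), (1, 0, 1), (1, 0, -1), (2, -1, 2)]),
    (75, [[1, 2, 3], [1, 4, 5], [2, 6, 7], [4, 6, 8]], [[1, 3, 5, 6, 7, 8]], 4, 0,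
     [(2, -1, 0), (1, -1, 0), (1, -2, 0), (1, 0, 1), (1, -1, -1), (1, 1, -1), (0, 2, -1), (0, 1, -2)]),
    (76, [[1, 2, 3], [1, 4, 5], [2, 6, 7], [4, 6, 8]], [[1, 3, 5, 6, 7, 8], [2, 3, 4, 5, 7, 8]], 2, 0,
     [(1, 2, 0), (1, 1, 1), (0, 1, -1), (1, -1, 1), (2, 1, 1), (1, -1, 0), (2, 0, 1), (0, 0, 1)]),
    (77, [[1, 2, 3], [1, 4, 5], [6, 7, 8]], [], 8, 2,
     [(0, 1, 1), (1, 0, 1), (1, 1, 2), (1, 0, 0), (1, -2, -2), (1, 1, -1), (0, 1, 0), (2, 1, -2)]),
    (78, [[1, 2, 3], [1, 4, 5], [6, 7, 8]], [[2, 3, 4, 5, 6, 7]], 6, 2,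
     [(0, 1, 1), (2, -1, 1), (1, -2, -1), (2, 0, -1), (2, 1, 0), (2, -1, 0), (1, 0, -1), (1, -1, 1)])]"

definition entries10 :: "entry list" where "entries10 = [
    (79, [[1, 2, 3], [4, 5, 6]], [], 9, 0,
     [(1, -2, -1), (0, 1, -1), (1, -1, -2), (2, -1, -1), (0, 1, 0), (2, 1, -1), (2, 0, 1), (1, -2, 0)]),
    (80, [[1, 2, 3], [4, 5, 6]], [[1, 2, 4, 5, 7, 8]], 7, 0,
     [(0, 1, -2), (2, -1, -2), (1, -2, 2), (1, 2, 1), (1, 1, -1), (0, 1, 2), (2, -1, 2), (2, 2, -1)]),
    (81, [[1, 2, 3], [4, 5, 6]], [[1, 2, 4, 5, 7, 8], [1, 3, 4, 6, 7, 8]], 5, 0,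
     [(1, -2, 0), (0, 1, 0), (1, -3, 0), (2, 3, 3), (0, 1, -1), (1, 1, 2), (2, 0, 1), (1, 1, 1)]),
    (82, [[1, 2, 3], [4, 5, 6]], [[1, 2, 4, 5, 7, 8], [1, 3, 4, 6, 7, 8], [2, 3, 5, 6, 7, 8]], 3, 0,
     [(1, 1, 0), (2, -1, 0), (0, 1, 0), (2, -1, 1), (4, 1, -1), (0, 1, -1), (1, -3, -1), (1, 0, -2)])]"

definition entry_ok :: "entry \<Rightarrow> bool"
  where "entry_ok = (\<lambda>(i, Is, Js, d, c, ws). bezoutianL Is Js \<and>
    int (genericL Is Js) = 12 - d - (if c = 0 then 0 else 1) \<and>
    (pattern77L Is \<longleftrightarrow> c = 2) \<and> (pattern10L Is Js \<and> \<not> pattern77L Is \<longleftrightarrow> c = 1) \<and>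
    (ws = [] \<or> config_okL ws Is Js \<and> genericityL ws Is Js))"

lemma entries1_ok: "list_all entry_ok entries1" by code_simp
lemma entries2_ok: "list_all entry_ok entries2" by code_simp
lemma entries3_ok: "list_all entry_ok entries3" by code_simp
lemma entries4_ok: "list_all entry_ok entries4" by code_simp
lemma entries5_ok: "list_all entry_ok entries5" by code_simp
lemma entries6_ok: "list_all entry_ok entries6" by code_simp
lemma entries7_ok: "list_all entry_ok entries7" by code_simp
lemma entries8_ok: "list_all entry_ok entries8" by code_simp
lemma entries9_ok: "list_all entry_ok entries9" by code_simp
lemma entries10_ok: "list_all entry_ok entries10" by code_simp

section \<open>The catalogue and its agreement with the given list\<close>

definition catalogue :: "entry list"
  where "catalogue = entries1 @ entries2 @ entries3 @ entries4 @ entries5 @ entries6 @ entries7 @ entries8 @ entries9 @ entries10"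

lemmas catalogue_defs = catalogue_def entries1_def entries2_def entries3_def entries4_def entries5_def entries6_def entries7_def entries8_def entries9_def entries10_def

lemma catalogue_ok: "e \<in> set catalogue \<Longrightarrow> entry_ok e"
proof -
  have "list_all entry_ok catalogue"
    unfolding catalogue_def list_all_append by (intro conjI entries1_ok entries2_ok entries3_ok entries4_ok entries5_ok entries6_ok entries7_ok entries8_ok entries9_ok entries10_ok)
  thus "e \<in> set catalogue \<Longrightarrow> entry_ok e" by (simp add: list_all_iff)
qed

lemma quatroid_list_eq: "quatroid_list = map (\<lambda>(i, Is, Js, d, c, ws). (i, (lsets Is, lsets Js), d)) catalogue"
  by (simp add: quatroid_list_def catalogue_defs lsets_def lset_def)

lemma quatroid_list_distinct: "distinct (map fst quatroid_list)"
  by (simp add: quatroid_list_def)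

lemma quat_delta:
  assumes "(i, Is, Js, d, c, ws) \<in> set catalogue"
  shows "i \<in> listed" "quat i = (lsets Is, lsets Js)" "delta i = d"
proof -
  have m: "(i, (lsets Is, lsets Js), d) \<in> set quatroid_list"
    unfolding quatroid_list_eq set_map by (rule image_eqI[OF _ assms]) simp
  thus "i \<in> listed" unfolding listed_def by force
  have "map_of quatroid_list i = Some ((lsets Is, lsets Js), d)"
    by (rule map_of_is_SomeI[OF quatroid_list_distinct m])
  thus "quat i = (lsets Is, lsets Js)" "delta i = d" by (simp_all add: quat_def delta_def)
qed

lemma listedE:
  assumes "i \<in> listed" obtains Is Js d c ws where "(i, Is, Js, d, c, ws) \<in> set catalogue"
  using assms unfolding listed_def quatroid_list_eq by auto

text \<open>The integers \<open>a + b \<omega>\<close> with \<open>\<omega>\<close> a primitive third root of unity.\<close>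

datatype eis = Eis int int

instantiation eis :: comm_ring_1
begin

definition "0 = Eis 0 0"
definition "1 = Eis 1 0"
definition "x + y = (case x of Eis a b \<Rightarrow> case y of Eis c d \<Rightarrow> Eis (a + c) (b + d))"
definition "- x = (case x of Eis a b \<Rightarrow> Eis (- a) (- b))"
definition "x - y = (case x of Eis a b \<Rightarrow> case y of Eis c d \<Rightarrow> Eis (a - c) (b - d))"
text \<open>The product is reduced by means of \<open>w^2 = - 1 - w\<close> for the primitive third
  root of unity \<open>w\<close>.\<close>

definition "x * y = (case x of Eis a b \<Rightarrow> case y of Eis c d \<Rightarrow> Eis (a * c - b * d) (a * d + b * c - b * d))"

instance
  by standard (auto simp: zero_eis_def one_eis_def plus_eis_def uminus_eis_def minus_eis_def times_eis_def
    algebra_simps split: eis.splits)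

end

definition eis_complex :: "eis \<Rightarrow> complex"
  where "eis_complex x = (case x of Eis a b \<Rightarrow> of_int a + of_int b * Complex (- 1 / 2) (sqrt 3 / 2))"

lemma ring_hom1_eis: "ring_hom1 eis_complex"
proof -
  define w where "w = Complex (- 1 / 2) (sqrt 3 / 2)"
  have "sqrt 3 * sqrt 3 = 3" by simp
  hence w: "w * w = - 1 - w" unfolding w_def by (simp add: complex_eq_iff)
  have e: "eis_complex (Eis a b) = of_int a + of_int b * w" for a b
    by (simp add: eis_complex_def w_def)
  have m: "eis_complex (Eis a b * Eis c d) = eis_complex (Eis a b) * eis_complex (Eis c d)" for a b c d
  proof -
    have "eis_complex (Eis a b) * eis_complex (Eis c d)
      = of_int a * of_int c + (of_int a * of_int d + of_int b * of_int c) * w + of_int b * of_int d * (w * w)"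
      unfolding e by (simp add: algebra_simps)
    also have "\<dots> = eis_complex (Eis a b * Eis c d)"
      unfolding w by (simp add: times_eis_def e algebra_simps)
    finally show ?thesis ..
  qed
  have "eis_complex (x * y) = eis_complex x * eis_complex y" for x y
    by (cases x; cases y) (simp only: m)
  moreover have "eis_complex (x + y) = eis_complex x + eis_complex y" for x y
    by (cases x; cases y) (simp add: e plus_eis_def algebra_simps)
  ultimately show ?thesis unfolding ring_hom1_def by (simp add: one_eis_def e)
qed

lemma eis_complex_eq_0: "eis_complex x = 0 \<longleftrightarrow> x = 0"
  by (cases x) (auto simp: eis_complex_def zero_eis_def complex_eq_iff)

lemma ring_hom1_of_int: "ring_hom1 (of_int :: int \<Rightarrow> complex)"
  by (simp add: ring_hom1_def)

text \<open>With points 3, 5 and 8 of the shape \<open>(1, s, 0)\<close>, \<open>(1, 0, r)\<close>,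
  \<open>(1, 1, r)\<close>, the triples 357 and 368 amount to \<open>r s = r + s\<close> and
  \<open>r + s = 1\<close>. Hence \<open>r\<close> and \<open>s\<close> are the roots of
  \<open>X^2 - X + 1\<close>, namely \<open>1 + w\<close> and \<open>- w\<close> for a primitive
  third root of unity \<open>w\<close>; the other triples hold for all \<open>r\<close> and
  \<open>s\<close>.\<close>

definition maclane :: "eis vec3 list"
  where "maclane = [(1, 0, 0), (0, 1, 0), (1, Eis 1 1, 0), (0, 0, 1), (1, 0, Eis 0 (-1)), (0, 1, 1), (1, 1, 1), (1, 1, Eis 0 (-1))]"

abbreviation I41 :: "nat list list"
  where "I41 \<equiv> [[1, 2, 3], [1, 4, 5], [1, 6, 7], [2, 4, 6], [2, 5, 8], [3, 5, 7], [3, 6, 8], [4, 7, 8]]"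

lemma maclane_ok: "config_okL maclane I41 [] \<and> genericityL maclane I41 []" by code_simp

lemma catalogue_classes:
  assumes "(i, Is, Js, d, c, ws) \<in> set catalogue"
  shows "i \<in> {10, 12, 18, 21, 26, 29, 31, 38, 47, 56, 58, 72} \<longleftrightarrow> c = 1"
    "i \<in> {33, 34, 35, 42, 44, 48, 49, 67, 68, 69, 77, 78} \<longleftrightarrow> c = 2" "c \<le> 2" "ws = [] \<Longrightarrow> Is = I41 \<and> Js = []"
proof -
  have "list_all (\<lambda>(i, Is, Js, d, c, ws). (i \<in> {10, 12, 18, 21, 26, 29, 31, 38, 47, 56, 58, 72} \<longleftrightarrow> c = 1) \<and>
    (i \<in> {33, 34, 35, 42, 44, 48, 49, 67, 68, 69, 77, 78} \<longleftrightarrow> c = 2) \<and> c \<le> 2 \<and> (ws = [] \<longrightarrow> Is = I41 \<and> Js = [])) catalogue"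
    by (simp add: catalogue_defs)
  from this[unfolded list_all_iff, rule_format, OF assms]
  show "i \<in> {10, 12, 18, 21, 26, 29, 31, 38, 47, 56, 58, 72} \<longleftrightarrow> c = 1"
    "i \<in> {33, 34, 35, 42, 44, 48, 49, 67, 68, 69, 77, 78} \<longleftrightarrow> c = 2" "c \<le> 2" "ws = [] \<Longrightarrow> Is = I41 \<and> Js = []"
    unfolding prod.case by blast+
qed

lemma catalogue_realization:
  assumes e: "(i, Is, Js, d, c, ws) \<in> set catalogue"
  obtains u where "config_ok u Is Js" "m_config (\<lambda>i. pcl (relab u i)) = generic_m (lsets Is) (lsets Js)"
proof -
  have b: "bezoutianL Is Js" and w: "ws = [] \<or> config_okL ws Is Js \<and> genericityL ws Is Js"
    using catalogue_ok[OF e] by (simp_all add: entry_ok_def)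
  show ?thesis
  proof (cases "ws = []")
    case True
    hence IJ: "Is = I41" "Js = []" using catalogue_classes(4)[OF e] by blast+
    have m: "config_okL maclane Is Js" "genericityL maclane Is Js" using maclane_ok unfolding IJ by blast+
    show ?thesis
      by (rule that[OF config_okL_sound[OF ring_hom1_eis eis_complex_eq_0 m(1)]
        m_config_vv[OF ring_hom1_eis eis_complex_eq_0 b m]])
  next
    case False
    hence m: "config_okL ws Is Js" "genericityL ws Is Js" using w by blast+
    show ?thesis
      by (rule that[OF config_okL_sound[OF ring_hom1_of_int of_int_eq_0_iff m(1)]
        m_config_vv[OF ring_hom1_of_int of_int_eq_0_iff b m]])
  qed
qed

section \<open>The assertions for a single entry and for the list\<close>

lemma catalogue_10_77:
  obtains ws ws' where "(10, I10, J10, 9, 1, ws) \<in> set catalogue" "(77, I77, [], 8, 2, ws') \<in> set catalogue"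
proof -
  have "(10, I10, J10, 9, 1, [(1, 0, -2), (1, 2, 2), (1, 1, 0), (2, 0, -1), (1, -2, -2), (0, 2, -1), (0, 1, -2), (2, -1, 2)]) \<in> set catalogue"
    by (simp add: catalogue_defs)
  moreover have "(77, I77, [], 8, 2, [(0, 1, 1), (1, 0, 1), (1, 1, 2), (1, 0, 0), (1, -2, -2), (1, 1, -1), (0, 1, 0), (2, 1, -2)]) \<in> set catalogue"
    by (simp add: catalogue_defs)
  ultimately show ?thesis by (rule that)
qed

lemma catalogue_props:
  assumes e: "(i, Is, Js, d, c, ws) \<in> set catalogue"
  shows "quatroid (lsets Is, lsets Js)" "bezoutian (lsets Is, lsets Js)"
    "12 - int (m_quatroid (lsets Is, lsets Js)) = d + (if c = 0 then 0 else 1)"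
    "quatroid_preceq (lsets Is, lsets Js) (quat 77) \<longleftrightarrow> c = 2"
    "quatroid_preceq (lsets Is, lsets Js) (quat 10) \<and> \<not> quatroid_preceq (lsets Is, lsets Js) (quat 77) \<longleftrightarrow> c = 1"
proof -
  have b: "bezoutianL Is Js" and m: "int (genericL Is Js) = 12 - d - (if c = 0 then 0 else 1)"
    and p: "pattern77L Is \<longleftrightarrow> c = 2" "pattern10L Is Js \<and> \<not> pattern77L Is \<longleftrightarrow> c = 1"
    using catalogue_ok[OF e] unfolding entry_ok_def prod.case by blast+
  have g: "good_lists Is Js" using b by (simp add: bezoutianL_def)
  note c36 = lsets_card[OF g]
  obtain u where u: "config_ok u Is Js" "m_config (\<lambda>i. pcl (relab u i)) = generic_m (lsets Is) (lsets Js)"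
    by (rule catalogue_realization[OF e])
  note r = config_ok_realization[OF g u(1)]
  show bez: "bezoutian (lsets Is, lsets Js)" by (rule bezoutianL_sound[OF b])
  show "quatroid (lsets Is, lsets Js)" unfolding quatroid_def using c36 r by auto
  show "12 - int (m_quatroid (lsets Is, lsets Js)) = d + (if c = 0 then 0 else 1)"
    unfolding m_quatroid_eqI[OF bez r u(2)] genericL_eq[OF b] m by simp
  obtain ws1 ws2 where e10: "(10, I10, J10, 9, 1, ws1) \<in> set catalogue"
    and e77: "(77, I77, [], 8, 2, ws2) \<in> set catalogue" by (rule catalogue_10_77)
  obtain v where v: "bezout_config v (lsets Is) (lsets Js)" by (rule bezout_configI[OF r bez])
  have q: "quat 10 = (lsets I10, lsets J10)" "quat 77 = (lsets I77, lsets [])"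
    using quat_delta(2)[OF e10] quat_delta(2)[OF e77] .
  have q': "(lsets I10, lsets J10) = ({{1, 2, 3}}, {{1, 4, 5, 6, 7, 8}})"
    "(lsets I77, lsets []) = ({{1, 2, 3}, {1, 4, 5}, {6, 7, 8}}, {})"
    by (simp_all add: lsets_def lset_def)
  have g77: "good_lists I77 []" and g10: "good_lists I10 J10"
    using catalogue_ok[OF e77] catalogue_ok[OF e10] unfolding entry_ok_def bezoutianL_def by simp_all
  obtain u77 where u77: "config_ok u77 I77 []" using catalogue_realization[OF e77] by blast
  obtain u10 where u10: "config_ok u10 I10 J10" using catalogue_realization[OF e10] by blast
  have t77: "quatroid_preceq (lsets Is, lsets Js) (quat 77) \<longleftrightarrow> pattern77L Is"
    unfolding pattern77L_iff[OF g, symmetric] q(2)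
  proof
    assume "quatroid_preceq (lsets Is, lsets Js) (lsets I77, lsets [])"
    thus "pattern77 (lsets Is)" unfolding q' by (rule bezout_config.preceq77D[OF v])
  next
    assume p77: "pattern77 (lsets Is)"
    show "quatroid_preceq (lsets Is, lsets Js) (lsets I77, lsets [])"
      by (rule preceq77I[OF c36(1) p77 g77 u77])
  qed
  have t10: "pattern10L Is Js \<Longrightarrow> quatroid_preceq (lsets Is, lsets Js) (quat 10)"
    unfolding pattern10L_iff[OF g, symmetric] q(1) by (rule preceq10I[OF c36 _ g10 u10])
  have t10': "quatroid_preceq (lsets Is, lsets Js) (quat 10) \<Longrightarrow> pattern10L Is Js \<or> pattern77L Is"
    unfolding pattern10L_iff[OF g, symmetric] pattern77L_iff[OF g, symmetric] q(1) q'
    by (rule bezout_config.preceq10D[OF v])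
  show "quatroid_preceq (lsets Is, lsets Js) (quat 77) \<longleftrightarrow> c = 2" using t77 p(1) by blast
  \<comment> \<open>By \<open>t10\<close> and \<open>t10'\<close>, for an entry that is not below
    number 77, being below number 10 is the same as \<open>pattern10L\<close>.\<close>
  show "quatroid_preceq (lsets Is, lsets Js) (quat 10) \<and> \<not> quatroid_preceq (lsets Is, lsets Js) (quat 77) \<longleftrightarrow> c = 1"
    using t10 t10' t77 p(2) by blast
qed

theorem theorem6p3:
  fixes A B :: "nat set"
  defines "A \<equiv> {10, 12, 18, 21, 26, 29, 31, 38, 47, 56, 58, 72}"
    and "B \<equiv> {33, 34, 35, 42, 44, 48, 49, 67, 68, 69, 77, 78}"
  shows "(\<forall>i\<in>listed. quatroid (quat i) \<and> bezoutian (quat i)) \<and>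
    (\<forall>i\<in>listed - (A \<union> B). 12 - int (m_quatroid (quat i)) = delta i) \<and>
    (\<forall>i\<in>A \<union> B. 12 - int (m_quatroid (quat i)) = delta i + 1) \<and>
    A = {i \<in> listed. quatroid_preceq (quat i) (quat 10) \<and> \<not> quatroid_preceq (quat i) (quat 77)} \<and>
    B = {i \<in> listed. quatroid_preceq (quat i) (quat 77)}"
proof -
  have AB: "A \<union> B \<subseteq> listed" unfolding A_def B_def listed_def quatroid_list_def by simp
  have *: "quatroid (quat i) \<and> bezoutian (quat i) \<and>
      12 - int (m_quatroid (quat i)) = delta i + (if i \<in> A \<union> B then 1 else 0) \<and>
      (i \<in> A \<longleftrightarrow> quatroid_preceq (quat i) (quat 10) \<and> \<not> quatroid_preceq (quat i) (quat 77)) \<and>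
      (i \<in> B \<longleftrightarrow> quatroid_preceq (quat i) (quat 77))" if "i \<in> listed" for i
  proof -
    obtain Is Js d c ws where e: "(i, Is, Js, d, c, ws) \<in> set catalogue" using \<open>i \<in> listed\<close> by (rule listedE)
    note cl = catalogue_classes[OF e, folded A_def B_def] and q = quat_delta(2,3)[OF e] and pr = catalogue_props[OF e]
    have "i \<in> A \<union> B \<longleftrightarrow> c \<noteq> 0" using cl(1-3) by auto
    hence "12 - int (m_quatroid (quat i)) = delta i + (if i \<in> A \<union> B then 1 else 0)" using pr(3) q by simp
    thus ?thesis unfolding cl(1,2) using pr(1,2,4,5)[folded q(1)] by blast
  qed
  show ?thesis
  proof (intro conjI ballI set_eqI)
    fix i
    show "i \<in> A \<longleftrightarrow> i \<in> {i \<in> listed. quatroid_preceq (quat i) (quat 10) \<and> \<not> quatroid_preceq (quat i) (quat 77)}"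
      "i \<in> B \<longleftrightarrow> i \<in> {i \<in> listed. quatroid_preceq (quat i) (quat 77)}"
      using *[of i] AB by blast+
    show "i \<in> listed \<Longrightarrow> quatroid (quat i)" "i \<in> listed \<Longrightarrow> bezoutian (quat i)" using *[of i] by blast+
    show "i \<in> listed - (A \<union> B) \<Longrightarrow> 12 - int (m_quatroid (quat i)) = delta i" using *[of i] by simp
    show "i \<in> A \<union> B \<Longrightarrow> 12 - int (m_quatroid (quat i)) = delta i + 1" using *[of i] AB by auto
  qed
qed

end
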